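(* (a) Let $A$ be a self-adjoint operator on a Hilbert space with cyclic vector $\varphi$, let $P$ be the orthogonal projection onto the span of $\varphi$, and let $A_\lambda=A+\lambda P$ for $\lambda\in\mathbb{R}$. Suppose $A$ has an interval $[a,b]$, $a<b$, in its spectrum and the spectrum there has no absolutely continuous component. Then: (i) There is a dense $G_\delta$ set $C$ in $[a,b]$ such that if $E\in C$, then $E$ is not an eigenvalue of any $A_\lambda$, $\lambda\in\mathbb{R}$. (ii) There is a dense $G_\delta$ set $L$ in $\mathbb{R}$ such that $A_\lambda$ has purely singular continuous spectrum in $[a,b]$ if $\lambda\in L$. (b) Let $H$ be the differential operator $-\frac{d^2}{dx^2}+V(x)$ on $[0,\infty)$, with $V$ real-valued and locally integrable on $[0,\infty)$, assumed to be limit point at infinity, and for $\theta\in[0,\pi)$ let $H_\theta$ be the self-adjoint operator on $L^2([0,\infty))$ given by $H$ with boundary condition $\cos\theta\, u(0)+\sin\theta\, u'(0)=0$. Suppose that for some $\theta_0\in[0,\pi)$, $H_{\theta_0}$ has an interval $[a,b]$, $a<b$, in its spectrum and the spectrum there has no absolutely continuous component. Then: (i) There is a dense $G_\delta$ set $C$ in $[a,b]$ such that if $E\in C$, then $E$ is not an eigenvalue of any $H_\theta$, $\theta\in[0,\pi)$. (ii) There is a dense $G_\delta$ set $L$ in $[0,\pi)$ such that $H_\theta$ has purely singular continuous spectrum in $[a,b]$ if $\theta\in L$.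
   Context: For a self-adjoint operator $D$, $d\mu_D^\psi$ is the spectral measure given by $(\psi,e^{isD}\psi)=\int e^{isE}\,d\mu_D^\psi(E)$. The spectrum of $D$ in $[a,b]$ has no absolutely continuous component if for every vector $\psi$ the restriction of $d\mu_D^\psi$ to $[a,b]$ has zero absolutely continuous part. $D$ has purely singular continuous spectrum in $[a,b]$ if $[a,b]\subset\operatorname{spec}(D)$ and for every $\psi$ this restriction has neither a pure point part nor an absolutely continuous part. A vector $\varphi$ is cyclic for $A$ if the vectors $(A-z)^{-1}\varphi$, $z\in\mathbb{C}\setminus\mathbb{R}$, have dense linear span. *)

theory Defs
  imports "HOL-Analysis.Analysis"
begin

section \<open>Complex Hilbert spaces\<close>

text \<open>The inner product is linear in its second argument. It is positive definite because its real
  part is the inner product of the underlying real inner product space.\<close>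

class complex_hilbert_space = real_inner + complete_space +
  fixes scaleC :: "complex \<Rightarrow> 'a \<Rightarrow> 'a" (infixr \<open>*\<^sub>C\<close> 75)
    and cinner :: "'a \<Rightarrow> 'a \<Rightarrow> complex"
  assumes scaleC_add_right: "c *\<^sub>C (x + y) = c *\<^sub>C x + c *\<^sub>C y"
    and scaleC_add_left: "(c + d) *\<^sub>C x = c *\<^sub>C x + d *\<^sub>C x"
    and scaleC_scaleC: "c *\<^sub>C d *\<^sub>C x = (c * d) *\<^sub>C x"
    and scaleR_scaleC: "r *\<^sub>R x = complex_of_real r *\<^sub>C x"
    and cinner_add_right: "cinner x (y + z) = cinner x y + cinner x z"
    and cinner_scaleC_right: "cinner x (c *\<^sub>C y) = c * cinner x y"
    and cinner_commute: "cinner y x = cnj (cinner x y)"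
    and inner_cinner: "inner x y = Re (cinner x y)"

global_interpretation complex_vector:
  vector_space "scaleC :: complex \<Rightarrow> 'a \<Rightarrow> 'a :: complex_hilbert_space"
proof unfold_locales
  fix x :: 'a
  show "1 *\<^sub>C x = x"
    using scaleR_scaleC[of 1 x] by simp
qed (simp_all add: scaleC_add_right scaleC_add_left scaleC_scaleC)


section \<open>Unbounded operators\<close>

text \<open>The values of \<open>op_app\<close> outside \<open>op_dom\<close> are irrelevant.\<close>

record 'a unbounded_op =
  op_dom :: "'a set"
  op_app :: "'a \<Rightarrow> 'a"

definition linear_op :: "'a :: complex_hilbert_space unbounded_op \<Rightarrow> bool" where
  "linear_op A \<longleftrightarrow> complex_vector.subspace (op_dom A) \<and>
     (\<forall>x\<in>op_dom A. \<forall>y\<in>op_dom A. op_app A (x + y) = op_app A x + op_app A y) \<and>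
     (\<forall>c. \<forall>x\<in>op_dom A. op_app A (c *\<^sub>C x) = c *\<^sub>C op_app A x)"

definition adjoint_op ::
  "'a :: complex_hilbert_space unbounded_op \<Rightarrow> 'a unbounded_op" where
  "adjoint_op A =
     \<lparr> op_dom = {y. \<exists>z. \<forall>x\<in>op_dom A. cinner y (op_app A x) = cinner z x},
       op_app = (\<lambda>y. THE z. \<forall>x\<in>op_dom A. cinner y (op_app A x) = cinner z x) \<rparr>"

definition self_adjoint :: "'a :: complex_hilbert_space unbounded_op \<Rightarrow> bool" where
  "self_adjoint A \<longleftrightarrow> linear_op A \<and> closure (op_dom A) = UNIV \<and>
     op_dom (adjoint_op A) = op_dom A \<and>
     (\<forall>x\<in>op_dom A. op_app (adjoint_op A) x = op_app A x)"

definition op_minus_scalar ::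
  "'a :: complex_hilbert_space unbounded_op \<Rightarrow> complex \<Rightarrow> 'a \<Rightarrow> 'a" where
  "op_minus_scalar A z x = op_app A x - z *\<^sub>C x"

definition resolvent_set :: "'a :: complex_hilbert_space unbounded_op \<Rightarrow> complex set" where
  "resolvent_set A = {z. bij_betw (op_minus_scalar A z) (op_dom A) UNIV \<and>
     (\<exists>K. \<forall>x\<in>op_dom A. norm x \<le> K * norm (op_minus_scalar A z x))}"

definition spectrum :: "'a :: complex_hilbert_space unbounded_op \<Rightarrow> complex set" where
  "spectrum A = - resolvent_set A"

definition resolvent ::
  "'a :: complex_hilbert_space unbounded_op \<Rightarrow> complex \<Rightarrow> 'a \<Rightarrow> 'a" where
  "resolvent A z = inv_into (op_dom A) (op_minus_scalar A z)"

definition eigenvalue :: "'a :: complex_hilbert_space unbounded_op \<Rightarrow> complex \<Rightarrow> bool" where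
  "eigenvalue A E \<longleftrightarrow> (\<exists>x\<in>op_dom A. x \<noteq> 0 \<and> op_app A x = E *\<^sub>C x)"

definition cyclic_vector :: "'a :: complex_hilbert_space unbounded_op \<Rightarrow> 'a \<Rightarrow> bool" where
  "cyclic_vector A \<phi> \<longleftrightarrow>
     closure (complex_vector.span {resolvent A z \<phi> | z. z \<notin> \<real>}) = UNIV"

definition orth_proj :: "'a :: complex_hilbert_space set \<Rightarrow> 'a \<Rightarrow> 'a" where
  "orth_proj M x = (THE y. y \<in> M \<and> (\<forall>m\<in>M. cinner m (x - y) = 0))"

text \<open>The operator \<open>A + r P\<close>, where \<open>P\<close> is the orthogonal projection onto the span of \<open>\<phi>\<close>.\<close>

definition rank_one_perturbation ::
  "'a :: complex_hilbert_space unbounded_op \<Rightarrow> 'a \<Rightarrow> real \<Rightarrow> 'a unbounded_op" where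
  "rank_one_perturbation A \<phi> r =
     \<lparr> op_dom = op_dom A,
       op_app = (\<lambda>x. op_app A x + r *\<^sub>R orth_proj (complex_vector.span {\<phi>}) x) \<rparr>"


section \<open>Spectral measures and spectral type\<close>

text \<open>\<open>U\<close> is a strongly continuous one-parameter unitary group whose infinitesimal generator
  is exactly \<open>\<i> D\<close>, domain included. By Stone's theorem there is precisely one such group if \<open>D\<close>
  is self-adjoint; this is the meaning of the exponential \<open>exp (\<i> s D)\<close> for unbounded \<open>D\<close>.\<close>

definition unitary_group_of ::
  "'a :: complex_hilbert_space unbounded_op \<Rightarrow> (real \<Rightarrow> 'a \<Rightarrow> 'a) \<Rightarrow> bool" where
  "unitary_group_of D U \<longleftrightarrow>
     (\<forall>s. (\<forall>x y. U s (x + y) = U s x + U s y) \<and> (\<forall>c x. U s (c *\<^sub>C x) = c *\<^sub>C U s x) \<and>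
          (\<forall>x y. cinner (U s x) (U s y) = cinner x y) \<and> surj (U s)) \<and>
     U 0 = id \<and> (\<forall>s t. U (s + t) = U s \<circ> U t) \<and>
     (\<forall>x. continuous_on UNIV (\<lambda>s. U s x)) \<and>
     op_dom D = {x. (\<lambda>s. U s x) differentiable (at 0)} \<and>
     (\<forall>x\<in>op_dom D. ((\<lambda>s. U s x) has_vector_derivative \<i> *\<^sub>C op_app D x) (at 0))"

definition exp_i_op ::
  "'a :: complex_hilbert_space unbounded_op \<Rightarrow> real \<Rightarrow> 'a \<Rightarrow> 'a" where
  "exp_i_op D = (THE U. unitary_group_of D U)"

definition spectral_measure ::
  "'a :: complex_hilbert_space unbounded_op \<Rightarrow> 'a \<Rightarrow> real measure" where
  "spectral_measure D \<psi> = (THE \<mu>. sets \<mu> = sets borel \<and> finite_measure \<mu> \<and>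
     (\<forall>s. cinner \<psi> (exp_i_op D s \<psi>) =
          (LINT E|\<mu>. exp (\<i> * complex_of_real s * complex_of_real E))))"

definition mutually_singular :: "'a measure \<Rightarrow> 'a measure \<Rightarrow> bool" where
  "mutually_singular M N \<longleftrightarrow>
     (\<exists>S. S \<in> sets M \<and> space M - S \<in> sets N \<and> emeasure M S = 0 \<and> emeasure N (space M - S) = 0)"

text \<open>The two parts below are those of the Lebesgue decomposition of a finite Borel measure on the
  real line.\<close>

definition ac_part :: "real measure \<Rightarrow> real measure" where
  "ac_part \<mu> = (THE \<nu>. sets \<nu> = sets borel \<and> absolutely_continuous lborel \<nu> \<and>
     (\<exists>\<sigma>. sets \<sigma> = sets borel \<and> mutually_singular lborel \<sigma> \<and>
          (\<forall>S\<in>sets borel. emeasure \<mu> S = emeasure \<nu> S + emeasure \<sigma> S)))"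

definition pp_part :: "real measure \<Rightarrow> real measure" where
  "pp_part \<mu> = density \<mu> (indicator {x. emeasure \<mu> {x} \<noteq> 0})"

definition spectral_measure_on ::
  "'a :: complex_hilbert_space unbounded_op \<Rightarrow> real \<Rightarrow> real \<Rightarrow> 'a \<Rightarrow> real measure" where
  "spectral_measure_on D a b \<psi> = density (spectral_measure D \<psi>) (indicator {a..b})"

definition interval_in_spectrum ::
  "'a :: complex_hilbert_space unbounded_op \<Rightarrow> real \<Rightarrow> real \<Rightarrow> bool" where
  "interval_in_spectrum D a b \<longleftrightarrow> complex_of_real ` {a..b} \<subseteq> spectrum D"

definition no_ac_spectrum_on ::
  "'a :: complex_hilbert_space unbounded_op \<Rightarrow> real \<Rightarrow> real \<Rightarrow> bool" where
  "no_ac_spectrum_on D a b \<longleftrightarrow>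
     (\<forall>\<psi>. ac_part (spectral_measure_on D a b \<psi>) = null_measure borel)"

definition purely_sc_spectrum_on ::
  "'a :: complex_hilbert_space unbounded_op \<Rightarrow> real \<Rightarrow> real \<Rightarrow> bool" where
  "purely_sc_spectrum_on D a b \<longleftrightarrow> interval_in_spectrum D a b \<and>
     (\<forall>\<psi>. pp_part (spectral_measure_on D a b \<psi>) = null_measure borel \<and>
          ac_part (spectral_measure_on D a b \<psi>) = null_measure borel)"

definition dense_gdelta_in :: "'a :: topological_space set \<Rightarrow> 'a set \<Rightarrow> bool" where
  "dense_gdelta_in S C \<longleftrightarrow>
     gdelta_in (top_of_set S) C \<and> (top_of_set S) closure_of C = S"


section \<open>The Hilbert space of square integrable functions on the half-line\<close>

abbreviation half_line :: "real measure" where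
  "half_line \<equiv> lebesgue_on {0..}"

definition square_integrable :: "(real \<Rightarrow> complex) \<Rightarrow> bool" where
  "square_integrable f \<longleftrightarrow> f \<in> borel_measurable half_line \<and>
     integrable half_line (\<lambda>x. (norm (f x))\<^sup>2)"

definition L2_rel :: "(real \<Rightarrow> complex) \<Rightarrow> (real \<Rightarrow> complex) \<Rightarrow> bool" where
  "L2_rel f g \<longleftrightarrow> square_integrable f \<and> square_integrable g \<and> (AE x in half_line. f x = g x)"

lemma square_integrable_measurable [measurable_dest]:
  "square_integrable f \<Longrightarrow> f \<in> borel_measurable half_line"
  by (simp add: square_integrable_def)

lemma square_integrable_zero: "square_integrable (\<lambda>x. 0)"
  by (simp add: square_integrable_def)

lemma square_integrable_add:
  assumes f: "square_integrable f" and g: "square_integrable g"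
  shows "square_integrable (\<lambda>x. f x + g x)"
proof -
  note [measurable] = f[THEN square_integrable_measurable] g[THEN square_integrable_measurable]
  have "integrable half_line (\<lambda>x. (norm (f x + g x))\<^sup>2)"
  proof (rule Bochner_Integration.integrable_bound)
    show "integrable half_line (\<lambda>x. 2 * (norm (f x))\<^sup>2 + 2 * (norm (g x))\<^sup>2)"
      using f g by (simp add: square_integrable_def)
    have "(norm (f x + g x))\<^sup>2 \<le> 2 * (norm (f x))\<^sup>2 + 2 * (norm (g x))\<^sup>2" for x
    proof -
      have "(norm (f x + g x))\<^sup>2 \<le> (norm (f x) + norm (g x))\<^sup>2"
        by (intro power_mono norm_triangle_ineq) simp
      also have "\<dots> \<le> 2 * (norm (f x))\<^sup>2 + 2 * (norm (g x))\<^sup>2"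
        using sum_squares_bound[of "norm (f x)" "norm (g x)"] by (simp add: power2_sum)
      finally show ?thesis .
    qed
    then show "AE x in half_line. norm ((norm (f x + g x))\<^sup>2)
        \<le> norm (2 * (norm (f x))\<^sup>2 + 2 * (norm (g x))\<^sup>2)"
      by simp
  qed measurable
  then show ?thesis by (simp add: square_integrable_def)
qed

lemma square_integrable_scale:
  assumes "square_integrable f"
  shows "square_integrable (\<lambda>x. c * f x)"
  using assms by (auto simp: square_integrable_def norm_mult power_mult_distrib)

lemma square_integrable_minus: "square_integrable f \<Longrightarrow> square_integrable (\<lambda>x. - f x)"
  by (simp add: square_integrable_def)

lemma square_integrable_diff:
  assumes "square_integrable f" "square_integrable g"
  shows "square_integrable (\<lambda>x. f x - g x)"
  using square_integrable_add[OF assms(1) square_integrable_scale[OF assms(2), of "-1"]] by simp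

lemma square_integrable_product:
  assumes f: "square_integrable f" and g: "square_integrable g"
  shows "integrable half_line (\<lambda>x. cnj (f x) * g x)"
proof (rule Bochner_Integration.integrable_bound)
  note [measurable] = f[THEN square_integrable_measurable] g[THEN square_integrable_measurable]
  show "integrable half_line (\<lambda>x. (norm (f x))\<^sup>2 + (norm (g x))\<^sup>2)"
    using f g by (simp add: square_integrable_def)
  have cnj: "cnj \<in> borel_measurable borel"
    by (intro borel_measurable_continuous_onI continuous_intros)
  show "(\<lambda>x. cnj (f x) * g x) \<in> borel_measurable half_line"
    by (intro borel_measurable_times measurable_compose[OF _ cnj]) measurable
  have "norm (f x) * norm (g x) \<le> (norm (f x))\<^sup>2 + (norm (g x))\<^sup>2" for x
  proof -
    have "2 * (norm (f x) * norm (g x)) \<le> (norm (f x))\<^sup>2 + (norm (g x))\<^sup>2"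
      using sum_squares_bound[of "norm (f x)" "norm (g x)"] by (simp only: mult.assoc)
    moreover have "0 \<le> norm (f x) * norm (g x)" by simp
    ultimately show ?thesis by linarith
  qed
  then show "AE x in half_line. norm (cnj (f x) * g x)
      \<le> norm ((norm (f x))\<^sup>2 + (norm (g x))\<^sup>2)"
    by (simp add: norm_mult)
qed

quotient_type half_line_L2 = "real \<Rightarrow> complex" / partial: L2_rel
  morphisms rep_L2 to_L2
proof (rule part_equivpI)
  show "\<exists>f. L2_rel f f"
    using square_integrable_zero by (auto simp: L2_rel_def)
  show "symp L2_rel"
    by (auto simp: symp_def L2_rel_def)
  show "transp L2_rel"
    unfolding transp_def L2_rel_def by auto
qed

lemma L2_rel_reflI:
  assumes "square_integrable f" "\<And>x. f x = g x"
  shows "L2_rel f g"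
proof -
  have "f = g" using assms(2) by (rule ext)
  with assms(1) show ?thesis by (simp add: L2_rel_def)
qed

lemmas square_integrable_intros =
  square_integrable_zero square_integrable_add square_integrable_diff square_integrable_scale
  square_integrable_minus

lemma L2_rel_square_integrable: "L2_rel f f \<Longrightarrow> square_integrable f"
  by (simp add: L2_rel_def)

lemma to_L2_cases:
  obtains f where "square_integrable f" "x = to_L2 f"
  using Quotient_half_line_L2 unfolding Quotient_alt_def
  by (metis L2_rel_def Quotient3_abs_rep Quotient3_half_line_L2 Quotient3_rep_reflp)

lemma L2_complete:
  assumes f: "\<And>n. square_integrable (f n)"
    and cauchy: "\<And>e. e > 0 \<Longrightarrow>
      \<exists>N. \<forall>m\<ge>N. \<forall>n\<ge>N. (LINT x|half_line. (norm (f m x - f n x))\<^sup>2) < e"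
  obtains g where "square_integrable g"
    and "(\<lambda>n. LINT x|half_line. (norm (f n x - g x))\<^sup>2) \<longlonglongrightarrow> 0"
proof -
  note [measurable] = f[THEN square_integrable_measurable]
  define I where "I m n = (\<integral>\<^sup>+x. ennreal ((norm (f m x - f n x))\<^sup>2) \<partial>half_line)" for m n
  have I: "I m n = ennreal (LINT x|half_line. (norm (f m x - f n x))\<^sup>2)" for m n
    unfolding I_def using square_integrable_diff[OF f f, of m n]
    by (intro nn_integral_eq_integral) (auto simp: square_integrable_def)
  have "\<exists>N. \<forall>m\<ge>N. \<forall>n\<ge>N. I m n \<le> ennreal ((1/4) ^ k)" for k :: nat
    using cauchy[of "(1/4) ^ k"] by (force simp: I intro: ennreal_leI)
  then obtain N where N: "\<And>k m n. m \<ge> N k \<Longrightarrow> n \<ge> N k \<Longrightarrow> I m n \<le> ennreal ((1/4) ^ k)"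
    by metis
  define r where "r k = (\<Sum>i\<le>k. N i)" for k
  have r: "N k \<le> r k" "N k \<le> r (Suc k)" for k
    using member_le_sum[of k "{..k}" N] by (auto simp: r_def)
  define d where "d k x = norm (f (r (Suc k)) x - f (r k) x)" for k x
  have [measurable]: "d k \<in> borel_measurable half_line" for k
    unfolding d_def by measurable
  have "(\<integral>\<^sup>+x. (\<Sum>k. ennreal (2 ^ k * (d k x)\<^sup>2)) \<partial>half_line)
      = (\<Sum>k. \<integral>\<^sup>+x. ennreal (2 ^ k * (d k x)\<^sup>2) \<partial>half_line)"
    by (intro nn_integral_suminf) measurable
  also have "\<dots> \<le> (\<Sum>k. ennreal ((1/2) ^ k))"
  proof (intro suminf_le summableI)
    fix k :: nat
    have "(\<integral>\<^sup>+x. ennreal (2 ^ k * (d k x)\<^sup>2) \<partial>half_line) = ennreal (2 ^ k) * I (r (Suc k)) (r k)"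
      unfolding I_def d_def by (subst nn_integral_cmult[symmetric]) (auto simp: ennreal_mult)
    also have "\<dots> \<le> ennreal (2 ^ k) * ennreal ((1/4) ^ k)"
      by (intro mult_left_mono N r) simp
    also have "\<dots> = ennreal ((1/2) ^ k)"
      by (subst ennreal_mult[symmetric]) (auto simp flip: power_mult_distrib)
    finally show "(\<integral>\<^sup>+x. ennreal (2 ^ k * (d k x)\<^sup>2) \<partial>half_line) \<le> ennreal ((1/2) ^ k)" .
  qed
  also have "\<dots> = ennreal (\<Sum>k. (1/2) ^ k)"
    by (rule suminf_ennreal2) simp_all
  finally have "(\<integral>\<^sup>+x. (\<Sum>k. ennreal (2 ^ k * (d k x)\<^sup>2)) \<partial>half_line)
      \<le> ennreal (\<Sum>k. (1/2) ^ k)" .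
  from neq_top_trans[OF ennreal_neq_top this]
  have "(\<integral>\<^sup>+x. (\<Sum>k. ennreal (2 ^ k * (d k x)\<^sup>2)) \<partial>half_line) \<noteq> \<infinity>"
    by (simp only: infinity_ennreal_def not_False_eq_True)
  then have "AE x in half_line. (\<Sum>k. ennreal (2 ^ k * (d k x)\<^sup>2)) \<noteq> \<infinity>"
    by (rule nn_integral_PInf_AE[rotated]) measurable
  then have conv: "AE x in half_line. convergent (\<lambda>k. f (r k) x)"
  proof eventually_elim
    case (elim x)
    then have "summable (\<lambda>k. 2 ^ k * (d k x)\<^sup>2)"
      by (intro summable_suminf_not_top) (simp, simp only: infinity_ennreal_def not_False_eq_True)
    from summable_imp_Bseq[OF this] obtain B where B: "\<And>k. norm (2 ^ k * (d k x)\<^sup>2) \<le> B"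
      by (meson BseqE)
    have "summable (\<lambda>k. d k x)"
    proof (rule summable_comparison_test')
      show "summable (\<lambda>k. sqrt B * (1 / sqrt 2) ^ k)"
        by (intro summable_mult summable_geometric) auto
      fix k :: nat
      have "(d k x)\<^sup>2 \<le> B * (1/2) ^ k"
        using B[of k] by (simp add: field_simps)
      then have "\<bar>d k x\<bar> \<le> sqrt (B * (1/2) ^ k)"
        by (metis real_sqrt_abs real_sqrt_le_mono)
      also have "\<dots> = sqrt B * (1 / sqrt 2) ^ k"
        by (simp add: real_sqrt_mult real_sqrt_power real_sqrt_divide)
      finally show "norm (d k x) \<le> sqrt B * (1 / sqrt 2) ^ k"
        by simp
    qed
    then have "summable (\<lambda>k. norm (f (r (Suc k)) x - f (r k) x))"
      by (simp add: d_def)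
    then have "summable (\<lambda>k. f (r (Suc k)) x - f (r k) x)"
      by (rule summable_norm_cancel)
    then have "convergent (\<lambda>n. f (r n) x - f (r 0) x)"
      unfolding summable_iff_convergent
      by (subst sum_lessThan_telescope[of "\<lambda>n. f (r n) x", symmetric])
    from convergent_add[OF this convergent_const[of "f (r 0) x"]]
    show ?case by simp
  qed
  define g where "g x = lim (\<lambda>k. f (r k) x)" for x
  have g [measurable]: "g \<in> borel_measurable half_line"
    unfolding g_def by measurable
  have bound: "(\<integral>\<^sup>+x. ennreal ((norm (f m x - g x))\<^sup>2) \<partial>half_line) \<le> ennreal ((1/4) ^ k)"
    if m: "m \<ge> N k" for m k
  proof -
    have "(\<integral>\<^sup>+x. ennreal ((norm (f m x - g x))\<^sup>2) \<partial>half_line)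
        = (\<integral>\<^sup>+x. liminf (\<lambda>j. ennreal ((norm (f m x - f (r j) x))\<^sup>2)) \<partial>half_line)"
    proof (rule nn_integral_cong_AE, use conv in eventually_elim)
      case (elim x)
      then have "(\<lambda>j. f (r j) x) \<longlonglongrightarrow> g x"
        by (simp add: convergent_LIMSEQ_iff g_def)
      then have "(\<lambda>j. ennreal ((norm (f m x - f (r j) x))\<^sup>2)) \<longlonglongrightarrow> ennreal ((norm (f m x - g x))\<^sup>2)"
        by (intro tendsto_ennrealI tendsto_intros)
      from lim_imp_Liminf[OF _ this] show ?case by simp
    qed
    also have "\<dots> \<le> liminf (\<lambda>j. I m (r j))"
      unfolding I_def by (intro nn_integral_liminf) measurable
    also have "\<dots> \<le> liminf (\<lambda>j::nat. ennreal ((1/4) ^ k))"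
    proof (intro Liminf_mono eventually_sequentiallyI[of k] N m)
      fix j assume "k \<le> j"
      then have "(\<Sum>i\<in>{..k}. N i) \<le> (\<Sum>i\<in>{..j}. N i)"
        by (intro sum_mono2) auto
      then show "N k \<le> r j"
        using r(1)[of k] by (simp add: r_def)
    qed
    finally show ?thesis by (simp add: Liminf_const)
  qed
  have diff: "square_integrable (\<lambda>x. f m x - g x)" if "m \<ge> N k" for m k
  proof -
    have "(\<integral>\<^sup>+x. ennreal (norm ((norm (f m x - g x))\<^sup>2)) \<partial>half_line) < \<infinity>"
      using le_less_trans[OF bound[OF that] ennreal_less_top] by simp
    then have "integrable half_line (\<lambda>x. (norm (f m x - g x))\<^sup>2)"
      by (intro integrableI_bounded) measurable
    then show ?thesis by (simp add: square_integrable_def)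
  qed
  have "square_integrable (\<lambda>x. f (N 0) x - (f (N 0) x - g x))"
    by (intro square_integrable_diff f diff[of 0]) simp
  then have gsq: "square_integrable g" by simp
  have "(\<lambda>n. LINT x|half_line. (norm (f n x - g x))\<^sup>2) \<longlonglongrightarrow> 0"
  proof (rule LIMSEQ_I)
    fix e :: real assume "e > 0"
    obtain k :: nat where k: "(1/4) ^ k < e"
      using real_arch_pow_inv[OF \<open>e > 0\<close>, of "1/4"] by auto
    have "norm ((LINT x|half_line. (norm (f n x - g x))\<^sup>2) - 0) < e" if n: "n \<ge> N k" for n
    proof -
      have "ennreal (LINT x|half_line. (norm (f n x - g x))\<^sup>2)
          = (\<integral>\<^sup>+x. ennreal ((norm (f n x - g x))\<^sup>2) \<partial>half_line)"
        using diff[OF n] by (intro nn_integral_eq_integral[symmetric]) (auto simp: square_integrable_def)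
      also have "\<dots> \<le> ennreal ((1/4) ^ k)" by (rule bound[OF n])
      finally show ?thesis using k by simp
    qed
    then show "\<exists>no. \<forall>n\<ge>no. norm ((LINT x|half_line. (norm (f n x - g x))\<^sup>2) - 0) < e"
      by blast
  qed
  with gsq show ?thesis by (rule that)
qed

instantiation half_line_L2 :: real_inner
begin

lift_definition zero_half_line_L2 :: half_line_L2 is "\<lambda>x. 0"
  by (simp add: L2_rel_def square_integrable_zero)

lift_definition plus_half_line_L2 :: "half_line_L2 \<Rightarrow> half_line_L2 \<Rightarrow> half_line_L2"
  is "\<lambda>f g x. f x + g x"
  by (auto simp: L2_rel_def square_integrable_add)

lift_definition minus_half_line_L2 :: "half_line_L2 \<Rightarrow> half_line_L2 \<Rightarrow> half_line_L2"
  is "\<lambda>f g x. f x - g x"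
  by (auto simp: L2_rel_def square_integrable_diff)

lift_definition uminus_half_line_L2 :: "half_line_L2 \<Rightarrow> half_line_L2"
  is "\<lambda>f x. - f x"
  by (auto simp: L2_rel_def square_integrable_def)

lift_definition scaleR_half_line_L2 :: "real \<Rightarrow> half_line_L2 \<Rightarrow> half_line_L2"
  is "\<lambda>r f x. complex_of_real r * f x"
  by (auto simp: L2_rel_def square_integrable_scale)

lift_definition inner_half_line_L2 :: "half_line_L2 \<Rightarrow> half_line_L2 \<Rightarrow> real"
  is "\<lambda>f g. Re (LINT x|half_line. cnj (f x) * g x)"
proof (rule arg_cong[where f = Re], rule integral_cong_AE)
  fix f1 f2 g1 g2 assume *: "L2_rel f1 f2" "L2_rel g1 g2"
  then show "(\<lambda>x. cnj (f1 x) * g1 x) \<in> borel_measurable half_line"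
    "(\<lambda>x. cnj (f2 x) * g2 x) \<in> borel_measurable half_line"
    using square_integrable_product by (auto simp: L2_rel_def)
  show "AE x in half_line. cnj (f1 x) * g1 x = cnj (f2 x) * g2 x"
    using * by (auto simp: L2_rel_def)
qed

definition norm_half_line_L2 :: "half_line_L2 \<Rightarrow> real" where
  "norm_half_line_L2 x = sqrt (inner x x)"

definition dist_half_line_L2 :: "half_line_L2 \<Rightarrow> half_line_L2 \<Rightarrow> real" where
  "dist_half_line_L2 x y = norm (x - y)"

definition sgn_half_line_L2 :: "half_line_L2 \<Rightarrow> half_line_L2" where
  "sgn_half_line_L2 x = inverse (norm x) *\<^sub>R x"

definition uniformity_half_line_L2 :: "(half_line_L2 \<times> half_line_L2) filter" where
  "uniformity_half_line_L2 = (INF e\<in>{0<..}. principal {(x, y). dist x y < e})"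

definition open_half_line_L2 :: "half_line_L2 set \<Rightarrow> bool" where
  "open_half_line_L2 U = (\<forall>x\<in>U. \<forall>\<^sub>F (x', y) in uniformity. x' = x \<longrightarrow> y \<in> U)"

lemma inner_to_L2_self:
  assumes "square_integrable f"
  shows "inner (to_L2 f) (to_L2 f) = (LINT x|half_line. (norm (f x))\<^sup>2)"
proof -
  have "L2_rel f f" using assms by (simp add: L2_rel_def)
  then have "inner (to_L2 f) (to_L2 f) = Re (LINT x|half_line. cnj (f x) * f x)"
    by (simp add: inner_half_line_L2.abs_eq)
  also have "(LINT x|half_line. cnj (f x) * f x)
      = (LINT x|half_line. complex_of_real ((norm (f x))\<^sup>2))"
    by (intro Bochner_Integration.integral_cong refl)
       (simp add: complex_norm_square mult.commute del: of_real_power)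
  finally show ?thesis
    by (simp only: integral_complex_of_real Re_complex_of_real)
qed

instance
proof
  fix x y z :: half_line_L2 and r q :: real
  show "x + y + z = x + (y + z)"
    by (transfer, rule L2_rel_reflI)
       ((intro square_integrable_intros L2_rel_square_integrable; assumption),
        simp add: algebra_simps)
  show "x + y = y + x"
    by (transfer, rule L2_rel_reflI)
       ((intro square_integrable_intros L2_rel_square_integrable; assumption),
        simp add: algebra_simps)
  show "0 + x = x"
    by (transfer, rule L2_rel_reflI)
       ((intro square_integrable_intros L2_rel_square_integrable; assumption),
        simp add: algebra_simps)
  show "- x + x = 0"
    by (transfer, rule L2_rel_reflI)
       ((intro square_integrable_intros L2_rel_square_integrable; assumption),
        simp add: algebra_simps)
  show "x - y = x + - y"
    by (transfer, rule L2_rel_reflI)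
       ((intro square_integrable_intros L2_rel_square_integrable; assumption),
        simp add: algebra_simps)
  show "r *\<^sub>R (x + y) = r *\<^sub>R x + r *\<^sub>R y"
    by (transfer, rule L2_rel_reflI)
       ((intro square_integrable_intros L2_rel_square_integrable; assumption),
        simp add: algebra_simps)
  show "(r + q) *\<^sub>R x = r *\<^sub>R x + q *\<^sub>R x"
    by (transfer, rule L2_rel_reflI)
       ((intro square_integrable_intros L2_rel_square_integrable; assumption),
        simp add: algebra_simps)
  show "r *\<^sub>R q *\<^sub>R x = (r * q) *\<^sub>R x"
    by (transfer, rule L2_rel_reflI)
       ((intro square_integrable_intros L2_rel_square_integrable; assumption),
        simp add: algebra_simps)
  show "1 *\<^sub>R x = x"
    by (transfer, rule L2_rel_reflI)
       ((intro square_integrable_intros L2_rel_square_integrable; assumption),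
        simp add: algebra_simps)
  show "dist x y = norm (x - y)" by (fact dist_half_line_L2_def)
  show "sgn x = inverse (norm x) *\<^sub>R x" by (fact sgn_half_line_L2_def)
  show "uniformity = (INF e\<in>{0<..}. principal {(x :: half_line_L2, y). dist x y < e})"
    by (fact uniformity_half_line_L2_def)
  show "open U \<longleftrightarrow> (\<forall>x\<in>U. \<forall>\<^sub>F (x', y) in uniformity. x' = x \<longrightarrow> y \<in> U)"
    for U :: "half_line_L2 set"
    by (fact open_half_line_L2_def)
  show "norm x = sqrt (inner x x)" by (fact norm_half_line_L2_def)
  show "inner x y = inner y x"
  proof transfer
    fix f g :: "real \<Rightarrow> complex"
    have "(LINT x|half_line. cnj (g x) * f x) = (LINT x|half_line. cnj (cnj (f x) * g x))"
      by (simp add: mult.commute)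
    also have "\<dots> = cnj (LINT x|half_line. cnj (f x) * g x)"
      by (rule Bochner_Integration.integral_cnj)
    finally show "Re (LINT x|half_line. cnj (f x) * g x) = Re (LINT x|half_line. cnj (g x) * f x)"
      by simp
  qed
  show "inner (x + y) z = inner x z + inner y z"
    by transfer (auto simp: L2_rel_def distrib_right square_integrable_product)
  show "inner (r *\<^sub>R x) y = r * inner x y"
    by transfer (simp add: mult.assoc)
  obtain f where f: "square_integrable f" "x = to_L2 f"
    by (rule to_L2_cases)
  show "0 \<le> inner x x"
    using f by (simp add: inner_to_L2_self)
  show "inner x x = 0 \<longleftrightarrow> x = 0"
  proof -
    have "inner x x = 0 \<longleftrightarrow> (AE t in half_line. (norm (f t))\<^sup>2 = 0)"
      using f by (simp add: inner_to_L2_self square_integrable_def integral_nonneg_eq_0_iff_AE)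
    also have "\<dots> \<longleftrightarrow> L2_rel f (\<lambda>t. 0)"
      using f by (simp add: L2_rel_def square_integrable_zero)
    also have "\<dots> \<longleftrightarrow> x = 0"
      using f square_integrable_zero Quotient3_rel[OF Quotient3_half_line_L2, of f "\<lambda>t. 0"]
      unfolding f zero_half_line_L2_def by (simp add: L2_rel_def)
    finally show ?thesis .
  qed
qed

end

lemma dist_to_L2:
  assumes "square_integrable f" "square_integrable g"
  shows "dist (to_L2 f) (to_L2 g) = sqrt (LINT x|half_line. (norm (f x - g x))\<^sup>2)"
proof -
  have "to_L2 f - to_L2 g = to_L2 (\<lambda>x. f x - g x)"
    using assms by (simp add: minus_half_line_L2.abs_eq L2_rel_def)
  then show ?thesis
    using assms
    by (simp add: dist_norm norm_eq_sqrt_inner inner_to_L2_self square_integrable_diff)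
qed

instantiation half_line_L2 :: complex_hilbert_space
begin

lift_definition scaleC_half_line_L2 :: "complex \<Rightarrow> half_line_L2 \<Rightarrow> half_line_L2"
  is "\<lambda>c f x. c * f x"
  by (auto simp: L2_rel_def square_integrable_scale)

lift_definition cinner_half_line_L2 :: "half_line_L2 \<Rightarrow> half_line_L2 \<Rightarrow> complex"
  is "\<lambda>f g. LINT x|half_line. cnj (f x) * g x"
proof (rule integral_cong_AE)
  fix f1 f2 g1 g2 assume *: "L2_rel f1 f2" "L2_rel g1 g2"
  then show "(\<lambda>x. cnj (f1 x) * g1 x) \<in> borel_measurable half_line"
    "(\<lambda>x. cnj (f2 x) * g2 x) \<in> borel_measurable half_line"
    using square_integrable_product by (auto simp: L2_rel_def)
  show "AE x in half_line. cnj (f1 x) * g1 x = cnj (f2 x) * g2 x"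
    using * by (auto simp: L2_rel_def)
qed

instance
proof
  fix x y z :: half_line_L2 and c d :: complex and r :: real
  show "c *\<^sub>C (x + y) = c *\<^sub>C x + c *\<^sub>C y"
    by (transfer, rule L2_rel_reflI)
       ((intro square_integrable_intros L2_rel_square_integrable; assumption),
        simp add: algebra_simps)
  show "(c + d) *\<^sub>C x = c *\<^sub>C x + d *\<^sub>C x"
    by (transfer, rule L2_rel_reflI)
       ((intro square_integrable_intros L2_rel_square_integrable; assumption),
        simp add: algebra_simps)
  show "c *\<^sub>C d *\<^sub>C x = (c * d) *\<^sub>C x"
    by (transfer, rule L2_rel_reflI)
       ((intro square_integrable_intros L2_rel_square_integrable; assumption),
        simp add: algebra_simps)
  show "r *\<^sub>R x = complex_of_real r *\<^sub>C x"
    by (transfer, rule L2_rel_reflI)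
       ((intro square_integrable_intros L2_rel_square_integrable; assumption),
        simp add: algebra_simps)
  show "cinner x (y + z) = cinner x y + cinner x z"
    by transfer (auto simp: L2_rel_def distrib_left square_integrable_product)
  show "cinner x (c *\<^sub>C y) = c * cinner x y"
    by transfer (simp add: mult.left_commute)
  show "cinner y x = cnj (cinner x y)"
  proof transfer
    fix f g :: "real \<Rightarrow> complex"
    have "(LINT x|half_line. cnj (g x) * f x) = (LINT x|half_line. cnj (cnj (f x) * g x))"
      by (simp add: mult.commute)
    then show "(LINT x|half_line. cnj (g x) * f x) = cnj (LINT x|half_line. cnj (f x) * g x)"
      by (simp only: Bochner_Integration.integral_cnj)
  qed
  show "inner x y = Re (cinner x y)"
    by transfer simp
next
  fix X :: "nat \<Rightarrow> half_line_L2"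
  assume X: "Cauchy X"
  have "\<exists>f. square_integrable f \<and> X n = to_L2 f" for n
    by (rule to_L2_cases[of "X n"]) blast
  then obtain f where f: "\<And>n. square_integrable (f n)" and Xf: "\<And>n. X n = to_L2 (f n)"
    by metis
  obtain g where g: "square_integrable g"
    and lim: "(\<lambda>n. LINT x|half_line. (norm (f n x - g x))\<^sup>2) \<longlonglongrightarrow> 0"
  proof (rule L2_complete[OF f])
    fix e :: real assume "e > 0"
    with X obtain N where N: "\<And>m n. m \<ge> N \<Longrightarrow> n \<ge> N \<Longrightarrow> dist (X m) (X n) < sqrt e"
      unfolding Cauchy_def by (metis real_sqrt_gt_zero)
    then show "\<exists>N. \<forall>m\<ge>N. \<forall>n\<ge>N. (LINT x|half_line. (norm (f m x - f n x))\<^sup>2) < e"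
      by (auto simp: Xf dist_to_L2 f)
  qed
  have "(\<lambda>n. dist (X n) (to_L2 g)) \<longlonglongrightarrow> 0"
    using tendsto_real_sqrt[OF lim] by (simp add: Xf dist_to_L2 f g)
  then show "convergent X"
    using tendsto_dist_iff convergentI by blast
qed

end


section \<open>Schroedinger operators on the half-line\<close>

text \<open>\<open>f\<close> is locally absolutely continuous on the closed half-line, with derivative \<open>f'\<close>.\<close>

definition locally_ac :: "(real \<Rightarrow> complex) \<Rightarrow> (real \<Rightarrow> complex) \<Rightarrow> bool" where
  "locally_ac f f' \<longleftrightarrow>
     (\<forall>x\<ge>0. f' absolutely_integrable_on {0..x} \<and> f x = f 0 + integral {0..x} f')"

text \<open>\<open>u\<close> and \<open>u'\<close> are locally absolutely continuous and \<open>- u'' + V u = f\<close>. The second derivative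
  is only determined up to a null set, and so is \<open>f\<close>.\<close>

definition schroedinger_expr ::
  "(real \<Rightarrow> real) \<Rightarrow> (real \<Rightarrow> complex) \<Rightarrow> (real \<Rightarrow> complex) \<Rightarrow> (real \<Rightarrow> complex) \<Rightarrow> bool" where
  "schroedinger_expr V u u' f \<longleftrightarrow> (\<exists>u''. locally_ac u u' \<and> locally_ac u' u'' \<and>
     (\<forall>x\<ge>0. f x = - u'' x + complex_of_real (V x) * u x))"

definition locally_integrable :: "(real \<Rightarrow> real) \<Rightarrow> bool" where
  "locally_integrable V \<longleftrightarrow> (\<forall>x\<ge>0. V absolutely_integrable_on {0..x})"

text \<open>Solutions are continuous up to \<open>0\<close>, so square integrability at infinity is the same as
  square integrability on the half-line.\<close>

definition limit_circle :: "(real \<Rightarrow> real) \<Rightarrow> bool" where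
  "limit_circle V \<longleftrightarrow>
     (\<forall>z u u'. schroedinger_expr V u u' (\<lambda>x. z * u x) \<longrightarrow> square_integrable u)"

definition limit_point :: "(real \<Rightarrow> real) \<Rightarrow> bool" where
  "limit_point V \<longleftrightarrow> \<not> limit_circle V"

definition schroedinger_graph ::
  "(real \<Rightarrow> real) \<Rightarrow> real \<Rightarrow> (half_line_L2 \<times> half_line_L2) set" where
  "schroedinger_graph V \<theta> = {(to_L2 u, to_L2 f) | u f. \<exists>u'. schroedinger_expr V u u' f \<and>
     square_integrable u \<and> square_integrable f \<and>
     complex_of_real (cos \<theta>) * u 0 + complex_of_real (sin \<theta>) * u' 0 = 0}"

definition schroedinger_op :: "(real \<Rightarrow> real) \<Rightarrow> real \<Rightarrow> half_line_L2 unbounded_op" where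
  "schroedinger_op V \<theta> =
     \<lparr> op_dom = Domain (schroedinger_graph V \<theta>),
       op_app = (\<lambda>\<psi>. THE \<eta>. (\<psi>, \<eta>) \<in> schroedinger_graph V \<theta>) \<rparr>"

end

theory Submission
  imports Defs "HOL-Probability.Probability" "HOL-Complex_Analysis.Complex_Analysis"
begin

text \<open>Both families are treated as the restrictions \<open>h = t g\<close> of one maximal operator with boundary values
  \<open>g\<close> and \<open>h\<close>, with \<open>t = - 1 / \<lambda>\<close> or \<open>t = - cot (\<theta> - \<theta>\<^sub>0)\<close>. Let \<open>\<gamma>(z)\<close> be the
  deficiency vectors with \<open>g = 1\<close>. An energy \<open>E\<close> can only be an eigenvalue of a perturbed operator if
  \<open>\<gamma>(E + i \<epsilon>)\<close> stays bounded as \<open>\<epsilon> \<rightarrow> 0\<close>, i.e. if \<open>E\<close> lies in one of the closed sets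
  \<open>G\<^sub>n = {E. \<forall>\<epsilon>. \<parallel>\<gamma>(E + i \<epsilon>)\<parallel> \<le> n}\<close>. On an interval in \<open>G\<^sub>n\<close> the spectral measure of the cyclic vector
  \<open>\<gamma>(i)\<close> would vanish, so \<open>G\<^sub>n\<close> has empty interior, and Baire's theorem gives (i). The parameter \<open>t\<close> of
  the eigenvalue \<open>E\<close> depends on \<open>E\<close> locally injectively and continuously on \<open>G\<^sub>n\<close>, so the parameters with
  eigenvalues form a meagre set. The spectrum keeps containing \<open>[a, b]\<close>, and the absence of an
  absolutely continuous part is inherited through the resolvent formula and Kolmogorov's weak type
  estimate; this gives (ii).\<close>

text \<open>For the rank one family \<open>\<gamma>(z)\<close> is (A - z)^(-1)
  \<open>\<phi>\<close>, so its squared norm at E + i e is the integral of d\<open>\<mu>\<close>(x)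
  / ((x - E)^2 + e^2). As e tends to 0 this increases to the integral of d\<open>\<mu>\<close>(x) /
  (x - E)^2, the classical function whose finiteness decides whether E is an eigenvalue for some
  coupling. The operator D itself corresponds to t = infinity and is treated apart, through the
  countability of its eigenvalues. Three obstacles shape the rest. The definitions speak of exp (i s
  D), the argument of resolvents; spectral measures are therefore built from the Cayley transform
  and identified afterwards through uniqueness of the group. Absence of an absolutely continuous
  part is expressed by convergence to 0 in measure of Poisson integrals: this avoids boundary values
  almost everywhere and survives multiplication by factors that are merely bounded in measure, which
  is what the weak type estimate gives for the matrix elements in the resolvent formula. Finally,
  cyclicity is not a hypothesis for the differential operators; it is derived from an entire
  function that decays away from the real axis.\<close>

abbreviation (input) cr :: "real \<Rightarrow> complex" where "cr \<equiv> complex_of_real"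

notation (input) LIMSEQ ("((_)/ ----> (_))" [60, 60] 60)

section \<open>Complex Hilbert spaces\<close>

lemma cinner_add_left: "cinner (x + y) z = cinner x z + cinner (y :: 'a :: complex_hilbert_space) z"
  by (metis cinner_commute cinner_add_right complex_cnj_add)

lemma cinner_scaleC_left: "cinner (c *\<^sub>C x) y = cnj c*cinner (x :: 'a :: complex_hilbert_space) y"
  by (metis cinner_commute cinner_scaleC_right complex_cnj_mult)

lemma scaleC_one [simp]: "1 *\<^sub>C x = (x :: 'a :: complex_hilbert_space)"
  by (fact complex_vector.scale_one)

lemma scaleC_zero_left [simp]: "0 *\<^sub>C x = (0 :: 'a :: complex_hilbert_space)"
  by (fact complex_vector.scale_zero_left)

lemma scaleC_zero_right [simp]: "c *\<^sub>C 0 = (0 :: 'a :: complex_hilbert_space)"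
  by (fact complex_vector.scale_zero_right)

lemma scaleC_eq_0_iff [simp]: "c *\<^sub>C x = 0 \<longleftrightarrow> c = 0 \<or> x = (0 :: 'a :: complex_hilbert_space)"
  by (fact complex_vector.scale_eq_0_iff)

lemma scaleC_minus1: "(-1) *\<^sub>C x = - (x :: 'a :: complex_hilbert_space)"
  using complex_vector.scale_minus_left[of 1 x] by simp

lemmas scaleC_minus_left = complex_vector.scale_minus_left
  and scaleC_minus_right = complex_vector.scale_minus_right
  and scaleC_diff_right = complex_vector.scale_right_diff_distrib
  and scaleC_diff_left = complex_vector.scale_left_diff_distrib

lemma cinner_zero_right [simp]: "cinner x 0 = 0" using cinner_scaleC_right[of x 0 0] by simp

lemma cinner_zero_left [simp]: "cinner 0 x = 0" using cinner_scaleC_left[of 0 0 x] by simp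

lemma cinner_minus_right [simp]: "cinner x (- y) = - cinner x y"
  using cinner_scaleC_right[of x "-1" y] by (simp add: scaleC_minus1)

lemma cinner_minus_left [simp]: "cinner (- x) y = - cinner x y"
  using cinner_scaleC_left[of "-1" x y] by (simp add: scaleC_minus1)

lemma cinner_diff_right: "cinner x (y - z) = cinner x y - cinner x z"
  using cinner_add_right[of x y "- z"] by simp

lemma cinner_diff_left: "cinner (x - y) z = cinner x z - cinner y z"
  using cinner_add_left[of x "- y" z] by simp

lemmas cinner_simps = cinner_add_left cinner_add_right cinner_diff_left cinner_diff_right
  cinner_scaleC_left cinner_scaleC_right

lemma cinner_sum_right: "cinner x (\<Sum>i\<in>I. f i) = (\<Sum>i\<in>I. cinner x (f i))"
  by (induction I rule: infinite_finite_induct) (simp_all add: cinner_add_right)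

lemma cinner_sum_left: "cinner (\<Sum>i\<in>I. f i) x = (\<Sum>i\<in>I. cinner (f i) x)"
  by (induction I rule: infinite_finite_induct) (simp_all add: cinner_add_left)

text \<open>Makes the limit rules for the real inner product available for
  \<open>cinner\<close>.\<close>

lemma cinner_eq_Complex: "cinner x y = Complex (inner x y) (- inner x (\<i> *\<^sub>C y))"
  by (simp add: complex_eq_iff inner_cinner cinner_scaleC_right)

lemma cinner_self: "cinner x x = cr ((norm x)\<^sup>2)"
proof -
  have "Im (cinner x x) = 0" using arg_cong[OF cinner_commute[of x x], of Im] by simp
  thus ?thesis by (simp add: complex_eq_iff power2_norm_eq_inner inner_cinner)
qed

lemma cinner_self_eq_0 [simp]: "cinner x x = 0 \<longleftrightarrow> x = 0" by (simp add: cinner_self)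

lemma cnj_cinner: "cnj (cinner x y) = cinner y x" by (metis cinner_commute)

lemma norm_scaleC [simp]: "norm (c *\<^sub>C x) = cmod c*norm (x :: 'a :: complex_hilbert_space)"
proof -
  have "cr ((norm (c *\<^sub>C x))\<^sup>2) = cr ((cmod c*norm x)\<^sup>2)"
    unfolding cinner_self[symmetric] cinner_scaleC_left cinner_scaleC_right
    by (simp add: cinner_self power_mult_distrib complex_norm_square mult.assoc[symmetric] mult.commute
         del: of_real_power)
  hence "(norm (c *\<^sub>C x))\<^sup>2 = (cmod c*norm x)\<^sup>2" by (simp only: of_real_eq_iff)
  thus ?thesis by (simp add: power2_eq_iff_nonneg)
qed

text \<open>The phase \<open>c\<close> rotates \<open>y\<close> so that the inner product becomes
  real and nonnegative; then the real Cauchy-Schwarz inequality applies, and the rotation does not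
  change the norm of \<open>y\<close>.\<close>

lemma cmod_cinner_le: "cmod (cinner x y) <= norm x*norm y"
proof (cases "cinner x y = 0")
  case False
  define c where "c = cnj (cinner x y)/cmod (cinner x y)"
  have c: "cmod c = 1" using False by (simp add: c_def norm_divide)
  have "cnj (cinner x y)*cinner x y = cmod (cinner x y)*cmod (cinner x y)"
    using complex_norm_square[of "cinner x y"] by (simp only: mult.commute power2_eq_square of_real_mult)
  hence "c*cinner x y = cmod (cinner x y)" using False unfolding c_def by (simp add: field_simps)
  hence "cmod (cinner x y) = inner x (c *\<^sub>C y)" by (simp add: inner_cinner cinner_scaleC_right)
  also have "... <= norm x*norm (c *\<^sub>C y)" by (rule norm_cauchy_schwarz)
  finally show ?thesis using c by simp
qed simp

lemma norm_diff_sq: "(norm (x - y))\<^sup>2 = (norm x)\<^sup>2 + (norm y)\<^sup>2 - 2*Re (cinner x (y :: 'a :: complex_hilbert_space))"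
  by (simp add: power2_norm_eq_inner inner_diff inner_commute inner_cinner[symmetric])

lemma norm_add_sq: "(norm (x + y))\<^sup>2 = (norm x)\<^sup>2 + (norm y)\<^sup>2 + 2*Re (cinner x (y :: 'a :: complex_hilbert_space))"
  by (simp add: power2_norm_eq_inner inner_add inner_commute inner_cinner[symmetric])

lemma norm_add_sq_le: "(norm (x + y))\<^sup>2 <= 2*(norm x)\<^sup>2 + 2*(norm (y :: 'a :: real_inner))\<^sup>2"
proof -
  have "(norm (x + y))\<^sup>2 + (norm (x - y))\<^sup>2 = 2*(norm x)\<^sup>2 + 2*(norm y)\<^sup>2"
    by (simp add: power2_norm_eq_inner inner_add inner_diff inner_commute)
  thus ?thesis by (smt (verit) zero_le_power2)
qed

lemma tendsto_scaleC [tendsto_intros]: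
  fixes x :: "'b => 'a :: complex_hilbert_space"
  assumes c: "(c \<longlongrightarrow> c0) F" and x: "(x \<longlongrightarrow> x0) F"
  shows "((%i. c i *\<^sub>C x i) \<longlongrightarrow> c0 *\<^sub>C x0) F"
proof (rule Lim_null[THEN iffD2], rule Lim_null_comparison)
  have "norm (c i *\<^sub>C x i - c0 *\<^sub>C x0) <= cmod (c i - c0)*norm (x i) + cmod c0*norm (x i - x0)" for i
  proof -
    have "c i *\<^sub>C x i - c0 *\<^sub>C x0 = (c i - c0) *\<^sub>C x i + c0 *\<^sub>C (x i - x0)"
      by (simp add: scaleC_diff_left scaleC_diff_right)
    thus ?thesis by (metis norm_scaleC norm_triangle_ineq)
  qed
  thus "\<forall>\<^sub>F i in F. norm (c i *\<^sub>C x i - c0 *\<^sub>C x0) <= cmod (c i - c0)*norm (x i) + cmod c0*norm (x i - x0)"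
    by simp
  have "((%i. cmod (c i - c0)*norm (x i) + cmod c0*norm (x i - x0)) \<longlongrightarrow>
      cmod (c0 - c0)*norm x0 + cmod c0*norm (x0 - x0)) F" by (intro tendsto_intros c x)
  thus "((%i. cmod (c i - c0)*norm (x i) + cmod c0*norm (x i - x0)) \<longlongrightarrow> 0) F" by simp
qed

lemma tendsto_cinner [tendsto_intros]:
  fixes x :: "'b => 'a :: complex_hilbert_space"
  assumes "(x \<longlongrightarrow> x0) F" "(y \<longlongrightarrow> y0) F"
  shows "((%i. cinner (x i) (y i)) \<longlongrightarrow> cinner x0 y0) F"
  unfolding cinner_eq_Complex by (intro tendsto_intros assms)

lemma continuous_on_scaleC [continuous_intros]:
  fixes x :: "'b :: topological_space => 'a :: complex_hilbert_space"
  shows "continuous_on S c ==> continuous_on S x ==> continuous_on S (%i. c i *\<^sub>C x i)"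
  unfolding continuous_on_def by (auto intro: tendsto_intros)

lemma continuous_on_cinner [continuous_intros]:
  fixes x :: "'b :: topological_space => 'a :: complex_hilbert_space"
  shows "continuous_on S x ==> continuous_on S y ==> continuous_on S (%i. cinner (x i) (y i))"
  unfolding continuous_on_def by (auto intro: tendsto_intros)

lemma cinner_closure_zero:
  assumes "y \<in> closure S" "!!x. x \<in> S ==> cinner x v = 0"
  shows "cinner y v = 0"
proof -
  obtain s where s: "!!n. s n \<in> S" "s ----> y" using assms(1) unfolding closure_sequential by blast
  have "(%n. cinner (s n) v) ----> cinner y v" by (intro tendsto_intros s)
  thus ?thesis using assms(2) s(1) by (simp add: LIMSEQ_const_iff)
qed

lemma dense_orthogonal_zero:
  assumes "closure S = UNIV" "!!x. x \<in> S ==> cinner x v = 0"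
  shows "v = 0" using cinner_closure_zero[of v S v] assms by simp

lemma polarization:
  fixes x y :: "'a :: complex_hilbert_space"
  assumes add: "!!x y. T (x + y) = T x + T y" and scale: "!!c x. T (c *\<^sub>C x) = c *\<^sub>C T x"
  shows "4*cinner x (T y) = cinner (x + y) (T (x + y)) - cinner (x - y) (T (x - y))
     - \<i>*cinner (x + \<i> *\<^sub>C y) (T (x + \<i> *\<^sub>C y)) + \<i>*cinner (x - \<i> *\<^sub>C y) (T (x - \<i> *\<^sub>C y))"
proof -
  have diff: "T (u - w) = T u - T w" for u w
    using add[of u "- w"] scale[of "-1" w] by (simp add: scaleC_minus1)
  show ?thesis by (simp add: add scale diff cinner_simps algebra_simps)
qed

text \<open>A minimising sequence for the distance to a closed subspace is Cauchy by the parallelogram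
  law.\<close>

lemma orthogonal_decomposition:
  fixes M :: "'a :: complex_hilbert_space set"
  assumes sub: "complex_vector.subspace M" and closed: "closed M"
  obtains y where "y \<in> M" "!!m. m \<in> M ==> cinner m (x - y) = 0"
proof -
  define d where "d = infdist x M"
  have M0: "0 \<in> M" using sub complex_vector.subspace_0 by blast
  hence ne: "M ~= {}" by auto
  have d: "d <= norm (x - m)" if "m \<in> M" for m
    using infdist_le[OF that, of x] by (simp add: d_def dist_norm)
  have d0: "0 <= d" by (simp add: d_def infdist_nonneg)
  have "EX m:M. norm (x - m) < d + 1/real (Suc n)" for n
  proof -
    have "(INF m\<in>M. dist x m) < d + 1/real (Suc n)" using ne by (simp add: d_def infdist_def)
    thus ?thesis using ne by (subst (asm) cINF_less_iff) (auto simp: dist_norm intro: bdd_belowI2[of _ 0])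
  qed
  then obtain m where m: "!!n. m n \<in> M" "!!n. norm (x - m n) < d + 1/real (Suc n)" by metis
  define e where "e n = (d + 1/real (Suc n))\<^sup>2 - d\<^sup>2" for n
  have e: "(norm (x - m n))\<^sup>2 <= d\<^sup>2 + e n" for n
    unfolding e_def using m(2)[of n] by (simp add: power_mono less_imp_le)
  have "(%n. (d + 1/real (Suc n))\<^sup>2 - d\<^sup>2) ----> (d + 0)\<^sup>2 - d\<^sup>2"
    using LIMSEQ_inverse_real_of_nat by (intro tendsto_intros) (simp add: inverse_eq_divide)
  hence e_lim: "e ----> 0" by (simp add: e_def[abs_def])
  have key: "(norm (m i - m j))\<^sup>2 <= 2*e i + 2*e j" for i j
  proof -
    have mid: "(1/2) *\<^sub>C (m i + m j) \<in> M" using sub m(1) by (simp add: complex_vector.subspace_def)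
    have "2 *\<^sub>C (x - (1/2) *\<^sub>C (m i + m j)) = (x - m i) + (x - m j)"
    proof -
      have "2 *\<^sub>C x = x + x" using scaleC_add_left[of 1 1 x] by simp
      thus ?thesis by (simp add: scaleC_diff_right scaleC_scaleC)
    qed
    hence "norm ((x - m i) + (x - m j)) = 2*norm (x - (1/2) *\<^sub>C (m i + m j))"
      by (metis norm_scaleC norm_numeral)
    hence "(norm ((x - m i) + (x - m j)))\<^sup>2 >= 4*d\<^sup>2"
      using power_mono[OF d[OF mid] d0, of 2] by (simp add: power_mult_distrib)
    moreover have "(norm ((x - m i) + (x - m j)))\<^sup>2 + (norm ((x - m i) - (x - m j)))\<^sup>2
        = 2*(norm (x - m i))\<^sup>2 + 2*(norm (x - m j))\<^sup>2"
      unfolding norm_diff_sq[of "x - m i"] norm_add_sq[of "x - m i"] by simp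
    moreover have "norm ((x - m i) - (x - m j)) = norm (m i - m j)" by (simp add: norm_minus_commute)
    ultimately show ?thesis using e[of i] e[of j] by simp
  qed
  have "Cauchy m"
  proof (rule metric_CauchyI)
    fix r :: real assume r: "r > 0"
    obtain N where N: "!!n. n >= N ==> \<bar>e n\<bar> < r\<^sup>2/4"
      using LIMSEQ_D[OF e_lim, of "r\<^sup>2/4"] r by auto
    have "dist (m i) (m j) < r" if "i >= N" "j >= N" for i j
    proof -
      have "(norm (m i - m j))\<^sup>2 < r\<^sup>2" using key[of i j] N[OF that(1)] N[OF that(2)] by linarith
      thus ?thesis using r by (simp add: dist_norm power_less_imp_less_base)
    qed
    thus "EX N. ALL i>=N. ALL j>=N. dist (m i) (m j) < r" by blast
  qed
  then obtain y where y: "m ----> y" using Cauchy_convergent_iff convergent_def by blast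
  have yM: "y \<in> M" using closed m(1) y closed_sequentially by blast
  have "(%n. (norm (x - m n))\<^sup>2) ----> (norm (x - y))\<^sup>2" by (intro tendsto_intros y)
  moreover have "(%n. d\<^sup>2 + e n) ----> d\<^sup>2 + 0" by (intro tendsto_intros e_lim)
  ultimately have yd: "(norm (x - y))\<^sup>2 <= d\<^sup>2"
    using LIMSEQ_le[OF _ _ , of _ "(norm (x - y))\<^sup>2" _ "d\<^sup>2 + 0"] e by auto
  have "cinner k (x - y) = 0" if k: "k \<in> M" for k
  proof (cases "k = 0")
    case False
    \<comment> \<open>Moving \<open>y\<close> along \<open>k\<close> by this optimal coefficient
      would lower the squared distance by |c|^2 |k|^2, which minimality forbids unless
      \<open>c\<close> vanishes.\<close>
    define c where "c = cinner k (x - y)/(norm k)\<^sup>2"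
    have "y + c *\<^sub>C k \<in> M" using sub k yM by (simp add: complex_vector.subspace_def)
    from power_mono[OF d[OF this] d0, of 2]
    have "d\<^sup>2 <= (norm ((x - y) - c *\<^sub>C k))\<^sup>2" by (simp add: algebra_simps)
    also have "... = (norm (x - y))\<^sup>2 + (cmod c)\<^sup>2*(norm k)\<^sup>2 - 2*Re (c*cinner (x - y) k)"
      by (simp add: norm_diff_sq cinner_scaleC_right power_mult_distrib)
    also have "c*cinner (x - y) k = cr ((cmod c)\<^sup>2*(norm k)\<^sup>2)"
    proof -
      have "cinner (x - y) k = cnj c*(norm k)\<^sup>2" using False unfolding c_def by (simp add: cnj_cinner)
      thus ?thesis by (simp add: complex_norm_square mult.assoc[symmetric] del: of_real_power)
    qed
    finally have "(cmod c)\<^sup>2*(norm k)\<^sup>2 <= 0" using yd by (simp add: mult.commute)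
    hence "c = 0" using False by (simp add: mult_le_0_iff)
    thus ?thesis using False by (simp add: c_def)
  qed simp
  thus ?thesis using that yM by blast
qed

lemma closed_subspace_eq_UNIV:
  fixes M :: "'a :: complex_hilbert_space set"
  assumes "complex_vector.subspace M" "closed M" "!!v. (!!m. m \<in> M ==> cinner m v = 0) ==> v = 0"
  shows "M = UNIV"
proof -
  have "x \<in> M" for x
  proof -
    obtain y where "y \<in> M" "!!m. m \<in> M ==> cinner m (x - y) = 0"
      using orthogonal_decomposition assms by metis
    thus ?thesis using assms(3)[of "x - y"] by simp
  qed
  thus ?thesis by auto
qed

section \<open>Self-adjoint operators and their resolvents\<close>

definition bounded_clinear :: "('a :: complex_hilbert_space => 'a) => bool" where
  "bounded_clinear T \<longleftrightarrow> (ALL x y. T (x + y) = T x + T y) & (ALL c x. T (c *\<^sub>C x) = c *\<^sub>C T x) &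
     (EX K. ALL x. norm (T x) <= K*norm x)"

lemma bounded_clinearD:
  assumes "bounded_clinear T"
  shows "T (x + y) = T x + T y" "T (c *\<^sub>C x) = c *\<^sub>C T x" "T 0 = 0" "T (x - y) = T x - T y" "T (- x) = - T x"
proof -
  show add: "T (x + y) = T x + T y" and scale: "T (c *\<^sub>C x) = c *\<^sub>C T x" for x y c
    using assms by (auto simp: bounded_clinear_def)
  show "T 0 = 0" using scale[of 0 0] by simp
  show m: "T (- x) = - T x" for x using scale[of "-1" x] by (simp add: scaleC_minus1)
  show "T (x - y) = T x - T y" using add[of x "- y"] m[of y] by simp
qed

lemma bounded_clinear_bound:
  assumes "bounded_clinear T"
  obtains K where "K > 0" "!!x. norm (T x) <= K*norm x"
proof -
  obtain K where K: "!!x. norm (T x) <= K*norm x" using assms by (auto simp: bounded_clinear_def)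
  have "norm (T x) <= (\<bar>K\<bar> + 1)*norm x" for x by (rule order_trans[OF K mult_right_mono]) auto
  thus ?thesis using that[of "\<bar>K\<bar> + 1"] by simp
qed

lemma bounded_clinear_tendsto:
  assumes T: "bounded_clinear T" and x: "(x \<longlongrightarrow> x0) F"
  shows "((%i. T (x i)) \<longlongrightarrow> T x0) F"
proof -
  obtain K where K: "!!x. norm (T x) <= K*norm x" using bounded_clinear_bound[OF T] by metis
  show ?thesis
  proof (rule Lim_null[THEN iffD2], rule Lim_null_comparison)
    show "\<forall>\<^sub>F i in F. norm (T (x i) - T x0) <= K*norm (x i - x0)"
      using K by (simp add: bounded_clinearD(4)[OF T, symmetric])
    have "((%i. K*norm (x i - x0)) \<longlongrightarrow> K*norm (x0 - x0)) F" by (intro tendsto_intros x)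
    thus "((%i. K*norm (x i - x0)) \<longlongrightarrow> 0) F" by simp
  qed
qed

lemma linear_opD:
  assumes "linear_op A"
  shows "0 \<in> op_dom A" "x \<in> op_dom A ==> y \<in> op_dom A ==> x + y \<in> op_dom A"
    "x \<in> op_dom A ==> y \<in> op_dom A ==> x - y \<in> op_dom A" "x \<in> op_dom A ==> c *\<^sub>C x \<in> op_dom A"
    "x \<in> op_dom A ==> y \<in> op_dom A ==> op_app A (x + y) = op_app A x + op_app A y"
    "x \<in> op_dom A ==> op_app A (c *\<^sub>C x) = c *\<^sub>C op_app A x"
    "x \<in> op_dom A ==> y \<in> op_dom A ==> op_app A (x - y) = op_app A x - op_app A y"
    "op_app A 0 = 0"
proof -
  show z: "0 \<in> op_dom A" and a: "!!x y. x \<in> op_dom A ==> y \<in> op_dom A ==> x + y \<in> op_dom A"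
    and s: "!!c x. x \<in> op_dom A ==> c *\<^sub>C x \<in> op_dom A"
    and aa: "!!x y. x \<in> op_dom A ==> y \<in> op_dom A ==> op_app A (x + y) = op_app A x + op_app A y"
    and as: "!!c x. x \<in> op_dom A ==> op_app A (c *\<^sub>C x) = c *\<^sub>C op_app A x"
    using assms by (auto simp: linear_op_def complex_vector.subspace_def)
  show "op_app A 0 = 0" using as[OF z, of 0] by simp
  assume x: "x \<in> op_dom A" and y: "y \<in> op_dom A"
  show "x - y \<in> op_dom A" using a[OF x s[OF y, of "-1"]] by (simp add: scaleC_minus1)
  show "op_app A (x - y) = op_app A x - op_app A y"
    using aa[OF x s[OF y, of "-1"]] as[OF y, of "-1"] by (simp add: scaleC_minus1)
qed

lemma closure_subspace:
  fixes M :: "'a :: complex_hilbert_space set"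
  assumes sub: "complex_vector.subspace M"
  shows "complex_vector.subspace (closure M)" unfolding complex_vector.subspace_def
proof (intro conjI ballI allI)
  show "0 \<in> closure M" using closure_subset sub complex_vector.subspace_0 by blast
  fix x y assume "x \<in> closure M" "y \<in> closure M"
  then obtain s t where s: "!!n. s n \<in> M" "s ----> x" and t: "!!n. t n \<in> M" "t ----> y"
    unfolding closure_sequential by metis
  have "s n + t n \<in> M" for n using sub s(1) t(1) by (simp add: complex_vector.subspace_def)
  thus "x + y \<in> closure M" unfolding closure_sequential using tendsto_add[OF s(2) t(2)]
    by (intro exI[of _ "%n. s n + t n"]) auto
next
  fix c x assume "x \<in> closure M"
  then obtain s where s: "!!n. s n \<in> M" "s ----> x" unfolding closure_sequential by metis
  have "c *\<^sub>C s n \<in> M" for n using sub s(1) by (simp add: complex_vector.subspace_def)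
  thus "c *\<^sub>C x \<in> closure M"
    unfolding closure_sequential using tendsto_scaleC[OF tendsto_const s(2)]
    by (intro exI[of _ "%n. c *\<^sub>C s n"]) auto
qed

text \<open>Density comes out of the two surjectivities: a \<open>v\<close> orthogonal to the domain
  is (D - i) u with u = (D + i) w, and symmetry gives 0 = (w, v) = |u|^2. For y in the domain of the
  adjoint with image z one solves (D + i) u = z + i y; then y - u is orthogonal to the range of D -
  i, which is everything.\<close>

lemma self_adjointI:
  assumes lin: "linear_op D"
    and sym: "!!x y. x \<in> op_dom D ==> y \<in> op_dom D ==> cinner x (op_app D y) = cinner (op_app D x) y"
    and plus: "!!y. EX x:op_dom D. op_app D x + \<i> *\<^sub>C x = y"
    and minus: "!!y. EX x:op_dom D. op_app D x - \<i> *\<^sub>C x = y"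
  shows "self_adjoint D"
proof -
  have sub: "complex_vector.subspace (op_dom D)" using lin by (simp add: linear_op_def)
  have orth: "v = 0" if v: "!!x. x \<in> op_dom D ==> cinner x v = 0" for v
  proof -
    obtain u where u: "u \<in> op_dom D" "op_app D u - \<i> *\<^sub>C u = v" using minus by blast
    obtain w where w: "w \<in> op_dom D" "op_app D w + \<i> *\<^sub>C w = u" using plus by blast
    have "cinner w v = cinner (op_app D w + \<i> *\<^sub>C w) u"
      unfolding u(2)[symmetric] using sym[OF w(1) u(1)] by (simp add: cinner_simps)
    hence "u = 0" using v[OF w(1)] by (simp add: w(2))
    thus ?thesis using u(2) linear_opD(8)[OF lin] by simp
  qed
  have "closure (op_dom D) = UNIV"
  proof (rule closed_subspace_eq_UNIV)
    show "complex_vector.subspace (closure (op_dom D))" by (rule closure_subspace[OF sub])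
    show "v = 0" if "!!m. m \<in> closure (op_dom D) ==> cinner m v = 0" for v
      using that closure_subset by (intro orth) blast
  qed simp
  note dense = this
  have uniq: "z = z'" if "ALL x:op_dom D. cinner y (op_app D x) = cinner z x"
    "ALL x:op_dom D. cinner y (op_app D x) = cinner z' x" for y z z'
  proof -
    have "z - z' = 0"
    proof (rule orth)
      fix x assume "x \<in> op_dom D"
      hence "cinner (z - z') x = 0" using that by (simp add: cinner_diff_left)
      thus "cinner x (z - z') = 0" using cnj_cinner by (metis complex_cnj_zero)
    qed
    thus ?thesis by simp
  qed
  have in_dom: "y \<in> op_dom D" if z: "ALL x:op_dom D. cinner y (op_app D x) = cinner z x" for y z
  proof -
    obtain u where u: "u \<in> op_dom D" "op_app D u + \<i> *\<^sub>C u = z + \<i> *\<^sub>C y" using plus by blast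
    have "cinner (y - u) (op_app D x - \<i> *\<^sub>C x) = 0" if x: "x \<in> op_dom D" for x
    proof -
      have "cinner u (op_app D x - \<i> *\<^sub>C x) = cinner (op_app D u + \<i> *\<^sub>C u) x"
        using sym[OF u(1) x] by (simp add: cinner_simps)
      thus ?thesis using z[rule_format, OF x] unfolding u(2) cinner_diff_left[of y]
        by (simp add: cinner_simps)
    qed
    hence "cinner (y - u) (y - u) = 0" using minus[of "y - u"] by metis
    thus ?thesis using u by simp
  qed
  have eq: "(THE z. ALL x:op_dom D. cinner y (op_app D x) = cinner z x) = op_app D y" if "y \<in> op_dom D" for y
    using sym[OF that] uniq by (intro the_equality) blast+
  show ?thesis unfolding self_adjoint_def adjoint_op_def
  proof (intro conjI lin dense)
    show "op_dom \<lparr>op_dom = {y. EX z. ALL x:op_dom D. cinner y (op_app D x) = cinner z x},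
        op_app = %y. THE z. ALL x:op_dom D. cinner y (op_app D x) = cinner z x\<rparr> = op_dom D"
    proof (intro set_eqI iffI)
      fix y assume "y \<in> op_dom \<lparr>op_dom = {y. EX z. ALL x:op_dom D. cinner y (op_app D x) = cinner z x},
        op_app = %y. THE z. ALL x:op_dom D. cinner y (op_app D x) = cinner z x\<rparr>"
      then obtain z where "ALL x:op_dom D. cinner y (op_app D x) = cinner z x" by auto
      thus "y \<in> op_dom D" by (rule in_dom)
    next
      fix y assume "y \<in> op_dom D"
      hence "ALL x:op_dom D. cinner y (op_app D x) = cinner (op_app D y) x" using sym by simp
      thus "y \<in> op_dom \<lparr>op_dom = {y. EX z. ALL x:op_dom D. cinner y (op_app D x) = cinner z x},
        op_app = %y. THE z. ALL x:op_dom D. cinner y (op_app D x) = cinner z x\<rparr>" by auto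
    qed
  qed (simp add: eq)
qed

section \<open>Resolvents of a self-adjoint operator\<close>

locale selfadj =
  fixes D :: "'a :: complex_hilbert_space unbounded_op"
  assumes self_adjoint: "self_adjoint D"
begin

lemma lin: "linear_op D" and dense: "closure (op_dom D) = UNIV"
  using self_adjoint by (auto simp: self_adjoint_def)

lemmas dom_simps = linear_opD[OF lin]

lemma adjoint_uniq:
  assumes "!!x. x \<in> op_dom D ==> cinner z x = cinner z' x"
  shows "z = z'"
proof -
  have "z - z' = 0"
  proof (rule dense_orthogonal_zero[OF dense])
    fix x assume "x \<in> op_dom D"
    hence "cinner (z - z') x = 0" using assms by (simp add: cinner_diff_left)
    thus "cinner x (z - z') = 0" using cnj_cinner by (metis complex_cnj_zero)
  qed
  thus ?thesis by simp
qed

lemma adjointI: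
  assumes "!!x. x \<in> op_dom D ==> cinner y (op_app D x) = cinner z x"
  shows "y \<in> op_dom D" "op_app D y = z"
proof -
  have "y \<in> op_dom (adjoint_op D)" using assms by (auto simp: adjoint_op_def)
  thus y: "y \<in> op_dom D" using self_adjoint by (simp add: self_adjoint_def)
  have "op_app (adjoint_op D) y = z"
    unfolding adjoint_op_def using assms adjoint_uniq by (auto intro!: the_equality)
  thus "op_app D y = z" using self_adjoint y by (simp add: self_adjoint_def)
qed

lemma symmetric:
  assumes "x \<in> op_dom D" "y \<in> op_dom D"
  shows "cinner x (op_app D y) = cinner (op_app D x) y"
proof -
  have "x \<in> op_dom (adjoint_op D)" using assms self_adjoint by (simp add: self_adjoint_def)
  then obtain z where z: "ALL y:op_dom D. cinner x (op_app D y) = cinner z y" by (auto simp: adjoint_op_def)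
  hence "op_app D x = z" using adjointI(2) by blast
  thus ?thesis using z assms by blast
qed

lemma closed_graph:
  assumes "!!n. x n \<in> op_dom D" "x ----> x0" "(%n. op_app D (x n)) ----> y0"
  shows "x0 \<in> op_dom D" "op_app D x0 = y0"
proof -
  have "cinner x0 (op_app D v) = cinner y0 v" if v: "v \<in> op_dom D" for v
  proof -
    have "(%n. cinner (x n) (op_app D v)) ----> cinner x0 (op_app D v)" by (intro tendsto_intros assms)
    moreover have "(%n. cinner (x n) (op_app D v)) ----> cinner y0 v"
      using symmetric[OF assms(1) v] by (simp add: tendsto_cinner assms(3))
    ultimately show ?thesis by (rule LIMSEQ_unique)
  qed
  note * = this
  show "x0 \<in> op_dom D" by (rule adjointI(1)[of x0 y0]) (rule *)
  show "op_app D x0 = y0" by (rule adjointI(2)) (rule *)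
qed

text \<open>By symmetry (x, D x) is real, so the imaginary part of (x, (D - z) x) is - Im z
  |x|^2.\<close>

lemma norm_minus_scalar_ge:
  assumes x: "x \<in> op_dom D"
  shows "\<bar>Im z\<bar>*norm x <= norm (op_minus_scalar D z x)"
proof -
  have "cinner x (op_app D x) = cnj (cinner x (op_app D x))" using symmetric[OF x x] by (simp add: cnj_cinner)
  hence "Im (cinner x (op_app D x)) = - Im (cinner x (op_app D x))" by (metis cnj.simps(2))
  hence "Im (cinner x (op_app D x)) = 0" by simp
  hence "Im (cinner x (op_minus_scalar D z x)) = - Im z*(norm x)\<^sup>2"
    by (simp add: op_minus_scalar_def cinner_simps cinner_self del: of_real_power)
  hence "\<bar>Im z\<bar>*(norm x)\<^sup>2 <= cmod (cinner x (op_minus_scalar D z x))"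
    using abs_Im_le_cmod[of "cinner x (op_minus_scalar D z x)"] by (simp add: abs_mult)
  also have "... <= norm x*norm (op_minus_scalar D z x)" by (rule cmod_cinner_le)
  finally show ?thesis by (cases "x = 0") (simp_all add: power2_eq_square)
qed

text \<open>The bound at \<open>z\<close> gives injectivity and, with the closed graph, a closed
  range; the bound at \<open>cnj z\<close> kills the orthogonal complement of the range. For real z
  both bounds coincide, and in this form the lemma later puts real points into resolvent
  sets.\<close>

lemma resolvent_setI:
  assumes r: "r > 0" and low: "!!x. x \<in> op_dom D ==> r*norm x <= norm (op_minus_scalar D z x)"
    and low': "!!x. x \<in> op_dom D ==> r*norm x <= norm (op_minus_scalar D (cnj z) x)"
  shows "z \<in> resolvent_set D"
proof -
  let ?S = "op_minus_scalar D z"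
  have add: "?S (x + y) = ?S x + ?S y" "?S (x - y) = ?S x - ?S y" if "x \<in> op_dom D" "y \<in> op_dom D" for x y
    using that dom_simps by (auto simp: op_minus_scalar_def scaleC_add_right scaleC_diff_right)
  have scale: "?S (c *\<^sub>C x) = c *\<^sub>C ?S x" if "x \<in> op_dom D" for x c
    using that dom_simps by (auto simp: op_minus_scalar_def scaleC_diff_right scaleC_scaleC mult.commute)
  have inj: "inj_on ?S (op_dom D)"
  proof (rule inj_onI)
    fix x y assume xy: "x \<in> op_dom D" "y \<in> op_dom D" "?S x = ?S y"
    hence "r*norm (x - y) <= 0" using low[of "x - y"] add(2)[OF xy(1,2)] dom_simps by auto
    thus "x = y" using r by (simp add: mult_le_0_iff)
  qed
  have "?S ` op_dom D = UNIV"
  proof (rule closed_subspace_eq_UNIV)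
    show "complex_vector.subspace (?S ` op_dom D)" unfolding complex_vector.subspace_def
    proof (intro conjI ballI allI)
      have "?S 0 = 0" using dom_simps by (simp add: op_minus_scalar_def)
      thus "0 \<in> ?S ` op_dom D" using dom_simps(1) by force
      fix x y assume "x \<in> ?S ` op_dom D" "y \<in> ?S ` op_dom D"
      thus "x + y \<in> ?S ` op_dom D" using add(1) dom_simps(2) by force
    next
      fix c x assume "x \<in> ?S ` op_dom D"
      thus "c *\<^sub>C x \<in> ?S ` op_dom D" proof -
        from \<open>x \<in> ?S ` op_dom D\<close> obtain u where "u \<in> op_dom D" "x = ?S u" by blast
        thus ?thesis using scale[of u c] dom_simps(4)[of u c] by (intro image_eqI[of _ _ "c *\<^sub>C u"]) auto
      qed
    qed
    show "closed (?S ` op_dom D)" unfolding closed_sequential_limits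
    proof (intro allI impI, elim conjE)
      fix y l assume y: "ALL n. y n \<in> ?S ` op_dom D" and l: "y ----> l"
      have "EX x. x \<in> op_dom D & y n = ?S x" for n using y[rule_format, of n] by (rule imageE) blast
      then obtain x where x: "!!n. x n \<in> op_dom D" "!!n. y n = ?S (x n)" by metis
      have "Cauchy x"
      proof (rule metric_CauchyI)
        fix e :: real assume "e > 0"
        hence "r*e > 0" using r by simp
        then obtain N where N: "!!m n. m >= N ==> n >= N ==> norm (y m - y n) < r*e"
          using LIMSEQ_imp_Cauchy[OF l] unfolding Cauchy_def dist_norm by metis
        have "dist (x m) (x n) < e" if "m >= N" "n >= N" for m n
        proof -
          have "r*norm (x m - x n) < r*e" using low[OF dom_simps(3)[OF x(1) x(1), of m n]] N[OF that]
            unfolding add(2)[OF x(1) x(1)] x(2) by (rule le_less_trans)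
          thus ?thesis using r by (simp add: dist_norm)
        qed
        thus "EX N. ALL m>=N. ALL n>=N. dist (x m) (x n) < e" by blast
      qed
      then obtain x0 where x0: "x ----> x0" using Cauchy_convergent_iff convergent_def by blast
      have "(%n. y n + z *\<^sub>C x n) ----> l + z *\<^sub>C x0" by (intro tendsto_intros l x0)
      hence "(%n. op_app D (x n)) ----> l + z *\<^sub>C x0" by (simp add: x(2) op_minus_scalar_def)
      from closed_graph[OF x(1) x0 this] show "l \<in> ?S ` op_dom D"
        by (auto simp: op_minus_scalar_def intro!: image_eqI[of _ _ x0])
    qed
    show "v = 0" if v: "!!m. m \<in> ?S ` op_dom D ==> cinner m v = 0" for v
    proof -
      have "cinner v (op_app D x) = cinner (cnj z *\<^sub>C v) x" if "x \<in> op_dom D" for x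
      proof -
        have "cinner (?S x) v = 0" using v that by blast
        hence "cinner v (?S x) = 0" by (metis cnj_cinner complex_cnj_zero)
        thus ?thesis by (simp add: op_minus_scalar_def cinner_simps)
      qed
      from adjointI[OF this] have "v \<in> op_dom D" "op_minus_scalar D (cnj z) v = 0"
        by (auto simp: op_minus_scalar_def)
      thus ?thesis using low'[of v] r by (simp add: mult_le_0_iff)
    qed
  qed
  moreover have "norm x <= (1/r)*norm (?S x)" if "x \<in> op_dom D" for x
    using low[OF that] r by (simp add: field_simps)
  ultimately show ?thesis using inj unfolding resolvent_set_def bij_betw_def by blast
qed

lemma nonreal_in_resolvent_set:
  assumes z: "Im z ~= 0"
  shows "z \<in> resolvent_set D" using norm_minus_scalar_ge[of _ z] norm_minus_scalar_ge[of _ "cnj z"] z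
  by (intro resolvent_setI[of "\<bar>Im z\<bar>"]) auto

abbreviation "R \<equiv> resolvent D"

lemma resolvent_in_dom: "z \<in> resolvent_set D ==> R z y \<in> op_dom D"
  unfolding resolvent_def resolvent_set_def by (auto simp: bij_betw_def intro: inv_into_into)

lemma resolvent_right: "z \<in> resolvent_set D ==> op_app D (R z y) = y + z *\<^sub>C R z y"
proof -
  assume "z \<in> resolvent_set D"
  hence "op_minus_scalar D z (R z y) = y"
    unfolding resolvent_def resolvent_set_def by (auto simp: bij_betw_def intro: f_inv_into_f)
  thus ?thesis by (simp add: op_minus_scalar_def algebra_simps)
qed

lemma resolvent_eqI:
  assumes "z \<in> resolvent_set D" "x \<in> op_dom D" "op_app D x = y + z *\<^sub>C x"
  shows "R z y = x"
proof -
  have "op_minus_scalar D z x = y" using assms by (simp add: op_minus_scalar_def)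
  moreover have "R z (op_minus_scalar D z x) = x" unfolding resolvent_def using assms(1,2)
    by (intro inv_into_f_f) (auto simp: resolvent_set_def bij_betw_def)
  ultimately show ?thesis by simp
qed

lemma resolvent_bounded: "z \<in> resolvent_set D ==> bounded_clinear (R z)"
proof -
  assume z: "z \<in> resolvent_set D"
  then obtain K where K: "!!x. x \<in> op_dom D ==> norm x <= K*norm (op_minus_scalar D z x)"
    by (auto simp: resolvent_set_def)
  show ?thesis unfolding bounded_clinear_def
  proof (intro conjI allI exI)
    show "norm (R z x) <= K*norm x" for x
      using K[OF resolvent_in_dom[OF z, of x]] resolvent_right[OF z, of x] by (simp add: op_minus_scalar_def)
    show "R z (x + y) = R z x + R z y" for x y using resolvent_in_dom[OF z] resolvent_right[OF z] dom_simps
      by (intro resolvent_eqI[OF z]) (auto simp: scaleC_add_right)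
    show "R z (c *\<^sub>C x) = c *\<^sub>C R z x" for c x
      using resolvent_in_dom[OF z] resolvent_right[OF z] dom_simps
      by (intro resolvent_eqI[OF z]) (auto simp: scaleC_add_right scaleC_scaleC mult.commute)
  qed
qed

lemmas resolvent_linear = bounded_clinearD[OF resolvent_bounded]

lemma resolvent_norm_le:
  assumes "Im z ~= 0"
  shows "norm (R z x) <= norm x/\<bar>Im z\<bar>"
  using norm_minus_scalar_ge[of "R z x" z] resolvent_in_dom resolvent_right nonreal_in_resolvent_set[OF assms] assms
  by (simp add: op_minus_scalar_def field_simps)

lemma resolvent_identity:
  assumes z: "z \<in> resolvent_set D" and w: "w \<in> resolvent_set D"
  shows "R z x - R w x = (z - w) *\<^sub>C R z (R w x)"
proof -
  have "R z (x + (w - z) *\<^sub>C R w x) = R w x" by (rule resolvent_eqI[OF z])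
       (use resolvent_in_dom[OF w] resolvent_right[OF w] in \<open>auto simp: scaleC_diff_left\<close>)
  hence "R z x = R w x - (w - z) *\<^sub>C R z (R w x)"
    using resolvent_linear[OF z] by (simp add: algebra_simps)
  thus ?thesis by (simp add: scaleC_diff_left)
qed

lemma resolvent_commute:
  assumes z: "z \<in> resolvent_set D" and w: "w \<in> resolvent_set D"
  shows "R z (R w x) = R w (R z x)"
proof (cases "z = w")
  case False
  have "(z - w) *\<^sub>C R z (R w x) = - ((w - z) *\<^sub>C R w (R z x))"
    using resolvent_identity[OF z w, of x] resolvent_identity[OF w z, of x] by (metis minus_diff_eq)
  also have "... = (z - w) *\<^sub>C R w (R z x)" by (simp add: scaleC_minus_left[symmetric])
  finally have "(z - w) *\<^sub>C (R z (R w x) - R w (R z x)) = 0" by (simp add: scaleC_diff_right)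
  thus ?thesis using False by simp
qed simp

lemma resolvent_adjoint:
  assumes z: "z \<in> resolvent_set D" and z': "cnj z \<in> resolvent_set D"
  shows "cinner x (R z y) = cinner (R (cnj z) x) y"
proof -
  let ?u = "R (cnj z) x" and ?v = "R z y"
  have "cinner x ?v = cinner (op_app D ?u - cnj z *\<^sub>C ?u) ?v" using resolvent_right[OF z', of x] by simp
  also have "... = cinner ?u (op_app D ?v - z *\<^sub>C ?v)"
    using symmetric[OF resolvent_in_dom[OF z', of x] resolvent_in_dom[OF z, of y]] by (simp add: cinner_simps)
  also have "... = cinner ?u y" using resolvent_right[OF z, of y] by simp
  finally show ?thesis .
qed

lemma resolvent_tendsto:
  assumes "Im z0 ~= 0"
  shows "((%z. R z x) \<longlongrightarrow> R z0 x) (at z0)"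
proof (rule Lim_null[THEN iffD2], rule Lim_null_comparison)
  let ?e = "\<bar>Im z0\<bar>/2"
  have e: "?e > 0" using assms by simp
  have "norm (R z x - R z0 x) <= cmod (z - z0)*(norm (R z0 x)/?e)" if "dist z z0 < ?e" for z
  proof -
    have "\<bar>Im z - Im z0\<bar> < ?e" using that abs_Im_le_cmod[of "z - z0"] by (simp add: dist_norm)
    hence im: "\<bar>Im z\<bar> >= ?e" by linarith
    hence nz: "Im z ~= 0" using e by auto
    have "norm (R z (R z0 x)) <= norm (R z0 x)/\<bar>Im z\<bar>" by (rule resolvent_norm_le[OF nz])
    also have "... <= norm (R z0 x)/?e" using im e by (intro divide_left_mono) auto
    finally show ?thesis
      unfolding resolvent_identity[OF nonreal_in_resolvent_set[OF nz] nonreal_in_resolvent_set[OF assms]]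
      unfolding norm_scaleC by (intro mult_left_mono) auto
  qed
  thus "\<forall>\<^sub>F z in at z0. norm (R z x - R z0 x) <= cmod (z - z0)*(norm (R z0 x)/?e)"
    using e unfolding eventually_at by blast
  have "((%z. cmod (z - z0)*(norm (R z0 x)/?e)) \<longlongrightarrow> cmod (z0 - z0)*(norm (R z0 x)/?e)) (at z0)"
    by (intro tendsto_intros) (use assms in auto)
  thus "((%z. cmod (z - z0)*(norm (R z0 x)/?e)) \<longlongrightarrow> 0) (at z0)" by simp
qed

lemma resolvent_continuous_on:
  assumes "!!z. z \<in> S ==> Im z ~= 0"
  shows "continuous_on S (%z. R z x)" unfolding continuous_on_def
  using resolvent_tendsto assms by (blast intro: tendsto_within_subset)

lemma resolvent_deriv:
  assumes z0: "Im z0 ~= 0"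
  shows "((%z. cinner y (R z x)) has_field_derivative cinner y (R z0 (R z0 x))) (at z0)"
proof -
  have "((%z. cinner y (R z (R z0 x))) \<longlongrightarrow> cinner y (R z0 (R z0 x))) (at z0)"
    by (intro tendsto_intros resolvent_tendsto z0)
  moreover have "\<forall>\<^sub>F z in at z0. cinner y (R z (R z0 x)) = (cinner y (R z x) - cinner y (R z0 x))/(z - z0)"
  proof -
    have "\<forall>\<^sub>F z in at z0. Im z ~= 0"
      using z0 by (intro tendsto_imp_eventually_ne[of Im "Im z0"] tendsto_intros)
    moreover have "\<forall>\<^sub>F z in at z0. z ~= z0" by (simp add: eventually_at_filter)
    ultimately show ?thesis
    proof eventually_elim
      case (elim z)
      thus ?case by (simp add: cinner_diff_right[symmetric] resolvent_identity nonreal_in_resolvent_set z0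
            cinner_scaleC_right)
    qed
  qed
  ultimately show ?thesis unfolding has_field_derivative_iff by (rule Lim_transform_eventually)
qed

end

section \<open>The trigonometric moment problem\<close>

lemma integral_exp_pi:
  fixes m :: int
  shows "(LINT x|lborel. indicator {-pi..pi} x *\<^sub>R exp (\<i> * of_int m*cr x)) = (if m = 0 then 2*pi else 0)"
proof (cases "m = 0")
  case True
  have "(LINT x|lborel. indicator {-pi..pi} x *\<^sub>R (1::complex)) = cr pi - cr (-pi)"
    by (intro integral_FTC_Icc) (auto intro!: derivative_eq_intros has_vector_derivative_of_real continuous_intros)
  thus ?thesis using True by simp
next
  case False
  let ?F = "%x. exp (\<i> * of_int m*cr x)/(\<i> * of_int m)"
  have "(LINT x|lborel. indicator {-pi..pi} x *\<^sub>R exp (\<i> * of_int m*cr x)) = ?F pi - ?F (-pi)"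
  proof (intro integral_FTC_Icc)
    fix x :: real
    have "((%z. exp (\<i> * of_int m*z)/(\<i> * of_int m)) has_field_derivative exp (\<i> * of_int m*cr x)) (at (cr x))"
      using False by (auto intro!: derivative_eq_intros)
    thus "(?F has_vector_derivative exp (\<i> * of_int m*cr x)) (at x within {-pi..pi})"
      by (rule has_vector_derivative_real_field)
  qed (auto intro!: continuous_intros)
  also have "exp (\<i> * of_int m*cr pi) = exp (\<i> * of_int m*cr (- pi))"
  proof -
    have "exp (\<i> * of_int m*cr pi) = exp (\<i> * of_int m*cr (- pi) + 2 * of_int m*pi*\<i>)"
      by (simp add: algebra_simps)
    also have "... = exp (\<i> * of_int m*cr (- pi))"
      by (subst exp_eq) (auto intro!: exI[of _ m] simp: algebra_simps)
    finally show ?thesis .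
  qed
  finally show ?thesis using False by simp
qed

text \<open>Counts the terms of the Fejer double sum that contribute to the moment of index j - k.
  Divided by n the count tends to 1, so the Fejer measures have the right moments in the
  limit.\<close>

lemma card_shifted_pairs:
  fixes j k n :: nat
  defines "S \<equiv> {(a, b). a < n & b < n & a + j = b + k}"
  shows "finite S" "card S <= n" "n <= card S + (j + k)"
proof -
  have sub: "S \<subseteq> {..<n} \<times> {..<n}" by (auto simp: S_def)
  thus fin: "finite S" by (rule finite_subset) simp
  have "card (fst ` S) = card S" by (rule card_image) (auto simp: inj_on_def S_def)
  moreover have "card (fst ` S) <= card {..<n}" by (rule card_mono) (auto simp: S_def)
  ultimately show "card S <= n" by simp
  have "(%t. (t + k, t + j)) ` {..<n - (j + k)} \<subseteq> S" by (auto simp: S_def)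
  from card_mono[OF fin this] have "n - (j + k) <= card S" by (subst (asm) card_image) (auto simp: inj_on_def)
  thus "n <= card S + (j + k)" by simp
qed

text \<open>The measures with Fejer densities \<open>(2 \<pi> n)\<^sup>-\<^sup>1 \<parallel>\<Sum>\<^sub>a\<^sub><\<^sub>n exp (- i a \<theta>) e\<^sub>a\<parallel>\<^sup>2\<close> have the right moments in
  the limit, and they are tight because they live on \<open>[-\<pi>, \<pi>]\<close>.\<close>

lemma trigonometric_moments:
  fixes e :: "nat => 'a :: complex_hilbert_space"
  assumes shift: "!!a b. cinner (e (Suc a)) (e (Suc b)) = cinner (e a) (e b)" and e0: "norm (e 0) = 1"
  shows "EX M. real_distribution M &
     (ALL j k. (LINT x|M. exp (\<i> * of_int (int j - int k)*cr x)) = cinner (e k) (e j))"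
proof -
  have shifts: "cinner (e (a + k)) (e (b + k)) = cinner (e a) (e b)" for a b k
    by (induction k) (simp_all add: shift)
  define E where "E j k x = exp (\<i> * of_int (int j - int k)*cr x)" for j k :: nat and x :: real
  define S where "S n j k = {(a, b). a < n & b < n & a + j = b + k}" for n j k :: nat
  define d where "d n x = (norm (\<Sum>a<n. exp (- \<i> * of_nat a*cr x) *\<^sub>C e a))\<^sup>2/(2*pi*real n)" for n x
  have d0: "0 <= d n x" for n x by (simp add: d_def)
  have cont_d: "continuous_on A (d n)" for n A unfolding d_def divide_inverse by (intro continuous_intros)
  have [measurable]: "d n \<in> borel_measurable borel" for n
    by (intro borel_measurable_continuous_onI cont_d)
  have cont_E: "continuous_on A (E j k)" for A j k unfolding E_def by (intro continuous_intros)
  have [measurable]: "E j k \<in> borel_measurable borel" for j k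
    by (intro borel_measurable_continuous_onI cont_E)
  \<comment> \<open>Absorbing the factor \<open>E j k x\<close> into the double sum by shifting the
    indices keeps all indices natural numbers, although the exponents j - k are integers.\<close>
  have dE: "cr (d n x)*E j k x =
      (\<Sum>a<n. \<Sum>b<n. cinner (e a) (e b)*E (a + j) (b + k) x)/(2*pi*real n)" for n x j k
  proof -
    have ex: "cnj (exp (- \<i> * of_nat a*cr x))*exp (- \<i> * of_nat b*cr x)*E j k x
       = E (a + j) (b + k) x" for a b unfolding E_def exp_cnj exp_add[symmetric]
      by (rule arg_cong[where f = exp]) (simp add: algebra_simps)
    have "cr (d n x)*(2*pi*real n)*E j k x = cinner (\<Sum>a<n. exp (- \<i> * of_nat a*cr x) *\<^sub>C e a)
       (\<Sum>a<n. exp (- \<i> * of_nat a*cr x) *\<^sub>C e a)*E j k x"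
      unfolding cinner_self d_def by (cases "n = 0") simp_all
    also have "... = (\<Sum>a<n. \<Sum>b<n. cnj (exp (- \<i> * of_nat a*cr x))*exp (- \<i> * of_nat b*cr x)*cinner (e a) (e b))*E j k x"
      unfolding cinner_sum_left cinner_sum_right cinner_scaleC_left cinner_scaleC_right
      by (subst sum.swap) (simp only: sum_distrib_left mult_ac)
    also have "... = (\<Sum>a<n. \<Sum>b<n. cinner (e a) (e b)*E (a + j) (b + k) x)"
      unfolding sum_distrib_right ex[symmetric] by (intro sum.cong refl) (simp only: mult_ac)
    finally have *: "cr (d n x)*(2*pi*real n)*E j k x = (\<Sum>a<n. \<Sum>b<n. cinner (e a) (e b)*E (a + j) (b + k) x)" .
    show ?thesis
    proof (cases "n = 0")
      case False
      thus ?thesis unfolding *[symmetric] by (simp add: field_simps)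
    qed (simp add: d_def)
  qed
  define \<mu> where "\<mu> n = density lborel (%x. ennreal (indicator {-pi..pi} x*d (Suc n) x))" for n
  have sets_\<mu> [simp, measurable_cong]: "sets (\<mu> n) = sets borel" and space_\<mu> [simp]: "space (\<mu> n) = UNIV" for n
    by (simp_all add: \<mu>_def)
  have int_\<mu>: "(LINT x|\<mu> n. E j k x) = of_nat (card (S (Suc n) j k))/of_nat (Suc n)*cinner (e k) (e j)" for n j k
  proof -
    have int1: "integrable lborel (%x. indicator {-pi..pi} x *\<^sub>R E j k x)" for j k
      by (rule borel_integrable_compact) (auto intro: cont_E)
    have "(LINT x|\<mu> n. E j k x) = (LINT x|lborel. (indicator {-pi..pi} x*d (Suc n) x) *\<^sub>R E j k x)"
      unfolding \<mu>_def by (intro integral_density) (auto simp: d0)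
    also have "... = (LINT x|lborel. (\<Sum>a<Suc n. \<Sum>b<Suc n. cinner (e a) (e b)*(indicator {-pi..pi} x *\<^sub>R E (a + j) (b + k) x))/(2*pi*real (Suc n)))"
    proof (intro Bochner_Integration.integral_cong refl)
      fix x
      have "(indicator {-pi..pi} x*d (Suc n) x) *\<^sub>R E j k x = indicator {-pi..pi} x *\<^sub>R (cr (d (Suc n) x)*E j k x)"
        by (simp add: scaleR_conv_of_real)
      also have "... = (\<Sum>a<Suc n. \<Sum>b<Suc n. cinner (e a) (e b)*(indicator {-pi..pi} x *\<^sub>R E (a + j) (b + k) x))/(2*pi*real (Suc n))"
        unfolding dE by (cases "x \<in> {-pi..pi}") simp_all
      finally show "(indicator {-pi..pi} x*d (Suc n) x) *\<^sub>R E j k x = ..." .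
    qed
    also have "... = (\<Sum>a<Suc n. \<Sum>b<Suc n. cinner (e a) (e b)*(LINT x|lborel. indicator {-pi..pi} x *\<^sub>R E (a + j) (b + k) x))/(2*pi*real (Suc n))"
    proof -
      have i: "integrable lborel (%x. cinner (e a) (e b)*(indicator {-pi..pi} x *\<^sub>R E (a + j) (b + k) x))" for a b
        by (intro integrable_mult_right int1)
      show ?thesis
        by (simp only: integral_divide_zero Bochner_Integration.integral_sum[OF Bochner_Integration.integrable_sum[OF i]]
            Bochner_Integration.integral_sum[OF i] integral_mult_right_zero)
    qed
    \<comment> \<open>Only the pairs with a + j = b + k survive, and by shift invariance each of
      them contributes the same inner product; what remains is a count.\<close>
    also have "... = (\<Sum>a<Suc n. \<Sum>b<Suc n. (if a + j = b + k then 2*pi*cinner (e k) (e j) else 0))/(2*pi*real (Suc n))"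
    proof -
      have "cinner (e a) (e b)*(LINT x|lborel. indicator {-pi..pi} x *\<^sub>R E (a + j) (b + k) x) = (if a + j = b + k then 2*pi*cinner (e k) (e j) else 0)" for a b
        unfolding E_def integral_exp_pi using shifts[of a j b] shifts[of k b j] by (auto simp: add.commute)
      thus ?thesis by (simp only:)
    qed
    also have "(\<Sum>a<Suc n. \<Sum>b<Suc n. (if a + j = b + k then 2*pi*cinner (e k) (e j) else 0)) = (\<Sum>p\<in>S (Suc n) j k. 2*pi*cinner (e k) (e j))"
      unfolding sum.cartesian_product
      by (rule sum.mono_neutral_cong_right) (auto simp: S_def split: if_splits)
    also have ".../(2*pi*real (Suc n)) = of_nat (card (S (Suc n) j k))/of_nat (Suc n)*cinner (e k) (e j)"
      unfolding sum_constant of_real_mult of_real_of_nat_eq by (simp add: divide_simps del: of_nat_Suc)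
    finally show ?thesis .
  qed
  have int_d: "integrable lborel (%x. indicator {-pi..pi} x*d (Suc n) x)" for n
    using borel_integrable_compact[of "{-pi..pi}" "d (Suc n)"] cont_d by auto
  have card0: "card (S n 0 0) = n" for n
  proof -
    have "S n 0 0 = (%a. (a, a)) ` {..<n}" by (auto simp: S_def)
    thus ?thesis by (simp add: card_image inj_on_def)
  qed
  have mass: "emeasure (\<mu> n) A = 1" if A: "A \<in> sets borel" "{-pi..pi} \<subseteq> A" for n A
  proof -
    have "emeasure (\<mu> n) A = (\<integral>\<^sup>+x. ennreal (indicator {-pi..pi} x*d (Suc n) x)*indicator A x \<partial>lborel)"
      unfolding \<mu>_def using A by (subst emeasure_density) auto
    also have "... = (\<integral>\<^sup>+x. ennreal (indicator {-pi..pi} x*d (Suc n) x) \<partial>lborel)"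
      using A by (intro nn_integral_cong) (auto split: split_indicator)
    also have "... = ennreal (LINT x|lborel. indicator {-pi..pi} x*d (Suc n) x)"
      using int_d d0 by (intro nn_integral_eq_integral) auto
    also have "(LINT x|lborel. indicator {-pi..pi} x*d (Suc n) x) = 1"
    proof -
      have "cr (LINT x|lborel. indicator {-pi..pi} x*d (Suc n) x) = (LINT x|\<mu> n. E 0 0 x)"
        unfolding \<mu>_def integral_complex_of_real[symmetric]
        by (subst integral_density) (auto simp: d0 E_def scaleR_conv_of_real)
      also have "... = 1" unfolding int_\<mu> card0 by (simp add: cinner_self e0 del: of_nat_Suc)
      finally show ?thesis by simp
    qed
    finally show ?thesis by simp
  qed
  have rd: "real_distribution (\<mu> n)" for n
  proof -
    interpret prob_space "\<mu> n" by (rule prob_spaceI) (simp add: mass)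
    show ?thesis by unfold_locales simp
  qed
  have "tight \<mu>" unfolding tight_def
  proof (intro conjI allI impI rd)
    fix \<epsilon> :: real assume "\<epsilon> > 0"
    have "{-pi..pi} \<subseteq> {-4<..4}"
    proof
      fix x :: real assume "x \<in> {-pi..pi}"
      hence "- pi <= x" "x <= pi" by auto
      thus "x \<in> {-4<..4}" using pi_less_4 by simp
    qed
    hence "measure (\<mu> n) {-4<..4} = 1" for n using mass[of "{-4<..4}" n] by (auto simp: measure_def)
    thus "EX a b. a < b & (ALL n. 1 - \<epsilon> < measure (\<mu> n) {a<..b})"
      using \<open>\<epsilon> > 0\<close> by (intro exI[of _ "-4"] exI[of _ 4]) auto
  qed
  from tight_imp_convergent_subsubsequence[OF this strict_mono_id]
  obtain r M where r: "strict_mono (r :: nat => nat)" and M: "real_distribution M"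
    and conv: "weak_conv_m (\<mu> \<circ> id \<circ> r) M" by blast
  have "(LINT x|M. E j k x) = cinner (e k) (e j)" for j k
  proof -
    have "(%n. LINT x|(\<mu> \<circ> id \<circ> r) n. E j k x) ----> (LINT x|M. E j k x)"
    proof (rule weak_conv_imp_integral_bdd_continuous_conv[OF _ M conv])
      show "real_distribution ((\<mu> \<circ> id \<circ> r) n)" for n by (simp add: rd)
      show "isCont (E j k) x" for x using cont_E[of UNIV] by (simp add: continuous_on_eq_continuous_at)
      show "norm (E j k x) <= 1" for x by (simp add: E_def)
    qed
    moreover have "(%n. of_nat (card (S (Suc n) j k))/of_nat (Suc n)*cinner (e k) (e j)) ----> 1*cinner (e k) (e j)"
    proof (intro tendsto_intros)
      have "(%n. real (card (S (Suc n) j k))/real (Suc n)) ----> 1"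
      proof (rule tendsto_sandwich)
        show "\<forall>\<^sub>F n in sequentially. 1 - real (j + k)*inverse (real (Suc n)) <= real (card (S (Suc n) j k))/real (Suc n)"
        proof (rule always_eventually, rule allI)
          fix n
          have "real (Suc n) <= real (card (S (Suc n) j k)) + real (j + k)"
            using card_shifted_pairs(3)[of "Suc n" j k] unfolding S_def of_nat_add[symmetric] of_nat_le_iff .
          from divide_right_mono[OF this, of "real (Suc n)"]
          show "1 - real (j + k)*inverse (real (Suc n)) <= real (card (S (Suc n) j k))/real (Suc n)"
            by (simp add: add_divide_distrib divide_inverse[of "real (j + k)"] algebra_simps del: of_nat_Suc of_nat_add)
        qed
        show "\<forall>\<^sub>F n in sequentially. real (card (S (Suc n) j k))/real (Suc n) <= 1"
          using card_shifted_pairs(2)[of "Suc _" j k] by (intro always_eventually allI) (simp add: S_def del: of_nat_Suc)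
        have "(%n. 1 - real (j + k)*inverse (real (Suc n))) ----> 1 - real (j + k)*0"
          by (intro tendsto_intros LIMSEQ_inverse_real_of_nat)
        thus "(%n. 1 - real (j + k)*inverse (real (Suc n))) ----> 1" by simp
      qed simp
      from tendsto_of_real[OF this, where 'a = complex]
      show "(%n. of_nat (card (S (Suc n) j k))/of_nat (Suc n)) ----> (1 :: complex)" by simp
    qed
    hence "(%n. LINT x|\<mu> n. E j k x) ----> cinner (e k) (e j)" by (simp only: int_\<mu> mult_1)
    from LIMSEQ_subseq_LIMSEQ[OF this r]
    have "(%n. LINT x|(\<mu> \<circ> id \<circ> r) n. E j k x) ----> cinner (e k) (e j)" by (simp add: comp_def)
    ultimately show ?thesis by (rule LIMSEQ_unique)
  qed
  thus ?thesis using M unfolding E_def by blast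
qed

section \<open>Functional calculus\<close>

lemma of_real_neq_nonreal [simp]: "Im z ~= 0 ==> cr x ~= z" by (auto simp: complex_eq_iff)

lemma of_real_plus_i [simp]: "cr x + \<i> ~= 0" "cr x ~= \<i>" by (auto simp: complex_eq_iff)

text \<open>The Cayley transform, which maps the real line onto the unit circle without 1;
  \<open>U\<close> below is the same function of the operator.\<close>

definition cay :: "real => complex" where
  "cay x = (cr x - \<i>)/(cr x + \<i>)"

lemma cay_cnj [simp]: "cay x*cnj (cay x) = 1" by (simp add: cay_def)

lemma norm_cay [simp]: "cmod (cay x) = 1"
proof -
  have "cr ((cmod (cay x))\<^sup>2) = of_real 1" by (simp only: complex_norm_square cay_cnj of_real_1)
  hence "(cmod (cay x))\<^sup>2 = 1" by (simp only: of_real_eq_iff)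
  thus ?thesis by (simp add: power2_eq_1_iff) (smt (verit) norm_ge_zero)
qed

lemma cay_measurable [measurable]: "cay \<in> borel_measurable borel"
  unfolding cay_def[abs_def] by (intro borel_measurable_continuous_onI continuous_intros) simp

lemma cnj_measurable [measurable]: "cnj \<in> borel_measurable borel"
  by (intro borel_measurable_continuous_onI continuous_intros)

text \<open>Inverts the Cayley transform. The points with exp (i t) = 1 would correspond to infinity
  and have to be excluded.\<close>

lemma cay_cot:
  assumes "sin (t/2) ~= 0"
  shows "cay (- cos (t/2)/sin (t/2)) = exp (\<i>*t)"
proof -
  define c s where "c = cr (cos (t/2))" and "s = cr (sin (t/2))"
  have s: "s ~= 0" using assms by (simp add: s_def)
  have e1: "c + \<i> * s = exp (\<i>*(t/2))" by (simp add: c_def s_def complex_eq_iff Re_exp Im_exp)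
  have e2: "c - \<i> * s = exp (- (\<i>*(t/2)))" by (simp add: c_def s_def complex_eq_iff Re_exp Im_exp)
  have "cay (- cos (t/2)/sin (t/2)) = (- c/s - \<i>)/(- c/s + \<i>)" by (simp add: cay_def c_def s_def)
  also have "... = (c + \<i> * s)/(c - \<i> * s)"
  proof -
    have *: "- c/s - \<i> = (c + \<i> * s)*(- 1/s)" "- c/s + \<i> = (c - \<i> * s)*(- 1/s)"
      using s by (simp_all add: field_simps)
    show ?thesis unfolding*using s by (intro nonzero_mult_divide_mult_cancel_right) simp
  qed
  also have "... = exp (\<i>*(t/2))*exp (\<i>*(t/2))" unfolding e1 e2 by (simp add: exp_minus field_simps)
  also have "... = exp (\<i>*t)"
    unfolding exp_add[symmetric] by (rule arg_cong[where f = exp]) (simp add: algebra_simps)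
  finally show ?thesis .
qed

lemma bounded_clinear_id: "bounded_clinear (%x. x)"
  unfolding bounded_clinear_def by (auto intro!: exI[of _ 1])

lemma bounded_clinear_comp:
  assumes "bounded_clinear S" "bounded_clinear T"
  shows "bounded_clinear (%x. S (T x))"
proof -
  obtain K where K: "K > 0" "!!x. norm (S x) <= K*norm x" using bounded_clinear_bound[OF assms(1)] by metis
  obtain L where L: "L > 0" "!!x. norm (T x) <= L*norm x" using bounded_clinear_bound[OF assms(2)] by metis
  have "norm (S (T x)) <= (K*L)*norm x" for x
    using order_trans[OF K(2) mult_left_mono[OF L(2)]] K(1) by (simp add: mult.assoc)
  thus ?thesis using bounded_clinearD[OF assms(1)] bounded_clinearD[OF assms(2)]
    unfolding bounded_clinear_def by auto
qed

lemma bounded_clinear_add: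
  assumes "bounded_clinear S" "bounded_clinear T"
  shows "bounded_clinear (%x. S x + T x)"
proof -
  obtain K where K: "K > 0" "!!x. norm (S x) <= K*norm x" using bounded_clinear_bound[OF assms(1)] by metis
  obtain L where L: "L > 0" "!!x. norm (T x) <= L*norm x" using bounded_clinear_bound[OF assms(2)] by metis
  have "norm (S x + T x) <= (K + L)*norm x" for x
    using norm_triangle_mono[OF K(2) L(2)] by (simp add: distrib_right)
  thus ?thesis using bounded_clinearD[OF assms(1)] bounded_clinearD[OF assms(2)]
    unfolding bounded_clinear_def by (auto simp: scaleC_add_right)
qed

lemma bounded_clinear_scale:
  assumes "bounded_clinear T"
  shows "bounded_clinear (%x. c *\<^sub>C T x)"
proof -
  obtain L where L: "L > 0" "!!x. norm (T x) <= L*norm x" using bounded_clinear_bound[OF assms(1)] by metis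
  have "norm (c *\<^sub>C T x) <= (cmod c*L)*norm x" for x
    using mult_left_mono[OF L(2), of "cmod c"] by (simp add: mult.assoc)
  hence "EX K. ALL x. norm (c *\<^sub>C T x) <= K*norm x" by blast
  thus ?thesis using bounded_clinearD(1,2)[OF assms(1)]
    unfolding bounded_clinear_def by (simp add: scaleC_add_right scaleC_scaleC mult.commute)
qed

lemma bounded_clinear_diff:
  assumes "bounded_clinear S" "bounded_clinear T"
  shows "bounded_clinear (%x. S x - T x)"
  using bounded_clinear_add[OF assms(1) bounded_clinear_scale[OF assms(2), of "-1"]]
  by (simp add: scaleC_minus1)

lemma bounded_clinear_funpow:
  assumes "bounded_clinear T"
  shows "bounded_clinear (T ^^ n)" by (induction n)
     (use bounded_clinear_id bounded_clinear_comp[OF assms] in \<open>simp_all add: id_def comp_def\<close>)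

section \<open>The Cayley transform of \<open>D\<close> and its moment measures\<close>

context selfadj
begin

lemma i_resolvent: "\<i> \<in> resolvent_set D" "- \<i> \<in> resolvent_set D"
  by (simp_all add: nonreal_in_resolvent_set)

text \<open>(D - i) (D + i)^(-1), written as 1 - 2 i (D + i)^(-1) so that it is visibly defined
  everywhere; \<open>V\<close> is (D + i) (D - i)^(-1), its inverse and adjoint.\<close>

definition U :: "'a => 'a" where "U x = x - (2*\<i>) *\<^sub>C R (- \<i>) x"
definition V :: "'a => 'a" where "V x = x + (2*\<i>) *\<^sub>C R \<i> x"

lemma bounded_U: "bounded_clinear U" and bounded_V: "bounded_clinear V"
  unfolding U_def[abs_def] V_def[abs_def]
  by (intro bounded_clinear_diff bounded_clinear_add bounded_clinear_scale bounded_clinear_id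
      resolvent_bounded i_resolvent)+

lemma UV: "U (V x) = x" and VU: "V (U x) = x"
proof -
  have "R \<i> x - R (-\<i>) x = (2*\<i>) *\<^sub>C R \<i> (R (- \<i>) x)"
    using resolvent_identity[OF i_resolvent, of x] by simp
  hence k: "R \<i> x = R (-\<i>) x + (2*\<i>) *\<^sub>C R \<i> (R (- \<i>) x)" by (simp add: algebra_simps)
  have "U (V x) = V x - (2*\<i>) *\<^sub>C (R (-\<i>) x + (2*\<i>) *\<^sub>C R \<i> (R (- \<i>) x))"
    unfolding U_def
    by (simp only: V_def resolvent_linear[OF i_resolvent(2)] resolvent_commute[OF i_resolvent(2,1)])
  thus "U (V x) = x" unfolding k[symmetric] V_def by simp
  have "V (U x) = U x + (2*\<i>) *\<^sub>C (R \<i> x - (2*\<i>) *\<^sub>C R \<i> (R (- \<i>) x))"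
    unfolding V_def by (simp only: U_def resolvent_linear[OF i_resolvent(1)])
  also have "R \<i> x - (2*\<i>) *\<^sub>C R \<i> (R (- \<i>) x) = R (-\<i>) x" by (subst k) simp
  finally show "V (U x) = x" unfolding U_def by simp
qed

lemma U_adjoint: "cinner x (U y) = cinner (V x) y"
proof -
  have "cinner x (R (-\<i>) y) = cinner (R \<i> x) y"
    using resolvent_adjoint[of "-\<i>" x y] i_resolvent by simp
  thus ?thesis by (simp add: U_def V_def cinner_simps)
qed

lemma V_adjoint: "cinner x (V y) = cinner (U x) y" by (metis U_adjoint cnj_cinner)

lemma U_isometric: "cinner (U x) (U y) = cinner x y" by (simp add: U_adjoint VU)

lemma norm_U: "norm (U x) = norm x" by (metis U_isometric norm_eq_sqrt_inner inner_cinner)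

lemma V_eq_U_adj_pow: "cinner x ((V ^^ n) y) = cinner ((U ^^ n) x) y"
proof (induction n arbitrary: x)
  case (Suc n)
  have "cinner x ((V ^^ Suc n) y) = cinner (U x) ((V ^^ n) y)" by (simp add: V_adjoint)
  also have "... = cinner ((U ^^ n) (U x)) y" by (rule Suc)
  finally show ?case by (simp add: funpow_swap1)
qed simp

lemma U_adj_pow: "cinner x ((U ^^ n) y) = cinner ((V ^^ n) x) y"
proof (induction n arbitrary: x)
  case (Suc n)
  have "cinner x ((U ^^ Suc n) y) = cinner (V x) ((U ^^ n) y)" by (simp add: U_adjoint)
  also have "... = cinner ((V ^^ n) (V x)) y" by (rule Suc)
  finally show ?case by (simp add: funpow_swap1)
qed simp

lemma UV_pow_commute: "(V ^^ k) ((U ^^ j) x) = (U ^^ j) ((V ^^ k) x)"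
proof -
  have "V ((U ^^ j) x) = (U ^^ j) (V x)" for x
    by (induction j arbitrary: x) (simp_all add: UV VU funpow_swap1)
  thus ?thesis by (induction k arbitrary: x) simp_all
qed

text \<open>Trigonometric polynomials in the Cayley variable, each paired with an operator built in
  the same way from \<open>U\<close> and \<open>V\<close>. A relation is used because one function
  has many representations; that the operator depends only on the function follows later from the
  norm formula.\<close>

inductive laur :: "(real => complex) => ('a => 'a) => bool" where
  mono: "laur (%x. cay x^j*cnj (cay x)^k) (%x. (U ^^ j) ((V ^^ k) x))"
| add: "laur p P ==> laur q Q ==> laur (%x. p x + q x) (%x. P x + Q x)"
| scale: "laur p P ==> laur (%x. c*p x) (%x. c *\<^sub>C P x)"

lemma laur_one: "laur (%x. 1) (%x. x)" using laur.mono[of 0 0] by simp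

lemma laur_cay: "laur cay U" using laur.mono[of 1 0] by simp

lemma laur_diff: "laur p P ==> laur q Q ==> laur (%x. p x - q x) (%x. P x - Q x)"
  using laur.add[OF _ laur.scale[of q Q "-1"], of p P] by (simp add: scaleC_minus1)

lemma laur_linear: "laur p P ==> bounded_clinear P"
proof (induction rule: laur.induct)
  case (mono j k)
  show ?case
    by (rule bounded_clinear_comp[OF bounded_clinear_funpow[OF bounded_U] bounded_clinear_funpow[OF bounded_V]])
qed (rule bounded_clinear_add bounded_clinear_scale; assumption)+

lemma laur_measurable: "laur p P ==> p \<in> borel_measurable borel" by (induction rule: laur.induct)
     (auto intro!: borel_measurable_add borel_measurable_times borel_measurable_power
       intro: measurable_compose[OF cay_measurable cnj_measurable])

lemma laur_bounded: "laur p P ==> EX C. ALL x. cmod (p x) <= C"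
proof (induction rule: laur.induct)
  case (mono j k)
  thus ?case by (auto intro!: exI[of _ 1] simp: norm_mult norm_power)
next
  case (add p P q Q)
  then obtain C C' where "!!x. cmod (p x) <= C" "!!x. cmod (q x) <= C'" by auto
  thus ?case by (intro exI[of _ "C + C'"]) (auto intro: norm_triangle_mono)
next
  case (scale p P c)
  then obtain C where "!!x. cmod (p x) <= C" by auto
  thus ?case by (intro exI[of _ "cmod c*C"]) (auto simp: norm_mult mult_left_mono)
qed

lemma laur_mult:
  assumes p: "laur p P" and q: "laur q Q"
  shows "laur (%x. p x*q x) (%x. P (Q x))" using p
proof (induction rule: laur.induct)
  case (mono j k)
  from q show ?case
  proof (induction rule: laur.induct)
    case (mono j' k')
    have "(%x. cay x^j*cnj (cay x)^k*(cay x^j'*cnj (cay x)^k')) =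
        (%x. cay x^(j + j')*cnj (cay x)^(k + k'))" by (simp add: fun_eq_iff power_add mult_ac)
    moreover have "(%x. (U ^^ j) ((V ^^ k) ((U ^^ j') ((V ^^ k') x)))) =
        (%x. (U ^^ (j + j')) ((V ^^ (k + k')) x))" by (simp add: fun_eq_iff funpow_add UV_pow_commute)
    ultimately show ?case using laur.mono[of "j + j'" "k + k'"] by simp
  next
    case (add p P q Q)
    have "bounded_clinear (%x. (U ^^ j) ((V ^^ k) x))" by (rule laur_linear[OF laur.mono])
    note lin = bounded_clinearD[OF this]
    show ?case using laur.add[OF add.IH] by (simp only: lin distrib_left)
  next
    case (scale p P c)
    have "bounded_clinear (%x. (U ^^ j) ((V ^^ k) x))" by (rule laur_linear[OF laur.mono])
    note lin = bounded_clinearD[OF this]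
    show ?case using laur.scale[OF scale.IH, of c] by (simp only: lin mult.left_commute)
  qed
next
  case (add p P p' P')
  show ?case using laur.add[OF add.IH] by (simp only: distrib_right)
next
  case (scale p P c)
  show ?case using laur.scale[OF scale.IH, of c] by (simp only: mult.assoc)
qed

lemma laur_cnj: "laur p P ==> EX P'. laur (%x. cnj (p x)) P' & (ALL x y. cinner x (P y) = cinner (P' x) y)"
proof (induction rule: laur.induct)
  case (mono j k)
  have "laur (%x. cnj (cay x^j*cnj (cay x)^k)) (%x. (U ^^ k) ((V ^^ j) x))"
    using laur.mono[of k j] by (simp add: mult.commute)
  moreover have "cinner x ((U ^^ j) ((V ^^ k) y)) = cinner ((U ^^ k) ((V ^^ j) x)) y" for x y
    by (simp add: U_adj_pow V_eq_U_adj_pow)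
  ultimately show ?case by blast
next
  case (add p P q Q)
  then obtain P' Q' where "laur (%x. cnj (p x)) P'" "!!x y. cinner x (P y) = cinner (P' x) y"
    "laur (%x. cnj (q x)) Q'" "!!x y. cinner x (Q y) = cinner (Q' x) y" by blast
  thus ?case using laur.add[of "%x. cnj (p x)" P' "%x. cnj (q x)" Q']
    by (intro exI[of _ "%x. P' x + Q' x"]) (simp add: cinner_simps)
next
  case (scale p P c)
  then obtain P' where "laur (%x. cnj (p x)) P'" "!!x y. cinner x (P y) = cinner (P' x) y" by blast
  thus ?case using laur.scale[of "%x. cnj (p x)" P' "cnj c"]
    by (intro exI[of _ "%x. cnj c *\<^sub>C P' x"]) (simp add: cinner_simps)
qed

text \<open>The mean ergodic theorem for \<open>U\<close>: it holds on the range of \<open>1 - U\<close>, which is the domain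
  of \<open>D\<close> and therefore dense.\<close>

lemma cesaro_U: "(%n. (1/of_nat n) *\<^sub>C (\<Sum>k<n. (U ^^ k) x)) ----> 0"
proof (rule LIMSEQ_I)
  fix e :: real assume e: "e > 0"
  have nU: "norm ((U ^^ k) x) = norm x" for k x by (induction k) (simp_all add: norm_U)
  have "x \<in> closure (op_dom D)" by (simp add: dense)
  then obtain y where y: "y \<in> op_dom D" "dist y x < e/2"
    using e unfolding closure_approachable by (meson half_gt_zero)
  \<comment> \<open>Since R(-i) inverts D + i, this choice gives y = w - U w, so the sums of powers
    applied to \<open>y\<close> telescope.\<close>
  define w where "w = (1/(2*\<i>)) *\<^sub>C (op_app D y + \<i> *\<^sub>C y)"
  have "R (-\<i>) (op_app D y + \<i> *\<^sub>C y) = y" using y(1) by (intro resolvent_eqI i_resolvent) auto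
  hence "y = w - U w" by (simp add: w_def U_def resolvent_linear[OF i_resolvent(2)] scaleC_scaleC)
  have lin: "(U ^^ k) (a - b) = (U ^^ k) a - (U ^^ k) b" for k a b
    by (rule bounded_clinearD[OF bounded_clinear_funpow[OF bounded_U]])
  have tel: "(\<Sum>k<n. (U ^^ k) y) = w - (U ^^ n) w" for n
    by (induction n) (simp_all add: \<open>y = w - U w\<close> lin funpow_swap1)
  obtain N0 :: nat where "4*norm w/e < N0" using reals_Archimedean2 by blast
  then obtain N :: nat where N: "N > 0" "4*norm w/e < N" using that[of "Suc N0"] by simp
  show "EX no. ALL n>=no. norm ((1/of_nat n) *\<^sub>C (\<Sum>k<n. (U ^^ k) x) - 0) < e"
  proof (intro exI[of _ N] allI impI)
    fix n assume n: "n >= N"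
    hence n0: "real n > 0" using N by simp
    have "(\<Sum>k<n. (U ^^ k) x) = (\<Sum>k<n. (U ^^ k) (x - y)) + (w - (U ^^ n) w)"
      unfolding tel[symmetric] lin by (simp add: sum_subtractf)
    hence "norm (\<Sum>k<n. (U ^^ k) x) <= norm (\<Sum>k<n. (U ^^ k) (x - y)) + norm (w - (U ^^ n) w)"
      by (simp add: norm_triangle_ineq)
    also have "... <= real n*norm (x - y) + 2*norm w"
    proof (rule add_mono)
      show "norm (\<Sum>k<n. (U ^^ k) (x - y)) <= real n*norm (x - y)"
        using norm_sum[of "%k. (U ^^ k) (x - y)" "{..<n}"] by (simp add: nU)
      show "norm (w - (U ^^ n) w) <= 2*norm w" using norm_triangle_ineq4[of w "(U ^^ n) w"] by (simp add: nU)
    qed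
    also have "... < real n*e"
    proof -
      have "real n*norm (x - y) <= real n*(e/2)"
        using y(2) n0 by (intro mult_left_mono) (auto simp: dist_norm norm_minus_commute)
      moreover have "2*norm w < real n*(e/2)"
      proof -
        have "4*norm w/e < real n" using N(2) n by linarith
        thus ?thesis using e by (simp add: field_simps)
      qed
      ultimately show ?thesis by (simp add: algebra_simps)
    qed
    finally show "norm ((1/of_nat n) *\<^sub>C (\<Sum>k<n. (U ^^ k) x) - 0) < e"
      using n0 by (simp add: norm_divide field_simps)
  qed
qed

text \<open>The moment measure lives on the circle, and an atom at the point 1 would be mass at
  infinity on the line. On \<open>Z\<close> all n exponentials in \<open>g n\<close> are 1, so M(Z)
  is at most the squared norm of the n-th ergodic mean, which tends to 0. Afterwards - cot (t/2)
  carries the measure to the line.\<close>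

lemma spectral_measure_unit:
  assumes x1: "norm x = 1"
  shows "EX \<mu>. sets \<mu> = sets borel & finite_measure \<mu> &
    (ALL j k. (LINT t|\<mu>. cay t^j*cnj (cay t)^k) = cinner x ((U ^^ j) ((V ^^ k) x)))"
proof -
  have "EX M. real_distribution M & (ALL j k. (LINT t|M. exp (\<i> * of_int (int j - int k)*cr t))
      = cinner ((U ^^ k) x) ((U ^^ j) x))" by (rule trigonometric_moments) (simp_all add: U_isometric x1)
  then obtain M where "real_distribution M" and mom: "!!j k. (LINT t|M. exp (\<i> * of_int (int j - int k)*cr t)) = cinner ((U ^^ k) x) ((U ^^ j) x)"
    by blast
  interpret M: real_distribution M by fact
  define Z where "Z = {t :: real. sin (t/2) = 0}"
  have Zb [measurable]: "Z \<in> sets borel" unfolding Z_def by measurable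
  have eZ: "exp (\<i>*cr t) = 1" if "t \<in> Z" for t
  proof -
    have "sin (t/2) = 0" using that by (simp add: Z_def)
    moreover have "cos t = 1 - 2*(sin (t/2))\<^sup>2" using cos_double_sin[of "t/2"] by simp
    moreover have "sin t = 2 * sin (t/2)*cos (t/2)" using sin_double[of "t/2"] by simp
    ultimately show ?thesis by (simp add: complex_eq_iff Re_exp Im_exp)
  qed
  define g where "g n t = (\<Sum>k<n. exp (\<i> * of_nat k*cr t))" for n and t :: real
  have [measurable]: "g n \<in> borel_measurable borel" for n
    unfolding g_def by (intro borel_measurable_continuous_onI continuous_intros)
  have le: "measure M Z <= (norm ((1/of_nat n) *\<^sub>C (\<Sum>k<n. (U ^^ k) x)))\<^sup>2" if n: "n > 0" for n
  proof -
    have int: "integrable M (%t. exp (\<i> * of_int (int j - int k)*cr t))" for j k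
      by (intro M.integrable_const_bound[where B=1]) (auto, measurable)
    have gg: "cr ((cmod (g n t))\<^sup>2) = (\<Sum>j<n. \<Sum>k<n. exp (\<i> * of_int (int j - int k)*cr t))" for t
      unfolding complex_norm_square g_def cnj_sum exp_cnj sum_product
      by (intro sum.cong refl) (simp add: exp_add[symmetric] algebra_simps)
    have "cr (LINT t|M. (cmod (g n t))\<^sup>2) = (\<Sum>j<n. \<Sum>k<n. cinner ((U ^^ k) x) ((U ^^ j) x))"
      unfolding integral_complex_of_real[symmetric] gg mom[symmetric]
      by (simp only: Bochner_Integration.integral_sum[OF Bochner_Integration.integrable_sum[OF int]]
            Bochner_Integration.integral_sum[OF int])
    also have "... = cinner (\<Sum>k<n. (U ^^ k) x) (\<Sum>k<n. (U ^^ k) x)"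
      by (simp only: cinner_sum_left cinner_sum_right)
    also have "... = cr ((norm (\<Sum>k<n. (U ^^ k) x))\<^sup>2)" by (rule cinner_self)
    finally have g2: "(LINT t|M. (cmod (g n t))\<^sup>2) = (norm (\<Sum>k<n. (U ^^ k) x))\<^sup>2"
      by (simp only: of_real_eq_iff)
    have gn: "cmod (g n t) <= n" for t
      unfolding g_def using norm_sum[of "%k. exp (\<i> * of_nat k*cr t)" "{..<n}"] by simp
    have "(real n)\<^sup>2*measure M Z = (LINT t|M. (real n)\<^sup>2*indicator Z t)" by simp
    also have "... <= (LINT t|M. (cmod (g n t))\<^sup>2)"
    proof (rule integral_mono)
      show "integrable M (%t. (real n)\<^sup>2*indicator Z t)" by (simp add: M.emeasure_eq_measure)
      show "integrable M (%t. (cmod (g n t))\<^sup>2)"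
        using gn by (intro M.integrable_const_bound[where B="(real n)\<^sup>2"]) (auto intro!: power_mono)
      fix t
      have "g n t = n" if "t \<in> Z"
        using eZ[OF that] by (simp add: g_def exp_of_nat_mult mult.assoc mult.left_commute[of \<i>])
      thus "(real n)\<^sup>2*indicator Z t <= (cmod (g n t))\<^sup>2" by (auto simp: indicator_def)
    qed
    finally show ?thesis using n unfolding g2
      by (simp add: power_mult_distrib norm_divide power_divide field_simps)
  qed
  have lim: "(%n. (norm ((1/of_nat n) *\<^sub>C (\<Sum>k<n. (U ^^ k) x)))\<^sup>2) ----> (norm (0::'a))\<^sup>2"
    by (intro tendsto_intros cesaro_U)
  have "measure M Z <= (norm (0::'a))\<^sup>2"
    by (rule LIMSEQ_le_const[OF lim], rule exI[of _ 1], intro allI impI, rule le) linarith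
  hence "measure M Z = 0" by (simp add: measure_le_0_iff)
  hence Z0: "AE t in M. t \<notin> Z" by (intro AE_I[of _ _ Z]) (auto simp: M.emeasure_eq_measure)
  define X where "X t = - cos (t/2)/sin (t/2)" for t :: real
  have [measurable]: "X \<in> borel_measurable borel" unfolding X_def by measurable
  have "(LINT t|distr M borel X. cay t^j*cnj (cay t)^k) = cinner x ((U ^^ j) ((V ^^ k) x))" for j k
  proof -
    have "(LINT t|distr M borel X. cay t^j*cnj (cay t)^k) = (LINT t|M. cay (X t)^j*cnj (cay (X t))^k)"
      by (intro integral_distr) measurable
    also have "... = (LINT t|M. exp (\<i> * of_int (int j - int k)*cr t))"
    proof (rule integral_cong_AE)
      show "AE t in M. cay (X t)^j*cnj (cay (X t))^k = exp (\<i> * of_int (int j - int k)*cr t)" using Z0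
      proof eventually_elim
        case (elim t)
        hence c: "cay (X t) = exp (\<i>*t)" unfolding X_def Z_def by (intro cay_cot) simp
        show ?case unfolding c exp_cnj exp_of_nat_mult[symmetric] exp_add[symmetric]
          by (rule arg_cong[where f = exp]) (simp add: algebra_simps)
      qed
    qed measurable
    also have "... = cinner x ((V ^^ k) ((U ^^ j) x))" unfolding mom V_eq_U_adj_pow ..
    finally show ?thesis by (simp only: UV_pow_commute)
  qed
  moreover have "finite_measure (distr M borel X)" by (intro M.finite_measure_distr) simp
  ultimately show ?thesis by (intro exI[of _ "distr M borel X"]) simp
qed

lemma smeas_exists:
  "EX \<mu>. sets \<mu> = sets borel & finite_measure \<mu> &
    (ALL p P. laur p P --> cinner x (P x) = (LINT t|\<mu>. p t))"
proof -
  have "EX \<mu>. sets \<mu> = sets borel & finite_measure \<mu> &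
    (ALL j k. (LINT t|\<mu>. cay t^j*cnj (cay t)^k) = cinner x ((U ^^ j) ((V ^^ k) x)))"
  proof (cases "x = 0")
    case True
    have "(U ^^ j) ((V ^^ k) 0) = 0" for j k by (rule bounded_clinearD[OF laur_linear[OF laur.mono]])
    thus ?thesis using True by (intro exI[of _ "null_measure borel"]) (auto intro!: finite_measureI)
  next
    case False
    define y where "y = cr (1/norm x) *\<^sub>C x"
    have "norm y = 1" using False by (simp add: y_def norm_divide)
    from spectral_measure_unit[OF this] obtain \<mu> where \<mu>: "sets \<mu> = sets borel" "finite_measure \<mu>"
      "!!j k. (LINT t|\<mu>. cay t^j*cnj (cay t)^k) = cinner y ((U ^^ j) ((V ^^ k) y))" by blast
    interpret finite_measure \<mu> by fact
    let ?\<nu> = "density \<mu> (%_. ennreal ((norm x)\<^sup>2))"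
    have "(LINT t|?\<nu>. cay t^j*cnj (cay t)^k) = cinner x ((U ^^ j) ((V ^^ k) x))" for j k
    proof -
      have xy: "x = cr (norm x) *\<^sub>C y" using False by (simp add: y_def scaleC_scaleC)
      have "(LINT t|?\<nu>. cay t^j*cnj (cay t)^k) = (LINT t|\<mu>. ((norm x)\<^sup>2) *\<^sub>R (cay t^j*cnj (cay t)^k))"
        by (intro integral_density) (auto simp: measurable_cong_sets[OF \<mu>(1) refl])
      also have "... = (norm x)\<^sup>2 *\<^sub>R cinner y ((U ^^ j) ((V ^^ k) y))" by (simp add: \<mu>(3))
      also have "... = cinner x ((U ^^ j) ((V ^^ k) x))"
        apply (subst (2 3) xy)
        unfolding bounded_clinearD(2)[OF laur_linear[OF laur.mono]] cinner_scaleC_left cinner_scaleC_right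
        by (simp add: scaleR_conv_of_real power2_eq_square mult.assoc)
      finally show ?thesis .
    qed
    moreover have "finite_measure ?\<nu>"
      by (rule finite_measureI) (auto simp: emeasure_density ennreal_mult_eq_top_iff nn_integral_cmult emeasure_eq_measure)
    ultimately show ?thesis using \<mu>(1) by (intro exI[of _ ?\<nu>]) simp
  qed
  then obtain \<mu> where s: "sets \<mu> = sets borel" and f: "finite_measure \<mu>" and
    m: "!!j k. (LINT t|\<mu>. cay t^j*cnj (cay t)^k) = cinner x ((U ^^ j) ((V ^^ k) x))" by blast
  interpret finite_measure \<mu> by fact
  have int: "integrable \<mu> p" if p: "laur p P" for p P
  proof -
    obtain C where "!!x. cmod (p x) <= C" using laur_bounded[OF p] by blast
    thus ?thesis using laur_measurable[OF p]
      by (intro integrable_const_bound[where B = C]) (auto simp: measurable_cong_sets[OF s refl])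
  qed
  have "cinner x (P x) = (LINT t|\<mu>. p t)" if "laur p P" for p P using that
    by (induction rule: laur.induct) (simp_all add: m cinner_simps int)
  thus ?thesis using s f by blast
qed

text \<open>Any measure with the right trigonometric integrals will do at this stage;
  \<open>spectral_measure_eq\<close> shows that it is the spectral measure once exp (i s D) is
  available.\<close>

definition smeas :: "'a => real measure" where
  "smeas x = (SOME \<mu>. sets \<mu> = sets borel & finite_measure \<mu> &
    (ALL p P. laur p P --> cinner x (P x) = (LINT t|\<mu>. p t)))"

lemma sets_smeas [simp, measurable_cong]: "sets (smeas x) = sets borel"
  and finite_smeas [simp]: "finite_measure (smeas x)"
  and laur_cinner: "laur p P ==> cinner x (P x) = (LINT t|smeas x. p t)"
  using someI_ex[OF smeas_exists[of x]] unfolding smeas_def[symmetric] by blast+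

lemma space_smeas [simp]: "space (smeas x) = UNIV" using sets_eq_imp_space_eq[OF sets_smeas] by simp

lemma integrable_smeas:
  fixes f :: "real => 'b :: {banach, second_countable_topology}"
  assumes "f \<in> borel_measurable borel" "!!t. norm (f t) <= (C::real)"
  shows "integrable (smeas x) f"
proof -
  interpret finite_measure "smeas x" by simp
  show ?thesis using assms by (intro integrable_const_bound[where B = C]) auto
qed

lemma laur_norm:
  assumes p: "laur p P"
  shows "(norm (P x))\<^sup>2 = (LINT t|smeas x. (cmod (p t))\<^sup>2)"
proof -
  obtain P' where P': "laur (%t. cnj (p t)) P'" "!!x y. cinner x (P y) = cinner (P' x) y"
    using laur_cnj[OF p] by blast
  have "cr ((norm (P x))\<^sup>2) = cinner (P x) (P x)" by (simp only: cinner_self)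
  also have "... = cinner (P' (P x)) x" by (rule P'(2))
  also have "... = cnj (cinner x (P' (P x)))" by (simp only: cnj_cinner)
  also have "... = cnj (LINT t|smeas x. cnj (p t)*p t)" by (simp only: laur_cinner[OF laur_mult[OF P'(1) p]])
  also have "(%t. cnj (p t)*p t) = (%t. cr ((cmod (p t))\<^sup>2))"
    by (simp only: complex_norm_square mult.commute)
  finally show ?thesis by (simp only: integral_complex_of_real complex_cnj_complex_of_real of_real_eq_iff)
qed

end

text \<open>Approximates exponentials by powers of resolvent functions, which are already within
  reach of the calculus. Two n-th powers of numbers of modulus at most 1 differ by at most n times
  the difference of the bases, here n |h(y/n)| with h(t) = o(t).\<close>

lemma exp_i_limit:
  "(%n. (1/(1 - \<i>*cr (y/Suc n)))^Suc n) ----> exp (\<i>*y)"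
proof (rule Lim_null[THEN iffD2], rule Lim_null_comparison)
  define h where "h t = 1/(1 - \<i>*t) - exp (\<i>*t)" for t :: complex
  have "(h has_field_derivative 0) (at 0)" unfolding h_def by (auto intro!: derivative_eq_intros)
  hence h: "((%t. h t/t) \<longlongrightarrow> 0) (at 0)"
    unfolding has_field_derivative_iff by (simp add: h_def)
  show "\<forall>\<^sub>F n in sequentially. norm ((1/(1 - \<i>*cr (y/Suc n)))^Suc n - exp (\<i>*y))
      <= real (Suc n)*cmod (h (cr (y/Suc n)))"
  proof (intro always_eventually allI)
    fix n
    let ?t = "cr (y/Suc n)"
    have "exp (\<i>*y) = exp (\<i>*?t)^Suc n"
      unfolding exp_of_nat_mult[symmetric] by (rule arg_cong[where f = exp]) (simp add: field_simps del: of_nat_Suc)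
    moreover have "norm ((1/(1 - \<i>*?t))^Suc n - exp (\<i>*?t)^Suc n) <= real (Suc n)*cmod (h ?t)"
      unfolding h_def
    proof (rule norm_power_diff)
      have "1 <= cmod (1 - \<i>*?t)" using abs_Re_le_cmod[of "1 - \<i>*?t"] by simp
      thus "norm (1/(1 - \<i>*?t)) <= 1" by (simp add: norm_divide divide_le_eq)
    qed simp
    ultimately show "norm ((1/(1 - \<i>*?t))^Suc n - exp (\<i>*y)) <= real (Suc n)*cmod (h ?t)" by simp
  qed
  show "(%n. real (Suc n)*cmod (h (cr (y/Suc n)))) ----> 0"
  proof (cases "y = 0")
    case False
    have "filterlim (%n. cr (y/Suc n)) (at 0) sequentially" unfolding filterlim_at
    proof
      show "\<forall>\<^sub>F n in sequentially. cr (y/Suc n) \<in> UNIV & cr (y/Suc n) ~= 0"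
        using False by (simp del: of_nat_Suc)
      have "(%n. cr (y*inverse (real (Suc n)))) ----> cr (y*0)"
        by (intro tendsto_intros LIMSEQ_inverse_real_of_nat)
      thus "(%n. cr (y/Suc n)) ----> 0" by (simp add: divide_inverse)
    qed
    from filterlim_compose[OF h this]
    have "(%n. \<bar>y\<bar>*cmod (h (cr (y/Suc n))/cr (y/Suc n))) ----> \<bar>y\<bar>*cmod 0"
      by (intro tendsto_intros)
    moreover have "\<bar>y\<bar>*cmod (h (cr (y/Suc n))/cr (y/Suc n))
       = real (Suc n)*cmod (h (cr (y/Suc n)))" for n
      using False by (simp add: norm_divide norm_mult field_simps del: of_nat_Suc)
    ultimately show ?thesis by simp
  qed (simp add: h_def)
qed

section \<open>The bounded functional calculus\<close>

context selfadj
begin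

text \<open>Bounded pointwise convergence of the functions together with strong convergence of the
  operators. Dominated convergence transports the trace and norm formulas to the limit, and the norm
  formula makes \<open>T\<close> unique for given \<open>f\<close>.\<close>

definition calc :: "(real => complex) => ('a => 'a) => bool" where
  "calc f T \<longleftrightarrow> (EX p P M. (ALL n. laur (p n) (P n)) & (ALL n x. cmod (p n x) <= M) &
     (ALL x. (%n. p n x) ----> f x) & (ALL v. (%n. P n v) ----> T v))"

lemma calcE:
  assumes "calc f T"
  obtains p P M where "!!n. laur (p n) (P n)" "!!n x. cmod (p n x) <= M"
    "!!x. (%n. p n x) ----> f x" "!!v. (%n. P n v) ----> T v" using assms unfolding calc_def by blast

lemma calc_measurable [measurable_dest]: "calc f T ==> f \<in> borel_measurable borel"
  by (erule calcE) (rule borel_measurable_LIMSEQ_metric, auto dest: laur_measurable)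

lemma calc_bounded:
  assumes "calc f T"
  obtains M where "!!x. cmod (f x) <= M" using assms
proof (rule calcE)
  fix p P M assume *: "!!n x. cmod (p n x) <= (M::real)" "!!x. (%n. p n x) ----> f x"
  have "cmod (f x) <= M" for x by (rule LIMSEQ_le_const2[OF tendsto_norm[OF *(2)]]) (use *(1) in auto)
  thus ?thesis by (rule that)
qed

lemma calc_integrable:
  "calc f T ==> integrable (smeas v) f" "calc f T ==> integrable (smeas v) (%t. (cmod (f t))\<^sup>2)"
proof -
  assume f: "calc f T"
  obtain M where M: "!!x. cmod (f x) <= M" using calc_bounded[OF f] by blast
  show "integrable (smeas v) f" by (rule integrable_smeas[OF calc_measurable[OF f] M])
  show "integrable (smeas v) (%t. (cmod (f t))\<^sup>2)"
    using calc_measurable[OF f] M by (intro integrable_smeas[where C = "M\<^sup>2"]) (auto intro!: power_mono)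
qed

lemma calc_cinner: 
  assumes "calc f T" 
  shows "cinner v (T v) = (LINT t|smeas v. f t)"
proof -
  obtain p P M where p: "!!n. laur (p n) (P n)" "!!n x. cmod (p n x) <= M"
    "!!x. (%n. p n x) ----> f x" "!!v. (%n. P n v) ----> T v" using assms unfolding calc_def by blast
  have "(%n. LINT t|smeas v. p n t) ----> (LINT t|smeas v. f t)"
    using laur_measurable[OF p(1)] calc_measurable[OF assms] p(2,3) 
    by (intro integral_dominated_convergence[where w = "%_. M"]) (auto intro!: integrable_smeas[where C = "\<bar>M\<bar>"])
  moreover have "(%n. cinner v (P n v)) ----> cinner v (T v)" by (intro tendsto_intros p(4))
  ultimately show ?thesis by (simp add: laur_cinner[OF p(1)] LIMSEQ_unique)
qed

lemma calc_norm:
  assumes "calc f T" 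
  shows "(norm (T v))\<^sup>2 = (LINT t|smeas v. (cmod (f t))\<^sup>2)"
proof -
  obtain p P M where p: "!!n. laur (p n) (P n)" "!!n x. cmod (p n x) <= M"
    "!!x. (%n. p n x) ----> f x" "!!v. (%n. P n v) ----> T v" using assms unfolding calc_def by blast
  have "(%n. LINT t|smeas v. (cmod (p n t))\<^sup>2) ----> (LINT t|smeas v. (cmod (f t))\<^sup>2)"
    using laur_measurable[OF p(1)] calc_measurable[OF assms] p(2,3) 
    by (intro integral_dominated_convergence[where w = "%_. M\<^sup>2"])
       (auto intro!: integrable_smeas[where C = "\<bar>M\<^sup>2\<bar>"] tendsto_intros power_mono)
  moreover have "(%n. (norm (P n v))\<^sup>2) ----> (norm (T v))\<^sup>2" by (intro tendsto_intros p(4))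
  ultimately show ?thesis by (simp add: laur_norm[OF p(1)] LIMSEQ_unique)
qed

text \<open>The squared distance of P_m v and P_n v is the integral of |p_m - p_n|^2 against
  \<open>smeas v\<close>, so bounded pointwise convergence of the functions already forces strong
  convergence of the operators.\<close>

lemma calc_exists:
  assumes p: "!!n. EX P. laur (p n) P" and M: "!!n x. cmod (p n x) <= M" and f: "!!x. (%n. p n x) ----> f x"
  shows "EX T. calc f T"
proof -
  obtain P where P: "!!n. laur (p n) (P n)" using p by metis
  have [measurable]: "p n \<in> borel_measurable borel" for n by (rule laur_measurable[OF P])
  have fm [measurable]: "f \<in> borel_measurable borel" by (rule borel_measurable_LIMSEQ_metric[OF _ f]) simp
  have fM: "cmod (f x) <= M" for x by (rule LIMSEQ_le_const2[OF tendsto_norm[OF f]]) (use M in auto)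
  have M0: "0 <= M" using order_trans[OF norm_ge_zero fM] .
  define K where "K = 2*M"
  have dM: "cmod (p n t - f t) <= K" for n t
    using norm_triangle_ineq4[of "p n t" "f t"] M[of n t] fM[of t] unfolding K_def by linarith
  have int: "integrable (smeas v) (%t. (cmod (p n t - f t))\<^sup>2)" for n v
    using dM by (intro integrable_smeas[where C = "K\<^sup>2"]) (auto intro!: power_mono)
  have "EX y. (%n. P n v) ----> y" for v
  proof -
    define E where "E n = (LINT t|smeas v. (cmod (p n t - f t))\<^sup>2)" for n
    have "E ----> (LINT t|smeas v. (cmod (f t - f t))\<^sup>2)" unfolding E_def
      using dM by (intro integral_dominated_convergence[where w = "%_. K\<^sup>2"] AE_I2 tendsto_intros f)
       (auto intro!: integrable_smeas[where C = "\<bar>K\<^sup>2\<bar>"] power_mono)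
    hence E: "E ----> 0" by simp
    have key: "(norm (P m v - P n v))\<^sup>2 <= 2*E m + 2*E n" for m n
    proof -
      have "(norm (P m v - P n v))\<^sup>2 = (LINT t|smeas v. (cmod (p m t - p n t))\<^sup>2)"
        by (rule laur_norm[OF laur_diff[OF P P]])
      also have "... <= (LINT t|smeas v. 2*(cmod (p m t - f t))\<^sup>2 + 2*(cmod (p n t - f t))\<^sup>2)"
      proof (rule integral_mono)
        fix t show "(cmod (p m t - p n t))\<^sup>2 <= 2*(cmod (p m t - f t))\<^sup>2 + 2*(cmod (p n t - f t))\<^sup>2"
          using norm_add_sq_le[of "p m t - f t" "f t - p n t"] by (simp add: norm_minus_commute)
        have "cmod (p m t - p n t) <= K" for t
          using norm_triangle_ineq4[of "p m t" "p n t"] M[of m t] M[of n t] unfolding K_def by linarith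
        thus "integrable (smeas v) (%t. (cmod (p m t - p n t))\<^sup>2)"
          by (intro integrable_smeas[where C = "K\<^sup>2"]) (auto intro!: power_mono)
      qed (intro Bochner_Integration.integrable_add integrable_mult_right int)
      also have "... = 2*E m + 2*E n" unfolding E_def by (simp add: int)
      finally show ?thesis .
    qed
    have "Cauchy (%n. P n v)"
    proof (rule metric_CauchyI)
      fix e :: real assume e: "e > 0"
      obtain N where N: "!!n. n >= N ==> \<bar>E n\<bar> < e\<^sup>2/4"
        using LIMSEQ_D[OF E, of "e\<^sup>2/4"] e by auto
      have "dist (P m v) (P n v) < e" if "m >= N" "n >= N" for m n
      proof -
        have "(norm (P m v - P n v))\<^sup>2 < e\<^sup>2"
          using key[of m n] N[OF that(1)] N[OF that(2)] by linarith
        thus ?thesis using e by (simp add: dist_norm power_less_imp_less_base)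
      qed
      thus "EX N. ALL m>=N. ALL n>=N. dist (P m v) (P n v) < e" by blast
    qed
    thus ?thesis using Cauchy_convergent_iff convergent_def by blast
  qed
  then obtain T where "!!v. (%n. P n v) ----> T v" by metis
  hence "calc f T" unfolding calc_def using P M f by blast
  thus ?thesis by blast
qed

lemma calc_laur: "laur p P ==> calc p P"
proof -
  assume p: "laur p P"
  obtain C where "!!x. cmod (p x) <= C" using laur_bounded[OF p] by blast
  thus ?thesis unfolding calc_def using p by (intro exI[of _ "%n. p"] exI[of _ "%n. P"] exI[of _ C]) auto
qed

lemma calc_add:
  assumes "calc f T" "calc g S"
  shows "calc (%x. f x + g x) (%v. T v + S v)"
proof -
  obtain p P M where p: "!!n. laur (p n) (P n)" "!!n x. cmod (p n x) <= M"
    "!!x. (%n. p n x) ----> f x" "!!v. (%n. P n v) ----> T v" using assms(1) unfolding calc_def by blast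
  obtain q Q N where q: "!!n. laur (q n) (Q n)" "!!n x. cmod (q n x) <= N"
    "!!x. (%n. q n x) ----> g x" "!!v. (%n. Q n v) ----> S v" using assms(2) unfolding calc_def by blast
  show ?thesis unfolding calc_def
    by (intro exI[of _ "%n x. p n x + q n x"] exI[of _ "%n v. P n v + Q n v"] exI[of _ "M + N"])
       (auto intro!: laur.add p q tendsto_intros norm_triangle_mono)
qed

lemma calc_scale:
  assumes "calc f T"
  shows "calc (%x. c*f x) (%v. c *\<^sub>C T v)"
proof -
  obtain p P M where p: "!!n. laur (p n) (P n)" "!!n x. cmod (p n x) <= M"
    "!!x. (%n. p n x) ----> f x" "!!v. (%n. P n v) ----> T v" using assms(1) unfolding calc_def by blast
  show ?thesis unfolding calc_def
    by (intro exI[of _ "%n x. c*p n x"] exI[of _ "%n v. c *\<^sub>C P n v"] exI[of _ "cmod c*M"])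
       (auto intro!: laur.scale p tendsto_intros mult_left_mono simp: norm_mult)
qed

lemma calc_diff:
  "calc f T ==> calc g S ==> calc (%x. f x - g x) (%v. T v - S v)"
  using calc_add[OF _ calc_scale[of g S "-1"], of f T] by (simp add: scaleC_minus1)

lemma smeas_total: "measure (smeas v) UNIV = (norm v)\<^sup>2" using laur_norm[OF laur_one, of v] by simp

lemma laur_norm_le:
  assumes p: "laur p P" and M: "!!x. cmod (p x) <= M"
  shows "norm (P v) <= M*norm v"
proof -
  interpret finite_measure "smeas v" by simp
  have M0: "0 <= M" using order_trans[OF norm_ge_zero M] .
  have "(norm (P v))\<^sup>2 = (LINT t|smeas v. (cmod (p t))\<^sup>2)" by (rule laur_norm[OF p])
  also have "... <= (LINT t|smeas v. M\<^sup>2)" using laur_measurable[OF p] M M0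
    by (intro integral_mono integrable_smeas[where C = "\<bar>M\<^sup>2\<bar>"]) (auto intro!: power_mono)
  also have "... = (M*norm v)\<^sup>2" by (simp add: smeas_total power_mult_distrib)
  finally show ?thesis using M0 by (simp add: power2_le_iff_abs_le)
qed

lemma calc_mult:
  assumes "calc f T" "calc g S"
  shows "calc (%x. f x*g x) (%v. T (S v))"
proof -
  obtain p P M where p: "!!n. laur (p n) (P n)" "!!n x. cmod (p n x) <= M"
    "!!x. (%n. p n x) ----> f x" "!!v. (%n. P n v) ----> T v" using assms(1) unfolding calc_def by blast
  obtain q Q N where q: "!!n. laur (q n) (Q n)" "!!n x. cmod (q n x) <= N"
    "!!x. (%n. q n x) ----> g x" "!!v. (%n. Q n v) ----> S v" using assms(2) unfolding calc_def by blast
  have "(%n. P n (Q n v)) ----> T (S v)" for v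
  proof -
    have "(%n. P n (Q n v - S v)) ----> 0"
    proof (rule Lim_null_comparison)
      show "\<forall>\<^sub>F n in sequentially. norm (P n (Q n v - S v)) <= M*norm (Q n v - S v)"
        using laur_norm_le[OF p(1,2)] by simp
      have "(%n. M*norm (Q n v - S v)) ----> M*norm (S v - S v)" by (intro tendsto_intros q)
      thus "(%n. M*norm (Q n v - S v)) ----> 0" by simp
    qed
    from tendsto_add[OF this p(4)[of "S v"]] show ?thesis
      by (simp add: bounded_clinearD(4)[OF laur_linear[OF p(1)]])
  qed
  moreover have "cmod (p n x*q n x) <= M*N" for n x
    unfolding norm_mult using order_trans[OF norm_ge_zero p(2)] by (intro mult_mono p q) auto
  moreover have "laur (%x. p n x*q n x) (%v. P n (Q n v))" for n by (rule laur_mult[OF p(1) q(1)])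
  moreover have "(%n. p n x*q n x) ----> f x*g x" for x by (intro tendsto_intros p q)
  ultimately show ?thesis unfolding calc_def
    by (intro exI[of _ "%n x. p n x*q n x"] exI[of _ "%n v. P n (Q n v)"] exI[of _ "M*N"]) blast
qed

lemma calc_unique:
  assumes "calc f T" "calc f S"
  shows "T = S"
proof
  fix v
  have "(norm (T v - S v))\<^sup>2 = (LINT t|smeas v. (cmod (f t - f t))\<^sup>2)"
    by (rule calc_norm[OF calc_diff[OF assms]])
  thus "T v = S v" by simp
qed

lemma calc_linear: "calc f T ==> bounded_clinear T"
proof -
  assume f: "calc f T"
  obtain p P M where p: "!!n. laur (p n) (P n)" "!!n x. cmod (p n x) <= M"
    "!!x. (%n. p n x) ----> f x" "!!v. (%n. P n v) ----> T v" using f unfolding calc_def by blast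
  note lin = bounded_clinearD[OF laur_linear[OF p(1)]]
  have "T (x + y) = T x + T y" for x y
    using tendsto_add[OF p(4)[of x] p(4)[of y]] p(4)[of "x + y"] by (simp add: lin LIMSEQ_unique)
  moreover have "T (c *\<^sub>C x) = c *\<^sub>C T x" for c x
    using tendsto_scaleC[OF tendsto_const p(4)[of x], of c] p(4)[of "c *\<^sub>C x"] by (simp add: lin LIMSEQ_unique)
  moreover have "norm (T v) <= M*norm v" for v
    by (rule LIMSEQ_le_const2[OF tendsto_norm[OF p(4)]]) (use laur_norm_le[OF p(1,2)] in auto)
  ultimately show ?thesis unfolding bounded_clinear_def by blast
qed

lemma calc_norm_le:
  assumes f: "calc f T" and M: "!!x. cmod (f x) <= M"
  shows "norm (T v) <= M*norm v"
proof -
  interpret finite_measure "smeas v" by simp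
  have M0: "0 <= M" using order_trans[OF norm_ge_zero M] .
  have "(norm (T v))\<^sup>2 = (LINT t|smeas v. (cmod (f t))\<^sup>2)" by (rule calc_norm[OF f])
  also have "... <= (LINT t|smeas v. M\<^sup>2)"
    using M M0 by (intro integral_mono calc_integrable[OF f]) (auto intro!: power_mono)
  also have "... = (M*norm v)\<^sup>2" by (simp add: smeas_total power_mult_distrib)
  finally show ?thesis using M0 by (simp add: power2_le_iff_abs_le)
qed

text \<open>On the diagonal both sides are the integral of \<open>f\<close>; inserting x + y and x +
  i y separates the two mixed terms.\<close>

lemma calc_adjoint:
  assumes f: "calc f T" and g: "calc (%x. cnj (f x)) S"
  shows "cinner x (T y) = cinner (S x) y"
proof -
  have diag: "cinner v (T v) = cinner (S v) v" for v
  proof -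
    have "cinner (S v) v = cnj (cinner v (S v))" by (simp only: cnj_cinner)
    also have "... = cnj (LINT t|smeas v. cnj (f t))" by (simp only: calc_cinner[OF g])
    also have "... = (LINT t|smeas v. f t)" by (simp only: Bochner_Integration.integral_cnj complex_cnj_cnj)
    finally show ?thesis by (simp only: calc_cinner[OF f])
  qed
  note T = bounded_clinearD[OF calc_linear[OF f]] and S = bounded_clinearD[OF calc_linear[OF g]]
  have 1: "cinner x (T y) + cinner y (T x) = cinner (S x) y + cinner (S y) x"
    using diag[of "x + y"] diag[of x] diag[of y] by (simp add: T S cinner_simps algebra_simps)
  have 2: "\<i>*cinner x (T y) - \<i>*cinner y (T x) = \<i>*cinner (S x) y - \<i>*cinner (S y) x"
    using diag[of "x + \<i> *\<^sub>C y"] diag[of x] diag[of y] by (simp add: T S cinner_simps algebra_simps)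
  from 2 have "\<i>*(cinner x (T y) - cinner y (T x)) = \<i>*(cinner (S x) y - cinner (S y) x)"
    by (simp only: right_diff_distrib)
  hence "cinner x (T y) - cinner y (T x) = cinner (S x) y - cinner (S y) x" by simp
  with 1 show ?thesis by (simp add: complex_eq_iff)
qed

text \<open>Bounded functions that are uniform limits of trigonometric polynomials in the Cayley
  variable. They form an algebra, so resolvent functions and their powers can serve as approximants
  in a single pointwise limit; \<open>calc\<close> itself admits only the polynomials there.\<close>

definition uc :: "(real => complex) => bool" where
  "uc f \<longleftrightarrow> (EX M. ALL x. cmod (f x) <= M) & (ALL e>0. EX p P. laur p P & (ALL x. cmod (f x - p x) <= e))"

lemma uc_laur: "laur p P ==> uc p"
  unfolding uc_def using laur_bounded[of p P] by (auto intro!: exI[of _ p] exI[of _ P])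

lemma uc_add:
  assumes f: "uc f" and g: "uc g"
  shows "uc (%x. f x + g x)" unfolding uc_def
proof (intro conjI allI impI)
  obtain M N where "!!x. cmod (f x) <= M" "!!x. cmod (g x) <= N" using f g unfolding uc_def by blast
  thus "EX M. ALL x. cmod (f x + g x) <= M" by (intro exI[of _ "M + N"]) (auto intro: norm_triangle_mono)
  fix e :: real assume "e > 0"
  hence "e/2 > 0" by simp
  with f g obtain p P q Q where *: "laur p P" "!!x. cmod (f x - p x) <= e/2" "laur q Q" "!!x. cmod (g x - q x) <= e/2"
    unfolding uc_def by meson
  have "cmod (f x + g x - (p x + q x)) <= e" for x
    using norm_triangle_mono[OF *(2)[of x] *(4)[of x]] by (simp add: algebra_simps)
  thus "EX p P. laur p P & (ALL x. cmod (f x + g x - p x) <= e)" using laur.add[OF *(1,3)] by blast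
qed

lemma uc_mult:
  assumes f: "uc f" and g: "uc g"
  shows "uc (%x. f x*g x)" unfolding uc_def
proof (intro conjI allI impI)
  obtain M0 N0 where M0: "!!x. cmod (f x) <= M0" and N0: "!!x. cmod (g x) <= N0" using f g unfolding uc_def by blast
  define M N where "M = M0 + 1" and "N = N0 + 1"
  have pos: "M > 0" "N > 0"
    using order_trans[OF norm_ge_zero M0] order_trans[OF norm_ge_zero N0] by (auto simp: M_def N_def)
  have M: "cmod (f x) <= M" and N: "cmod (g x) + 1 <= N" for x
    using M0[of x] N0[of x] by (auto simp: M_def N_def)
  have "cmod (f x*g x) <= M*N" for x unfolding norm_mult using M[of x] N[of x] pos by (intro mult_mono) auto
  thus "EX M. ALL x. cmod (f x*g x) <= M" by blast
  fix e :: real assume e: "e > 0"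
  define d where "d = min 1 (e/(M + N))"
  have d: "d > 0" using pos e by (simp add: d_def)
  with f g obtain p P q Q where *: "laur p P" "!!x. cmod (f x - p x) <= d" "laur q Q" "!!x. cmod (g x - q x) <= d"
    unfolding uc_def by meson
  have "cmod (f x*g x - p x*q x) <= e" for x
  proof -
    have "cmod (q x) <= cmod (g x) + cmod (g x - q x)" by (metis norm_minus_commute norm_triangle_sub)
    hence q: "cmod (q x) <= N" using N[of x] *(4)[of x] by (simp add: d_def)
    have "f x*g x - p x*q x = f x*(g x - q x) + (f x - p x)*q x" by (simp add: algebra_simps)
    hence "cmod (f x*g x - p x*q x) <= cmod (f x)*cmod (g x - q x) + cmod (f x - p x)*cmod (q x)"
      by (metis norm_mult norm_triangle_ineq)
    also have "... <= M*d + d*N" using M[of x] q *(2,4)[of x] d pos by (intro add_mono mult_mono) auto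
    also have "... = (M + N)*d" by (simp add: algebra_simps)
    also have "... <= (M + N)*(e/(M + N))" using pos by (intro mult_left_mono) (auto simp: d_def)
    finally show ?thesis using pos by simp
  qed
  thus "EX p P. laur p P & (ALL x. cmod (f x*g x - p x) <= e)" using laur_mult[OF *(1,3)] by blast
qed

lemma uc_const: "uc (%x. c)" using uc_laur[OF laur.scale[OF laur_one, of c]] by simp

lemma uc_power: "uc f ==> uc (%x. f x^n)" by (induction n) (auto intro: uc_const uc_mult)

lemma uc_cnj:
  assumes f: "uc f"
  shows "uc (%x. cnj (f x))" unfolding uc_def
proof (intro conjI allI impI)
  show "EX M. ALL x. cmod (cnj (f x)) <= M" using f by (simp add: uc_def)
  fix e :: real assume "e > 0"
  then obtain p P where p: "laur p P" "!!x. cmod (f x - p x) <= e" using f unfolding uc_def by meson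
  obtain P' where "laur (%x. cnj (p x)) P'" using laur_cnj[OF p(1)] by blast
  moreover have "cmod (cnj (f x) - cnj (p x)) <= e" for x
    using p(2)[of x] by (simp add: complex_cnj_diff[symmetric] del: complex_cnj_diff)
  ultimately show "EX p P. laur p P & (ALL x. cmod (cnj (f x) - p x) <= e)" by blast
qed

text \<open>A Neumann series argument.\<close>

lemma uc_fixpoint:
  assumes a: "uc a" and b: "uc b" and r: "!!x. r x = a x + b x*r x"
    and q: "!!x. cmod (b x) <= q" "q < 1" and bdd: "!!x. cmod (r x) <= C"
  shows "uc r"
proof -
  have q0: "0 <= q" using order_trans[OF norm_ge_zero q(1)] .
  have C0: "0 <= C" using order_trans[OF norm_ge_zero bdd] .
  have step: "EX g. uc g & (ALL x. cmod (r x - g x) <= q^n*C)" for n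
  proof (induction n)
    case 0
    thus ?case using uc_const[of 0] bdd by (intro exI[of _ "%_. 0"]) auto
  next
    case (Suc n)
    then obtain g where g: "uc g" "!!x. cmod (r x - g x) <= q^n*C" by blast
    have "cmod (r x - (a x + b x*g x)) <= q^Suc n*C" for x
    proof -
      have "r x - (a x + b x*g x) = b x*(r x - g x)" using r[of x] by (simp add: algebra_simps)
      hence "cmod (r x - (a x + b x*g x)) <= q*(q^n*C)"
        using q(1)[of x] g(2)[of x] q0 by (simp add: norm_mult mult_mono)
      thus ?thesis by simp
    qed
    thus ?case using uc_add[OF a uc_mult[OF b g(1)]] by blast
  qed
  show ?thesis unfolding uc_def
  proof (intro conjI allI impI)
    show "EX M. ALL x. cmod (r x) <= M" using bdd by blast
    fix e :: real assume e: "e > 0"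
    have "(%n. q^n*C) ----> 0*C" using q0 q(2) by (intro tendsto_intros LIMSEQ_power_zero) simp
    hence "(%n. q^n*C) ----> 0" by simp
    hence "\<forall>\<^sub>F n in sequentially. q^n*C < e/2" using e by (intro order_tendstoD(2)[of _ 0]) auto
    then obtain n where n: "q^n*C < e/2" unfolding eventually_sequentially by blast
    obtain g where g: "uc g" "!!x. cmod (r x - g x) <= q^n*C" using step by blast
    obtain p P where p: "laur p P" "!!x. cmod (g x - p x) <= e/2"
      using g(1) e unfolding uc_def by (meson half_gt_zero)
    have "cmod (r x - p x) <= e" for x using norm_triangle_mono[OF g(2)[of x] p(2)[of x]] n by simp
    thus "EX p P. laur p P & (ALL x. cmod (r x - p x) <= e)" using p(1) by blast
  qed
qed

lemma cmod_resolvent_fun_le: "Im z ~= 0 ==> cmod (1/(cr x - z)) <= 1/\<bar>Im z\<bar>"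
  using abs_Im_le_cmod[of "cr x - z"] by (simp add: norm_divide frac_le)

text \<open>For Im z > 0 the function 1/(x - z) solves an affine fixed point equation whose factor
  has modulus |z - i| / |z + i| < 1; the Neumann series runs in powers of the conjugate Cayley
  variable. Conjugation covers the lower half-plane.\<close>

lemma uc_resolvent:
  assumes z: "Im z ~= 0"
  shows "uc (%x. 1/(cr x - z))"
proof -
  have *: "uc (%x. 1/(cr x - z))" if z: "Im z > 0" for z
  proof (rule uc_fixpoint)
    have zi: "z + \<i> ~= 0" using z by (auto simp: complex_eq_iff)
    have conj: "cnj (cay x) = (cr x + \<i>)/(cr x - \<i>)" for x by (simp add: cay_def)
    have cc: "uc (%x. cnj (cay x))" by (rule uc_cnj[OF uc_laur[OF laur_cay]])
    have "uc (%x. (1/(z + \<i>))*(cnj (cay x)*(1 + (-1)*cay x)))"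
      by (intro uc_mult uc_add uc_const cc uc_laur[OF laur_cay])
    moreover have "(1/(z + \<i>))*(cnj (cay x)*(1 + (-1)*cay x)) = (1/(z + \<i>))*(2*\<i>/(cr x - \<i>))" for x
    proof -
      have "cnj (cay x)*(1 + (-1)*cay x) = cnj (cay x) - 1" by (simp add: algebra_simps)
      also have "... = 2*\<i>/(cr x - \<i>)" unfolding conj by (simp add: field_simps)
      finally show ?thesis by simp
    qed
    ultimately show "uc (%x. (1/(z + \<i>))*(2*\<i>/(cr x - \<i>)))" by simp
    show "uc (%x. ((z - \<i>)/(z + \<i>))*cnj (cay x))" by (intro uc_mult uc_const cc)
    show "cmod (1/(cr x - z)) <= 1/\<bar>Im z\<bar>" for x using z by (intro cmod_resolvent_fun_le) simp
    show "cmod (((z - \<i>)/(z + \<i>))*cnj (cay x)) <= cmod ((z - \<i>)/(z + \<i>))" for x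
      by (simp add: norm_mult norm_divide)
    have "(cmod (z - \<i>))\<^sup>2 < (cmod (z + \<i>))\<^sup>2"
      unfolding cmod_power2 using z by (simp add: power2_eq_square algebra_simps)
    hence "cmod (z - \<i>) < cmod (z + \<i>)" by (rule power_less_imp_less_base) simp
    thus "cmod ((z - \<i>)/(z + \<i>)) < 1" using zi by (simp add: norm_divide)
    fix x :: real
    have xz: "cr x - z ~= 0" using z by simp
    have xi: "cr x - \<i> ~= 0" by simp
    \<comment> \<open>Divided by (x - i)(z + i)(x - z), this polynomial identity is the fixed point
      equation.\<close>
    have "(cr x - \<i>)*(z + \<i>) = 2*\<i>*(cr x - z) + (z - \<i>)*(cr x + \<i>)"
      by (simp add: algebra_simps)
    note eq = this
    have "1/(cr x - z) = ((cr x - \<i>)*(z + \<i>))/((cr x - \<i>)*(z + \<i>)*(cr x - z))"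
      using zi xi xz by simp
    also have "... = (2*\<i>*(cr x - z) + (z - \<i>)*(cr x + \<i>))/((cr x - \<i>)*(z + \<i>)*(cr x - z))"
      by (simp only: eq)
    also have "... = (1/(z + \<i>))*(2*\<i>/(cr x - \<i>)) + ((z - \<i>)/(z + \<i>))*cnj (cay x)*(1/(cr x - z))"
    proof -
      have "(c*W + A*B)/(X*Z*W) = (1/Z)*(c/X) + (A/Z)*(B/X)*(1/W)"
        if "X ~= 0" "Z ~= 0" "W ~= 0" for c A B X Z W :: complex using that by (simp add: field_simps)
      thus ?thesis unfolding conj using zi xi xz by blast
    qed
    finally show "1/(cr x - z) = (1/(z + \<i>))*(2*\<i>/(cr x - \<i>)) + ((z - \<i>)/(z + \<i>))*cnj (cay x)*(1/(cr x - z))" .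
  qed
  show ?thesis
  proof (cases "Im z > 0")
    case False
    hence "uc (%x. 1/(cr x - cnj z))" using z by (intro *) simp
    from uc_cnj[OF this] show ?thesis by simp
  qed (rule *)
qed

text \<open>Replacing the n-th function by a polynomial within 1/(n + 1) of it changes neither the
  pointwise limit nor, beyond adding 1, the uniform bound.\<close>

lemma calc_uc_limit:
  assumes g: "!!n. uc (g n)" and M: "!!n x. cmod (g n x) <= M" and f: "!!x. (%n. g n x) ----> f x"
  shows "EX T. calc f T"
proof -
  have "EX p P. laur p P & (ALL x. cmod (g n x - p x) <= inverse (real (Suc n)))" for n
    using g[of n] unfolding uc_def by simp
  then obtain p P where p: "!!n. laur (p n) (P n)" "!!n x. cmod (g n x - p n x) <= inverse (real (Suc n))"
    by metis
  show ?thesis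
  proof (rule calc_exists)
    show "EX P. laur (p n) P" for n using p(1) by blast
    fix x
    show "cmod (p n x) <= M + 1" for n
    proof -
      have "cmod (p n x) <= cmod (g n x) + cmod (g n x - p n x)"
        by (metis norm_minus_commute norm_triangle_sub)
      moreover have "inverse (real (Suc n)) <= 1" by (simp add: inverse_eq_divide divide_le_eq)
      ultimately show ?thesis using M[of n x] p(2)[of n x] by linarith
    qed
    have "(%n. g n x - p n x) ----> 0"
      by (rule Lim_null_comparison[OF _ LIMSEQ_inverse_real_of_nat]) (use p(2) in auto)
    from tendsto_diff[OF f[of x] this] show "(%n. p n x) ----> f x" by simp
  qed
qed

lemma calc_uc: "uc f ==> EX T. calc f T"
proof -
  assume f: "uc f"
  then obtain M where "!!x. cmod (f x) <= M" unfolding uc_def by blast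
  with f show ?thesis by (intro calc_uc_limit[where g = "%_. f"]) auto
qed

lemma calc_resolvent_minus_i: "calc (%x. 1/(cr x + \<i>)) (R (-\<i>))"
proof -
  have "calc (%x. (1/(2*\<i>))*(1 - cay x)) (%v. (1/(2*\<i>)) *\<^sub>C (v - U v))"
    by (intro calc_scale calc_laur laur_diff laur_one laur_cay)
  moreover have "(1/(2*\<i>))*(1 - cay x) = 1/(cr x + \<i>)" for x
  proof -
    have "1 - cay x = ((cr x + \<i>) - (cr x - \<i>))/(cr x + \<i>)"
      unfolding cay_def diff_divide_distrib by simp
    thus ?thesis by simp
  qed
  moreover have "(1/(2*\<i>)) *\<^sub>C (v - U v) = R (-\<i>) v" for v by (simp add: U_def scaleC_scaleC)
  ultimately show ?thesis by simp
qed

text \<open>The bridge to the unbounded operator: f = (g + i f)/(x + i), so by uniqueness of the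
  calculus T = R(-i) (S + i T), which lands in the domain.\<close>

lemma calc_op:
  assumes f: "calc f T" and g: "calc g S" and fg: "!!x. g x = cr x*f x"
  shows "T v \<in> op_dom D" "op_app D (T v) = S v"
proof -
  have "calc (%x. 1/(cr x + \<i>)*(g x + \<i>*f x)) (%v. R (-\<i>) (S v + \<i> *\<^sub>C T v))"
    by (intro calc_mult calc_add calc_scale calc_resolvent_minus_i f g)
  moreover have "1/(cr x + \<i>)*(g x + \<i>*f x) = f x" for x
    unfolding fg by (simp add: distrib_right[symmetric])
  ultimately have "calc f (%v. R (-\<i>) (S v + \<i> *\<^sub>C T v))" by simp
  from calc_unique[OF f this] have T: "T v = R (-\<i>) (S v + \<i> *\<^sub>C T v)" for v by metis
  show "T v \<in> op_dom D" by (subst T) (rule resolvent_in_dom[OF i_resolvent(2)])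
  have "op_app D (T v) = (S v + \<i> *\<^sub>C T v) + (-\<i>) *\<^sub>C T v"
    using resolvent_right[OF i_resolvent(2), of "S v + \<i> *\<^sub>C T v"] T[of v] by simp
  thus "op_app D (T v) = S v" by (simp add: scaleC_minus_left)
qed

lemma calc_resolvent:
  assumes z: "Im z ~= 0"
  shows "calc (%x. 1/(cr x - z)) (R z)"
proof -
  let ?r = "%x. 1/(cr x - z)"
  obtain T where T: "calc ?r T" using calc_uc[OF uc_resolvent[OF z]] by blast
  have S: "calc (%x. 1 + z*?r x) (%v. v + z *\<^sub>C T v)"
    by (intro calc_add calc_scale T calc_laur laur_one)
  have eq: "1 + z*?r x = cr x*?r x" for x
  proof -
    have "cr x - z ~= 0" using z by simp
    thus ?thesis by (simp add: field_simps)
  qed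
  have "R z v = T v" for v using calc_op[OF T S eq, of v] by (intro resolvent_eqI nonreal_in_resolvent_set z)
  hence "T = R z" by auto
  thus ?thesis using T by simp
qed

lemma calc_exp: "EX T. calc (%x. exp (\<i>*cr s*cr x)) T"
proof (cases "s = 0")
  case True
  thus ?thesis using calc_laur[OF laur_one] by auto
next
  case False
  show ?thesis
  proof (rule calc_uc_limit)
    fix x :: real
    show "(%n. (1/(1 - \<i>*cr (s*x/Suc n)))^Suc n) ----> exp (\<i>*cr s*cr x)"
      using exp_i_limit[of "s*x"] by (simp add: mult.assoc)
    fix n
    have "1 <= cmod (1 - \<i>*cr (s*x/Suc n))" using abs_Re_le_cmod[of "1 - \<i>*cr (s*x/Suc n)"] by simp
    thus "cmod ((1/(1 - \<i>*cr (s*x/Suc n)))^Suc n) <= 1"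
      unfolding norm_power by (intro power_le_one) (simp_all add: norm_divide divide_le_eq)
  next
    fix n
    \<comment> \<open>The pole of 1/(1 - i s x/(n + 1)) as a function of x; it is not real, so the
      factor is a multiple of a resolvent function.\<close>
    define c where "c = - \<i>*cr (real (Suc n)/s)"
    have c: "Im c ~= 0" using False by (simp add: c_def del: of_nat_Suc)
    have "1/(1 - \<i>*cr (s*x/Suc n)) = (- c)*(1/(cr x - c))" for x
    proof -
      have "cr x - c ~= 0" using c by simp
      moreover have "1 - \<i>*cr (s*x/Suc n) = (cr x - c)/(- c)"
        using False unfolding c_def by (simp add: field_simps del: of_nat_Suc)
      ultimately show ?thesis by simp
    qed
    thus "uc (%x. (1/(1 - \<i>*cr (s*x/Suc n)))^Suc n)"
      by (simp only:) (intro uc_power uc_mult uc_const uc_resolvent c)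
  qed
qed

end

section \<open>The unitary group and the spectral measures\<close>

lemma has_vector_derivative_quotient:
  "(f has_vector_derivative d) (at t) \<longleftrightarrow> ((%h. (1/h) *\<^sub>R (f (t + h) - f t)) \<longlongrightarrow> d) (at 0)"
proof -
  have "(f has_vector_derivative d) (at t) \<longleftrightarrow> ((%h. norm (f (t + h) - f t - h *\<^sub>R d)/norm h) \<longlongrightarrow> 0) (at 0)"
    unfolding has_vector_derivative_def has_derivative_at by (simp add: bounded_linear_scaleR_left)
  also have "... \<longleftrightarrow> ((%h. norm ((1/h) *\<^sub>R (f (t + h) - f t) - d)) \<longlongrightarrow> 0) (at 0)"
  proof (rule tendsto_cong)
    have "norm (f (t + h) - f t - h *\<^sub>R d)/norm h = norm ((1/h) *\<^sub>R (f (t + h) - f t) - d)" if "h ~= 0" for h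
    proof -
      have "(1/h) *\<^sub>R (f (t + h) - f t) - d = (1/h) *\<^sub>R (f (t + h) - f t - h *\<^sub>R d)"
        using that by (simp add: scaleR_diff_right)
      thus ?thesis by simp
    qed
    thus "\<forall>\<^sub>F h in at 0. norm (f (t + h) - f t - h *\<^sub>R d)/norm h = norm ((1/h) *\<^sub>R (f (t + h) - f t) - d)"
      by (auto simp: eventually_at_filter)
  qed
  also have "... \<longleftrightarrow> ((%h. (1/h) *\<^sub>R (f (t + h) - f t)) \<longlongrightarrow> d) (at 0)"
    by (simp add: tendsto_norm_zero_iff Lim_null[symmetric])
  finally show ?thesis .
qed

lemma bounded_bilinear_cinner: "bounded_bilinear (cinner :: 'a :: complex_hilbert_space => 'a => complex)"
proof
  show "EX K. ALL a b :: 'a. norm (cinner a b) <= norm a*norm b*K"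
    by (intro exI[of _ 1]) (simp add: cmod_cinner_le)
qed (simp_all add: cinner_simps scaleR_scaleC scaleR_conv_of_real)

lemma bounded_clinear_bounded_linear:
  assumes "bounded_clinear T"
  shows "bounded_linear T"
proof -
  obtain K where "!!x. norm (T x) <= K*norm x" using bounded_clinear_bound[OF assms] by metis
  thus ?thesis by (intro bounded_linear_intro[where K = K])
       (auto simp: bounded_clinearD[OF assms] scaleR_scaleC mult.commute)
qed

lemma has_vector_derivative_bounded_clinear:
  "bounded_clinear T ==> (f has_vector_derivative d) F ==> ((%s. T (f s)) has_vector_derivative T d) F"
  by (rule bounded_linear.has_vector_derivative[OF bounded_clinear_bounded_linear])

text \<open>Levy's uniqueness theorem is only available for probability measures.\<close>

lemma finite_measure_eqI_char:
  assumes M: "sets M = sets borel" "finite_measure M" and N: "sets N = sets borel" "finite_measure N"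
    and eq: "!!s. (LINT E|M. exp (\<i>*cr s*cr E)) = (LINT E|N. exp (\<i>*cr s*cr E))"
  shows "M = (N :: real measure)"
proof -
  interpret M: finite_measure M by fact
  interpret N: finite_measure N by fact
  have sp: "space M = UNIV" "space N = UNIV" 
    using sets_eq_imp_space_eq[OF M(1)] sets_eq_imp_space_eq[OF N(1)] by simp_all
  have mass: "measure M UNIV = measure N UNIV" using eq[of 0] by (simp add: sp)
  show ?thesis
  proof (cases "measure M UNIV = 0")
    case True
    have "emeasure M A = 0" "emeasure N A = 0" for A
      using emeasure_mono[of A UNIV M] emeasure_mono[of A UNIV N] True mass
      using M.emeasure_eq_measure N.emeasure_eq_measure M(1) N(1)
      by (metis M.bounded_measure N.bounded_measure ennreal_0 measure_le_0_iff sp)+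
    thus ?thesis by (intro measure_eqI) (simp_all add: M N)
  next
    case False
    define c where "c = 1/measure M UNIV"
    have c: "c > 0" using False by (simp add: c_def zero_less_measure_iff)
    have *: "real_distribution (density K (%_. ennreal c)) &
       char (density K (%_. ennreal c)) = (%s. c *\<^sub>R (LINT E|K. exp (\<i>*cr s*cr E)))"
      if K: "sets K = sets borel" "finite_measure K" "measure K UNIV = measure M UNIV" for K
    proof
      interpret K: finite_measure K by fact
      have spK: "space K = UNIV" using sets_eq_imp_space_eq[OF K(1)] by simp
      interpret prob_space "density K (%_. ennreal c)"
      proof (rule prob_spaceI)
        show "emeasure (density K (%_. ennreal c)) (space (density K (%_. ennreal c))) = 1"
          using c K(3) False by (simp add: emeasure_density_const spK K(1) K.emeasure_eq_measure c_def ennreal_mult[symmetric])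
      qed
      show "real_distribution (density K (%_. ennreal c))" by unfold_locales (simp add: K(1))
      have "char (density K (%_. ennreal c)) s = c *\<^sub>R (LINT E|K. exp (\<i>*cr s*cr E))" for s
      proof -
        have "char (density K (%_. ennreal c)) s = (LINT E|K. c *\<^sub>R exp (\<i>*(cr s*cr E)))"
          unfolding char_def using c
          by (subst integral_density) (auto simp: measurable_cong_sets[OF K(1) refl] intro!: borel_measurable_continuous_onI continuous_intros)
        thus ?thesis by (simp add: mult.assoc)
      qed
      thus "char (density K (%_. ennreal c)) = (%s. c *\<^sub>R (LINT E|K. exp (\<i>*cr s*cr E)))" by auto
    qed
    have "density M (%_. ennreal c) = density N (%_. ennreal c)"
      using *[OF M refl] *[OF N mass[symmetric]] eq by (intro Levy_uniqueness) auto
    hence "ennreal c*emeasure M A = ennreal c*emeasure N A" if "A \<in> sets borel" for A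
      using that by (metis emeasure_density_const M(1) N(1))
    hence "emeasure M A = emeasure N A" if "A \<in> sets borel" for A
      using that c by (simp add: M.emeasure_eq_measure N.emeasure_eq_measure ennreal_mult[symmetric])
    thus ?thesis by (intro measure_eqI) (simp_all add: M N)
  qed
qed

lemma exp_i_diff_le: "cmod (exp (\<i>*cr t) - 1) <= \<bar>t\<bar>" using iexp_approx1[of t 0] by simp

context selfadj
begin

definition expi :: "real => 'a => 'a" where
  "expi s = (SOME T. calc (%x. exp (\<i>*cr s*cr x)) T)"

lemma calc_expi: "calc (%x. exp (\<i>*cr s*cr x)) (expi s)" unfolding expi_def by (rule someI_ex[OF calc_exp])

lemma expi_linear: "bounded_clinear (expi s)" by (rule calc_linear[OF calc_expi])

lemma expi_add: "expi (s + t) x = expi s (expi t x)"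
proof -
  have "calc (%x. exp (\<i>*cr (s + t)*cr x)) (%v. expi s (expi t v))"
    using calc_mult[OF calc_expi[of s] calc_expi[of t]] by (simp add: exp_add[symmetric] algebra_simps)
  from calc_unique[OF calc_expi this] show ?thesis by metis
qed

lemma expi_0: "expi 0 x = x" using calc_unique[OF calc_expi[of 0], of "%x. x"] calc_laur[OF laur_one] by simp

lemma expi_isometric: "cinner (expi s x) (expi s y) = cinner x y"
proof -
  have "calc (%x. cnj (exp (\<i>*cr s*cr x))) (expi (-s))" using calc_expi[of "-s"] by (simp add: exp_cnj)
  from calc_adjoint[OF calc_expi this] have "cinner (expi s x) (expi s y) = cinner (expi (-s) (expi s x)) y" .
  thus ?thesis by (simp add: expi_add[symmetric] expi_0)
qed

lemma expi_adjoint: "cinner (expi s x) y = cinner x (expi (-s) y)"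
  using expi_isometric[of s x "expi (-s) y"] by (simp add: expi_add[symmetric] expi_0)

lemma expi_continuous: "continuous_on UNIV (%s. expi s x)" unfolding continuous_on_sequentially
proof (intro allI ballI impI)
  fix S :: "nat => real" and s assume "(ALL n. S n \<in> UNIV) & S ----> s"
  hence S: "S ----> s" by simp
  have eq: "(norm (expi (S n) x - expi s x))\<^sup>2 = (LINT t|smeas x. (cmod (exp (\<i>*cr (S n)*cr t) - exp (\<i>*cr s*cr t)))\<^sup>2)" for n
    by (rule calc_norm[OF calc_diff[OF calc_expi calc_expi]])
  have bd: "cmod (exp (\<i>*cr a*cr t) - exp (\<i>*cr b*cr t)) <= 2" for a b t
    using norm_triangle_ineq4[of "exp (\<i>*cr a*cr t)" "exp (\<i>*cr b*cr t)"] by simp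
  have bd2: "(cmod (exp (\<i>*cr a*cr t) - exp (\<i>*cr b*cr t)))\<^sup>2 <= 4" for a b t
    using power_mono[OF bd[of a t b] norm_ge_zero, of 2] by simp
  have "(%n. LINT t|smeas x. (cmod (exp (\<i>*cr (S n)*cr t) - exp (\<i>*cr s*cr t)))\<^sup>2)
    ----> (LINT t|smeas x. (cmod (exp (\<i>*cr s*cr t) - exp (\<i>*cr s*cr t)))\<^sup>2)"
    by (intro integral_dominated_convergence[where w = "%_. 4"] AE_I2 tendsto_intros S)
       (auto intro!: bd2 integrable_smeas[where C = 4] borel_measurable_continuous_onI continuous_intros)
  hence "(%n. (norm (expi (S n) x - expi s x))\<^sup>2) ----> 0" by (simp add: eq)
  hence "(%n. sqrt ((norm (expi (S n) x - expi s x))\<^sup>2)) ----> sqrt 0" by (rule tendsto_real_sqrt)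
  hence "(%n. expi (S n) x - expi s x) ----> 0" by (simp add: tendsto_norm_zero_iff)
  thus "((%s. expi s x) \<circ> S) ----> expi s x" by (simp add: comp_def LIM_zero_iff)
qed

text \<open>Writing x = R(-i) y puts a factor 1/(t + i) into the function of the difference
  quotient. It compensates the growth of (exp (i s t) - 1)/s, leaving a bound of 2 uniform in s and
  t, so dominated convergence against \<open>smeas y\<close> applies.\<close>

lemma expi_derivative:
  assumes x: "x \<in> op_dom D"
  shows "((%s. expi s x) has_vector_derivative \<i> *\<^sub>C op_app D x) (at 0)"
  unfolding has_vector_derivative_quotient tendsto_at_iff_sequentially
proof (intro allI impI)
  fix S :: "nat => real" assume S0: "ALL i. S i \<in> UNIV - {0}" and S: "S ----> 0"
  define y where "y = op_app D x + \<i> *\<^sub>C x"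
  have xy: "x = R (-\<i>) y"  unfolding y_def by (rule resolvent_eqI[symmetric, OF i_resolvent(2) x]) simp
  let ?r = "%t. 1/(cr t + \<i>)"
  define f where "f s t = cr (1/s)*((exp (\<i>*cr s*cr t) - 1)*?r t) - \<i>*(1 - \<i>*?r t)" for s t
  have f: "calc (f s) (%v. cr (1/s) *\<^sub>C (expi s (R (-\<i>) v) - R (-\<i>) v) - \<i> *\<^sub>C (v - \<i> *\<^sub>C R (-\<i>) v))" for s
    unfolding f_def
    by (intro calc_diff calc_scale calc_mult[of "%t. exp (\<i>*cr s*cr t) - 1" "%v. expi s v - v" "?r" "R (-\<i>)"]
        calc_expi calc_laur[OF laur_one] calc_resolvent_minus_i)
  have fy: "cr (1/s) *\<^sub>C (expi s (R (-\<i>) y) - R (-\<i>) y) - \<i> *\<^sub>C (y - \<i> *\<^sub>C R (-\<i>) y)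
     = (1/s) *\<^sub>R (expi (0 + s) x - expi 0 x) - \<i> *\<^sub>C op_app D x" for s
    unfolding xy[symmetric] by (simp add: expi_0 scaleR_scaleC y_def)
  have eq: "(norm ((1/s) *\<^sub>R (expi (0 + s) x - expi 0 x) - \<i> *\<^sub>C op_app D x))\<^sup>2 = (LINT t|smeas y. (cmod (f s t))\<^sup>2)" for s
    using calc_norm[OF f[of s], of y] unfolding fy .
  have one: "1 - \<i>*?r t = cr t*?r t" for t by (simp add: divide_simps)
  have tr: "\<bar>t\<bar>*cmod (?r t) <= 1" for t
    using abs_Re_le_cmod[of "cr t + \<i>"] by (simp add: norm_divide divide_le_eq)
  have bd: "cmod (f s t) <= 2" if "s ~= 0" for s t
  proof -
    have "cmod (cr (1/s)*((exp (\<i>*cr s*cr t) - 1)*?r t)) <= 1"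
    proof -
      have "cmod (exp (\<i>*cr s*cr t) - 1) <= \<bar>s*t\<bar>"
        using exp_i_diff_le[of "s*t"] by (simp add: mult.assoc)
      hence "cmod (cr (1/s)*((exp (\<i>*cr s*cr t) - 1)*?r t)) <= \<bar>1/s\<bar>*(\<bar>s*t\<bar>*cmod (?r t))"
        unfolding norm_mult norm_of_real by (intro mult_left_mono mult_right_mono) auto
      also have "... = \<bar>t\<bar>*cmod (?r t)" using that by (simp add: abs_mult)
      finally show ?thesis using tr[of t] by linarith
    qed
    moreover have "cmod (\<i>*(1 - \<i>*?r t)) <= 1"
      unfolding one using tr[of t] by (simp add: norm_mult norm_divide)
    ultimately show ?thesis unfolding f_def using norm_triangle_ineq4 order_trans by (smt (verit, best))
  qed
  have lim: "(%n. f (S n) t) ----> 0" for t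
  proof -
    have "((%s. exp (\<i>*cr s*cr t)) has_vector_derivative \<i>*cr t) (at 0)"
      by (auto intro!: derivative_eq_intros has_vector_derivative_real_field[of "%s. exp (\<i> * s*cr t)" "\<i>*cr t" 0, simplified])
    hence "((%h. cr (1/h)*(exp (\<i>*cr h*cr t) - 1)) \<longlongrightarrow> \<i>*cr t) (at 0)"
      unfolding has_vector_derivative_quotient by (simp add: scaleR_conv_of_real)
    hence "(%n. cr (1/S n)*(exp (\<i>*cr (S n)*cr t) - 1)) ----> \<i>*cr t"
      unfolding tendsto_at_iff_sequentially using S0 S by (simp add: comp_def)
    from tendsto_diff[OF tendsto_mult[OF this tendsto_const[of "?r t"]] tendsto_const[of "\<i>*(1 - \<i>*?r t)"]]
    have "(%n. (cr (1/S n)*(exp (\<i>*cr (S n)*cr t) - 1))*?r t - \<i>*(1 - \<i>*?r t))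
      ----> (\<i>*cr t)*?r t - \<i>*(1 - \<i>*?r t)" .
    thus ?thesis unfolding f_def one by (simp add: mult.assoc)
  qed
  have "(%n. LINT t|smeas y. (cmod (f (S n) t))\<^sup>2) ----> (LINT t|smeas y. 0)"
  proof (rule integral_dominated_convergence[where w = "%_. 2\<^sup>2"])
    show "AE t in smeas y. (%n. (cmod (f (S n) t))\<^sup>2) ----> 0"
    proof (rule AE_I2)
      fix t
      from tendsto_power[OF tendsto_norm[OF lim[of t]], of 2]
      show "(%n. (cmod (f (S n) t))\<^sup>2) ----> 0" by simp
    qed
    show "AE t in smeas y. norm ((cmod (f (S n) t))\<^sup>2) <= 2\<^sup>2" for n
      using S0 by (auto intro!: power_mono[of _ 2 2, simplified] bd)
    show "(%t. (cmod (f (S n) t))\<^sup>2) \<in> borel_measurable (smeas y)" for n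
      using calc_measurable[OF f[of "S n"]] by simp
  qed (auto intro!: integrable_smeas[where C = 4])
  hence "(%n. sqrt ((norm ((1/S n) *\<^sub>R (expi (0 + S n) x - expi 0 x) - \<i> *\<^sub>C op_app D x))\<^sup>2)) ----> sqrt 0"
    unfolding eq by (intro tendsto_real_sqrt) simp
  hence "(%n. (1/S n) *\<^sub>R (expi (0 + S n) x - expi 0 x) - \<i> *\<^sub>C op_app D x) ----> 0"
    by (simp only: real_sqrt_abs abs_norm_cancel real_sqrt_zero tendsto_norm_zero_iff)
  thus "((%h. (1/h) *\<^sub>R (expi (0 + h) x - expi 0 x)) \<circ> S) ----> \<i> *\<^sub>C op_app D x"
    unfolding comp_def by (rule LIM_zero_cancel)
qed

lemma unitary_group_expi: "unitary_group_of D expi" unfolding unitary_group_of_def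
proof (intro conjI allI ballI)
  show "expi s (x + y) = expi s x + expi s y" "expi s (c *\<^sub>C x) = c *\<^sub>C expi s x" for s x y c
    by (simp_all add: bounded_clinearD[OF expi_linear])
  show "cinner (expi s x) (expi s y) = cinner x y" for s x y by (rule expi_isometric)
  show "surj (expi s)" for s by (rule surjI[of _ "expi (-s)"]) (simp add: expi_add[symmetric] expi_0)
  show "expi 0 = id" by (simp add: fun_eq_iff expi_0)
  show "expi (s + t) = expi s \<circ> expi t" for s t by (simp add: fun_eq_iff expi_add)
  show "continuous_on UNIV (%s. expi s x)" for x by (rule expi_continuous)
  show "((%s. expi s x) has_vector_derivative \<i> *\<^sub>C op_app D x) (at 0)" if "x \<in> op_dom D" for x
    by (rule expi_derivative[OF that])
  show "op_dom D = {x. (%s. expi s x) differentiable (at 0)}"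
  proof (intro set_eqI iffI)
    fix x assume "x \<in> op_dom D"
    thus "x \<in> {x. (%s. expi s x) differentiable (at 0)}"
      using expi_derivative differentiableI_vector by blast
  next
    fix x assume "x \<in> {x. (%s. expi s x) differentiable (at 0)}"
    then obtain w where w: "((%s. expi s x) has_vector_derivative w) (at 0)"
      by (auto simp: vector_derivative_works)
    \<comment> \<open>Differentiability of the orbit puts \<open>x\<close> into the domain of the
      adjoint: the difference quotient is moved to \<open>y\<close>, with h replaced by -h, and
      \<open>y\<close> is known to be differentiable.\<close>
    have "cinner x (op_app D y) = cinner (- \<i> *\<^sub>C w) y" if y: "y \<in> op_dom D" for y
    proof -
      have "((%h. cinner ((1/h) *\<^sub>R (expi (0 + h) x - expi 0 x)) y) \<longlongrightarrow> cinner w y) (at 0)"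
        by (intro tendsto_intros w[unfolded has_vector_derivative_quotient])
      moreover have "((%h. cinner x ((1/(-h)) *\<^sub>R (expi (0 + (-h)) y - expi 0 y))) \<longlongrightarrow> cinner x (\<i> *\<^sub>C op_app D y)) (at 0)"
      proof (intro tendsto_intros)
        have "filterlim (%h::real. - h) (at 0) (at 0)"
          unfolding filterlim_at using tendsto_minus[OF tendsto_ident_at, of "0::real" UNIV]
          by (auto simp: eventually_at_filter)
        from filterlim_compose[OF expi_derivative[OF y, unfolded has_vector_derivative_quotient] this]
        show "((%h. (1/(-h)) *\<^sub>R (expi (0 + (-h)) y - expi 0 y)) \<longlongrightarrow> \<i> *\<^sub>C op_app D y) (at 0)" .
      qed
      moreover have "cinner ((1/h) *\<^sub>R (expi (0 + h) x - expi 0 x)) y = - cinner x ((1/(-h)) *\<^sub>R (expi (0 + (-h)) y - expi 0 y))" for h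
        by (simp add: expi_0 scaleR_scaleC cinner_simps expi_adjoint)
      ultimately have "((%h. cinner x ((1/(-h)) *\<^sub>R (expi (0 + (-h)) y - expi 0 y))) \<longlongrightarrow> - cinner w y) (at 0)"
        by (simp add: tendsto_minus_cancel_left)
      hence "cinner x (\<i> *\<^sub>C op_app D y) = - cinner w y"
        using \<open>((%h. cinner x ((1/(-h)) *\<^sub>R (expi (0 + (-h)) y - expi 0 y))) \<longlongrightarrow> cinner x (\<i> *\<^sub>C op_app D y)) (at 0)\<close>
        by (intro tendsto_unique[OF _ _ ]) auto
      hence "\<i>*cinner x (op_app D y) = \<i>*(\<i>*cinner w y)" by (simp add: cinner_simps)
      hence "cinner x (op_app D y) = \<i>*cinner w y" by (simp only: mult_cancel_left) simp
      thus ?thesis by (simp add: cinner_simps)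
    qed
    thus "x \<in> op_dom D" by (rule adjointI(1))
  qed
qed

lemma unitary_group_invariant:
  assumes W: "unitary_group_of D W" and x: "x \<in> op_dom D"
  shows "W t x \<in> op_dom D" "((%s. W s x) has_vector_derivative \<i> *\<^sub>C op_app D (W t x)) (at t)"
proof -
  have add: "W s (x + y) = W s x + W s y" and scale: "W s (c *\<^sub>C x) = c *\<^sub>C W s x" and iso: "cinner (W s x) (W s y) = cinner x y"
    and grp: "W (s + r) x = W s (W r x)" for s r x y c using W by (auto simp: unitary_group_of_def)
  have dom: "op_dom D = {x. (%s. W s x) differentiable (at 0)}"
    and der: "!!x. x \<in> op_dom D ==> ((%s. W s x) has_vector_derivative \<i> *\<^sub>C op_app D x) (at 0)"
    using W by (auto simp: unitary_group_of_def)
  have "norm (W s x) = norm x" for s x by (metis iso norm_eq_sqrt_inner inner_cinner)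
  hence lin: "bounded_clinear (W s)" for s
    unfolding bounded_clinear_def by (auto intro!: add scale exI[of _ 1])
  have d0: "((%s. W t (W s x)) has_vector_derivative W t (\<i> *\<^sub>C op_app D x)) (at 0)"
    by (rule has_vector_derivative_bounded_clinear[OF lin der[OF x]])
  have comm: "W t (W s x) = W s (W t x)" for s by (metis grp add.commute)
  show dom': "W t x \<in> op_dom D" unfolding dom using d0 by (auto simp: comm intro: differentiableI_vector)
  have eq: "W t (\<i> *\<^sub>C op_app D x) = \<i> *\<^sub>C op_app D (W t x)"
    using vector_derivative_unique_at[OF d0[unfolded comm] der[OF dom']] .
  show "((%s. W s x) has_vector_derivative \<i> *\<^sub>C op_app D (W t x)) (at t)"
    using d0 unfolding has_vector_derivative_quotient eq by (simp add: grp[symmetric] add.commute)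
qed

text \<open>\<open>exp_i_op\<close> is a definite description, so uniqueness is required. On the
  domain the inner product of the two orbits has derivative 0 by symmetry of D, hence equals |x|^2;
  for vectors of norm |x| this means equality. Density and boundedness do the rest.\<close>

lemma unitary_group_unique:
  assumes W: "unitary_group_of D W"
  shows "W = expi"
proof -
  have on_dom: "W t x = expi t x" if x: "x \<in> op_dom D" for t x
  proof -
    let ?f = "%t. cinner (W t x) (expi t x)"
    have "(?f has_vector_derivative 0) (at t)" for t
    proof -
      note w = unitary_group_invariant[OF W x, of t] and e = unitary_group_invariant[OF unitary_group_expi x, of t]
      from bounded_bilinear.FDERIV[OF bounded_bilinear_cinner w(2)[unfolded has_vector_derivative_def] e(2)[unfolded has_vector_derivative_def]]
      have "(?f has_derivative (%h. cinner (W t x) (h *\<^sub>R \<i> *\<^sub>C op_app D (expi t x)) + cinner (h *\<^sub>R \<i> *\<^sub>C op_app D (W t x)) (expi t x))) (at t)" .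
      moreover have "cinner (W t x) (h *\<^sub>R \<i> *\<^sub>C op_app D (expi t x)) + cinner (h *\<^sub>R \<i> *\<^sub>C op_app D (W t x)) (expi t x) = h *\<^sub>R 0" for h
        using symmetric[OF w(1) e(1)] by (simp add: scaleR_scaleC cinner_simps)
      ultimately show ?thesis unfolding has_vector_derivative_def by simp
    qed
    then obtain c where "!!t. t \<in> UNIV ==> ?f t = c"
      by (rule has_vector_derivative_zero_constant[of UNIV ?f, rotated 1]) auto
    hence "?f t = ?f 0" by simp
    also have "... = cinner x x" using W by (simp add: expi_0 unitary_group_of_def)
    finally have "(norm (W t x - expi t x))\<^sup>2 = (norm (W t x))\<^sup>2 + (norm (expi t x))\<^sup>2 - 2*(norm x)\<^sup>2"
      by (simp add: norm_diff_sq cinner_self)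
    moreover have "norm (W t x) = norm x" "norm (expi t x) = norm x"
      using W expi_isometric[of t x x] unfolding unitary_group_of_def norm_eq_sqrt_inner inner_cinner by auto
    ultimately show ?thesis by simp
  qed
  have "W t x = expi t x" for t x
  proof -
    obtain s where s: "!!n. s n \<in> op_dom D" "s ----> x"
      using dense closure_sequential[of x "op_dom D"] by auto
    have "bounded_clinear (W t)"
      using W unfolding bounded_clinear_def unitary_group_of_def norm_eq_sqrt_inner inner_cinner
      by (auto intro!: exI[of _ 1])
    from bounded_clinear_tendsto[OF this s(2)] bounded_clinear_tendsto[OF expi_linear[of t] s(2)]
    show ?thesis using on_dom[OF s(1)] by (simp add: LIMSEQ_unique)
  qed
  thus ?thesis by (simp add: fun_eq_iff)
qed

lemma exp_i_op_eq: "exp_i_op D = expi"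
  unfolding exp_i_op_def using unitary_group_expi unitary_group_unique by (rule the_equality)

text \<open>Exponentials belong to the calculus, so \<open>smeas v\<close> has the required Fourier
  transform, and a finite measure is determined by its Fourier transform.\<close>

lemma spectral_measure_eq: "spectral_measure D v = smeas v" unfolding spectral_measure_def exp_i_op_eq
proof (rule the_equality)
  show *: "sets (smeas v) = sets borel & finite_measure (smeas v) &
    (ALL s. cinner v (expi s v) = (LINT E|smeas v. exp (\<i>*cr s*cr E)))"
    by (simp add: calc_cinner[OF calc_expi])
  fix \<mu> :: "real measure" assume "sets \<mu> = sets borel & finite_measure \<mu> &
    (ALL s. cinner v (expi s v) = (LINT E|\<mu>. exp (\<i>*cr s*cr E)))"
  with * show "\<mu> = smeas v" by (intro finite_measure_eqI_char) auto
qed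

section \<open>Atoms of spectral measures and eigenvalues\<close>

lemma atom_projection:
  obtains T where "calc (%x. indicator {e} x) T"
    "!!v. T v \<in> op_dom D" "!!v. op_app D (T v) = cr e *\<^sub>C T v"
    "!!v. (norm (T v))\<^sup>2 = measure (smeas v) {e}"
proof -
  \<comment> \<open>The spectral projection at \<open>e\<close> is the strong limit of - c R(e + c)
    as c = i/(n + 1) tends to 0: the functions have modulus at most 1, take the value 1 at
    \<open>e\<close> and tend to 0 elsewhere.\<close>
  define c where "c n = \<i>*cr (inverse (real (Suc n)))" for n
  have imc: "Im (c n) = inverse (real (Suc n))" for n
    unfolding c_def by (simp only: Im_i_times Re_complex_of_real)
  have imc0: "Im (cr e + c n) ~= 0" for n using imc[of n] by (simp del: of_nat_Suc)
  have "EX T. calc (%x. indicator {e} x) T"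
  proof (rule calc_uc_limit)
    show "uc (%x. (- c n)*(1/(cr x - (cr e + c n))))" for n by (intro uc_mult uc_const uc_resolvent imc0)
    show "cmod ((- c n)*(1/(cr x - (cr e + c n)))) <= 1" for n x
    proof -
      have "cmod (1/(cr x - (cr e + c n))) <= 1/inverse (real (Suc n))"
        using cmod_resolvent_fun_le[OF imc0[of n], of x] imc[of n] by (simp del: of_nat_Suc)
      hence "cmod (c n)*cmod (1/(cr x - (cr e + c n))) <= inverse (real (Suc n))*(1/inverse (real (Suc n)))"
        by (intro mult_mono) (auto simp: c_def norm_mult norm_inverse simp del: of_nat_Suc)
      thus ?thesis by (simp add: norm_mult norm_divide del: of_nat_Suc)
    qed
    have cl: "c ----> \<i>*cr 0" unfolding c_def by (intro tendsto_intros LIMSEQ_inverse_real_of_nat)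
    fix x
    show "(%n. (- c n)*(1/(cr x - (cr e + c n)))) ----> indicator {e} x"
    proof (cases "x = e")
      case True
      have "c n ~= 0" for n using imc[of n] by (auto simp del: of_nat_Suc)
      thus ?thesis using True by simp
    next
      case False
      have "(%n. (- c n)*(1/(cr x - (cr e + c n)))) ----> (- (\<i>*cr 0))*(1/(cr x - (cr e + \<i>*cr 0)))"
        using False by (intro tendsto_intros cl) simp
      thus ?thesis using False by simp
    qed
  qed
  then obtain T where T: "calc (%x. indicator {e} x) T" by blast
  have S: "calc (%x. cr e*indicator {e} x) (%v. cr e *\<^sub>C T v)" by (rule calc_scale[OF T])
  have eq: "cr e*indicator {e} x = cr x*indicator {e} x" for x by (auto simp: indicator_def)
  show ?thesis
  proof (rule that[OF T calc_op[OF T S eq]])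
    fix v
    interpret finite_measure "smeas v" by simp
    have "(norm (T v))\<^sup>2 = (LINT t|smeas v. (cmod (indicator {e} t))\<^sup>2)" by (rule calc_norm[OF T])
    also have "... = (LINT t|smeas v. indicator {e} t)"
      by (intro Bochner_Integration.integral_cong refl) (auto simp: indicator_def)
    finally show "(norm (T v))\<^sup>2 = measure (smeas v) {e}" by simp
  qed
qed

lemma no_eigenvalue_no_atom:
  assumes "~ eigenvalue D (cr e)"
  shows "emeasure (smeas v) {e} = 0"
proof -
  interpret finite_measure "smeas v" by simp
  obtain T where T: "calc (%x. indicator {e} x) T" "!!v. T v \<in> op_dom D"
    "!!v. op_app D (T v) = cr e *\<^sub>C T v" "!!v. (norm (T v))\<^sup>2 = measure (smeas v) {e}"
    using atom_projection[of e thesis] by blast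
  have "T v = 0" using assms T(2,3) unfolding eigenvalue_def by blast
  thus ?thesis using T(4)[of v] by (simp add: emeasure_eq_measure)
qed

lemma eigenvector_atom:
  assumes x: "x \<in> op_dom D" "op_app D x = cr e *\<^sub>C x" and gx: "cinner g x ~= 0"
  shows "emeasure (smeas g) {e} ~= 0"
proof -
  obtain T where T: "calc (%x. indicator {e} x) T" "!!v. T v \<in> op_dom D"
    "!!v. op_app D (T v) = cr e *\<^sub>C T v" "!!v. (norm (T v))\<^sup>2 = measure (smeas v) {e}"
    using atom_projection[of e thesis] by blast
  define z where "z = cr e + \<i>"
  have z: "Im z ~= 0" by (simp add: z_def)
  have Rx: "R z x = \<i> *\<^sub>C x"
  proof (rule resolvent_eqI[OF nonreal_in_resolvent_set[OF z]])
    show "\<i> *\<^sub>C x \<in> op_dom D" using dom_simps x by blast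
    show "op_app D (\<i> *\<^sub>C x) = x + z *\<^sub>C \<i> *\<^sub>C x"
      using x dom_simps(6) by (simp add: z_def scaleC_scaleC scaleC_add_left scaleC_diff_left distrib_left mult.commute scaleC_minus1)
  qed
  \<comment> \<open>This is (t - e)/(t - z), which vanishes only at \<open>e\<close>. Its operator
    annihilates the eigenvector, so \<open>smeas x\<close> is concentrated at \<open>e\<close> and
    \<open>T x = x\<close>.\<close>
  let ?F = "%t. 1 + \<i>*(1/(cr t - z))"
  have F: "calc ?F (%v. v + \<i> *\<^sub>C R z v)"
    by (intro calc_add calc_scale calc_laur[OF laur_one] calc_resolvent z)
  have "x + \<i> *\<^sub>C R z x = 0" by (simp add: Rx scaleC_scaleC scaleC_minus1)
  with calc_norm[OF F, of x] have "(LINT t|smeas x. (cmod (?F t))\<^sup>2) = 0" by simp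
  hence "AE t in smeas x. (cmod (?F t))\<^sup>2 = 0"
    using calc_integrable(2)[OF F] by (subst (asm) integral_nonneg_eq_0_iff_AE) auto
  hence AE: "AE t in smeas x. t = e"
  proof eventually_elim
    case (elim t)
    have "cr t - z ~= 0" using z by simp
    thus ?case using elim by (simp add: z_def field_simps)
  qed
  have "(norm (x - T x))\<^sup>2 = (LINT t|smeas x. (cmod (1 - indicator {e} t))\<^sup>2)"
    by (rule calc_norm[OF calc_diff[OF calc_laur[OF laur_one] T(1)]])
  also have "... = (LINT t|smeas x. 0)"
    by (rule integral_cong_AE) (use AE in \<open>auto elim!: eventually_mono\<close>)
  finally have Tx: "T x = x" by simp
  have "calc (%x. cnj (indicator {e} x)) T"
  proof -
    have "(%x. cnj (indicator {e} x)) = (%x. indicator {e} x)" by (auto simp: fun_eq_iff indicator_def)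
    thus ?thesis using T(1) by simp
  qed
  from calc_adjoint[OF T(1) this, of g x] have "cinner g x = cinner (T g) x" by (simp add: Tx)
  hence "T g ~= 0" using gx by auto
  hence "measure (smeas g) {e} ~= 0" unfolding T(4)[of g, symmetric] by simp
  thus ?thesis by (auto simp: measure_def)
qed

text \<open>The first form is the Poisson integral of the spectral measure; the second allows the
  resolvent formula to be estimated in norm.\<close>

lemma Im_resolvent:
  assumes e: "e > 0"
  shows "Im (cinner v (R (Complex x e) v)) = (LINT t|smeas v. e/((t - x)\<^sup>2 + e\<^sup>2))"
    "Im (cinner v (R (Complex x e) v)) = e*(norm (R (Complex x e) v))\<^sup>2"
proof -
  have z: "Im (Complex x e) ~= 0" using e by simp
  note c = calc_resolvent[OF z]
  have "Im (cinner v (R (Complex x e) v)) = Im (LINT t|smeas v. 1/(cr t - Complex x e))"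
    by (simp only: calc_cinner[OF c])
  also have "... = (LINT t|smeas v. Im (1/(cr t - Complex x e)))"
    by (rule integral_Im[symmetric, OF calc_integrable(1)[OF c]])
  also have "(%t. Im (1/(cr t - Complex x e))) = (%t. e/((t - x)\<^sup>2 + e\<^sup>2))"
    by (simp add: Im_divide)
  finally show 1: "Im (cinner v (R (Complex x e) v)) = (LINT t|smeas v. e/((t - x)\<^sup>2 + e\<^sup>2))" .
  have "(norm (R (Complex x e) v))\<^sup>2 = (LINT t|smeas v. (cmod (1/(cr t - Complex x e)))\<^sup>2)"
    by (rule calc_norm[OF c])
  also have "(%t. (cmod (1/(cr t - Complex x e)))\<^sup>2) = (%t. 1/((t - x)\<^sup>2 + e\<^sup>2))"
    by (simp add: norm_divide power_divide cmod_power2)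
  finally show "Im (cinner v (R (Complex x e) v)) = e*(norm (R (Complex x e) v))\<^sup>2"
    unfolding 1 by (simp only: integral_mult_right_zero[symmetric]) simp
qed

end

section \<open>Absolutely continuous parts and Poisson integrals\<close>

text \<open>Exhaustion: the union of a maximising sequence of Lebesgue null sets attains the
  supremum of their measures, so no null set outside of it carries mass. It will carry the singular
  part.\<close>

lemma maximal_null_set:
  fixes \<mu> :: "real measure"
  assumes sets [simp, measurable_cong]: "sets \<mu> = sets borel" and fin: "finite_measure \<mu>"
  obtains N where "N \<in> sets borel" "emeasure lborel N = 0"
    "!!S. S \<in> sets borel ==> emeasure lborel S = 0 ==> emeasure \<mu> (S - N) = 0"
proof -
  interpret finite_measure \<mu> by fact
  let ?Z = "{S \<in> sets borel. emeasure lborel S = 0}"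
  define s where "s = (SUP S\<in>?Z. measure \<mu> S)"
  have Z0: "{} \<in> ?Z" by simp
  have bdd: "bdd_above (measure \<mu> ` ?Z)"
    by (rule bdd_aboveI2[of _ _ "measure \<mu> (space \<mu>)"]) (simp add: bounded_measure)
  have "EX S:?Z. s - inverse (real (Suc n)) < measure \<mu> S" for n
  proof -
    have "s - inverse (real (Suc n)) < (SUP S\<in>?Z. measure \<mu> S)" by (simp add: s_def)
    thus ?thesis using Z0 bdd by (subst (asm) less_cSUP_iff) auto
  qed
  then obtain S where S: "!!n. S n \<in> ?Z" "!!n. s - inverse (real (Suc n)) < measure \<mu> (S n)" by metis
  define N where "N = (\<Union>n. S n)"
  have SN: "S n \<subseteq> N" for n by (auto simp: N_def)
  have Nb: "N \<in> sets borel" using S(1) by (auto simp: N_def)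
  have "(\<Union>n. S n) \<in> null_sets lborel" using S(1) by (intro null_sets_UN) (auto simp: null_sets_def)
  hence N0: "emeasure lborel N = 0" by (simp add: N_def null_sets_def)
  have NZ: "N \<in> ?Z" using Nb N0 by simp
  have "s <= measure \<mu> N"
  proof (rule field_le_epsilon)
    fix e :: real assume "e > 0"
    then obtain n where "inverse (real (Suc n)) < e" using reals_Archimedean by blast
    moreover have "measure \<mu> (S n) <= measure \<mu> N" using SN Nb by (intro finite_measure_mono) auto
    ultimately show "s <= measure \<mu> N + e" using S(2)[of n] by linarith
  qed
  show ?thesis
  proof (rule that[OF Nb N0])
    fix T :: "real set" assume T: "T \<in> sets borel" "emeasure lborel T = 0"
    have "T \<union> N \<in> null_sets lborel" using T Nb N0 by (intro null_sets.Un) (auto simp: null_sets_def)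
    hence "T \<union> N \<in> ?Z" by (simp add: null_sets_def)
    hence "measure \<mu> (T \<union> N) <= s" unfolding s_def by (rule cSUP_upper[OF _ bdd])
    moreover have "measure \<mu> (T \<union> N) = measure \<mu> (T - N) + measure \<mu> N"
    proof -
      have "(T - N) \<inter> N = {}" by blast
      from finite_measure_Union[OF _ _ this] show ?thesis using T Nb by (simp add: Un_Diff_cancel2)
    qed
    ultimately have "measure \<mu> (T - N) <= 0" using \<open>s <= measure \<mu> N\<close> by linarith
    thus "emeasure \<mu> (T - N) = 0" by (simp add: emeasure_eq_measure measure_le_0_iff)
  qed
qed

definition lebesgue_decomposition :: "real measure => real measure => real measure => bool" where
  "lebesgue_decomposition \<mu> \<nu> \<sigma> \<longleftrightarrow> sets \<nu> = sets borel & absolutely_continuous lborel \<nu> &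
     sets \<sigma> = sets borel & mutually_singular lborel \<sigma> &
     (ALL S:sets borel. emeasure \<mu> S = emeasure \<nu> S + emeasure \<sigma> S)"

text \<open>\<open>ac_part\<close> is a definite description. If N is the union of the two null sets
  carrying the singular parts, both absolutely continuous parts must be A |-> \<open>\<mu>\<close>(A
  - N).\<close>

lemma lebesgue_decomposition_unique:
  assumes 1: "lebesgue_decomposition \<mu> \<nu> \<sigma>" and 2: "lebesgue_decomposition \<mu> \<nu>' \<sigma>'"
  shows "\<nu> = \<nu>'"
proof -
  obtain S where S: "S \<in> sets borel" "emeasure lborel S = 0" "emeasure \<sigma> (- S) = 0"
    using 1 by (auto simp: lebesgue_decomposition_def mutually_singular_def Compl_eq_Diff_UNIV)
  obtain S' where S': "S' \<in> sets borel" "emeasure lborel S' = 0" "emeasure \<sigma>' (- S') = 0"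
    using 2 by (auto simp: lebesgue_decomposition_def mutually_singular_def Compl_eq_Diff_UNIV)
  define N where "N = S \<union> S'"
  have N: "N \<in> sets borel" "N \<in> null_sets lborel"
    using S S' by (auto simp: N_def null_sets_def intro!: emeasure_Un_null_set)
       (metis S(1) S(2) S'(1) S'(2) emeasure_Un_null_set null_setsI sets_lborel)
  have *: "emeasure \<tau> A = emeasure \<mu> (A - N)"
    if d: "lebesgue_decomposition \<mu> \<tau> \<rho>" and T: "T \<in> sets borel" "emeasure \<rho> (- T) = 0" "T \<subseteq> N" and A: "A \<in> sets borel" for \<tau> \<rho> T A
  proof -
    have s: "sets \<tau> = sets borel" "sets \<rho> = sets borel" using d by (auto simp: lebesgue_decomposition_def)
    have "N \<in> null_sets \<tau>" using d N by (auto simp: lebesgue_decomposition_def absolutely_continuous_def)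
    hence "emeasure \<tau> A = emeasure \<tau> (A - N)" using A s by (simp add: emeasure_Diff_null_set)
    moreover have "emeasure \<rho> (A - N) <= emeasure \<rho> (- T)" using T s by (intro emeasure_mono) auto
    moreover have "emeasure \<mu> (A - N) = emeasure \<tau> (A - N) + emeasure \<rho> (A - N)"
      using d A N(1) unfolding lebesgue_decomposition_def by blast
    ultimately show ?thesis using T(2) by simp
  qed
  have "emeasure \<nu> A = emeasure \<nu>' A" if "A \<in> sets borel" for A
    using *[OF 1 S(1,3) _ that] *[OF 2 S'(1,3) _ that] by (auto simp: N_def)
  thus ?thesis using 1 2 by (intro measure_eqI) (auto simp: lebesgue_decomposition_def)
qed

lemma emeasure_density_indicator:
  assumes [measurable_cong]: "sets \<mu> = sets borel" and [measurable]: "A \<in> sets borel" "B \<in> sets borel"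
  shows "emeasure (density \<mu> (indicator B)) A = emeasure \<mu> (A \<inter> B)"
proof -
  have "emeasure (density \<mu> (indicator B)) A = (\<integral>\<^sup>+x. indicator B x*indicator A x \<partial>\<mu>)"
    by (rule emeasure_density) auto
  thus ?thesis by (simp add: indicator_inter_arith[symmetric] Int_commute)
qed

lemma lebesgue_decomposition_exists:
  assumes sets [simp, measurable_cong]: "sets \<mu> = sets borel" and fin: "finite_measure \<mu>"
  shows "EX \<nu> \<sigma>. lebesgue_decomposition \<mu> \<nu> \<sigma>"
proof -
  obtain N where N [measurable]: "N \<in> sets borel" and N0: "emeasure lborel N = 0"
    and max: "!!S. S \<in> sets borel ==> emeasure lborel S = 0 ==> emeasure \<mu> (S - N) = 0"
    using maximal_null_set[OF assms] by blast
  note d = emeasure_density_indicator[OF sets]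
  have "lebesgue_decomposition \<mu> (density \<mu> (indicator (- N))) (density \<mu> (indicator N))"
    unfolding lebesgue_decomposition_def
  proof (intro conjI ballI)
    show "absolutely_continuous lborel (density \<mu> (indicator (- N)))" unfolding absolutely_continuous_def
      using max by (auto simp: null_sets_def d Diff_eq[symmetric])
    show "mutually_singular lborel (density \<mu> (indicator N))"
      unfolding mutually_singular_def using N N0 by (intro exI[of _ N]) (auto simp: d Diff_eq)
    fix S :: "real set" assume S: "S \<in> sets borel"
    have "emeasure \<mu> S = emeasure \<mu> ((S \<inter> - N) \<union> (S \<inter> N))" by (rule arg_cong[where f = "emeasure \<mu>"]) auto
    also have "... = emeasure \<mu> (S \<inter> - N) + emeasure \<mu> (S \<inter> N)"
      using S N by (intro plus_emeasure[symmetric]) (auto simp: Diff_eq[symmetric])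
    finally show "emeasure \<mu> S = emeasure (density \<mu> (indicator (- N))) S + emeasure (density \<mu> (indicator N)) S"
      using S N by (simp add: d)
  qed simp_all
  thus ?thesis by blast
qed

lemma ac_part_null_iff:
  assumes sets [simp, measurable_cong]: "sets \<mu> = sets borel" and fin: "finite_measure \<mu>"
  shows "ac_part \<mu> = null_measure borel \<longleftrightarrow> (EX N:sets borel. emeasure lborel N = 0 & emeasure \<mu> (- N) = 0)"
proof -
  have ac: "ac_part \<mu> = (THE \<nu>. EX \<sigma>. lebesgue_decomposition \<mu> \<nu> \<sigma>)"
    unfolding ac_part_def lebesgue_decomposition_def by (rule arg_cong[where f = The]) (auto simp: fun_eq_iff)
  have *: "ac_part \<mu> = \<nu>" if "lebesgue_decomposition \<mu> \<nu> \<sigma>" for \<nu> \<sigma>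
    unfolding ac using that lebesgue_decomposition_unique by (intro the_equality) blast+
  show ?thesis
  proof
    assume null: "ac_part \<mu> = null_measure borel"
    obtain \<nu> \<sigma> where d: "lebesgue_decomposition \<mu> \<nu> \<sigma>" using lebesgue_decomposition_exists[OF assms] by blast
    hence "\<nu> = null_measure borel" using*null by simp
    hence "ALL S:sets borel. emeasure \<mu> S = emeasure \<sigma> S" using d by (simp add: lebesgue_decomposition_def)
    moreover obtain S where "S \<in> sets borel" "emeasure lborel S = 0" "emeasure \<sigma> (- S) = 0"
      using d by (auto simp: lebesgue_decomposition_def mutually_singular_def Compl_eq_Diff_UNIV)
    moreover have "- S \<in> sets borel" if "S \<in> sets borel" for S :: "real set" using that by (rule borel_comp)
    ultimately show "EX N:sets borel. emeasure lborel N = 0 & emeasure \<mu> (- N) = 0" by metis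
  next
    assume "EX N:sets borel. emeasure lborel N = 0 & emeasure \<mu> (- N) = 0"
    then obtain N where N: "N \<in> sets borel" "emeasure lborel N = 0" "emeasure \<mu> (- N) = 0" by blast
    have "lebesgue_decomposition \<mu> (null_measure borel) \<mu>"
      unfolding lebesgue_decomposition_def mutually_singular_def absolutely_continuous_def
      using N by (auto simp: Compl_eq_Diff_UNIV null_sets_def intro!: bexI[of _ N])
    thus "ac_part \<mu> = null_measure borel" by (rule *)
  qed
qed

text \<open>Without the usual factor 1/pi this is exactly the imaginary part of 1/(t - x - i e); the
  total mass is therefore pi.\<close>

definition poisson_kernel :: "real => real => real => real" where
  "poisson_kernel e t x = e/((t - x)\<^sup>2 + e\<^sup>2)"

lemma poisson_kernel_measurable [measurable]:
  "(%p. poisson_kernel e (fst p) (snd p)) \<in> borel_measurable (borel \<Otimes>\<^sub>M borel)"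
  "(%t. poisson_kernel e t x) \<in> borel_measurable borel" "(%x. poisson_kernel e t x) \<in> borel_measurable borel"
  unfolding poisson_kernel_def by measurable

lemma poisson_kernel_nonneg: "e > 0 ==> 0 <= poisson_kernel e t x" by (simp add: poisson_kernel_def)

lemma poisson_kernel_sym: "poisson_kernel e t x = poisson_kernel e x t"
  by (simp add: poisson_kernel_def power2_commute)

lemma poisson_kernel_integral:
  assumes e: "e > 0" and ab: "a <= b"
  shows "(\<integral>\<^sup>+x\<in>{a..b}. ennreal (poisson_kernel e t x) \<partial>lborel) = arctan ((b - t)/e) - arctan ((a - t)/e)"
proof (rule nn_integral_FTC_Icc)
  fix x
  have pos: "(t - x)\<^sup>2 + e\<^sup>2 > 0" using e by (simp add: add_nonneg_pos)
  have "((%x. arctan ((x - t)/e)) has_real_derivative inverse (1 + ((x - t)/e)\<^sup>2)*(1/e)) (at x)"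
    using e by (auto intro!: derivative_eq_intros)
  also have "inverse (1 + ((x - t)/e)\<^sup>2)*(1/e) = poisson_kernel e t x"
  proof -
    have "1 + ((x - t)/e)\<^sup>2 = ((t - x)\<^sup>2 + e\<^sup>2)/e\<^sup>2"
      using e by (simp add: power_divide add_divide_distrib power2_commute)
    thus ?thesis using e by (simp add: poisson_kernel_def power2_eq_square)
  qed
  finally show "((%x. arctan ((x - t)/e)) has_real_derivative poisson_kernel e t x) (at x)" .
qed (use assms in \<open>auto intro: poisson_kernel_nonneg\<close>)

lemma poisson_kernel_integral_le:
  assumes e: "e > 0"
  shows "(\<integral>\<^sup>+x\<in>{a..b}. ennreal (poisson_kernel e t x) \<partial>lborel) <= ennreal pi"
proof (cases "a <= b")
  case True
  have "arctan ((b - t)/e) - arctan ((a - t)/e) <= pi"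
    using arctan_ubound[of "(b - t)/e"] arctan_lbound[of "(a - t)/e"] by linarith
  thus ?thesis unfolding poisson_kernel_integral[OF e True] by (intro ennreal_leI)
qed simp

lemma poisson_kernel_integral_tendsto:
  assumes t: "a < t" "t < b"
  shows "(%n. \<integral>\<^sup>+x\<in>{a..b}. ennreal (poisson_kernel (inverse (real (Suc n))) t x) \<partial>lborel) ----> ennreal pi"
proof -
  have inf: "filterlim (%n. c/inverse (real (Suc n))) at_top sequentially" if "c > 0" for c
  proof -
    have "filterlim (%n. c*real (Suc n)) at_top sequentially"
      by (rule filterlim_tendsto_pos_mult_at_top[OF tendsto_const that])
         (rule filterlim_compose[OF filterlim_real_sequentially filterlim_Suc])
    thus ?thesis by (simp add: divide_inverse)
  qed
  have neg: "(%n. arctan ((a - t)/inverse (real (Suc n)))) ----> - (pi/2)"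
  proof -
    have "(%n. - arctan ((t - a)/inverse (real (Suc n)))) ----> - (pi/2)"
      using t by (intro tendsto_minus filterlim_compose[OF tendsto_arctan_at_top inf]) simp
    moreover have "- arctan ((t - a)/inverse (real (Suc n))) = arctan ((a - t)/inverse (real (Suc n)))" for n
      by (simp add: arctan_minus[symmetric] minus_divide_left del: arctan_minus of_nat_Suc)
    ultimately show ?thesis by simp
  qed
  have "(%n. arctan ((b - t)/inverse (real (Suc n))) - arctan ((a - t)/inverse (real (Suc n)))) ----> pi/2 - (- (pi/2))"
    using t by (intro tendsto_diff neg filterlim_compose[OF tendsto_arctan_at_top inf]) simp
  hence "(%n. ennreal (arctan ((b - t)/inverse (real (Suc n))) - arctan ((a - t)/inverse (real (Suc n))))) ----> ennreal pi"
    by (intro tendsto_ennrealI) simp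
  thus ?thesis using t by (subst poisson_kernel_integral) (auto simp del: of_nat_Suc)
qed

definition poisson :: "real measure => real => real => ennreal" where
  "poisson \<mu> e x = (\<integral>\<^sup>+t. ennreal (poisson_kernel e t x) \<partial>\<mu>)"

text \<open>Convergence to 0 in Lebesgue measure on [a, b]; the truncation at 1 turns it into
  convergence of integrals.\<close>

definition vanishes_on :: "real => real => (nat => real => ennreal) => bool" where
  "vanishes_on a b u \<longleftrightarrow> (%n. \<integral>\<^sup>+x\<in>{a..b}. min 1 (u n x) \<partial>lborel) ----> 0"

lemma ennreal_tendsto_0I:
  assumes "!!d :: real. d > 0 ==> \<forall>\<^sub>F n in F. f n <= ennreal (C*d)" "C > 0"
  shows "(f \<longlongrightarrow> (0 :: ennreal)) F"
proof (rule order_tendstoI)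
  fix y :: ennreal assume y: "0 < y"
  define d where "d = (if y = top then 1 else enn2real y/2)"
  have d: "d > 0" "ennreal d < y" using y by (cases y; force simp: d_def ennreal_less_iff)+
  have "\<forall>\<^sub>F n in F. f n <= ennreal (C*(d/C))" using d assms(2) by (intro assms(1)) simp
  thus "\<forall>\<^sub>F n in F. f n < y" using d assms(2) by (auto elim!: eventually_mono)
qed simp

lemma poisson_measurable:
  assumes "sets \<mu> = sets borel" "finite_measure \<mu>"
  shows "poisson \<mu> e \<in> borel_measurable borel"
proof -
  interpret finite_measure \<mu> by fact
  have [measurable_cong]: "sets \<mu> = sets borel" by fact
  show ?thesis unfolding poisson_def poisson_kernel_def by measurable
qed

lemma poisson_swap:
  fixes g :: "real => ennreal"
  assumes sets [measurable_cong]: "sets \<mu> = sets borel" and fin: "sigma_finite_measure \<mu>" and g [measurable]: "g \<in> borel_measurable borel"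
  shows "(\<integral>\<^sup>+x. (\<integral>\<^sup>+t. ennreal (poisson_kernel e t x)*g t \<partial>\<mu>)*indicator {a..b} x \<partial>lborel) =
     (\<integral>\<^sup>+t. (\<integral>\<^sup>+x\<in>{a..b}. ennreal (poisson_kernel e t x) \<partial>lborel)*g t \<partial>\<mu>)"
proof -
  interpret sigma_finite_measure \<mu> by fact
  interpret pair_sigma_finite lborel \<mu> by unfold_locales
  have "(\<integral>\<^sup>+x. (\<integral>\<^sup>+t. ennreal (poisson_kernel e t x)*g t \<partial>\<mu>)*indicator {a..b} x \<partial>lborel)
     = (\<integral>\<^sup>+x. \<integral>\<^sup>+t. ennreal (poisson_kernel e t x)*g t*indicator {a..b} x \<partial>\<mu> \<partial>lborel)"
    by (intro nn_integral_cong nn_integral_multc[symmetric]) measurable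
  also have "... = (\<integral>\<^sup>+t. (\<integral>\<^sup>+x\<in>{a..b}. ennreal (poisson_kernel e t x)*g t \<partial>lborel) \<partial>\<mu>)"
    by (rule Fubini'[symmetric]) (unfold poisson_kernel_def, measurable)
  also have "... = (\<integral>\<^sup>+t. \<integral>\<^sup>+x. ennreal (poisson_kernel e t x)*indicator {a..b} x*g t \<partial>lborel \<partial>\<mu>)"
    by (intro nn_integral_cong) (simp add: mult_ac)
  also have "... = (\<integral>\<^sup>+t. (\<integral>\<^sup>+x\<in>{a..b}. ennreal (poisson_kernel e t x) \<partial>lborel)*g t \<partial>\<mu>)"
    by (intro nn_integral_cong nn_integral_multc) measurable
  finally show ?thesis .
qed

text \<open>Up to a set of small \<open>\<mu>\<close>-measure, \<open>\<mu>\<close> lives on a compact null set \<open>K\<close> and outside of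
  \<open>(a, b)\<close>, and the Poisson integral of that part tends to zero pointwise on \<open>(a, b) - K\<close>.\<close>

lemma poisson_vanishes:
  assumes sets [simp, measurable_cong]: "sets \<mu> = sets borel" and fin: "finite_measure \<mu>"
    and N [measurable]: "N \<in> sets borel" and N0: "emeasure lborel N = 0" and conc: "emeasure \<mu> ({a..b} - N) = 0"
  shows "vanishes_on a b (%n. poisson \<mu> (inverse (real (Suc n))))" unfolding vanishes_on_def
proof (rule ennreal_tendsto_0I[where C = "pi + 1"])
  interpret finite_measure \<mu> by fact
  have sp: "space \<mu> = UNIV" using sets_eq_imp_space_eq[OF sets] by simp
  fix d :: real assume d: "d > 0"
  let ?B = "N \<inter> {a..b}"
  have "EX K. K \<subseteq> ?B & compact K & measure \<mu> ?B - d < measure \<mu> K"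
  proof -
    have "emeasure \<mu> ?B = (SUP K\<in>{K. K \<subseteq> ?B & compact K}. emeasure \<mu> K)"
      by (rule inner_regular) (simp_all add: emeasure_eq_measure)
    moreover have "ennreal (measure \<mu> ?B - d) < emeasure \<mu> ?B \<or> measure \<mu> ?B - d < 0"
      using d by (auto simp: emeasure_eq_measure ennreal_less_iff not_less)
    ultimately consider "ennreal (measure \<mu> ?B - d) < (SUP K\<in>{K. K \<subseteq> ?B & compact K}. emeasure \<mu> K)" | "measure \<mu> ?B - d < 0" by auto
    thus ?thesis
    proof cases
      case 1
      then obtain K where K: "K \<subseteq> ?B" "compact K" "ennreal (measure \<mu> ?B - d) < emeasure \<mu> K"
        by (auto simp: less_SUP_iff)
      hence "measure \<mu> ?B - d < measure \<mu> K"
        unfolding emeasure_eq_measure by (metis ennreal_leI not_less)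
      thus ?thesis using K by blast
    qed (auto intro!: exI[of _ "{}"])
  qed
  then obtain K where K: "K \<subseteq> ?B" "compact K" "measure \<mu> ?B - d < measure \<mu> K" by blast
  have Kb [measurable]: "K \<in> sets borel" using K(2) by (simp add: borel_compact)
  \<comment> \<open>An open set of small measure. Up to a Lebesgue null set it fills [a, b], so
    pointwise limits are wanted only there.\<close>
  define Q where "Q = {a<..<b} - K"
  have Q: "open Q" unfolding Q_def by (intro open_Diff compact_imp_closed K) simp
  hence Qb [measurable]: "Q \<in> sets borel" by simp
  have "measure \<mu> Q <= measure \<mu> (({a..b} - N) \<union> (?B - K))"
    by (intro finite_measure_mono) (auto simp: Q_def)
  also have "... <= measure \<mu> ({a..b} - N) + measure \<mu> (?B - K)" by (intro measure_Un_le) auto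
  also have "measure \<mu> ({a..b} - N) = 0" using conc by (simp add: measure_def)
  also have "measure \<mu> (?B - K) = measure \<mu> ?B - measure \<mu> K"
    using K(1) by (intro finite_measure_Diff) auto
  finally have \<mu>Q: "measure \<mu> Q <= d" using K(3) by simp
  have "AE x in lborel. x \<notin> K \<union> {a, b}"
  proof (rule AE_not_in)
    have "K \<subseteq> N" using K by blast
    hence "emeasure lborel K <= emeasure lborel N" by (rule emeasure_mono) simp
    hence "K \<in> null_sets lborel" using N0 by (auto simp: null_sets_def)
    moreover have "{a, b} \<in> null_sets lborel" by (simp add: finite_imp_null_set_lborel)
    ultimately show "K \<union> {a, b} \<in> null_sets lborel" by (rule null_sets.Un)
  qed
  hence AEQ: "AE x in lborel. x \<in> {a..b} --> x \<in> Q" by eventually_elim (auto simp: Q_def)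
  define e where "e n = inverse (real (Suc n))" for n
  have e: "e n > 0" for n by (simp add: e_def)
  have elim0: "e ----> 0" unfolding e_def by (rule LIMSEQ_inverse_real_of_nat)
  \<comment> \<open>\<open>A\<close> comes from the mass at most d on \<open>Q\<close> and has
    integral at most pi d; \<open>B\<close> comes from the mass off \<open>Q\<close>, which keeps a
    positive distance from each x in \<open>Q\<close>, and eventually contributes less than d. This
    is the origin of the constant pi + 1.\<close>
  define A where "A n x = (\<integral>\<^sup>+t. ennreal (poisson_kernel (e n) t x)*indicator Q t \<partial>\<mu>)" for n x
  define B where "B n x = (\<integral>\<^sup>+t. ennreal (poisson_kernel (e n) t x)*indicator (- Q) t \<partial>\<mu>)" for n x
  have Qc [measurable]: "- Q \<in> sets borel" using Qb by (rule borel_comp)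
  have meas [measurable]: "A n \<in> borel_measurable borel" "B n \<in> borel_measurable borel" for n
    unfolding A_def B_def poisson_kernel_def by measurable
  have split: "poisson \<mu> (e n) x = A n x + B n x" for n x
  proof -
    have "poisson \<mu> (e n) x = (\<integral>\<^sup>+t. ennreal (poisson_kernel (e n) t x)*indicator Q t + ennreal (poisson_kernel (e n) t x)*indicator (- Q) t \<partial>\<mu>)"
      unfolding poisson_def by (intro nn_integral_cong) (auto split: split_indicator)
    also have "... = A n x + B n x" unfolding A_def B_def by (intro nn_integral_add) measurable
    finally show ?thesis .
  qed
  have IA: "(\<integral>\<^sup>+x\<in>{a..b}. A n x \<partial>lborel) <= ennreal (pi*d)" for n
  proof -
    have "(\<integral>\<^sup>+x\<in>{a..b}. A n x \<partial>lborel) =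
     (\<integral>\<^sup>+t. (\<integral>\<^sup>+x\<in>{a..b}. ennreal (poisson_kernel (e n) t x) \<partial>lborel)*indicator Q t \<partial>\<mu>)"
      unfolding A_def by (intro poisson_swap sets sigma_finite_measure_axioms) measurable
    also have "... <= (\<integral>\<^sup>+t. ennreal pi*indicator Q t \<partial>\<mu>)"
      by (intro nn_integral_mono mult_right_mono poisson_kernel_integral_le e) simp
    also have "... = ennreal (pi*measure \<mu> Q)"
      by (simp add: nn_integral_cmult_indicator emeasure_eq_measure ennreal_mult)
    also have "... <= ennreal (pi*d)" using \<mu>Q by (intro ennreal_leI mult_left_mono) auto
    finally show ?thesis .
  qed
  have Bpt: "(%n. B n x) ----> 0" if x: "x \<in> Q" for x
  proof -
    obtain r where r: "r > 0" "ball x r \<subseteq> Q" using Q x open_contains_ball by blast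
    have le: "B n x <= ennreal (e n/r\<^sup>2*measure \<mu> UNIV)" for n
    proof -
      have "B n x <= (\<integral>\<^sup>+t. ennreal (e n/r\<^sup>2) \<partial>\<mu>)" unfolding B_def
      proof (intro nn_integral_mono)
        fix t
        show "ennreal (poisson_kernel (e n) t x)*indicator (- Q) t <= ennreal (e n/r\<^sup>2)"
        proof (cases "t \<in> Q")
          case False
          moreover have "\<bar>t - x\<bar> < r ==> t \<in> Q" using r(2) by (auto simp: subset_iff dist_real_def abs_minus_commute)
          ultimately have "r <= \<bar>t - x\<bar>" by (meson not_less)
          hence "r\<^sup>2 <= (t - x)\<^sup>2" using r(1) by (metis abs_of_pos abs_le_square_iff)
          hence "poisson_kernel (e n) t x <= e n/r\<^sup>2"
            unfolding poisson_kernel_def using e[of n] r(1) by (intro divide_left_mono mult_pos_pos add_nonneg_pos) (auto intro: add_increasing2)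
          thus ?thesis using False by (simp add: ennreal_leI)
        qed simp
      qed
      also have "... = ennreal (e n/r\<^sup>2*measure \<mu> UNIV)"
        using e[of n] r by (simp add: sp emeasure_eq_measure ennreal_mult[symmetric])
      finally show ?thesis .
    qed
    have "(%n. ennreal (e n/r\<^sup>2*measure \<mu> UNIV)) ----> ennreal (0/r\<^sup>2*measure \<mu> UNIV)"
      using r by (intro tendsto_intros tendsto_ennrealI elim0) auto
    hence lim: "(%n. ennreal (e n/r\<^sup>2*measure \<mu> UNIV)) ----> 0" by simp
    show ?thesis
      by (rule tendsto_sandwich[OF _ _ tendsto_const lim]) (intro always_eventually allI le zero_le)+
  qed
  have "(%n. \<integral>\<^sup>+x\<in>{a..b}. min 1 (B n x) \<partial>lborel) ----> (\<integral>\<^sup>+x. 0 \<partial>(lborel :: real measure))"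
  proof (rule nn_integral_dominated_convergence[where w = "indicator {a..b}"])
    show "AE x in lborel. (%n. min 1 (B n x)*indicator {a..b} x) ----> 0" using AEQ
    proof eventually_elim
      case (elim x)
      show ?case
      proof (cases "x \<in> {a..b}")
        case True
        hence "(%n. min 1 (B n x)) ----> min 1 0" using elim by (intro tendsto_min tendsto_const Bpt) auto
        thus ?thesis using True by simp
      qed simp
    qed
    show "(\<integral>\<^sup>+x. indicator {a..b} x \<partial>(lborel :: real measure)) < \<infinity>"
      by (cases "a <= b") (auto simp: emeasure_lborel_Icc_eq)
  qed (auto split: split_indicator)
  hence "(%n. \<integral>\<^sup>+x\<in>{a..b}. min 1 (B n x) \<partial>lborel) ----> 0" by simp
  hence "\<forall>\<^sub>F n in sequentially. (\<integral>\<^sup>+x\<in>{a..b}. min 1 (B n x) \<partial>lborel) < ennreal d"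
    using d by (intro order_tendstoD(2)[of _ 0]) auto
  thus "\<forall>\<^sub>F n in sequentially. (\<integral>\<^sup>+x\<in>{a..b}. min 1 (poisson \<mu> (inverse (real (Suc n))) x) \<partial>lborel) <= ennreal ((pi + 1)*d)"
  proof eventually_elim
    case (elim n)
    have "(\<integral>\<^sup>+x\<in>{a..b}. min 1 (poisson \<mu> (e n) x) \<partial>lborel) <=
        (\<integral>\<^sup>+x. A n x*indicator {a..b} x + min 1 (B n x)*indicator {a..b} x \<partial>lborel)"
    proof (intro nn_integral_mono)
      fix x
      have "min 1 (A n x + B n x) <= A n x + min 1 (B n x)"
        by (cases "B n x <= 1") (auto simp: min_def intro: order_trans add_increasing)
      thus "min 1 (poisson \<mu> (e n) x)*indicator {a..b} x <= A n x*indicator {a..b} x + min 1 (B n x)*indicator {a..b} x"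
        unfolding split by (auto split: split_indicator)
    qed
    also have "... = (\<integral>\<^sup>+x\<in>{a..b}. A n x \<partial>lborel) + (\<integral>\<^sup>+x\<in>{a..b}. min 1 (B n x) \<partial>lborel)"
      by (intro nn_integral_add) measurable
    also have "... <= ennreal (pi*d) + ennreal d" using elim by (intro add_mono IA) simp
    also have "... = ennreal ((pi + 1)*d)" using d by (simp add: ennreal_plus[symmetric] algebra_simps del: ennreal_plus)
    finally show ?case by (simp add: e_def)
  qed
qed (use pi_gt_zero in linarith)

text \<open>After removal of the maximal null set the measure on [a, b] has a density
  \<open>f\<close>. The Poisson integral of its truncation \<open>g\<close> tends to 0 in mean on
  [a, b], while by Fubini the same integral is that of \<open>g\<close> against weights tending to
  pi inside the interval; Fatou's lemma gives g = 0.\<close>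

lemma poisson_vanishes_imp_singular:
  assumes sets [simp, measurable_cong]: "sets \<mu> = sets borel" and fin: "finite_measure \<mu>"
    and van: "vanishes_on a b (%n. poisson \<mu> (inverse (real (Suc n))))"
  shows "EX N:sets borel. emeasure lborel N = 0 & emeasure \<mu> ({a..b} - N) = 0"
proof -
  interpret finite_measure \<mu> by fact
  obtain N where N [measurable]: "N \<in> sets borel" and N0: "emeasure lborel N = 0"
    and max: "!!S. S \<in> sets borel ==> emeasure lborel S = 0 ==> emeasure \<mu> (S - N) = 0"
    using maximal_null_set[OF sets fin] by blast
  define \<nu> where "\<nu> = density \<mu> (indicator ({a..b} - N))"
  have s\<nu> [simp, measurable_cong]: "sets \<nu> = sets borel" by (simp add: \<nu>_def)
  have e\<nu>: "emeasure \<nu> A = emeasure \<mu> (A \<inter> ({a..b} - N))" if "A \<in> sets borel" for A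
    unfolding \<nu>_def using that N by (intro emeasure_density_indicator) auto
  have ac: "absolutely_continuous lborel \<nu>" unfolding absolutely_continuous_def
  proof
    fix S :: "real set" assume "S \<in> null_sets lborel"
    hence S: "S \<in> sets borel" "emeasure lborel S = 0" by (auto simp: null_sets_def)
    have "emeasure \<mu> (S \<inter> ({a..b} - N)) <= emeasure \<mu> (S - N)" using S by (intro emeasure_mono) auto
    thus "S \<in> null_sets \<nu>" using S max[OF S] by (simp add: null_sets_def e\<nu>)
  qed
  obtain f where f [measurable]: "f \<in> borel_measurable lborel" and f\<nu>: "density lborel f = \<nu>"
    using sigma_finite_measure.Radon_Nikodym[OF sigma_finite_lborel ac] by auto
  \<comment> \<open>The truncation at 1 bounds the Poisson integral of \<open>g\<close> by pi as
    well as by that of \<open>\<mu>\<close>, hence by pi times the truncated Poisson integral of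
    \<open>\<mu>\<close>.\<close>
  define g where "g t = min (f t) 1*indicator {a..b} t" for t
  have [measurable]: "g \<in> borel_measurable borel" unfolding g_def using f by simp
  have pg: "(\<integral>\<^sup>+t. ennreal (poisson_kernel e t x)*g t \<partial>lborel) <= poisson \<mu> e x" for e x
  proof -
    have "(\<integral>\<^sup>+t. ennreal (poisson_kernel e t x)*g t \<partial>lborel) <= (\<integral>\<^sup>+t. f t*ennreal (poisson_kernel e t x) \<partial>lborel)"
      by (intro nn_integral_mono) (auto simp: g_def mult.commute[of "f _"] mult.assoc intro!: mult_left_mono split: split_indicator)
    also have "... = (\<integral>\<^sup>+t. ennreal (poisson_kernel e t x) \<partial>\<nu>)"
      unfolding f\<nu>[symmetric] by (rule nn_integral_density[symmetric]) auto
    also have "... = (\<integral>\<^sup>+t. indicator ({a..b} - N) t*ennreal (poisson_kernel e t x) \<partial>\<mu>)"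
      unfolding \<nu>_def by (rule nn_integral_density) auto
    also have "... <= poisson \<mu> e x"
      unfolding poisson_def by (intro nn_integral_mono) (auto split: split_indicator)
    finally show ?thesis .
  qed
  have pg1: "(\<integral>\<^sup>+t. ennreal (poisson_kernel e t x)*g t \<partial>lborel) <= ennreal pi" if "e > 0" for e x
  proof -
    have "(\<integral>\<^sup>+t. ennreal (poisson_kernel e t x)*g t \<partial>lborel) <= (\<integral>\<^sup>+t\<in>{a..b}. ennreal (poisson_kernel e x t) \<partial>lborel)"
      by (intro nn_integral_mono) (auto simp: g_def poisson_kernel_sym[of e] intro!: mult_left_le split: split_indicator)
    also have "... <= ennreal pi" by (rule poisson_kernel_integral_le[OF that])
    finally show ?thesis .
  qed
  define e where "e n = inverse (real (Suc n))" for n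
  have e: "e n > 0" for n by (simp add: e_def)
  define I where "I n t = (\<integral>\<^sup>+x\<in>{a..b}. ennreal (poisson_kernel (e n) t x) \<partial>lborel)" for n t
  have [measurable]: "I n \<in> borel_measurable borel" for n unfolding I_def poisson_kernel_def by measurable
  have up: "(\<integral>\<^sup>+t. I n t*g t \<partial>lborel) <= ennreal pi*(\<integral>\<^sup>+x\<in>{a..b}. min 1 (poisson \<mu> (e n) x) \<partial>lborel)" for n
  proof -
    have "(\<integral>\<^sup>+t. I n t*g t \<partial>lborel) = (\<integral>\<^sup>+x. (\<integral>\<^sup>+t. ennreal (poisson_kernel (e n) t x)*g t \<partial>lborel)*indicator {a..b} x \<partial>lborel)"
      unfolding I_def by (intro poisson_swap[symmetric] sigma_finite_lborel) simp_all
    also have "... <= (\<integral>\<^sup>+x. ennreal pi*(min 1 (poisson \<mu> (e n) x)*indicator {a..b} x) \<partial>lborel)"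
    proof (intro nn_integral_mono)
      fix x
      have "(\<integral>\<^sup>+t. ennreal (poisson_kernel (e n) t x)*g t \<partial>lborel) <= ennreal pi*min 1 (poisson \<mu> (e n) x)"
      proof (cases "poisson \<mu> (e n) x <= 1")
        case True
        have "1*poisson \<mu> (e n) x <= ennreal pi*poisson \<mu> (e n) x"
          using pi_ge_two by (intro mult_right_mono) (simp_all add: ennreal_1[symmetric] ennreal_leI del: ennreal_1)
        thus ?thesis using True pg[of "e n" x] by (simp add: min_def)
      qed (use pg1[OF e] in \<open>auto simp: min_def\<close>)
      thus "(\<integral>\<^sup>+t. ennreal (poisson_kernel (e n) t x)*g t \<partial>lborel)*indicator {a..b} x <= ennreal pi*(min 1 (poisson \<mu> (e n) x)*indicator {a..b} x)"
        by (auto split: split_indicator)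
    qed
    also have "... = ennreal pi*(\<integral>\<^sup>+x\<in>{a..b}. min 1 (poisson \<mu> (e n) x) \<partial>lborel)"
    proof (rule nn_integral_cmult)
      have [measurable]: "poisson \<mu> (e n) \<in> borel_measurable borel" by (rule poisson_measurable[OF sets fin])
      show "(%x. min 1 (poisson \<mu> (e n) x)*indicator {a..b} x) \<in> borel_measurable lborel" by simp
    qed
    finally show ?thesis .
  qed
  have "(%n. ennreal pi*(\<integral>\<^sup>+x\<in>{a..b}. min 1 (poisson \<mu> (e n) x) \<partial>lborel)) ----> ennreal pi*0"
    using van unfolding vanishes_on_def e_def by (intro ennreal_tendsto_cmult) simp_all
  hence lim: "(%n. ennreal pi*(\<integral>\<^sup>+x\<in>{a..b}. min 1 (poisson \<mu> (e n) x) \<partial>lborel)) ----> 0" by simp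
  have up0: "(%n. \<integral>\<^sup>+t. I n t*g t \<partial>lborel) ----> 0"
    by (rule tendsto_sandwich[OF _ _ tendsto_const lim]) (intro always_eventually allI up zero_le)+
  have "(\<integral>\<^sup>+t. liminf (%n. I n t*g t) \<partial>lborel) <= liminf (%n. \<integral>\<^sup>+t. I n t*g t \<partial>lborel)"
    by (intro nn_integral_liminf) measurable
  also have "... = 0" using lim_imp_Liminf[OF _ up0] by simp
  finally have "AE t in lborel. liminf (%n. I n t*g t) = 0"
    by (subst (asm) le_zero_eq, subst (asm) nn_integral_0_iff_AE) auto
  moreover have "AE t in lborel. t \<notin> {a, b}" by (rule AE_not_in) (simp add: finite_imp_null_set_lborel)
  ultimately have "AE t in lborel. t \<in> {a..b} --> f t = 0"
  proof eventually_elim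
    case (elim t)
    show ?case
    proof
      assume "t \<in> {a..b}"
      hence t: "a < t" "t < b" using elim by auto
      have "(%n. I n t) ----> ennreal pi"
        unfolding I_def e_def by (rule poisson_kernel_integral_tendsto[OF t])
      hence "(%n. I n t*g t) ----> ennreal pi*g t" by (intro tendsto_mult_ennreal tendsto_const) auto
      from lim_imp_Liminf[OF trivial_limit_sequentially this] have "ennreal pi*g t = 0" using elim by simp
      hence "g t = 0" using pi_gt_zero by (auto simp: ennreal_eq_0_iff)
      thus "f t = 0" using t by (auto simp: g_def min_def split: if_splits)
    qed
  qed
  hence "emeasure \<nu> {a..b} = 0"
    unfolding f\<nu>[symmetric] by (subst emeasure_density) (auto simp: nn_integral_0_iff_AE split: split_indicator elim!: eventually_mono)
  hence "emeasure \<mu> ({a..b} - N) = 0" by (simp add: e\<nu> Int_absorb1 Diff_subset)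
  thus ?thesis using N N0 by blast
qed

section \<open>A weak type estimate for Herglotz functions\<close>

text \<open>Kolmogorov's argument: the real part of \<open>F / (F + i K)\<close> is nonnegative, and it is at least
  \<open>1/2\<close> where \<open>\<bar>F\<bar> \<ge> K\<close>. Its integral along a horizontal segment is moved by Cauchy's theorem to the
  two other sides of a triangle, where \<open>\<bar>F\<bar> \<le> C / Im z\<close> applies; the weight \<open>(z - A) (B - z)\<close>
  compensates the singularities at the two corners.\<close>

lemma herglotz_weak_type:
  fixes F :: "complex => complex"
  assumes holo: "F holomorphic_on {z. Im z > 0}"
    and nonneg: "!!z. Im z > 0 ==> 0 <= Im (F z)"
    and bound: "!!z. Im z > 0 ==> cmod (F z) <= C/Im z"
    and ab: "a < b" and K: "K > 0" and e: "e > 0"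
  shows "emeasure lborel {x \<in> {a..b}. K <= cmod (F (Complex x e))} <= ennreal (16*(b - a + 2)\<^sup>2*C/K)"
proof -
  have C: "0 <= C" using order_trans[OF norm_ge_zero bound[of \<i>]] by simp
  \<comment> \<open>The corners lie at distance 1 outside [a, b], so the weight (x - A)(B - x) is at
    least 1 on [a, b].\<close>
  define A B L where "A = a - 1" and "B = b + 1" and "L = b - a + 2"
  have L: "L = B - A" "L > 0" and AB: "A < B" using ab by (auto simp: A_def B_def L_def)
  define h where "h z = F (z + \<i>*e)" for z :: complex
  define q where "q z = h z/(h z + \<i>*K)" for z :: complex
  define f where "f z = (z - A)*(B - z)*q z" for z :: complex
  \<comment> \<open>The apex of an isosceles right triangle over [A, B]: on the side through a
    corner p the distance |z - p| is at most 2 Im z.\<close>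
  define c where "c = Complex ((A + B)/2) (L/2)"
  have him: "0 <= Im (h z)" if "Im z >= 0" for z unfolding h_def using that e by (intro nonneg) simp
  have den: "K <= cmod (h z + \<i>*K)" if "Im z >= 0" for z
    using him[OF that] abs_Im_le_cmod[of "h z + \<i>*K"] K by simp
  have den0: "h z + \<i>*K ~= 0" if "Im z >= 0" for z using den[OF that] K by auto
  let ?H = "{z. 0 <= Im z}"
  have "h holomorphic_on ?H" unfolding h_def using e
    by (intro holomorphic_on_compose_gen[OF _ holo, unfolded comp_def]) (auto intro!: holomorphic_intros)
  hence holf: "f holomorphic_on ?H" unfolding f_def q_def using den0 by (auto intro!: holomorphic_intros)
  have contf: "continuous_on ?H f" by (rule holomorphic_on_imp_continuous_on[OF holf])
  have cvx: "convex ?H" using convex_halfspace_Im_ge[of 0] by simp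
  have mem: "cr A \<in> ?H" "cr B \<in> ?H" "c \<in> ?H" using L by (auto simp: c_def)
  have seg: "closed_segment u v \<subseteq> ?H" if "u \<in> ?H" "v \<in> ?H" for u v
    by (rule closed_segment_subset[OF that cvx])
  have cint: "f contour_integrable_on linepath u v" if "u \<in> ?H" "v \<in> ?H" for u v
    by (rule contour_integrable_continuous_linepath[OF continuous_on_subset[OF contf seg[OF that]]])
  define I where "I u v = contour_integral (linepath u v) f" for u v
  have hI: "(f has_contour_integral I u v) (linepath u v)" if "u \<in> ?H" "v \<in> ?H" for u v
    unfolding I_def by (rule has_contour_integral_integral[OF cint[OF that]])
  have "(f has_contour_integral 0) (linepath (cr A) (cr B) +++ linepath (cr B) c +++ linepath c (cr A))"
  proof (rule Cauchy_theorem_triangle, rule holomorphic_on_subset[OF holf])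
    show "convex hull {cr A, cr B, c} \<subseteq> ?H" using mem cvx by (intro hull_minimal) auto
  qed
  moreover have "(f has_contour_integral (I A B + (I B c + I c A))) (linepath (cr A) (cr B) +++ linepath (cr B) c +++ linepath c (cr A))"
    by (intro has_contour_integral_join hI mem) (auto intro: valid_path_join)
  ultimately have sum0: "I A B + (I B c + I c A) = 0" using has_contour_integral_unique by blast
  have qle: "cmod (q z) <= C/(Im z*K)" if "Im z > 0" for z
  proof -
    have "cmod (h z) <= C/Im (z + \<i>*e)" unfolding h_def using that e by (intro bound) simp
    also have "... <= C/Im z" using that e C by (intro divide_left_mono) auto
    finally have "cmod (q z) <= (C/Im z)/K"
      unfolding q_def norm_divide using den[of z] that K C by (intro frac_le) auto
    thus ?thesis by simp
  qed
  \<comment> \<open>The product of 2 Im z for the near corner, 2 L for the far one and C/(K Im z)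
    for \<open>q\<close>; the imaginary parts cancel.\<close>
  define M where "M = 4*L*C/K"
  have M: "0 <= M" using L C K by (simp add: M_def)
  have side: "cmod (f z) <= M"
    if z: "z \<in> closed_segment c p" and pp: "(p, p') \<in> {(cr A, cr B), (cr B, cr A)}" for z p p'
  proof -
    obtain s where s: "0 <= s" "s <= 1" "z = (1 - s) *\<^sub>R c + s *\<^sub>R p" using z by (auto simp: closed_segment_def)
    have im: "2*Im z = (1 - s)*L" using pp unfolding s(3) by (auto simp: c_def)
    have "cmod (c - p) <= L" using pp cmod_le[of "c - p"] L AB by (auto simp: c_def field_simps)
    moreover have zp: "z - p = (1 - s) *\<^sub>R (c - p)" unfolding s(3) by (simp add: algebra_simps)
    ultimately have r: "cmod (z - p) <= 2*Im z" unfolding im using s by (auto intro: mult_left_mono)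
    have "2*Im z <= L" unfolding im using s L by (simp add: mult_left_le_one_le)
    moreover have "cmod (p - p') = L"
      using pp AB norm_of_real[of "A - B", where 'a = complex] by (auto simp: L(1) norm_minus_commute)
    ultimately have r': "cmod (z - p') <= 2*L" using r norm_triangle_ineq[of "z - p" "p - p'"] by simp
    show ?thesis
    proof (cases "s = 1")
      case False
      hence "0 < (1 - s)*L" using s L by simp
      hence z0: "Im z > 0" unfolding im[symmetric] by simp
      have "cmod (f z) = cmod (z - p)*cmod (z - p')*cmod (q z)"
        using pp unfolding f_def by (auto simp: norm_mult norm_minus_commute mult_ac)
      also have "... <= (2*Im z)*(2*L)*(C/(Im z*K))"
        using z0 L C K by (intro mult_mono r r' qle mult_nonneg_nonneg) auto
      also have "... = M" using z0 by (simp add: M_def field_simps)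
      finally show ?thesis .
    qed (use pp M zp in \<open>auto simp: f_def\<close>)
  qed
  have len: "cmod (c - A) <= L" "cmod (c - B) <= L"
    using cmod_le[of "c - A"] cmod_le[of "c - B"] L AB by (auto simp: c_def field_simps)
  have "cmod (I c A) <= M*cmod (A - c)"
    unfolding I_def using side[of _ A B] by (intro contour_integral_bound_linepath[OF cint[OF mem(3,1)] M]) auto
  moreover have "cmod (I B c) <= M*cmod (c - B)" unfolding I_def using side[of _ B A]
    by (intro contour_integral_bound_linepath[OF cint[OF mem(2,3)] M]) (auto simp: closed_segment_commute)
  moreover note mult_left_mono[OF len(1) M] mult_left_mono[OF len(2) M]
  ultimately have I12: "cmod (I c A) <= M*L" "cmod (I B c) <= M*L"
    unfolding norm_minus_commute[of "cr A"] by linarith+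
  have "I A B = - (I B c + I c A)" using sum0 by (simp only: eq_neg_iff_add_eq_0)
  hence "cmod (I A B) <= cmod (I B c) + cmod (I c A)" by (simp only: norm_minus_cancel norm_triangle_ineq)
  also have "... <= M*L + M*L" by (rule add_mono[OF I12(2,1)])
  \<comment> \<open>Two sides of length at most L. The final constant 16 is twice this, as the real
    part of \<open>q\<close> is only known to be at least 1/2 on the set to be measured.\<close>
  also have "... = 8*L\<^sup>2*C/K" by (simp add: M_def power2_eq_square)
  finally have Re_le: "Re (I A B) <= 8*L\<^sup>2*C/K" using complex_Re_le_cmod order_trans by blast
  have "((%x. f (cr x)) has_integral I A B) {A..B}"
    using hI[OF mem(1,2)] AB by (subst (asm) has_contour_integral_linepath_Reals_iff) auto
  hence int: "((%x. Re (f (cr x))) has_integral Re (I A B)) {A..B}" by (rule has_integral_Re)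
  have Ref: "Re (f (cr x)) = (x - A)*(B - x)*Re (q (cr x))" for x
  proof -
    have "f (cr x) = cr ((x - A)*(B - x))*q (cr x)" by (simp add: f_def)
    thus ?thesis by (simp only: times_complex.simps Re_complex_of_real Im_complex_of_real mult_zero_left diff_zero)
  qed
  have Req: "Re (q (cr x)) = ((cmod (h x))\<^sup>2 + K*Im (h x))/(cmod (h x + \<i>*K))\<^sup>2" for x :: real
    unfolding q_def Re_divide cmod_power2 by (simp add: power2_eq_square algebra_simps)
  have Re0: "0 <= Re (q (cr x))" for x
    unfolding Req using him[of "cr x"] K by (intro divide_nonneg_nonneg add_nonneg_nonneg) auto
  have Re2: "1/2 <= Re (q (cr x))" if "K <= cmod (F (Complex x e))" for x
  proof -
    have hx: "h (cr x) = F (Complex x e)"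
      unfolding h_def by (rule arg_cong[where f = F]) (simp add: complex_eq_iff)
    have "(cmod (h x + \<i>*K))\<^sup>2 = (cmod (h x))\<^sup>2 + 2*K*Im (h x) + K\<^sup>2"
      unfolding cmod_power2 by (simp add: power2_eq_square algebra_simps)
    also have "... <= 2*((cmod (h x))\<^sup>2 + K*Im (h x))"
      using power_mono[OF that, of 2] K unfolding hx by simp
    finally show ?thesis unfolding Req using den0[of "cr x"] by (simp add: field_simps)
  qed
  let ?S = "{x \<in> {a..b}. K <= cmod (F (Complex x e))}"
  have [measurable]: "(%x. F (Complex x e)) \<in> borel_measurable borel" using e unfolding Complex_eq
    by (intro borel_measurable_continuous_onI continuous_on_compose2[OF holomorphic_on_imp_continuous_on[OF holo]] continuous_intros) auto
  have Sb: "?S \<in> sets borel" by measurable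
  have "emeasure lborel ?S = (\<integral>\<^sup>+x. indicator ?S x \<partial>lborel)" using Sb by simp
  also have "... <= (\<integral>\<^sup>+x. ennreal 2*(ennreal (Re (f (cr x)))*indicator {A..B} x) \<partial>lborel)"
  proof (intro nn_integral_mono)
    fix x
    show "indicator ?S x <= ennreal 2*(ennreal (Re (f (cr x)))*indicator {A..B} x)"
    proof (cases "x \<in> ?S")
      case True
      have "1*1 <= (x - A)*(B - x)" using True by (intro mult_mono) (auto simp: A_def B_def)
      hence "1*(1/2) <= ((x - A)*(B - x))*Re (q (cr x))" using Re2[of x] True by (intro mult_mono) auto
      hence "1 <= 2*Re (f (cr x))" unfolding Ref by simp
      hence "ennreal 1 <= ennreal (2*Re (f (cr x)))" by (rule ennreal_leI)
      thus ?thesis using True by (simp add: ennreal_mult' A_def B_def)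
    qed simp
  qed
  also have "... = ennreal 2*(\<integral>\<^sup>+x\<in>{A..B}. ennreal (Re (f (cr x))) \<partial>lborel)"
  proof (rule nn_integral_cmult)
    have "continuous_on UNIV (%x. f (cr x))"
      by (intro continuous_on_compose2[OF contf] continuous_intros) auto
    hence "(%x. Re (f (cr x))) \<in> borel_measurable borel"
      by (intro borel_measurable_continuous_onI continuous_intros)
    thus "(%x. ennreal (Re (f (cr x)))*indicator {A..B} x) \<in> borel_measurable lborel" by simp
  qed
  also have "(\<integral>\<^sup>+x\<in>{A..B}. ennreal (Re (f (cr x))) \<partial>lborel) = ennreal (Re (I A B))"
  proof (rule nn_integral_has_integral_lebesgue'[OF _ int])
    fix x assume "x \<in> {A..B}"
    thus "0 <= Re (f (cr x))" unfolding Ref using Re0 by (intro mult_nonneg_nonneg) auto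
  qed
  also have "ennreal 2*ennreal (Re (I A B)) <= ennreal 2*ennreal (8*L\<^sup>2*C/K)"
    using Re_le by (intro mult_left_mono ennreal_leI) auto
  also have "... = ennreal (2*(8*L\<^sup>2*C/K))" by (rule ennreal_mult'[symmetric]) simp
  also have "2*(8*L\<^sup>2*C/K) = 16*(b - a + 2)\<^sup>2*C/K" by (simp add: L_def)
  finally show ?thesis .
qed

lemma vanishes_on_le:
  assumes v: "vanishes_on a b v" and le: "!!n x. x \<in> {a..b} ==> u n x <= ennreal C * v n x" and C: "C >= 1"
    and [measurable]: "!!n. v n \<in> borel_measurable borel"
  shows "vanishes_on a b u"
proof -
  have up: "(\<integral>\<^sup>+x\<in>{a..b}. min 1 (u n x) \<partial>lborel) <= ennreal C*(\<integral>\<^sup>+x\<in>{a..b}. min 1 (v n x) \<partial>lborel)" for n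
  proof -
    have "(\<integral>\<^sup>+x\<in>{a..b}. min 1 (u n x) \<partial>lborel) <= (\<integral>\<^sup>+x. ennreal C*(min 1 (v n x)*indicator {a..b} x) \<partial>lborel)"
    proof (intro nn_integral_mono)
      fix x
      have "min 1 (u n x) <= ennreal C*min 1 (v n x)" if "x \<in> {a..b}"
      proof (cases "v n x <= 1")
        case True
        thus ?thesis using le[OF that, of n] by (auto simp: min_def)
      next
        case False
        have "1 <= ennreal C" using C by (simp add: ennreal_1[symmetric] ennreal_leI del: ennreal_1)
        moreover have "min 1 (v n x) = 1" using False by (simp add: min_def)
        ultimately show ?thesis by (metis min.coboundedI1 mult.right_neutral)
      qed
      thus "min 1 (u n x)*indicator {a..b} x <= ennreal C*(min 1 (v n x)*indicator {a..b} x)"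
        by (auto split: split_indicator)
    qed
    also have "... = ennreal C*(\<integral>\<^sup>+x\<in>{a..b}. min 1 (v n x) \<partial>lborel)"
      by (rule nn_integral_cmult) simp
    finally show ?thesis .
  qed
  have "(%n. ennreal C*(\<integral>\<^sup>+x\<in>{a..b}. min 1 (v n x) \<partial>lborel)) ----> ennreal C*0"
    using v unfolding vanishes_on_def by (intro ennreal_tendsto_cmult) simp_all
  hence lim: "(%n. ennreal C*(\<integral>\<^sup>+x\<in>{a..b}. min 1 (v n x) \<partial>lborel)) ----> 0" by simp
  show ?thesis unfolding vanishes_on_def
    by (rule tendsto_sandwich[OF _ _ tendsto_const lim]) (intro always_eventually allI up zero_le)+
qed

lemma vanishes_on_add:
  assumes v: "vanishes_on a b v" and w: "vanishes_on a b w"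
    and [measurable]: "!!n. v n \<in> borel_measurable borel" "!!n. w n \<in> borel_measurable borel"
  shows "vanishes_on a b (%n x. v n x + w n x)"
proof -
  have up: "(\<integral>\<^sup>+x\<in>{a..b}. min 1 (v n x + w n x) \<partial>lborel) <=
     (\<integral>\<^sup>+x\<in>{a..b}. min 1 (v n x) \<partial>lborel) + (\<integral>\<^sup>+x\<in>{a..b}. min 1 (w n x) \<partial>lborel)" for n
  proof -
    have "(\<integral>\<^sup>+x\<in>{a..b}. min 1 (v n x + w n x) \<partial>lborel) <=
      (\<integral>\<^sup>+x. min 1 (v n x)*indicator {a..b} x + min 1 (w n x)*indicator {a..b} x \<partial>lborel)"
    proof (intro nn_integral_mono)
      fix x
      have "min 1 (v n x + w n x) <= min 1 (v n x) + min 1 (w n x)"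
        by (cases "v n x <= 1"; cases "w n x <= 1") (auto simp: min_def add_increasing add_increasing2)
      thus "min 1 (v n x + w n x)*indicator {a..b} x <= min 1 (v n x)*indicator {a..b} x + min 1 (w n x)*indicator {a..b} x"
        by (auto split: split_indicator)
    qed
    also have "... = (\<integral>\<^sup>+x\<in>{a..b}. min 1 (v n x) \<partial>lborel) + (\<integral>\<^sup>+x\<in>{a..b}. min 1 (w n x) \<partial>lborel)"
      by (rule nn_integral_add) auto
    finally show ?thesis .
  qed
  have lim: "(%n. (\<integral>\<^sup>+x\<in>{a..b}. min 1 (v n x) \<partial>lborel) + (\<integral>\<^sup>+x\<in>{a..b}. min 1 (w n x) \<partial>lborel)) ----> 0"
    using tendsto_add[OF v[unfolded vanishes_on_def] w[unfolded vanishes_on_def]] by simp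
  show ?thesis unfolding vanishes_on_def
    by (rule tendsto_sandwich[OF _ _ tendsto_const lim]) (intro always_eventually allI up zero_le)+
qed

text \<open>Outside a set of measure d the factor is below a constant independent of n, and a
  constant factor does not disturb convergence in measure; on the exceptional set the truncation at
  1 costs at most d.\<close>

lemma vanishes_on_mult_bounded:
  assumes v: "vanishes_on a b v" and [measurable]: "!!n. v n \<in> borel_measurable borel" "!!n. c n \<in> borel_measurable borel"
    and c: "!!d. d > 0 ==> EX K>0. ALL n. emeasure lborel {x \<in> {a..b}. K <= c n x} <= ennreal d"
    and c0: "!!n x. 0 <= c n x"
  shows "vanishes_on a b (%n x. ennreal ((c n x)\<^sup>2) * v n x)" unfolding vanishes_on_def
proof (rule ennreal_tendsto_0I[where C = 2])
  fix d :: real assume d: "d > 0"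
  obtain K0 where K0: "K0 > 0" "!!n. emeasure lborel {x \<in> {a..b}. K0 <= c n x} <= ennreal d" using c[OF d] by blast
  \<comment> \<open>Enlarged so that K^2 is at least 1, as \<open>vanishes_on_le\<close> asks
    for.\<close>
  define K where "K = K0 + 1"
  have K: "K >= 1" using K0 by (simp add: K_def)
  have em: "emeasure lborel {x \<in> {a..b}. K <= c n x} <= ennreal d" for n
  proof -
    have "emeasure lborel {x \<in> {a..b}. K <= c n x} <= emeasure lborel {x \<in> {a..b}. K0 <= c n x}"
      by (intro emeasure_mono) (auto simp: K_def)
    thus ?thesis using K0(2) order_trans by blast
  qed
  have "vanishes_on a b (%n x. ennreal (K\<^sup>2) * v n x)"
    by (rule vanishes_on_le[OF v order_refl]) (use K in auto)
  hence "\<forall>\<^sub>F n in sequentially. (\<integral>\<^sup>+x\<in>{a..b}. min 1 (ennreal (K\<^sup>2) * v n x) \<partial>lborel) < ennreal d"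
    unfolding vanishes_on_def using d by (intro order_tendstoD(2)[of _ 0]) auto
  thus "\<forall>\<^sub>F n in sequentially. (\<integral>\<^sup>+x\<in>{a..b}. min 1 (ennreal ((c n x)\<^sup>2) * v n x) \<partial>lborel) <= ennreal (2*d)"
  proof eventually_elim
    case (elim n)
    let ?S = "{x \<in> {a..b}. K <= c n x}"
    have "(\<integral>\<^sup>+x\<in>{a..b}. min 1 (ennreal ((c n x)\<^sup>2) * v n x) \<partial>lborel) <=
      (\<integral>\<^sup>+x. indicator ?S x + min 1 (ennreal (K\<^sup>2) * v n x)*indicator {a..b} x \<partial>lborel)"
    proof (intro nn_integral_mono)
      fix x
      have "min 1 (ennreal ((c n x)\<^sup>2) * v n x) <= min 1 (ennreal (K\<^sup>2) * v n x)" if "~ K <= c n x"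
        using that c0[of n x] by (intro min.mono order_refl mult_right_mono ennreal_leI power_mono) auto
      moreover have "min 1 (ennreal ((c n x)\<^sup>2) * v n x) <= 1 + min 1 (ennreal (K\<^sup>2) * v n x)"
        by (simp add: add_increasing2 min.coboundedI1)
      ultimately show "min 1 (ennreal ((c n x)\<^sup>2) * v n x)*indicator {a..b} x <= indicator ?S x + min 1 (ennreal (K\<^sup>2) * v n x)*indicator {a..b} x"
        by (auto split: split_indicator)
    qed
    also have "... = emeasure lborel ?S + (\<integral>\<^sup>+x\<in>{a..b}. min 1 (ennreal (K\<^sup>2) * v n x) \<partial>lborel)"
      by (subst nn_integral_add) auto
    also have "... <= ennreal d + ennreal d" using em elim by (intro add_mono) auto
    also have "... = ennreal (2*d)" using d by (simp add: ennreal_plus[symmetric] del: ennreal_plus)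
    finally show ?case .
  qed
qed simp

section \<open>Matrix elements of the resolvent and the criterion for absence of absolutely
  continuous spectrum\<close>

context selfadj
begin

lemma cinner_resolvent_continuous:
  assumes e: "e > 0"
  shows "continuous_on UNIV (%x. cinner u (R (Complex x e) v))" "continuous_on UNIV (%x. R (Complex x e) v)"
proof -
  have "continuous_on {z. Im z ~= 0} (%z. R z v)" by (rule resolvent_continuous_on) simp
  thus c: "continuous_on UNIV (%x. R (Complex x e) v)"
  proof (rule continuous_on_compose2)
    show "continuous_on UNIV (%x. Complex x e)" unfolding Complex_eq by (intro continuous_intros)
  qed (use e in auto)
  thus "continuous_on UNIV (%x. cinner u (R (Complex x e) v))" by (intro continuous_intros)
qed

text \<open>Diagonal matrix elements are Herglotz functions bounded by |v|^2 / Im z. Allowing every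
  larger \<open>K\<close> lets several vectors share one level.\<close>

lemma resolvent_weak_type_diag:
  assumes ab: "a < b" and d: "d > 0"
  shows "EX K0>0. ALL K>=K0. ALL e>0. emeasure lborel {x \<in> {a..b}. K <= cmod (cinner v (R (Complex x e) v))} <= ennreal d"
proof -
  define C where "C = (norm v)\<^sup>2"
  define K0 where "K0 = 16*(b - a + 2)\<^sup>2*C/d + 1"
  have K0: "K0 > 0" using d by (simp add: K0_def C_def add_nonneg_pos)
  have "emeasure lborel {x \<in> {a..b}. K <= cmod (cinner v (R (Complex x e) v))} <= ennreal d" if K: "K >= K0" and e: "e > 0" for K e
  proof -
    have "emeasure lborel {x \<in> {a..b}. K <= cmod (cinner v (R (Complex x e) v))} <= ennreal (16*(b - a + 2)\<^sup>2*C/K)"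
    proof (rule herglotz_weak_type[OF _ _ _ ab _ e])
      show "(%z. cinner v (R z v)) holomorphic_on {z. Im z > 0}" unfolding holomorphic_on_def
      proof
        fix z assume "z \<in> {z. Im z > 0}"
        hence "((%z. cinner v (R z v)) has_field_derivative cinner v (R z (R z v))) (at z)"
          by (intro resolvent_deriv) simp
        thus "(%z. cinner v (R z v)) field_differentiable (at z within {z. Im z > 0})"
          unfolding field_differentiable_def using has_field_derivative_at_within by blast
      qed
      show "0 <= Im (cinner v (R z v))" if "Im z > 0" for z
        using Im_resolvent(2)[OF that, of v "Re z"] that by simp
      show "cmod (cinner v (R z v)) <= C/Im z" if "Im z > 0" for z
      proof -
        have "cmod (cinner v (R z v)) <= norm v * norm (R z v)" by (rule cmod_cinner_le)
        also have "... <= norm v * (norm v/\<bar>Im z\<bar>)" using that by (intro mult_left_mono resolvent_norm_le) auto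
        finally show ?thesis using that by (simp add: C_def power2_eq_square)
      qed
      show "0 < K" using K K0 by simp
    qed
    also have "... <= ennreal d"
    proof (rule ennreal_leI)
      have "16*(b - a + 2)\<^sup>2*C/d <= K" using K by (simp add: K0_def)
      thus "16*(b - a + 2)\<^sup>2*C/K <= d" using d K K0 by (simp add: field_simps)
    qed
    finally show ?thesis .
  qed
  thus ?thesis using K0 by blast
qed

text \<open>Off-diagonal elements are no Herglotz functions, but by polarization they are
  combinations of the four diagonal ones for u + i^k v. Where the off-diagonal element reaches
  \<open>K\<close>, one of the four does too; each exceptional set is allotted measure d/4.\<close>

lemma resolvent_weak_type:
  assumes ab: "a < b" and d: "d > 0"
  shows "EX K>0. ALL e>0. emeasure lborel {x \<in> {a..b}. K <= cmod (cinner u (R (Complex x e) v))} <= ennreal d"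
proof -
  define w :: "nat => 'a" where "w k = u + \<i>^k *\<^sub>C v" for k
  have "ALL k. EX K0. K0 > 0 & (ALL K>=K0. ALL e>0. emeasure lborel {x \<in> {a..b}. K <= cmod (cinner (w k) (R (Complex x e) (w k)))} <= ennreal (d/4))"
    using d by (intro allI resolvent_weak_type_diag ab) simp
  from choice[OF this] obtain K0 where K0': "ALL k. K0 k > 0 & (ALL K>=K0 k. ALL e>0. emeasure lborel {x \<in> {a..b}. K <= cmod (cinner (w k) (R (Complex x e) (w k)))} <= ennreal (d/4))"
    by blast
  have K0: "K0 k > 0" "K >= K0 k ==> e > 0 ==> emeasure lborel {x \<in> {a..b}. K <= cmod (cinner (w k) (R (Complex x e) (w k)))} <= ennreal (d/4)" for k K e
    using K0'[rule_format, of k] by simp_all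
  define K where "K = K0 0 + K0 1 + K0 2 + K0 3"
  have Kk: "K >= K0 k" if "k < 4" for k
  proof -
    have "k = 0 \<or> k = 1 \<or> k = 2 \<or> k = 3" using that by linarith
    thus ?thesis using K0(1)[of 0] K0(1)[of 1] K0(1)[of 2] K0(1)[of 3] unfolding K_def by (elim disjE) auto
  qed
  have Kpos: "K > 0" using K0(1)[of 0] Kk[of 0] by linarith
  have "emeasure lborel {x \<in> {a..b}. K <= cmod (cinner u (R (Complex x e) v))} <= ennreal d" if e: "e > 0" for e
  proof -
    define S where "S k = {x \<in> {a..b}. K <= cmod (cinner (w k) (R (Complex x e) (w k)))}" for k
    have [measurable]: "(%x. cinner (w k) (R (Complex x e) (w k))) \<in> borel_measurable borel" for k
      by (intro borel_measurable_continuous_onI cinner_resolvent_continuous e)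
    have Sb: "S k \<in> sets lborel" for k unfolding S_def by measurable
    have "{x \<in> {a..b}. K <= cmod (cinner u (R (Complex x e) v))} \<subseteq> (\<Union>k<4. S k)"
    proof
      fix x assume "x \<in> {x \<in> {a..b}. K <= cmod (cinner u (R (Complex x e) v))}"
      hence x: "x \<in> {a..b}" "K <= cmod (cinner u (R (Complex x e) v))" by auto
      define T where "T = R (Complex x e)"
      have T: "bounded_clinear T" unfolding T_def using e by (intro resolvent_bounded nonreal_in_resolvent_set) simp
      have w: "w 0 = u + v" "w 1 = u + \<i> *\<^sub>C v" "w 2 = u - v" "w 3 = u - \<i> *\<^sub>C v"
        by (simp_all add: w_def scaleC_minus1 scaleC_minus_left power3_eq_cube)
      have "EX k<4. K <= cmod (cinner (w k) (T (w k)))"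
      proof (rule ccontr)
        assume "~ (EX k<4. K <= cmod (cinner (w k) (T (w k))))"
        hence lt: "cmod (cinner (w k) (T (w k))) < K" if "k < 4" for k using that by (meson not_le)
        have "4*cinner u (T v) = cinner (w 0) (T (w 0)) - cinner (w 2) (T (w 2))
           - \<i>*cinner (w 1) (T (w 1)) + \<i>*cinner (w 3) (T (w 3))"
          unfolding w by (rule polarization) (simp_all add: bounded_clinearD[OF T])
        moreover have "cmod (p - q - \<i>*r + \<i> * s) <= cmod p + cmod q + cmod r + cmod s" for p q r s
          using norm_triangle_ineq[of "p - q - \<i>*r" "\<i> * s"] norm_triangle_ineq4[of "p - q" "\<i>*r"] norm_triangle_ineq4[of p q]
          by (simp add: norm_mult)
        ultimately have "cmod (4*cinner u (T v)) < 4*K"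
          using lt[of 0] lt[of 1] lt[of 2] lt[of 3] by (smt (verit) numeral_less_iff zero_less_numeral one_less_numeral_iff semiring_norm)
        thus False using x(2) by (simp add: norm_mult T_def)
      qed
      thus "x \<in> (\<Union>k<4. S k)" using x(1) by (auto simp: S_def T_def)
    qed
    hence "emeasure lborel {x \<in> {a..b}. K <= cmod (cinner u (R (Complex x e) v))} <= emeasure lborel (\<Union>k<4. S k)"
      using Sb by (intro emeasure_mono) auto
    also have "... <= (\<Sum>k<4. emeasure lborel (S k))" using Sb by (intro emeasure_subadditive_finite) auto
    also have "... <= (\<Sum>k<(4::nat). ennreal (d/4))"
      unfolding S_def using K0(2)[OF Kk _ ] e by (intro sum_mono) auto
    also have "... = ennreal d" using d by (subst sum_ennreal) auto
    finally show ?thesis .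
  qed
  thus ?thesis using Kpos by blast
qed

definition im_res :: "'a => nat => real => ennreal" where
  "im_res v n x = ennreal (Im (cinner v (R (Complex x (inverse (real (Suc n)))) v)))"

lemma im_res_measurable [measurable]: "im_res v n \<in> borel_measurable borel"
proof -
  have "(%x. Im (cinner v (R (Complex x (inverse (real (Suc n)))) v))) \<in> borel_measurable borel"
    by (intro borel_measurable_continuous_onI continuous_intros cinner_resolvent_continuous) simp
  thus ?thesis unfolding im_res_def[abs_def] by simp
qed

lemma poisson_smeas: "poisson (smeas v) (inverse (real (Suc n))) x = im_res v n x"
proof -
  let ?e = "inverse (real (Suc n))"
  have e: "?e > 0" by simp
  have bd: "norm (poisson_kernel ?e t x) <= 1/?e" for t
  proof -
    have "poisson_kernel ?e t x <= ?e/?e\<^sup>2"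
      unfolding poisson_kernel_def using e by (intro divide_left_mono mult_pos_pos add_nonneg_pos) auto
    also have "... = 1/?e" by (simp add: power2_eq_square del: of_nat_Suc)
    finally show ?thesis using poisson_kernel_nonneg[OF e, of t x] by simp
  qed
  have "poisson (smeas v) ?e x = ennreal (LINT t|smeas v. poisson_kernel ?e t x)" unfolding poisson_def
  proof (rule nn_integral_eq_integral)
    show "integrable (smeas v) (%t. poisson_kernel ?e t x)" by (rule integrable_smeas[OF _ bd]) simp
    show "AE t in smeas v. 0 <= poisson_kernel ?e t x" using poisson_kernel_nonneg[OF e] by (intro AE_I2)
  qed
  thus ?thesis unfolding im_res_def Im_resolvent(1)[OF e] poisson_kernel_def .
qed

lemma spectral_measure_on_emeasure:
  assumes "A \<in> sets borel"
  shows "emeasure (spectral_measure_on D a b v) A = emeasure (smeas v) (A \<inter> {a..b})"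
  unfolding spectral_measure_on_def spectral_measure_eq using assms by (intro emeasure_density_indicator) auto

lemma sets_spectral_measure_on [simp]: "sets (spectral_measure_on D a b v) = sets borel"
  by (simp add: spectral_measure_on_def spectral_measure_eq)

lemma finite_spectral_measure_on: "finite_measure (spectral_measure_on D a b v)"
proof (rule finite_measureI)
  interpret finite_measure "smeas v" by simp
  have "space (spectral_measure_on D a b v) = UNIV"
    using sets_eq_imp_space_eq[OF sets_spectral_measure_on] by simp
  thus "emeasure (spectral_measure_on D a b v) (space (spectral_measure_on D a b v)) ~= \<infinity>"
    using spectral_measure_on_emeasure[of UNIV] by (simp add: emeasure_eq_measure)
qed

text \<open>Turns a statement about the Lebesgue decomposition into one about resolvents, the form
  in which it can be carried to the perturbed operators.\<close>

lemma ac_part_null_iff_vanishes: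
  "ac_part (spectral_measure_on D a b v) = null_measure borel \<longleftrightarrow> vanishes_on a b (im_res v)"
proof -
  have eq: "emeasure (spectral_measure_on D a b v) (- N) = emeasure (smeas v) ({a..b} - N)" if N: "N \<in> sets borel" for N
  proof -
    have "- N \<in> sets borel" using N by (rule borel_comp)
    thus ?thesis by (simp add: spectral_measure_on_emeasure Diff_eq Int_commute)
  qed
  have van: "(%n. poisson (smeas v) (inverse (real (Suc n)))) = im_res v"
    by (simp only: fun_eq_iff poisson_smeas) blast
  have "ac_part (spectral_measure_on D a b v) = null_measure borel \<longleftrightarrow>
     (EX N:sets borel. emeasure lborel N = 0 & emeasure (smeas v) ({a..b} - N) = 0)"
    unfolding ac_part_null_iff[OF sets_spectral_measure_on finite_spectral_measure_on] using eq by auto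
  also have "... \<longleftrightarrow> vanishes_on a b (im_res v)"
    using poisson_vanishes[OF sets_smeas finite_smeas, of _ v a b] poisson_vanishes_imp_singular[OF sets_smeas finite_smeas, of a b v]
    unfolding van by blast
  finally show ?thesis .
qed

lemma no_ac_spectrum_iff: "no_ac_spectrum_on D a b \<longleftrightarrow> (ALL v. vanishes_on a b (im_res v))"
  unfolding no_ac_spectrum_on_def ac_part_null_iff_vanishes ..

lemma pp_part_null:
  assumes "!!x. x \<in> {a..b} ==> emeasure (smeas v) {x} = 0"
  shows "pp_part (spectral_measure_on D a b v) = null_measure borel"
proof -
  have "emeasure (spectral_measure_on D a b v) {x} = 0" for x
    using assms[of x] by (cases "x \<in> {a..b}") (simp_all add: spectral_measure_on_emeasure)
  hence "pp_part (spectral_measure_on D a b v) = density (spectral_measure_on D a b v) (%_. 0)"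
    unfolding pp_part_def by (intro arg_cong2[where f = density] refl) (auto simp: fun_eq_iff)
  also have "... = null_measure borel" by (intro measure_eqI) (auto simp: emeasure_density)
  finally show ?thesis .
qed

lemma purely_sc_spectrumI:
  assumes "interval_in_spectrum D a b" "no_ac_spectrum_on D a b"
    "!!x. x \<in> {a..b} ==> ~ eigenvalue D (cr x)"
  shows "purely_sc_spectrum_on D a b" using assms no_eigenvalue_no_atom
  unfolding purely_sc_spectrum_on_def no_ac_spectrum_on_def by (auto intro!: pp_part_null)

end

section \<open>Boundary triples\<close>

text \<open>New boundary values in which the condition h = t g reads as vanishing of the first one.
  For real t this substitution preserves the form on the right of Green's formula.\<close>

abbreviation (input) shift_triple :: "real => ('a \<times> 'a :: complex_hilbert_space \<times> complex \<times> complex) set => _" where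
  "shift_triple t T == {(x, y, h - cr t*g, - g) | x y g h. (x, y, g, h) \<in> T}"

text \<open>An element \<open>(x, y, g, h)\<close> of \<open>T\<close> stands for a vector \<open>x\<close> in the domain of a maximal operator (or
  relation) that maps \<open>x\<close> to \<open>y\<close>, with boundary values \<open>g\<close> and \<open>h\<close>. The operators in question are the
  restrictions given by \<open>g = 0\<close> and by \<open>h = t g\<close>. For a rank one perturbation of \<open>A\<close> one takes
  \<open>y = A x - g \<phi>\<close> and \<open>h = (\<phi>, x)\<close>; for Schroedinger operators \<open>g\<close> and \<open>h\<close> are
  combinations of \<open>u(0)\<close> and \<open>u'(0)\<close>.\<close>

locale boundary_triple = selfadj D for D :: "'a :: complex_hilbert_space unbounded_op" +
  fixes T :: "('a \<times> 'a \<times> complex \<times> complex) set"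
  assumes T_add: "(x, y, g, h) \<in> T ==> (x', y', g', h') \<in> T ==> (x + x', y + y', g + g', h + h') \<in> T"
    and T_scale: "(x, y, g, h) \<in> T ==> (c *\<^sub>C x, c *\<^sub>C y, c*g, c*h) \<in> T"
    and green: "(x, y, g, h) \<in> T ==> (x', y', g', h') \<in> T ==>
      cinner x y' - cinner y x' = cnj g*h' - cnj h*g'"
    and T_uniq: "(0, 0, g, h) \<in> T ==> g = 0 & h = 0"
    and D_graph: "x \<in> op_dom D & op_app D x = y \<longleftrightarrow> (EX h. (x, y, 0, h) \<in> T)"
    and gamma_ex: "EX x h z. Im z ~= 0 & (x, z *\<^sub>C x, 1, h) \<in> T"
begin

lemma T_diff:
  assumes "(x, y, g, h) \<in> T" "(x', y', g', h') \<in> T"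
  shows "(x - x', y - y', g - g', h - h') \<in> T"
  using T_add[OF assms(1) T_scale[OF assms(2), of "-1"]] by (simp add: scaleC_minus1)

text \<open>The pair (x, y) matters here: in the rank one case T contains (0, - g
  \<open>\<phi>\<close>, g, 0), so \<open>x\<close> alone fixes neither \<open>y\<close> nor
  \<open>g\<close>.\<close>

lemma T_same:
  assumes "(x, y, g, h) \<in> T" "(x, y, g', h') \<in> T"
  shows "g = g'" "h = h'" using T_uniq[of "g - g'" "h - h'"] T_diff[OF assms] by auto

lemma in_dom_T: "x \<in> op_dom D ==> EX h. (x, op_app D x, 0, h) \<in> T" using D_graph by blast

lemma T_in_dom: "(x, y, 0, h) \<in> T ==> x \<in> op_dom D" "(x, y, 0, h) \<in> T ==> op_app D x = y"
  using D_graph by blast+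

lemma T_resolvent: "z \<in> resolvent_set D ==> EX h. (R z v, v + z *\<^sub>C R z v, 0, h) \<in> T"
  using in_dom_T[OF resolvent_in_dom, of z v] resolvent_right[of z v] by simp

lemma T_resolvent_eq:
  assumes "z \<in> resolvent_set D" "(x, v + z *\<^sub>C x, 0, h) \<in> T"
  shows "x = R z v" using resolvent_eqI[OF assms(1) T_in_dom[OF assms(2)]] by simp

section \<open>Deficiency vectors and the Weyl function\<close>

lemma gam_exists:
  assumes z: "z \<in> resolvent_set D"
  shows "EX x h. (x, z *\<^sub>C x, 1, h) \<in> T"
proof -
  obtain x0 h0 z0 where z0: "(x0, z0 *\<^sub>C x0, 1, h0) \<in> T" using gamma_ex by blast
  obtain h1 where h1: "(R z x0, x0 + z *\<^sub>C R z x0, 0, h1) \<in> T" using T_resolvent[OF z] by blast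
  let ?x = "x0 + (z - z0) *\<^sub>C R z x0"
  have "(?x, z0 *\<^sub>C x0 + (z - z0) *\<^sub>C (x0 + z *\<^sub>C R z x0), 1, h0 + (z - z0)*h1) \<in> T"
    using T_add[OF z0 T_scale[OF h1, of "z - z0"]] by simp
  moreover have "z0 *\<^sub>C x0 + (z - z0) *\<^sub>C (x0 + z *\<^sub>C R z x0) = z *\<^sub>C ?x"
    by (simp add: scaleC_add_right scaleC_scaleC scaleC_diff_left algebra_simps)
  ultimately show ?thesis by metis
qed

text \<open>The gamma field and the Weyl function of the triple. In the rank one case they are R z
  \<open>\<phi>\<close> and (\<open>\<phi>\<close>, R z \<open>\<phi>\<close>), for the differential
  operators the square integrable Weyl solution and Weyl's m-function.\<close>

definition gam :: "complex => 'a" where "gam z = (SOME x. EX h. (x, z *\<^sub>C x, 1, h) \<in> T)"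
definition wey :: "complex => complex" where "wey z = (SOME h. (gam z, z *\<^sub>C gam z, 1, h) \<in> T)"

lemma gam_T: "z \<in> resolvent_set D ==> (gam z, z *\<^sub>C gam z, 1, wey z) \<in> T"
  unfolding wey_def using someI_ex[OF gam_exists] unfolding gam_def by (rule someI_ex)

lemma gam_unique:
  assumes z: "z \<in> resolvent_set D" and x: "(x, z *\<^sub>C x, 1, h) \<in> T"
  shows "x = gam z"
proof -
  have "(x - gam z, 0 + z *\<^sub>C (x - gam z), 0, h - wey z) \<in> T"
    using T_diff[OF x gam_T[OF z]] by (simp add: scaleC_diff_right)
  from T_resolvent_eq[OF z this] show ?thesis by (simp add: resolvent_linear[OF z])
qed

lemma gam_shift:
  assumes z: "z \<in> resolvent_set D" and x: "(x, w *\<^sub>C x, 1, h) \<in> T"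
  shows "gam z = x + (z - w) *\<^sub>C R z x"
proof -
  obtain h1 where h1: "(R z x, x + z *\<^sub>C R z x, 0, h1) \<in> T" using T_resolvent[OF z] by blast
  let ?x = "x + (z - w) *\<^sub>C R z x"
  have "(?x, w *\<^sub>C x + (z - w) *\<^sub>C (x + z *\<^sub>C R z x), 1, h + (z - w)*h1) \<in> T"
    using T_add[OF x T_scale[OF h1, of "z - w"]] by simp
  moreover have "w *\<^sub>C x + (z - w) *\<^sub>C (x + z *\<^sub>C R z x) = z *\<^sub>C ?x"
    by (simp add: scaleC_add_right scaleC_scaleC scaleC_diff_left algebra_simps)
  ultimately show ?thesis using gam_unique[OF z] by metis
qed

lemma gam_resolvent:
  assumes "z \<in> resolvent_set D" "w \<in> resolvent_set D"
  shows "gam z = gam w + (z - w) *\<^sub>C R z (gam w)" by (rule gam_shift[OF assms(1) gam_T[OF assms(2)]])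

lemma gam_neq_0: "z \<in> resolvent_set D ==> gam z ~= 0" using gam_T[of z] T_uniq[of 1 "wey z"] by auto

lemma wey_green:
  assumes "z \<in> resolvent_set D" "w \<in> resolvent_set D"
  shows "(z - cnj w)*cinner (gam w) (gam z) = wey z - cnj (wey w)"
  using green[OF gam_T[OF assms(2)] gam_T[OF assms(1)]] by (simp add: cinner_simps algebra_simps)

text \<open>Green's formula for \<open>gam z\<close> with itself. It makes \<open>wey\<close>
  nonreal off the real axis, hence different from every real parameter t.\<close>

lemma Im_wey:
  assumes "z \<in> resolvent_set D"
  shows "Im (wey z) = Im z*(norm (gam z))\<^sup>2"
proof -
  have "Im ((z - cnj z)*cinner (gam z) (gam z)) = Im (wey z - cnj (wey z))"
    using wey_green[OF assms assms] by simp
  thus ?thesis by (simp add: cinner_self del: of_real_power)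
qed

text \<open>Green's formula against \<open>gam (cnj z)\<close>, whose first boundary value is 1,
  reads off the second boundary value of the resolvent.\<close>

lemma resolvent_T:
  assumes z: "z \<in> resolvent_set D" "cnj z \<in> resolvent_set D"
  shows "(R z v, v + z *\<^sub>C R z v, 0, cinner (gam (cnj z)) v) \<in> T"
proof -
  obtain h where h: "(R z v, v + z *\<^sub>C R z v, 0, h) \<in> T" using T_resolvent[OF z(1)] by blast
  have "h = cinner (gam (cnj z)) v" using green[OF gam_T[OF z(2)] h] by (simp add: cinner_simps)
  thus ?thesis using h by simp
qed

lemma gam_continuous:
  assumes e: "e > 0"
  shows "continuous_on UNIV (%x. gam (Complex x e))"
proof -
  have eq: "gam (Complex x e) = gam \<i> + (Complex x e - \<i>) *\<^sub>C R (Complex x e) (gam \<i>)" for x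
    using e by (intro gam_resolvent nonreal_in_resolvent_set) auto
  have "continuous_on UNIV (%x. Complex x e)" unfolding Complex_eq by (intro continuous_intros)
  thus ?thesis unfolding eq by (intro continuous_intros cinner_resolvent_continuous e)
qed

section \<open>The perturbed operators and Krein's resolvent formula\<close>

definition perturbed :: "real => 'a unbounded_op => bool" where
  "perturbed t D' \<longleftrightarrow> (ALL x y. x \<in> op_dom D' & op_app D' x = y \<longleftrightarrow> (EX g. (x, y, g, cr t*g) \<in> T))"

lemma zero_T: "(0, 0, 0, 0) \<in> T"
proof -
  obtain x h z where "(x, z *\<^sub>C x, 1, h) \<in> T" using gamma_ex by blast
  from T_scale[OF this, of 0] show ?thesis by simp
qed

text \<open>Symmetry is Green's formula with real t. Surjectivity of D' - z is Krein's ansatz R z y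
  + c \<open>gam z\<close>, solvable because \<open>wey z\<close> is not real. The swapped triple
  then makes all later statements available for D' as well.\<close>

lemma perturbed_triple:
  assumes D': "perturbed t D'"
  shows "boundary_triple D' (shift_triple t T)"
proof -
  have gr: "x \<in> op_dom D' & op_app D' x = y \<longleftrightarrow> (EX g. (x, y, g, cr t*g) \<in> T)" for x y
    using D' by (simp add: perturbed_def)
  have inT: "EX g. (x, op_app D' x, g, cr t*g) \<in> T" if "x \<in> op_dom D'" for x
    using gr[of x "op_app D' x"] that by simp
  have add: "x + y \<in> op_dom D' & op_app D' (x + y) = op_app D' x + op_app D' y" if xy: "x \<in> op_dom D'" "y \<in> op_dom D'" for x y
  proof -
    obtain g g' where "(x, op_app D' x, g, cr t*g) \<in> T" "(y, op_app D' y, g', cr t*g') \<in> T"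
      using inT xy by blast
    from T_add[OF this] show ?thesis unfolding gr by (intro exI[of _ "g + g'"]) (simp add: distrib_left)
  qed
  have scale: "c *\<^sub>C x \<in> op_dom D' & op_app D' (c *\<^sub>C x) = c *\<^sub>C op_app D' x" if x: "x \<in> op_dom D'" for x c
  proof -
    obtain g where "(x, op_app D' x, g, cr t*g) \<in> T" using inT x by blast
    from T_scale[OF this, of c] show ?thesis unfolding gr by (intro exI[of _ "c*g"]) (simp add: mult_ac)
  qed
  have zero: "0 \<in> op_dom D'" using gr[of 0 0] zero_T by (metis mult_zero_right)
  have lin': "linear_op D'" unfolding linear_op_def complex_vector.subspace_def using add scale zero by blast
  have sur: "EX x:op_dom D'. op_app D' x - z *\<^sub>C x = y" if z: "Im z ~= 0" for z y
  proof -
    have zr: "z \<in> resolvent_set D" "cnj z \<in> resolvent_set D" using z by (auto intro: nonreal_in_resolvent_set)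
    have "Im (wey z) ~= 0" using z gam_neq_0[OF zr(1)] by (simp add: Im_wey[OF zr(1)])
    hence ne: "cr t - wey z ~= 0" by auto
    \<comment> \<open>Determined by the boundary condition: the second boundary value (gam (cnj z),
      y) + c wey z must equal t c.\<close>
    define c where "c = cinner (gam (cnj z)) y/(t - wey z)"
    let ?x = "R z y + c *\<^sub>C gam z"
    have "(?x, (y + z *\<^sub>C R z y) + c *\<^sub>C z *\<^sub>C gam z, 0 + c*1, cinner (gam (cnj z)) y + c*wey z) \<in> T"
      by (rule T_add[OF resolvent_T[OF zr] T_scale[OF gam_T[OF zr(1)]]])
    moreover have "cinner (gam (cnj z)) y + c*wey z = t*c"
    proof -
      have "cinner (gam (cnj z)) y = c*(t - wey z)" using ne by (simp add: c_def)
      thus ?thesis by (simp add: algebra_simps)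
    qed
    moreover have "(y + z *\<^sub>C R z y) + c *\<^sub>C z *\<^sub>C gam z = y + z *\<^sub>C ?x"
      by (simp add: scaleC_add_right scaleC_scaleC mult.commute)
    ultimately have "(?x, y + z *\<^sub>C ?x, c, t*c) \<in> T" by (simp only: add_0 mult_1_right)
    hence "?x \<in> op_dom D' & op_app D' ?x = y + z *\<^sub>C ?x" unfolding gr by blast
    thus ?thesis by (intro bexI[of _ ?x]) auto
  qed
  have sa: "self_adjoint D'"
  proof (rule self_adjointI[OF lin'])
    fix x y assume "x \<in> op_dom D'" "y \<in> op_dom D'"
    then obtain g g' where "(x, op_app D' x, g, cr t*g) \<in> T" "(y, op_app D' y, g', cr t*g') \<in> T"
      using inT by blast
    from green[OF this] show "cinner x (op_app D' y) = cinner (op_app D' x) y" by simp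
  next
    show "EX x:op_dom D'. op_app D' x + \<i> *\<^sub>C x = y" for y using sur[of "-\<i>" y] by (simp add: scaleC_minus_left)
    show "EX x:op_dom D'. op_app D' x - \<i> *\<^sub>C x = y" for y using sur[of "\<i>" y] by simp
  qed
  let ?T = "shift_triple t T"
  have T': "(x, y, g', h') \<in> ?T \<longleftrightarrow> (x, y, - h', g' - cr t*h') \<in> T" for x y g' h'
  proof
    assume "(x, y, g', h') \<in> ?T"
    thus "(x, y, - h', g' - cr t*h') \<in> T" by auto
  next
    assume "(x, y, - h', g' - cr t*h') \<in> T"
    thus "(x, y, g', h') \<in> ?T" by (intro CollectI exI[of _ x] exI[of _ y] exI[of _ "- h'"] exI[of _ "g' - cr t*h'"]) auto
  qed
  show ?thesis
  proof (unfold_locales, unfold T')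
    show "self_adjoint D'" by (rule sa)
    fix x y g h x' y' g' h' assume 1: "(x, y, - h, g - cr t*h) \<in> T" and 2: "(x', y', - h', g' - cr t*h') \<in> T"
    show "(x + x', y + y', - (h + h'), g + g' - cr t*(h + h')) \<in> T"
      using T_add[OF 1 2] by (simp add: algebra_simps)
    show "cinner x y' - cinner y x' = cnj g*h' - cnj h*g'" using green[OF 1 2] by (simp add: algebra_simps)
  next
    fix x y g h c assume 1: "(x, y, - h, g - cr t*h) \<in> T"
    show "(c *\<^sub>C x, c *\<^sub>C y, - (c*h), c*g - cr t*(c*h)) \<in> T"
      using T_scale[OF 1, of c] by (simp add: algebra_simps)
  next
    fix g h assume "(0, 0, - h, g - cr t*h) \<in> T"
    from T_uniq[OF this] show "g = 0 & h = 0" by auto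
  next
    fix x y
    have "(EX g. (x, y, g, cr t*g) \<in> T) \<longleftrightarrow> (EX h. (x, y, - h, 0 - cr t*h) \<in> T)"
    proof (intro iffI; elim exE)
      fix g assume "(x, y, g, cr t*g) \<in> T"
      thus "EX h. (x, y, - h, 0 - cr t*h) \<in> T" by (intro exI[of _ "- g"]) simp
    next
      fix h assume "(x, y, - h, 0 - cr t*h) \<in> T"
      thus "EX g. (x, y, g, cr t*g) \<in> T" by (intro exI[of _ "- h"]) simp
    qed
    thus "x \<in> op_dom D' & op_app D' x = y \<longleftrightarrow> (EX h. (x, y, - h, 0 - cr t*h) \<in> T)" using gr by simp
  next
    have z: "\<i> \<in> resolvent_set D" by (rule i_resolvent)
    have "Im (wey \<i>) ~= 0" using gam_neq_0[OF z] by (simp add: Im_wey[OF z])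
    hence ne: "wey \<i> - cr t ~= 0" by (auto simp: complex_eq_iff)
    define c where "c = 1/(wey \<i> - t)"
    have "(c *\<^sub>C gam \<i>, \<i> *\<^sub>C c *\<^sub>C gam \<i>, c, c*wey \<i>) \<in> T"
      using T_scale[OF gam_T[OF z], of c] by (simp add: scaleC_scaleC mult.commute)
    moreover have "c*wey \<i> = 1 - cr t*(- c)" using ne by (simp add: c_def field_simps)
    ultimately have "(c *\<^sub>C gam \<i>, \<i> *\<^sub>C c *\<^sub>C gam \<i>, - (- c), 1 - cr t*(- c)) \<in> T" by simp
    thus "EX x h z. Im z ~= 0 & (x, z *\<^sub>C x, - h, 1 - cr t*h) \<in> T"
      by (intro exI[of _ "c *\<^sub>C gam \<i>"] exI[of _ "- c"] exI[of _ "\<i>"]) simp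
  qed
qed

text \<open>In the swapped triple the condition h' = 0 means g = 0. Thus D is a perturbation of D',
  and results can be used in both directions.\<close>

lemma perturbed_back:
  assumes "perturbed t D'"
  shows "boundary_triple.perturbed (shift_triple t T) 0 D"
proof -
  interpret B: boundary_triple D' "shift_triple t T" by (rule perturbed_triple[OF assms])
  show ?thesis unfolding B.perturbed_def D_graph by auto
qed

text \<open>A form of Krein's formula that mixes the deficiency vectors of both operators and so
  avoids the denominator t - wey z. The scalar factor is controlled through the resolvent of D', the
  vector through that of D.\<close>

lemma resolvent_difference:
  assumes D': "perturbed t D'" and z: "Im z ~= 0"
  defines "b \<equiv> boundary_triple.gam (shift_triple t T)"
  shows "resolvent D' z v = R z v - cinner (b (cnj z)) v *\<^sub>C gam z"
proof -
  interpret B: boundary_triple D' "shift_triple t T" by (rule perturbed_triple[OF D'])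
  have zr: "z \<in> resolvent_set D" "z \<in> resolvent_set D'" "cnj z \<in> resolvent_set D'"
    using z by (auto intro: nonreal_in_resolvent_set B.nonreal_in_resolvent_set)
  define c where "c = cinner (b (cnj z)) v"
  have "(B.R z v, v + z *\<^sub>C B.R z v, 0, c) \<in> (shift_triple t T)"
    unfolding c_def b_def by (rule B.resolvent_T[OF zr(2,3)])
  hence "(B.R z v, v + z *\<^sub>C B.R z v, - c, - t*c) \<in> T" by auto
  from T_add[OF this T_scale[OF gam_T[OF zr(1)], of c]]
  have "(B.R z v + c *\<^sub>C gam z, v + z *\<^sub>C (B.R z v + c *\<^sub>C gam z), 0, - t*c + c*wey z) \<in> T"
    by (simp add: scaleC_add_right scaleC_scaleC mult.commute add.assoc)
  from T_resolvent_eq[OF zr(1) this] show ?thesis by (simp add: c_def algebra_simps)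
qed

text \<open>Subtracting g \<open>gam E\<close> from a vector of the domain of D' leads into the
  domain of D; the boundary condition determines g with denominator t - wey E. This bounds the
  inverse by K + |gam E|^2 / |t - wey E|, the constant \<open>M\<close>.\<close>

lemma resolvent_set_perturbed:
  assumes D': "perturbed t D'" and E: "cr E \<in> resolvent_set D" and ne: "wey (cr E) ~= t"
  shows "cr E \<in> resolvent_set D'"
proof -
  let ?E = "cr E"
  have gr: "x \<in> op_dom D' & op_app D' x = y \<longleftrightarrow> (EX g. (x, y, g, cr t*g) \<in> T)" for x y
    using D' by (simp add: perturbed_def)
  have Ec: "cnj ?E \<in> resolvent_set D" using E by simp
  interpret B: selfadj D' using perturbed_triple[OF D'] by (rule boundary_triple.axioms)
  obtain K where K: "K > 0" "!!x. norm (R ?E x) <= K*norm x"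
    using bounded_clinear_bound[OF resolvent_bounded[OF E]] by metis
  define c where "c = cmod (cr t - wey ?E)"
  have c: "c > 0" using ne by (auto simp: c_def)
  define M where "M = K + (norm (gam ?E))\<^sup>2/c"
  have M: "M > 0" using K(1) c by (simp add: M_def add_pos_nonneg)
  have low: "1/M*norm x <= norm (op_minus_scalar D' ?E x)" if x: "x \<in> op_dom D'" for x
  proof -
    define y where "y = op_minus_scalar D' ?E x"
    have "op_app D' x = y + ?E *\<^sub>C x" by (simp add: y_def op_minus_scalar_def)
    then obtain g where g: "(x, y + ?E *\<^sub>C x, g, cr t*g) \<in> T" using gr[of x "y + ?E *\<^sub>C x"] x by auto
    from T_diff[OF g T_scale[OF gam_T[OF E], of g]]
    have 1: "(x - g *\<^sub>C gam ?E, y + ?E *\<^sub>C (x - g *\<^sub>C gam ?E), 0, cr t*g - g*wey ?E) \<in> T"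
      by (simp add: scaleC_diff_right scaleC_scaleC mult.commute add_diff_eq)
    hence 2: "x - g *\<^sub>C gam ?E = R ?E y" by (rule T_resolvent_eq[OF E])
    have "g*(cr t - wey ?E) = cinner (gam ?E) y"
      using T_same(2)[OF 1[unfolded 2] resolvent_T[OF E Ec, of y]] by (simp add: algebra_simps)
    hence "cmod g*c <= norm (gam ?E)*norm y" unfolding c_def norm_mult[symmetric] by (simp add: cmod_cinner_le)
    hence "cmod g <= norm (gam ?E)*norm y/c" using c by (simp add: pos_le_divide_eq)
    hence "cmod g*norm (gam ?E) <= norm (gam ?E)*norm y/c*norm (gam ?E)" by (rule mult_right_mono) simp
    moreover have "norm (gam ?E)*norm y/c*norm (gam ?E) + K*norm y = M*norm y"
      by (simp add: M_def power2_eq_square distrib_right)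
    ultimately have "norm x <= M*norm y"
      using norm_triangle_sub[of x "g *\<^sub>C gam ?E"] K(2)[of y] unfolding 2 norm_scaleC by linarith
    thus ?thesis using M by (simp add: y_def[symmetric] field_simps)
  qed
  show ?thesis by (rule B.resolvent_setI[of "1/M"]) (use M low in auto)
qed

end

section \<open>Stability of spectrum and of singularity under perturbation\<close>

context selfadj
begin

text \<open>Openness of the resolvent set along the real axis, with one radius that also bounds all
  the resolvents nearby.\<close>

lemma resolvent_set_near:
  assumes E0: "cr E0 \<in> resolvent_set D"
  obtains r where "r > 0"
    "!!E y. \<bar>E - E0\<bar> <= r ==> cr E \<in> resolvent_set D & r*norm (R (cr E) y) <= norm y"
proof -
  obtain K where K: "!!x. x \<in> op_dom D ==> norm x <= K*norm (op_minus_scalar D (cr E0) x)"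
    using E0 unfolding resolvent_set_def by blast
  define r where "r = 1/(2*(\<bar>K\<bar> + 1))"
  have r: "r > 0" by (simp add: r_def)
  have low: "r*norm x <= norm (op_minus_scalar D (cr E) x)" if x: "x \<in> op_dom D" and E: "\<bar>E - E0\<bar> <= r" for x E
  proof -
    have "norm x <= (\<bar>K\<bar> + 1)*norm (op_minus_scalar D (cr E0) x)"
      by (rule order_trans[OF K[OF x] mult_right_mono]) auto
    hence "2*r*norm x <= norm (op_minus_scalar D (cr E0) x)" by (simp add: r_def field_simps)
    moreover have "op_minus_scalar D (cr E0) x = op_minus_scalar D (cr E) x + (E - E0) *\<^sub>R x"
      by (simp add: op_minus_scalar_def scaleR_scaleC scaleC_diff_left)
    hence "norm (op_minus_scalar D (cr E0) x) <= norm (op_minus_scalar D (cr E) x) + \<bar>E - E0\<bar>*norm x"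
      using norm_triangle_ineq[of "op_minus_scalar D (cr E) x" "(E - E0) *\<^sub>R x"] by simp
    moreover have "\<bar>E - E0\<bar>*norm x <= r*norm x" using E by (rule mult_right_mono) simp
    ultimately show ?thesis by linarith
  qed
  have "cr E \<in> resolvent_set D & r*norm (R (cr E) y) <= norm y" if E: "\<bar>E - E0\<bar> <= r" for E y
  proof
    show Er: "cr E \<in> resolvent_set D" by (rule resolvent_setI[OF r]) (use low E in auto)
    show "r*norm (R (cr E) y) <= norm y"
      using low[OF resolvent_in_dom[OF Er] E, of y] resolvent_right[OF Er, of y] by (simp add: op_minus_scalar_def)
  qed
  with that r show thesis by blast
qed

end

context boundary_triple
begin

text \<open>On the resolvent set, \<open>wey\<close> is strictly monotone along the real line. Hence a point of the
  resolvent set of \<open>D\<close> can at most be an isolated point of the spectrum of \<open>D'\<close>.\<close>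

lemma interval_in_spectrum_perturbed:
  assumes D': "perturbed t D'" and ab: "a < b" and sp: "interval_in_spectrum D' a b"
  shows "interval_in_spectrum D a b" unfolding interval_in_spectrum_def
proof
  fix z assume "z \<in> cr ` {a..b}"
  then obtain E0 where E0: "E0 \<in> {a..b}" "z = cr E0" by blast
  show "z \<in> spectrum D"
  proof (rule ccontr)
    assume "z \<notin> spectrum D"
    hence E0r: "cr E0 \<in> resolvent_set D" by (simp add: E0 spectrum_def)
    obtain r where r: "r > 0" "!!E y. \<bar>E - E0\<bar> <= r ==> cr E \<in> resolvent_set D & r*norm (R (cr E) y) <= norm y"
      using resolvent_set_near[OF E0r] by blast
    have "EX E. E \<in> {a..b} & E ~= E0 & \<bar>E - E0\<bar> <= r/2"
    proof (cases "E0 < b")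
      case True
      thus ?thesis using E0(1) r(1) by (intro exI[of _ "min b (E0 + r/2)"]) (auto simp: min_def)
    next
      case False
      thus ?thesis using E0(1) r(1) ab by (intro exI[of _ "max a (E0 - r/2)"]) (auto simp: max_def)
    qed
    then obtain E where E: "E \<in> {a..b}" "E ~= E0" "\<bar>E - E0\<bar> <= r/2" by blast
    have Er: "cr E \<in> resolvent_set D" "r*norm (R (cr E) y) <= norm y" for y
      using r(2)[of E y] E(3) r(1) by auto
    have w: "wey (cr F) = t" if "F \<in> {a..b}" "cr F \<in> resolvent_set D" for F
    proof (rule ccontr)
      assume "wey (cr F) ~= t"
      from resolvent_set_perturbed[OF D' that(2) this] show False
        using sp that(1) unfolding interval_in_spectrum_def spectrum_def by blast
    qed
    let ?g = "gam (cr E0)" and ?e = "cr (E - E0)"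
    \<comment> \<open>Both points have Weyl function t, so Green's formula makes the two deficiency
      vectors orthogonal; yet for |E - E0| at most r/2 they differ by at most half the norm of the
      one at E0.\<close>
    have "?e*cinner ?g (gam (cr E)) = 0"
      using wey_green[OF Er(1) E0r] w[OF E0(1) E0r] w[OF E(1) Er(1)] by simp
    hence "cinner ?g (gam (cr E)) = 0" using E(2) by simp
    hence "cinner ?g ?g = - (?e*cinner ?g (R (cr E) ?g))"
      unfolding gam_resolvent[OF Er(1) E0r] by (simp add: cinner_simps eq_neg_iff_add_eq_0)
    hence "(norm ?g)\<^sup>2 = \<bar>E - E0\<bar>*cmod (cinner ?g (R (cr E) ?g))"
      by (metis cinner_self norm_minus_cancel norm_mult norm_of_real abs_power2 power2_abs)
    also have "... <= r/2*(norm ?g*norm (R (cr E) ?g))"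
      using r(1) by (intro mult_mono E(3) cmod_cinner_le) auto
    also have "... = norm ?g*(r*norm (R (cr E) ?g))/2" by simp
    also have "... <= norm ?g*norm ?g/2" by (intro divide_right_mono mult_left_mono Er(2)) auto
    finally show False using gam_neq_0[OF E0r] by (simp add: power2_eq_square)
  qed
qed

text \<open>By the resolvent difference, e |R' v|^2 is at most 2 e |R v|^2 plus 2 |k|^2 e |gam z|^2.
  The terms with R and \<open>gam\<close> tend to 0 in measure by hypothesis on D, and k is bounded
  in measure by the weak type estimate for D'. There is no circularity, as that estimate holds for
  every self-adjoint operator.\<close>

lemma no_ac_spectrum_perturbed:
  assumes D': "perturbed t D'" and ab: "a < b" and nac: "no_ac_spectrum_on D a b"
  shows "no_ac_spectrum_on D' a b"
proof -
  interpret B: boundary_triple D' "shift_triple t T" by (rule perturbed_triple[OF D'])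
  define e where "e n = inverse (real (Suc n))" for n
  have e: "e n > 0" "e n <= 1" for n by (auto simp: e_def inverse_eq_divide)
  define M where "M = \<bar>a\<bar> + \<bar>b\<bar> + 2"
  have M: "M >= 1" by (simp add: M_def)
  have zM: "cmod (Complex x (e n) + \<i>) <= M" "cmod (Complex x (e n) - \<i>) <= M" if "x \<in> {a..b}" for x n
    using that e[of n] cmod_le[of "Complex x (e n) + \<i>"] cmod_le[of "Complex x (e n) - \<i>"] by (auto simp: M_def)
  define \<gamma> \<beta> where "\<gamma> = gam \<i>" and "\<beta> = B.gam \<i>"
  let ?q = "%n. e n*(2*(norm \<gamma>)\<^sup>2)"
  have van: "vanishes_on a b (im_res v)" for v using nac by (simp add: no_ac_spectrum_iff)
  have "vanishes_on a b (B.im_res v)" for v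
  proof -
    \<comment> \<open>Dominates the scalar factor (B.gam (cnj z), v), after expansion of the
      deficiency vector around \<open>\<i>\<close>; \<open>M\<close> bounds |z + i| and |z -
      i|.\<close>
    define c where "c n x = cmod (cinner \<beta> v) + M*cmod (cinner \<beta> (B.R (Complex x (e n)) v))" for n x
    have [measurable]: "c n \<in> borel_measurable borel" for n
      unfolding c_def by (intro borel_measurable_continuous_onI continuous_intros B.cinner_resolvent_continuous e)
    \<comment> \<open>Dominates e |gam z|^2, again by expansion around \<open>\<i>\<close>: the
      constant term carries the factor e, the other is a Poisson integral.\<close>
    define w where "w n x = ennreal (?q n) + ennreal (2*M\<^sup>2)*im_res \<gamma> n x" for n x
    have [measurable]: "w n \<in> borel_measurable borel" for n unfolding w_def by measurable
    have vw: "vanishes_on a b w" unfolding w_def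
    proof (rule vanishes_on_add)
      show "vanishes_on a b (%n x. ennreal (?q n))" unfolding vanishes_on_def
      proof (rule tendsto_sandwich[OF _ _ tendsto_const])
        show "\<forall>\<^sub>F n in sequentially. (\<integral>\<^sup>+x. min 1 (ennreal (?q n))*indicator {a..b} x \<partial>lborel) <= ennreal (?q n*(b - a))"
        proof (intro always_eventually allI)
          fix n
          have "(\<integral>\<^sup>+x. min 1 (ennreal (?q n))*indicator {a..b} x \<partial>lborel) <= (\<integral>\<^sup>+x. ennreal (?q n)*indicator {a..b} x \<partial>lborel)"
            by (intro nn_integral_mono mult_right_mono) auto
          also have "... = ennreal (?q n)*ennreal (b - a)" using ab by (simp add: nn_integral_cmult_indicator)
          also have "... = ennreal (?q n*(b - a))" using ab e[of n] by (intro ennreal_mult[symmetric]) auto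
          finally show "(\<integral>\<^sup>+x. min 1 (ennreal (?q n))*indicator {a..b} x \<partial>lborel) <= ennreal (?q n*(b - a))" .
        qed
        have "(%n. ennreal (?q n*(b - a))) ----> ennreal (0*(2*(norm \<gamma>)\<^sup>2)*(b - a))"
          unfolding e_def by (intro tendsto_ennrealI tendsto_intros LIMSEQ_inverse_real_of_nat)
        thus "(%n. ennreal (?q n*(b - a))) ----> 0" by simp
      qed simp
      show "vanishes_on a b (%n x. ennreal (2*M\<^sup>2)*im_res \<gamma> n x)"
      proof (rule vanishes_on_le[OF van order_refl])
        show "1 <= 2*M\<^sup>2" using power_mono[OF M, of 2] by simp
      qed simp
    qed measurable
    have "vanishes_on a b (%n x. ennreal ((c n x)\<^sup>2)*w n x)"
    proof (rule vanishes_on_mult_bounded[OF vw])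
      fix d :: real assume d: "d > 0"
      obtain K where K: "K > 0" "!!e. e > 0 ==> emeasure lborel {x \<in> {a..b}. K <= cmod (cinner \<beta> (B.R (Complex x e) v))} <= ennreal d"
        using B.resolvent_weak_type[OF ab d] by metis
      show "EX K>0. ALL n. emeasure lborel {x \<in> {a..b}. K <= c n x} <= ennreal d"
      proof (intro exI[of _ "cmod (cinner \<beta> v) + M*K"] conjI allI)
        show "0 < cmod (cinner \<beta> v) + M*K" using K M by (intro add_nonneg_pos) auto
        have "{x \<in> {a..b}. cmod (cinner \<beta> v) + M*K <= c n x} = {x \<in> {a..b}. K <= cmod (cinner \<beta> (B.R (Complex x (e n)) v))}" for n
          using M by (auto simp: c_def)
        thus "emeasure lborel {x \<in> {a..b}. cmod (cinner \<beta> v) + M*K <= c n x} <= ennreal d" for n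
          using K(2)[OF e(1)[of n]] by simp
      qed
    next
      show "0 <= c n x" for n x using M by (simp add: c_def)
    qed measurable
    from vanishes_on_add[OF van[of v] this]
    have "vanishes_on a b (%n x. im_res v n x + ennreal ((c n x)\<^sup>2)*w n x)" by measurable
    thus ?thesis
    proof (rule vanishes_on_le[where C = 2])
      fix n x assume x: "x \<in> {a..b}"
      define z where "z = Complex x (e n)"
      have z: "Im z ~= 0" using e(1)[of n] by (simp add: z_def)
      have zr: "z \<in> resolvent_set D" "cnj z \<in> resolvent_set D'"
        using z by (auto intro: nonreal_in_resolvent_set B.nonreal_in_resolvent_set)
      define k where "k = cinner (B.gam (cnj z)) v"
      have "k = cinner \<beta> v + (z + \<i>)*cinner \<beta> (B.R z v)"
      proof -
        have "B.gam (cnj z) = \<beta> + (cnj z - \<i>) *\<^sub>C B.R (cnj z) \<beta>"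
          unfolding \<beta>_def by (rule B.gam_resolvent[OF zr(2) B.i_resolvent(1)])
        moreover have "cinner (B.R (cnj z) \<beta>) v = cinner \<beta> (B.R z v)"
          using z by (intro B.resolvent_adjoint[symmetric] B.nonreal_in_resolvent_set) auto
        ultimately show ?thesis by (simp add: k_def cinner_simps)
      qed
      hence "cmod k <= cmod (cinner \<beta> v) + cmod (z + \<i>)*cmod (cinner \<beta> (B.R z v))"
        by (simp add: norm_triangle_ineq norm_mult[symmetric] del: norm_mult)
      also have "... <= c n x" unfolding c_def z_def by (intro add_left_mono mult_right_mono zM x) simp
      finally have kc: "cmod k <= c n x" .
      have "(norm (B.R z v))\<^sup>2 <= 2*(norm (R z v))\<^sup>2 + 2*(norm (- (k *\<^sub>C gam z)))\<^sup>2"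
        unfolding resolvent_difference[OF D' z] k_def[symmetric]
        using norm_add_sq_le[of "R z v" "- (k *\<^sub>C gam z)"] by simp
      also have "(norm (- (k *\<^sub>C gam z)))\<^sup>2 = (cmod k)\<^sup>2*(norm (gam z))\<^sup>2" by (simp add: power_mult_distrib)
      also have "(cmod k)\<^sup>2*(norm (gam z))\<^sup>2 <= (c n x)\<^sup>2*(norm (gam z))\<^sup>2"
        using kc by (intro mult_right_mono power_mono) auto
      also have "(norm (gam z))\<^sup>2 <= 2*(norm \<gamma>)\<^sup>2 + 2*(M\<^sup>2*(norm (R z \<gamma>))\<^sup>2)"
      proof -
        have "gam z = \<gamma> + (z - \<i>) *\<^sub>C R z \<gamma>" unfolding \<gamma>_def by (rule gam_resolvent[OF zr(1) i_resolvent(1)])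
        hence "(norm (gam z))\<^sup>2 <= 2*(norm \<gamma>)\<^sup>2 + 2*((cmod (z - \<i>))\<^sup>2*(norm (R z \<gamma>))\<^sup>2)"
          using norm_add_sq_le[of \<gamma> "(z - \<i>) *\<^sub>C R z \<gamma>"] by (simp add: power_mult_distrib)
        also have "(cmod (z - \<i>))\<^sup>2*(norm (R z \<gamma>))\<^sup>2 <= M\<^sup>2*(norm (R z \<gamma>))\<^sup>2"
          unfolding z_def by (intro mult_right_mono power_mono zM x) auto
        finally show ?thesis by simp
      qed
      finally have "(norm (B.R z v))\<^sup>2 <= 2*((norm (R z v))\<^sup>2 + (c n x)\<^sup>2*(2*(norm \<gamma>)\<^sup>2 + 2*(M\<^sup>2*(norm (R z \<gamma>))\<^sup>2)))"
        by (simp add: mult_left_mono)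
      hence "e n*(norm (B.R z v))\<^sup>2 <= e n*(2*((norm (R z v))\<^sup>2 + (c n x)\<^sup>2*(2*(norm \<gamma>)\<^sup>2 + 2*(M\<^sup>2*(norm (R z \<gamma>))\<^sup>2))))"
        using e(1)[of n] by (intro mult_left_mono) auto
      also have "... = 2*(e n*(norm (R z v))\<^sup>2 + (c n x)\<^sup>2*(?q n + 2*M\<^sup>2*(e n*(norm (R z \<gamma>))\<^sup>2)))"
        by (simp add: algebra_simps)
      finally have "ennreal (e n*(norm (B.R z v))\<^sup>2) <= ennreal (2*(e n*(norm (R z v))\<^sup>2 + (c n x)\<^sup>2*(?q n + 2*M\<^sup>2*(e n*(norm (R z \<gamma>))\<^sup>2))))"
        by (rule ennreal_leI)
      also have "... = ennreal 2*(ennreal (e n*(norm (R z v))\<^sup>2) + ennreal ((c n x)\<^sup>2)*(ennreal (?q n) + ennreal (2*M\<^sup>2)*ennreal (e n*(norm (R z \<gamma>))\<^sup>2)))"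
      proof -
        have "ennreal (2*(p + q*(r + u*w))) = ennreal 2*(ennreal p + ennreal q*(ennreal r + ennreal u*ennreal w))"
          if "0 <= p" "0 <= q" "0 <= r" "0 <= u" "0 <= w" for p q r u w :: real
          using that by (simp add: ennreal_mult distrib_left del: ennreal_numeral)
        thus ?thesis using e(1)[of n] by simp
      qed
      finally show "B.im_res v n x <= ennreal 2*(im_res v n x + ennreal ((c n x)\<^sup>2)*w n x)"
        unfolding im_res_def B.im_res_def w_def e_def[symmetric] z_def[symmetric]
        unfolding z_def Im_resolvent(2)[OF e(1)] B.Im_resolvent(2)[OF e(1)] .
    qed simp_all
  qed
  thus ?thesis by (simp add: B.no_ac_spectrum_iff)
qed

end

section \<open>Eigenvalues of the perturbed operators\<close>

lemma dense_gdelta_in_countable_Int: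
  fixes S :: "real set"
  assumes S: "closed S" and N: "countable \<N>" and op: "!!N. N \<in> \<N> ==> closed N"
    and dense: "!!N. N \<in> \<N> ==> S \<subseteq> closure (S - N)"
  shows "dense_gdelta_in S (S - \<Union>\<N>)"
proof -
  \<comment> \<open>\<open>S\<close> itself is inserted so that the intersection stays inside
    \<open>S\<close> even for an empty family.\<close>
  have eq: "S - \<Union>\<N> = \<Inter> (insert S ((%N. S - N) ` \<N>))" by auto
  have opn: "openin (top_of_set S) (S - N)" if "N \<in> \<N>" for N
    using op[OF that] by (metis Diff_eq open_Compl openin_open_Int)
  have "S \<subseteq> closure (\<Inter> (insert S ((%N. S - N) ` \<N>)))"
  proof (rule Baire[OF S])
    show "countable (insert S ((%N. S - N) ` \<N>))" using N by simp
    fix T assume "T \<in> insert S ((%N. S - N) ` \<N>)"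
    thus "openin (top_of_set S) T & S \<subseteq> closure T" using opn dense closure_subset[of S] by auto
  qed
  hence "(top_of_set S) closure_of (S - \<Union>\<N>) = S"
    unfolding eq[symmetric] by (simp add: closure_of_subtopology Int_absorb1 Diff_subset) (auto simp: Int_absorb2)
  moreover have "gdelta_in (top_of_set S) (S - \<Union>\<N>)" unfolding eq
  proof (rule gdelta_in_Inter)
    show "countable (insert S ((%N. S - N) ` \<N>))" using N by simp
    fix T assume "T \<in> insert S ((%N. S - N) ` \<N>)"
    hence "openin (top_of_set S) T" using opn by auto
    thus "gdelta_in (top_of_set S) T" by (rule open_imp_gdelta_in)
  qed simp
  ultimately show ?thesis by (simp add: dense_gdelta_in_def)
qed

lemma closure_Icc_Diff_nowhere_dense:
  fixes a b :: real
  assumes "a < b" and "interior N = {}"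
  shows "{a..b} \<subseteq> closure ({a..b} - N)"
proof -
  have "{a..b} = closure {a<..<b}" using assms(1) by simp
  also have "closure {a<..<b} \<subseteq> closure ({a..b} - N)"
  proof (rule closure_minimal)
    show "{a<..<b} \<subseteq> closure ({a..b} - N)"
    proof
      fix x assume x: "x \<in> {a<..<b}"
      show "x \<in> closure ({a..b} - N)" unfolding closure_iff_nhds_not_empty
      proof (intro allI impI notI)
        fix A V assume V: "V \<subseteq> A" "open V" "x \<in> V" and e: "({a..b} - N) \<inter> A = {}"
        have "{a<..<b} \<inter> V \<subseteq> N" using e V(1) greaterThanLessThan_subseteq_atLeastAtMost_iff[of a b a b] by blast
        hence "{a<..<b} \<inter> V \<subseteq> interior N" using V(2) by (intro interior_maximal) auto
        thus False using assms(2) x V(3) by auto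
      qed
    qed
  qed simp
  finally show ?thesis .
qed

text \<open>An interval in the image would be carried back by the continuous inverse to a connected
  subset of \<open>K\<close> with two points, hence to an interval in \<open>K\<close>.\<close>

lemma inj_image_nowhere_dense:
  fixes f :: "real => real"
  assumes K: "compact K" "interior K = {}" and f: "continuous_on K f" and inj: "inj_on f K"
  shows "closed (f ` K)" "interior (f ` K) = {}"
proof -
  show "closed (f ` K)" by (rule compact_imp_closed[OF compact_continuous_image[OF f K(1)]])
  show "interior (f ` K) = {}"
  proof (rule ccontr)
    assume "interior (f ` K) ~= {}"
    then obtain y e where e: "e > 0" "cball y e \<subseteq> f ` K" unfolding mem_interior_cball[symmetric] by (metis all_not_in_conv mem_interior_cball)
    hence sub: "{y..y + e} \<subseteq> f ` K" by (auto simp: cball_eq_atLeastAtMost)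
    let ?g = "inv_into K f"
    have gK: "?g ` {y..y + e} \<subseteq> K" using sub by (auto intro: inv_into_into)
    have "connected (?g ` {y..y + e})"
      by (intro connected_continuous_image continuous_on_subset[OF continuous_on_inv[OF f K(1)] sub])
        (auto simp: inv_into_f_f[OF inj])
    moreover have "?g y \<in> ?g ` {y..y + e}" "?g (y + e) \<in> ?g ` {y..y + e}" using e(1) by auto
    moreover have "?g y ~= ?g (y + e)"
      using f_inv_into_f[of y f K] f_inv_into_f[of "y + e" f K] sub e(1) by (metis (no_types) add_cancel_left_right atLeastAtMost_iff less_eq_real_def less_add_same_cancel1 order_refl subsetD less_irrefl)
    ultimately obtain p q where "p < q" "{p..q} \<subseteq> K" using connected_contains_Icc gK by (metis linorder_neqE order_trans)
    moreover from this(2) have "{p<..<q} \<subseteq> interior K" by (intro interior_maximal) auto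
    ultimately show False using K(2) by auto
  qed
qed

section \<open>Eigenvectors as limits of deficiency vectors\<close>

locale cyclic_boundary_triple = boundary_triple +
  assumes cyc: "(!!z. Im z ~= 0 ==> cinner (gam z) v = 0) ==> v = 0"
begin

text \<open>Closed because the bound is imposed at each e > 0 separately, where the norm depends
  continuously on E. Over all n these sets exhaust the energies of [a, b] that admit an eigenvector
  with g = 1.\<close>

definition G :: "real => real => nat => real set" where
  "G a b n = {E \<in> {a..b}. ALL e>0. norm (gam (Complex E e)) <= real n}"

lemma closed_G: "closed (G a b n)"
proof -
  have "G a b n = {a..b} \<inter> (\<Inter>e\<in>{0<..}. {E. norm (gam (Complex E e)) <= real n})"
    by (auto simp: G_def)
  also have "closed ..."
    by (intro closed_Int closed_INT ballI closed_Collect_le continuous_intros gam_continuous) auto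
  finally show ?thesis .
qed

lemma G_subset: "G a b n \<subseteq> {a..b}" by (auto simp: G_def)

text \<open>Green's formula makes such a vector orthogonal to all deficiency vectors. Hence
  eigenvectors of perturbed operators can be normalised to g = 1, and then they are unique.\<close>

lemma simple:
  assumes x: "(x, cr E *\<^sub>C x, 0, 0) \<in> T"
  shows "x = 0"
proof (rule cyc)
  fix z :: complex assume z: "Im z ~= 0"
  have "(cr E - cnj z)*cinner (gam z) x = 0"
    using green[OF gam_T[OF nonreal_in_resolvent_set[OF z]] x] by (simp add: cinner_simps algebra_simps)
  moreover have "cr E - cnj z ~= 0" using z by (auto simp: complex_eq_iff)
  ultimately show "cinner (gam z) x = 0" by simp
qed

text \<open>\<open>gam z\<close> arises from \<open>u\<close> by the function (x - E)/(x - z) of D,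
  whose modulus is at most 1 for z above E.\<close>

lemma norm_gam_le:
  assumes u: "(u, cr E *\<^sub>C u, 1, h) \<in> T" and e: "e > 0"
  shows "norm (gam (Complex E e)) <= norm u"
proof -
  define z where "z = Complex E e"
  have z: "Im z ~= 0" using e by (simp add: z_def)
  have g: "gam z = u + (z - cr E) *\<^sub>C R z u" by (rule gam_shift[OF nonreal_in_resolvent_set[OF z] u])
  have c: "calc (%x. 1 + (z - cr E)*(1/(cr x - z))) (%v. v + (z - cr E) *\<^sub>C R z v)"
    by (intro calc_add calc_scale calc_laur[OF laur_one] calc_resolvent z)
  have "cmod (1 + (z - cr E)*(1/(cr x - z))) <= 1" for x
  proof -
    have "cr x - z ~= 0" using z by simp
    hence "1 + (z - cr E)*(1/(cr x - z)) = cr (x - E)/(cr x - z)" by (simp add: field_simps)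
    moreover have "\<bar>x - E\<bar> <= cmod (cr x - z)"
      using abs_Re_le_cmod[of "cr x - z"] by (simp add: z_def)
    ultimately show ?thesis by (simp add: norm_divide divide_le_eq_1 del: of_real_diff)
  qed
  from calc_norm_le[OF c this, of u] show ?thesis unfolding z_def[symmetric] g by simp
qed

text \<open>Boundedness alone forces convergence. With q n the squared norms and e n = 1/(n + 1),
  Green's formula gives (e m + e n) |gam z_n - gam z_m|^2 = (e m - e n)(q n - q m). So q increases,
  converges because it is bounded, and controls the distances.\<close>

lemma eigen_limit:
  assumes E: "!!e. e > 0 ==> norm (gam (Complex E e)) <= M"
  obtains u h where "(u, cr E *\<^sub>C u, 1, h) \<in> T" "norm u <= M"
    "(%n. gam (Complex E (inverse (real (Suc n))))) ----> u"
proof -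
  define e where "e n = inverse (real (Suc n))" for n
  have e: "e n > 0" for n by (simp add: e_def)
  define z where "z n = Complex E (e n)" for n
  have zr: "z n \<in> resolvent_set D" for n using e[of n] by (intro nonreal_in_resolvent_set) (simp add: z_def)
  define q where "q n = (norm (gam (z n)))\<^sup>2" for n
  have key: "(e m + e n)*(norm (gam (z n) - gam (z m)))\<^sup>2 = (e m - e n)*(q n - q m)" for m n
  proof -
    have "Im ((z n - cnj (z m))*cinner (gam (z m)) (gam (z n))) = Im (wey (z n) - cnj (wey (z m)))"
      by (simp only: wey_green[OF zr zr])
    moreover have "z n - cnj (z m) = \<i>*cr (e n + e m)" by (simp add: z_def complex_eq_iff)
    moreover have "Im (wey (z k)) = e k*q k" for k by (simp only: Im_wey[OF zr] q_def) (simp add: z_def)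
    ultimately have "(e n + e m)*Re (cinner (gam (z m)) (gam (z n))) = e n*q n + e m*q m" by simp
    moreover have "Re (cinner (gam (z n)) (gam (z m))) = Re (cinner (gam (z m)) (gam (z n)))"
      by (metis cnj_cinner complex_cnj(1) cnj.simps(1))
    ultimately show ?thesis unfolding norm_diff_sq q_def[symmetric] by (simp add: algebra_simps)
  qed
  have en: "e n <= e m" if "m <= n" for m n using that by (simp add: e_def)
  have inc: "incseq q"
  proof (rule incseq_SucI)
    fix n
    have "e (Suc n) < e n" by (simp add: e_def)
    moreover have "0 <= (e n - e (Suc n))*(q (Suc n) - q n)"
      unfolding key[symmetric] using e[of n] e[of "Suc n"] by (intro mult_nonneg_nonneg) auto
    ultimately show "q n <= q (Suc n)" by (simp add: zero_le_mult_iff)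
  qed
  have M0: "0 <= M" using order_trans[OF norm_ge_zero E[of 1]] by simp
  have "q n <= M\<^sup>2" for n unfolding q_def z_def using E[OF e] by (intro power_mono) auto
  then obtain L where L: "q ----> L" using incseq_convergent[OF inc] by metis
  have qq: "(norm (gam (z n) - gam (z m)))\<^sup>2 <= \<bar>q n - q m\<bar>" for m n
  proof -
    have "(e m + e n)*(norm (gam (z n) - gam (z m)))\<^sup>2 <= \<bar>e m - e n\<bar>*\<bar>q n - q m\<bar>"
      unfolding key by (metis abs_ge_self abs_mult)
    also have "... <= (e m + e n)*\<bar>q n - q m\<bar>" using e[of m] e[of n] by (intro mult_right_mono) auto
    finally show ?thesis using e[of m] e[of n] by (simp add: mult_le_cancel_left_pos add_pos_pos)
  qed
  have "Cauchy (%n. gam (z n))"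
  proof (rule metric_CauchyI)
    fix r :: real assume r: "r > 0"
    then obtain N where N: "!!m n. m >= N ==> n >= N ==> \<bar>q m - q n\<bar> < r\<^sup>2"
      using LIMSEQ_imp_Cauchy[OF L] unfolding Cauchy_def dist_real_def by (metis zero_less_power)
    have "dist (gam (z m)) (gam (z n)) < r" if "m >= N" "n >= N" for m n
    proof -
      have "(norm (gam (z m) - gam (z n)))\<^sup>2 < r\<^sup>2" using qq[of m n] N[OF that] by linarith
      thus ?thesis using r by (simp add: dist_norm power_less_imp_less_base)
    qed
    thus "EX N. ALL m>=N. ALL n>=N. dist (gam (z m)) (gam (z n)) < r" by blast
  qed
  then obtain u where u: "(%n. gam (z n)) ----> u" using Cauchy_convergent_iff convergent_def by blast
  have zl: "z ----> cr E"
  proof -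
    have "(%n. cr E + \<i>*cr (e n)) ----> cr E + \<i>*cr 0"
      unfolding e_def by (intro tendsto_intros LIMSEQ_inverse_real_of_nat)
    thus ?thesis by (simp add: z_def[abs_def] Complex_eq)
  qed
  \<comment> \<open>The deficiency vectors are not in the domain of D, but their differences from
    \<open>gam \<i>\<close> are; there the closed graph applies.\<close>
  have dz: "gam (z n) - gam \<i> \<in> op_dom D" "op_app D (gam (z n) - gam \<i>) = z n *\<^sub>C gam (z n) - \<i> *\<^sub>C gam \<i>" for n
    using T_in_dom T_diff[OF gam_T[OF zr[of n]] gam_T[OF i_resolvent(1)]] by simp_all
  have "(%n. gam (z n) - gam \<i>) ----> u - gam \<i>" by (intro tendsto_intros u)
  note * = this
  have "(%n. op_app D (gam (z n) - gam \<i>)) ----> cr E *\<^sub>C u - \<i> *\<^sub>C gam \<i>"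
    unfolding dz by (intro tendsto_intros u zl)
  note closed_graph[where x = "%n. gam (z n) - gam \<i>", OF dz(1)*this]
  hence "op_app D (u - gam \<i>) = cr E *\<^sub>C u - \<i> *\<^sub>C gam \<i>"
    "u - gam \<i> \<in> op_dom D" by simp_all
  then obtain h where "(u - gam \<i>, cr E *\<^sub>C u - \<i> *\<^sub>C gam \<i>, 0, h) \<in> T"
    using D_graph by blast
  from T_add[OF this gam_T[OF i_resolvent(1)]] have "(u, cr E *\<^sub>C u, 1, h + wey \<i>) \<in> T" by simp
  moreover have "norm u <= M"
    by (rule LIMSEQ_le_const2[OF tendsto_norm[OF u]]) (use E e in \<open>auto simp: z_def\<close>)
  ultimately show ?thesis using that u by (simp add: z_def e_def)
qed

text \<open>The eigenvector normalised by g = 1 together with its second boundary value, the only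
  parameter t for which E is an eigenvalue. Green's formula makes it real. Where no such vector
  exists the value is arbitrary.\<close>

definition eig :: "real => 'a \<times> real" where
  "eig E = (SOME p. (fst p, cr E *\<^sub>C fst p, 1, cr (snd p)) \<in> T)"

abbreviation "eu E \<equiv> fst (eig E)"
abbreviation "ef E \<equiv> snd (eig E)"

lemma eig_real:
  assumes u: "(u, cr E *\<^sub>C u, 1, h) \<in> T"
  shows "h = cr (Re h)"
proof -
  have "cnj h = h" using green[OF u u] by (simp add: cinner_simps)
  thus ?thesis by (simp add: complex_eq_iff)
qed

lemma eig_T:
  assumes u: "(u, cr E *\<^sub>C u, 1, h) \<in> T"
  shows "(eu E, cr E *\<^sub>C eu E, 1, cr (ef E)) \<in> T"
proof -
  have "EX p. (fst p, cr E *\<^sub>C fst p, 1, cr (snd p)) \<in> T"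
    using u eig_real[OF u] by (intro exI[of _ "(u, Re h)"]) simp
  from someI_ex[OF this] show ?thesis unfolding eig_def .
qed

lemma eig_unique:
  assumes u: "(u, cr E *\<^sub>C u, 1, h) \<in> T"
  shows "u = eu E" "h = cr (ef E)"
proof -
  have r: "cnj h = h" using eig_real[OF u] by (metis complex_cnj_complex_of_real)
  show h: "h = cr (ef E)" using green[OF u eig_T[OF u]] by (simp add: cinner_simps r)
  have "(u - eu E, cr E *\<^sub>C (u - eu E), 0, 0) \<in> T"
    using T_diff[OF u eig_T[OF u]] by (simp add: h scaleC_diff_right)
  thus "u = eu E" using simple by fastforce
qed

lemma G_eig:
  assumes "E \<in> G a b n"
  shows "(eu E, cr E *\<^sub>C eu E, 1, cr (ef E)) \<in> T" "norm (eu E) <= real n"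
    "(%n. gam (Complex E (inverse (real (Suc n))))) ----> eu E"
proof -
  have "!!e. e > 0 ==> norm (gam (Complex E e)) <= real n" using assms by (simp add: G_def)
  from eigen_limit[OF this] obtain u h where *: "(u, cr E *\<^sub>C u, 1, h) \<in> T" "norm u <= real n"
    "(%n. gam (Complex E (inverse (real (Suc n))))) ----> u" by blast
  show "(eu E, cr E *\<^sub>C eu E, 1, cr (ef E)) \<in> T" by (rule eig_T[OF *(1)])
  show "norm (eu E) <= real n" "(%n. gam (Complex E (inverse (real (Suc n))))) ----> eu E"
    using *(2,3) eig_unique(1)[OF *(1)] by simp_all
qed

lemma eig_in_G:
  assumes "(u, cr E *\<^sub>C u, 1, h) \<in> T" "E \<in> {a..b}"
  shows "EX n. E \<in> G a b n"
proof -
  obtain n :: nat where "norm u <= real n" using real_arch_simple by blast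
  thus ?thesis using norm_gam_le[OF assms(1)] assms(2) by (auto simp: G_def intro: order_trans)
qed

lemma perturbed_eigenvalue:
  assumes D': "perturbed t D'" and E: "eigenvalue D' (cr E)" "E \<in> {a..b}"
  shows "EX n. E \<in> G a b n & ef E = t"
proof -
  obtain x where x: "x \<in> op_dom D'" "x ~= 0" "op_app D' x = cr E *\<^sub>C x"
    using E(1) by (auto simp: eigenvalue_def)
  then obtain g where g: "(x, cr E *\<^sub>C x, g, cr t*g) \<in> T" using D' by (auto simp: perturbed_def)
  have "g ~= 0"
  proof
    assume "g = 0"
    hence "(x, cr E *\<^sub>C x, 0, 0) \<in> T" using g by simp
    thus False using simple x(2) by blast
  qed
  hence u: "((1/g) *\<^sub>C x, cr E *\<^sub>C (1/g) *\<^sub>C x, 1, cr t) \<in> T"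
    using T_scale[OF g, of "1/g"] by (simp add: scaleC_scaleC mult.commute)
  show ?thesis using eig_in_G[OF u E(2)] eig_unique(2)[OF u] by auto
qed

text \<open>The difference quotient of the parameter is an inner product of eigenvectors. It gives
  the Lipschitz bound at once, and strict local monotonicity as soon as that inner product stays
  near |eu E|^2.\<close>

lemma ef_diff:
  assumes E: "E \<in> G a b n" and F: "F \<in> G a b n"
  shows "cr (F - E)*cinner (eu E) (eu F) = cr (ef F - ef E)"
  using green[OF G_eig(1)[OF E] G_eig(1)[OF F]] by (simp add: cinner_simps algebra_simps)

lemma ef_Lipschitz:
  assumes E: "E \<in> G a b n" and F: "F \<in> G a b n"
  shows "\<bar>ef F - ef E\<bar> <= (real n)\<^sup>2*\<bar>F - E\<bar>"
proof -
  have "\<bar>ef F - ef E\<bar> = \<bar>F - E\<bar>*cmod (cinner (eu E) (eu F))"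
    using arg_cong[OF ef_diff[OF E F], of cmod] by (simp only: norm_mult norm_of_real)
  also have "... <= \<bar>F - E\<bar>*(real n*real n)"
    by (intro mult_left_mono order_trans[OF cmod_cinner_le] mult_mono G_eig(2)[OF E] G_eig(2)[OF F]) auto
  finally show ?thesis by (simp add: power2_eq_square mult.commute)
qed

lemma ef_continuous: "continuous_on (G a b n) ef"
proof (rule continuous_onI)
  fix E e :: real assume E: "E \<in> G a b n" and e: "e > 0"
  define d where "d = e/((real n)\<^sup>2 + 1)"
  have p: "(real n)\<^sup>2 + 1 > 0" by (simp add: add_nonneg_pos)
  have "dist (ef F) (ef E) <= e" if F: "F \<in> G a b n" "dist F E < d" for F
  proof -
    have "\<bar>ef F - ef E\<bar> <= (real n)\<^sup>2*\<bar>F - E\<bar>" by (rule ef_Lipschitz[OF E F(1)])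
    also have "... <= ((real n)\<^sup>2 + 1)*d" using F(2) by (intro mult_mono) (auto simp: dist_real_def)
    also have "... = e" using p by (simp add: d_def)
    finally show ?thesis by (simp add: dist_real_def)
  qed
  thus "EX d>0. ALL F:G a b n. dist F E < d --> dist (ef F) (ef E) <= e"
    using e p by (intro exI[of _ d]) (auto simp: d_def)
qed

text \<open>The vectors \<open>gam z\<close>, to which Green's formula applies, approximate \<open>eu E\<close>; this yields the weak
  continuity of \<open>eu\<close>.\<close>

lemma eu_weakly_continuous:
  assumes E: "E \<in> G a b n" and F: "!!k. F k \<in> G a b n" "F ----> E"
  shows "(%k. cinner (eu E) (eu (F k))) ----> cinner (eu E) (eu E)"
proof (rule LIMSEQ_I)
  fix r :: real assume r: "r > 0"
  \<comment> \<open>A third of r after multiplication by the norm bound n of \<open>eu\<close>; the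
    1 is added for the case n = 0.\<close>
  define r' where "r' = r/(3*(real n + 1))"
  have r': "r' > 0" using r by (simp add: r'_def)
  obtain m where m: "norm (gam (Complex E (inverse (real (Suc m)))) - eu E) < r'"
    using LIMSEQ_D[OF G_eig(3)[OF E] r'] by blast
  define z where "z = Complex E (inverse (real (Suc m)))"
  have z: "Im z ~= 0" by (simp add: z_def del: of_nat_Suc)
  \<comment> \<open>For nonreal z Green's formula gives the inner product with \<open>gam z\<close>
    explicitly, and only the continuous \<open>ef\<close> enters.\<close>
  have ip: "cinner (gam z) (eu X) = (cr (ef X) - cnj (wey z))/(cr X - cnj z)" if X: "X \<in> G a b n" for X
  proof -
    have "(cr X - cnj z)*cinner (gam z) (eu X) = cr (ef X) - cnj (wey z)"
      using green[OF gam_T[OF nonreal_in_resolvent_set[OF z]] G_eig(1)[OF X]] by (simp add: cinner_simps algebra_simps)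
    moreover have "cr X - cnj z ~= 0" using z by (auto simp: complex_eq_iff)
    ultimately show ?thesis by (simp add: field_simps)
  qed
  have efl: "(%k. ef (F k)) ----> ef E"
    using continuous_on_tendsto_compose[OF ef_continuous F(2) E] F(1) by simp
  have "(%k. (cr (ef (F k)) - cnj (wey z))/(cr (F k) - cnj z)) \<longlonglongrightarrow>
     (cr (ef E) - cnj (wey z))/(cr E - cnj z)"
    using z by (intro tendsto_divide tendsto_diff tendsto_of_real tendsto_const F(2) efl) (auto simp: complex_eq_iff)
  hence "(%k. cinner (gam z) (eu (F k))) ----> cinner (gam z) (eu E)" by (simp add: ip F(1) E)
  from LIMSEQ_D[OF this, of "r/3"] r obtain N where N: "!!k. k >= N ==> norm (cinner (gam z) (eu (F k)) - cinner (gam z) (eu E)) < r/3"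
    by auto
  have close: "cmod (cinner (eu E) (eu X) - cinner (gam z) (eu X)) <= r/3" if X: "X \<in> G a b n" for X
  proof -
    have "cmod (cinner (eu E) (eu X) - cinner (gam z) (eu X)) <= norm (eu E - gam z)*norm (eu X)"
      unfolding cinner_diff_left[symmetric] by (rule cmod_cinner_le)
    also have "... <= r'*(real n + 1)" using m G_eig(2)[OF X] r'
      by (intro mult_mono) (auto simp: z_def norm_minus_commute)
    also have "... = r/3"
    proof -
      have "3*real n + 3 ~= 0" by linarith
      thus ?thesis by (simp add: r'_def field_simps)
    qed
    finally show ?thesis .
  qed
  show "EX no. ALL k>=no. norm (cinner (eu E) (eu (F k)) - cinner (eu E) (eu E)) < r"
  proof (intro exI[of _ N] allI impI)
    fix k assume k: "k >= N"
    have tri: "cmod (p - q) <= cmod (p - p') + cmod (p' - q') + cmod (q - q')" for p q p' q' :: complex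
      using norm_triangle_ineq[of "p - p'" "p' - q'"] norm_triangle_ineq4[of "p - q'" "q - q'"] by simp
    have "cmod (cinner (eu E) (eu (F k)) - cinner (eu E) (eu E)) <=
        cmod (cinner (eu E) (eu (F k)) - cinner (gam z) (eu (F k))) + cmod (cinner (gam z) (eu (F k)) - cinner (gam z) (eu E))
        + cmod (cinner (eu E) (eu E) - cinner (gam z) (eu E))" by (rule tri)
    thus "norm (cinner (eu E) (eu (F k)) - cinner (eu E) (eu E)) < r"
      using N[OF k] close[OF F(1)[of k]] close[OF E] by linarith
  qed
qed

text \<open>The points of \<open>G a b n\<close> at which the difference quotients of
  \<open>ef\<close> within distance 1/(m + 1) have the lower bound 1/(m + 1); one number serves as
  both radius and slope.\<close>

definition P :: "real => real => nat => nat => real set" where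
  "P a b n m = {E \<in> G a b n. ALL F:G a b n. \<bar>F - E\<bar> <= 1/real (Suc m) --> 1/real (Suc m) <= Re (cinner (eu E) (eu F))}"

text \<open>By weak continuity the inner products tend to |eu E|^2, which is positive because the
  first boundary value of \<open>eu E\<close> is 1.\<close>

lemma G_covered: "E \<in> G a b n ==> EX m. E \<in> P a b n m"
proof (rule ccontr)
  assume E: "E \<in> G a b n" and "\<nexists>m. E \<in> P a b n m"
  hence "ALL m. EX F. F \<in> G a b n & \<bar>F - E\<bar> <= 1/real (Suc m) & Re (cinner (eu E) (eu F)) < 1/real (Suc m)"
    unfolding P_def by (auto simp: not_le)
  from choice[OF this] obtain F where F: "!!m. F m \<in> G a b n" "!!m. \<bar>F m - E\<bar> <= 1/real (Suc m)"
    "!!m. Re (cinner (eu E) (eu (F m))) < 1/real (Suc m)" by blast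
  have l0: "(%m. 1/real (Suc m)) ----> 0" using LIMSEQ_inverse_real_of_nat by (simp add: inverse_eq_divide)
  have "(%m. F m - E) ----> 0" by (rule Lim_null_comparison[OF _ l0]) (use F(2) in auto)
  hence "F ----> E" by (rule LIM_zero_cancel)
  from tendsto_Re[OF eu_weakly_continuous[OF E F(1) this]]
  have "Re (cinner (eu E) (eu E)) <= 0"
    by (rule LIMSEQ_le[OF _ l0]) (use F(3) in \<open>auto intro: less_imp_le\<close>)
  hence "eu E = 0" by (simp add: cinner_self del: of_real_power)
  thus False using G_eig(1)[OF E] T_uniq[of 1] by auto
qed

lemma P_mono:
  assumes E: "E \<in> P a b n m" and F: "F \<in> G a b n" and EF: "E <= F" "F - E <= 1/real (Suc m)"
  shows "(F - E)*(1/real (Suc m)) <= ef F - ef E"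
proof -
  have EG: "E \<in> G a b n" using E by (simp add: P_def)
  have "\<bar>F - E\<bar> <= 1/real (Suc m)" using EF by simp
  hence "1/real (Suc m) <= Re (cinner (eu E) (eu F))" using E F unfolding P_def by blast
  hence "(F - E)*(1/real (Suc m)) <= (F - E)*Re (cinner (eu E) (eu F))" using EF by (intro mult_left_mono) auto
  also have "... = Re (cr (F - E)*cinner (eu E) (eu F))" by (simp del: of_real_diff)
  also have "... = ef F - ef E" unfolding ef_diff[OF EG F] by (simp del: of_real_diff)
  finally show ?thesis .
qed

text \<open>On an interval contained in \<open>G a b n\<close>, the spectral measure of \<open>gam \<i>\<close> has zero density everywhere,
  so it vanishes there.\<close>

lemma interior_G_empty:
  assumes sp: "interval_in_spectrum D a b"
  shows "interior (G a b n) = {}"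
proof (rule ccontr)
  assume "interior (G a b n) ~= {}"
  then obtain E0 where "E0 \<in> interior (G a b n)" by blast
  then obtain r where r: "r > 0" "cball E0 r \<subseteq> G a b n" unfolding mem_interior_cball by blast
  hence sub: "{E0 - r..E0 + r} \<subseteq> G a b n" by (simp add: cball_eq_atLeastAtMost)
  define \<gamma> where "\<gamma> = gam \<i>"
  interpret fm: finite_measure "smeas \<gamma>" by simp
  define J where "J = {E0 - r..E0 + r}"
  have calc_gam: "EX T'. calc (%t. 1 + (z - \<i>)*(1/(cr t - z))) T' & T' \<gamma> = gam z" if z: "Im z ~= 0" for z
  proof (intro exI conjI)
    show "calc (%t. 1 + (z - \<i>)*(1/(cr t - z))) (%v. v + (z - \<i>) *\<^sub>C R z v)"
      by (intro calc_add calc_scale calc_laur[OF laur_one] calc_resolvent z)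
    show "\<gamma> + (z - \<i>) *\<^sub>C R z \<gamma> = gam z"
      unfolding \<gamma>_def using gam_resolvent[OF nonreal_in_resolvent_set[OF z] i_resolvent(1)] by simp
  qed
  \<comment> \<open>The squared norm of \<open>gam (E + i e)\<close> is the integral of (t^2 +
    1)/((t - E)^2 + e^2), and on [E - e, E + e] the integrand is at least 1/(2 e^2). The norm bound
    n makes the mass quadratic in e.\<close>
  have small: "measure (smeas \<gamma>) {E - e..E + e} <= 2*(real n)\<^sup>2*e\<^sup>2" if E: "E \<in> J" and e: "e > 0" for E e
  proof -
    define z where "z = Complex E e"
    have z: "Im z ~= 0" using e by (simp add: z_def)
    let ?f = "%t. 1 + (z - \<i>)*(1/(cr t - z))"
    obtain T' where T': "calc ?f T'" "T' \<gamma> = gam z" using calc_gam[OF z] by blast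
    have "norm (gam z) <= real n" using E sub e by (auto simp: J_def G_def z_def)
    hence n2: "(LINT t|smeas \<gamma>. (cmod (?f t))\<^sup>2) <= (real n)\<^sup>2"
      unfolding calc_norm[OF T'(1), of \<gamma>, symmetric] T'(2) by (intro power_mono) auto
    have lower: "indicator {E - e..E + e} t*(1/(2*e\<^sup>2)) <= (cmod (?f t))\<^sup>2" for t
    proof (cases "t \<in> {E - e..E + e}")
      case True
      have nz: "cr t - z ~= 0" using z by simp
      hence "?f t = (cr t - \<i>)/(cr t - z)" by (simp add: field_simps)
      hence "(cmod (?f t))\<^sup>2 = (t\<^sup>2 + 1)/((t - E)\<^sup>2 + e\<^sup>2)"
        by (simp add: norm_divide power_divide cmod_power2 z_def)
      moreover have "(t - E)\<^sup>2 <= e\<^sup>2"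
      proof -
        have "\<bar>t - E\<bar> <= \<bar>e\<bar>" using True e by (auto simp: abs_le_iff)
        thus ?thesis by (simp only: abs_le_square_iff)
      qed
      moreover have "0 < (t - E)\<^sup>2 + e\<^sup>2" using e by (simp add: add_nonneg_pos)
      ultimately have "1/(2*e\<^sup>2) <= (cmod (?f t))\<^sup>2" using e by (simp add: frac_le)
      thus ?thesis using True by simp
    qed simp
    have "measure (smeas \<gamma>) {E - e..E + e}*(1/(2*e\<^sup>2)) = (LINT t|smeas \<gamma>. indicator {E - e..E + e} t*(1/(2*e\<^sup>2)))"
      by simp
    also have "... <= (LINT t|smeas \<gamma>. (cmod (?f t))\<^sup>2)"
      by (rule integral_mono[OF _ calc_integrable(2)[OF T'(1)] lower]) (simp add: fm.emeasure_eq_measure)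
    also note n2
    finally show ?thesis using e by (simp add: field_simps)
  qed
  \<comment> \<open>The distribution function: its increments are quadratically small on the
    interval, so its derivative vanishes there and it is constant.\<close>
  define \<Phi> where "\<Phi> x = measure (smeas \<gamma>) {..x}" for x
  have diff: "\<Phi> y - \<Phi> x = measure (smeas \<gamma>) {x<..y}" if "x <= y" for x y
  proof -
    have "{..y} - {..x} = {x<..y}" using that by auto
    thus ?thesis using fm.finite_measure_Diff[of "{..y}" "{..x}"] that by (simp add: \<Phi>_def)
  qed
  have quad: "\<bar>\<Phi> y - \<Phi> x\<bar> <= 2*(real n)\<^sup>2*(y - x)\<^sup>2" if "x < y" "x \<in> J" for x y
  proof -
    have "\<Phi> y - \<Phi> x <= measure (smeas \<gamma>) {x - (y - x)..x + (y - x)}"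
      unfolding diff[OF less_imp_le[OF that(1)]] by (rule fm.finite_measure_mono) (use that in auto)
    moreover have "0 <= \<Phi> y - \<Phi> x" using diff[of x y] that(1) by simp
    ultimately show ?thesis using small[OF that(2), of "y - x"] that(1) by simp
  qed
  have "EX k. ALL x:J. \<Phi> x = k"
  proof (rule has_field_derivative_zero_constant)
    fix x assume x: "x \<in> J"
    show "(\<Phi> has_field_derivative 0) (at x within J)" unfolding has_field_derivative_iff
    proof (rule Lim_null_comparison)
      have "\<bar>\<Phi> y - \<Phi> x\<bar>/\<bar>y - x\<bar> <= 2*(real n)\<^sup>2*\<bar>y - x\<bar>" if "y \<in> J" "y ~= x" for y
      proof -
        have "\<bar>\<Phi> y - \<Phi> x\<bar> <= 2*(real n)\<^sup>2*\<bar>y - x\<bar>*\<bar>y - x\<bar>"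
          using quad[of x y] quad[of y x] x that unfolding mult.assoc abs_mult_self_eq
          by (cases "x < y") (auto simp: power2_eq_square algebra_simps abs_minus_commute)
        thus ?thesis using that(2) by (simp add: pos_divide_le_eq)
      qed
      thus "\<forall>\<^sub>F y in at x within J. norm ((\<Phi> y - \<Phi> x)/(y - x)) <= 2*(real n)\<^sup>2*\<bar>y - x\<bar>"
        by (auto simp: eventually_at_filter)
      have "((%y. 2*(real n)\<^sup>2*\<bar>y - x\<bar>) \<longlongrightarrow> 2*(real n)\<^sup>2*\<bar>x - x\<bar>) (at x within J)" by (intro tendsto_intros)
      thus "((%y. 2*(real n)\<^sup>2*\<bar>y - x\<bar>) \<longlongrightarrow> 0) (at x within J)" by simp
    qed
  qed (simp add: J_def)
  moreover have "E0 - r \<in> J" "E0 + r \<in> J" using r(1) by (auto simp: J_def)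
  ultimately have "\<Phi> (E0 + r) - \<Phi> (E0 - r) = 0" by (metis diff_self)
  hence "measure (smeas \<gamma>) {E0 - r<..E0 + r} = 0" using diff[of "E0 - r" "E0 + r"] r(1) by simp
  hence AEJ: "AE t in smeas \<gamma>. t \<notin> {E0 - r<..E0 + r}"
    by (intro AE_I[of _ _ "{E0 - r<..E0 + r}"]) (auto simp: fm.emeasure_eq_measure)
  \<comment> \<open>The vectors f(D) \<open>\<gamma>\<close>. Their norms are integrals against the
    one measure known to vanish near E0, and by \<open>cyc\<close> they are dense.\<close>
  define Y where "Y = {Tf \<gamma> | f Tf. calc f Tf}"
  have YI: "Tf \<gamma> \<in> Y" if "calc f Tf" for f Tf using that unfolding Y_def by blast
  have subY: "complex_vector.subspace Y" unfolding complex_vector.subspace_def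
  proof (intro conjI ballI allI)
    have "calc (%x. 0*1) (%v. 0 *\<^sub>C v)" by (rule calc_scale[OF calc_laur[OF laur_one]])
    thus "0 \<in> Y" using YI by fastforce
    fix x y assume "x \<in> Y" "y \<in> Y"
    then obtain f Tf g Tg where 1: "calc f Tf" "x = Tf \<gamma>" "calc g Tg" "y = Tg \<gamma>" unfolding Y_def by blast
    show "x + y \<in> Y" using YI[OF calc_add[OF 1(1,3)]] 1 by simp
  next
    fix c x assume "x \<in> Y"
    then obtain f Tf where 1: "calc f Tf" "x = Tf \<gamma>" unfolding Y_def by blast
    show "c *\<^sub>C x \<in> Y" using YI[OF calc_scale[OF 1(1), of c]] 1 by simp
  qed
  have denseY: "closure Y = UNIV"
  proof (rule closed_subspace_eq_UNIV[OF closure_subspace[OF subY]])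
    fix v assume v: "!!m. m \<in> closure Y ==> cinner m v = 0"
    show "v = 0"
    proof (rule cyc)
      fix z :: complex assume "Im z ~= 0"
      hence "gam z \<in> Y" using calc_gam[of z] YI by metis
      thus "cinner (gam z) v = 0" using v closure_subset by blast
    qed
  qed simp
  have ri: "Im \<i> ~= 0" by simp
  \<comment> \<open>(D - E0) R(i), with function (t - E0)/(t - i). Since |t - E0| >= r on the
    support, it dominates r R(i); this is the lower bound that puts E0 into the resolvent
    set.\<close>
  define S where "S v = v + (\<i> - cr E0) *\<^sub>C R \<i> v" for v
  have calcS: "calc (%t. 1 + (\<i> - cr E0)*(1/(cr t - \<i>))) S"
    unfolding S_def by (intro calc_add calc_scale calc_laur[OF laur_one] calc_resolvent ri)
  have onY: "r*norm (R \<i> v) <= norm (S v)" if vY: "v \<in> Y" for v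
  proof -
    obtain f Tf where f: "calc f Tf" "v = Tf \<gamma>" using vY unfolding Y_def by blast
    let ?u = "%t. r\<^sup>2*(cmod (1/(cr t - \<i>)*f t))\<^sup>2" and ?w = "%t. (cmod ((1 + (\<i> - cr E0)*(1/(cr t - \<i>)))*f t))\<^sup>2"
    note c1 = calc_mult[OF calc_resolvent[OF ri] f(1)] and c2 = calc_mult[OF calcS f(1)]
    have "r\<^sup>2*(norm (R \<i> v))\<^sup>2 = (LINT t|smeas \<gamma>. ?u t)"
      unfolding f(2) using calc_norm[OF c1, of \<gamma>] by simp
    also have "... <= (LINT t|smeas \<gamma>. ?w t)"
    proof (rule integral_mono_AE)
      show "integrable (smeas \<gamma>) (%t. ?u t)" by (intro integrable_mult_right calc_integrable(2)[OF c1])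
      show "integrable (smeas \<gamma>) (%t. ?w t)" by (rule calc_integrable(2)[OF c2])
      show "AE t in smeas \<gamma>. ?u t <= ?w t" using AEJ
      proof eventually_elim
        case (elim t)
        have "cr t - \<i> ~= 0" by simp
        hence "1 + (\<i> - cr E0)*(1/(cr t - \<i>)) = cr (t - E0)*(1/(cr t - \<i>))"
          by (simp add: field_simps)
        moreover have "r <= \<bar>t - E0\<bar>" using elim by auto
        hence "r\<^sup>2 <= (t - E0)\<^sup>2" using r(1) power_mono[of r "\<bar>t - E0\<bar>" 2] by simp
        ultimately show ?case
          by (simp only: norm_mult norm_of_real power_mult_distrib power2_abs mult.assoc) (intro mult_right_mono; simp)
      qed
    qed
    also have "... = (norm (S v))\<^sup>2" unfolding f(2) using calc_norm[OF c2, of \<gamma>] by simp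
    finally have "(r*norm (R \<i> v))\<^sup>2 <= (norm (S v))\<^sup>2" by (simp add: power_mult_distrib)
    thus ?thesis by (rule power2_le_imp_le) simp
  qed
  have all: "r*norm (R \<i> v) <= norm (S v)" for v
  proof -
    obtain s where s: "!!k. s k \<in> Y" "s ----> v" using denseY closure_sequential[of v Y] by auto
    show ?thesis
    proof (rule LIMSEQ_le)
      show "(%k. r*norm (R \<i> (s k))) ----> r*norm (R \<i> v)"
        by (intro tendsto_intros bounded_clinear_tendsto[OF resolvent_bounded[OF i_resolvent(1)]] s)
      show "(%k. norm (S (s k))) ----> norm (S v)"
        by (intro tendsto_intros bounded_clinear_tendsto[OF calc_linear[OF calcS]] s)
    qed (use onY s(1) in auto)
  qed
  have low: "r*norm x <= norm (op_minus_scalar D (cr E0) x)" if x: "x \<in> op_dom D" for x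
  proof -
    define v where "v = op_app D x - \<i> *\<^sub>C x"
    have Rv: "R \<i> v = x" unfolding v_def by (rule resolvent_eqI[OF i_resolvent(1) x]) simp
    have "S v = op_minus_scalar D (cr E0) x"
      unfolding S_def Rv by (simp add: v_def op_minus_scalar_def scaleC_diff_left)
    thus ?thesis using all[of v] Rv by simp
  qed
  have "cr E0 \<in> resolvent_set D" by (rule resolvent_setI[OF r(1) low]) (use low in auto)
  moreover have "E0 \<in> {E0 - r..E0 + r}" using r(1) by simp
  hence "E0 \<in> {a..b}" using sub G_subset by (metis subsetD)
  ultimately show False using sp unfolding interval_in_spectrum_def spectrum_def by blast
qed

text \<open>An eigenvector of D has second boundary value different from 0, so it is not orthogonal
  to \<open>gam \<i>\<close> and produces an atom of a single finite measure.\<close>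

lemma eigenvalue_countable: "countable {E. eigenvalue D (cr E)}"
proof -
  interpret fm: finite_measure "smeas (gam \<i>)" by simp
  have "{E. eigenvalue D (cr E)} \<subseteq> {E. measure (smeas (gam \<i>)) {E} ~= 0}"
  proof
    fix E assume "E \<in> {E. eigenvalue D (cr E)}"
    then obtain x where x: "x \<in> op_dom D" "x ~= 0" "op_app D x = cr E *\<^sub>C x"
      by (auto simp: eigenvalue_def)
    obtain h where h: "(x, cr E *\<^sub>C x, 0, h) \<in> T" using in_dom_T[OF x(1)] x(3) by auto
    have "h ~= 0" using simple[of x E] h x(2) by auto
    moreover have "(cr E + \<i>)*cinner (gam \<i>) x = h"
      using green[OF gam_T[OF i_resolvent(1)] h] by (simp add: cinner_simps algebra_simps)
    ultimately have "cinner (gam \<i>) x ~= 0" by auto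
    from eigenvector_atom[OF x(1,3) this] show "E \<in> {E. measure (smeas (gam \<i>)) {E} ~= 0}"
      by (simp add: fm.emeasure_eq_measure)
  qed
  thus ?thesis using fm.countable_support countable_subset by blast
qed

theorem eigenvalues_generic:
  assumes ab: "a < b" and sp: "interval_in_spectrum D a b"
  shows "EX C. dense_gdelta_in {a..b} C & (ALL E:C. ~ eigenvalue D (cr E) &
     (ALL t D'. perturbed t D' --> ~ eigenvalue D' (cr E)))"
proof -
  \<comment> \<open>The operator D, the case t = infinity, is not among the perturbed ones; its
    countably many eigenvalues are removed as single points.\<close>
  define \<N> where "\<N> = range (G a b) \<union> (%E. {E}) ` {E. eigenvalue D (cr E)}"
  have "dense_gdelta_in {a..b} ({a..b} - \<Union>\<N>)"
  proof (rule dense_gdelta_in_countable_Int)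
    show "countable \<N>" unfolding \<N>_def using eigenvalue_countable by auto
    fix N assume "N \<in> \<N>"
    hence "closed N & interior N = {}" unfolding \<N>_def using closed_G interior_G_empty[OF sp] by auto
    thus "closed N" "{a..b} \<subseteq> closure ({a..b} - N)"
      using closure_Icc_Diff_nowhere_dense[OF ab] by auto
  qed simp
  moreover have "~ eigenvalue D (cr E)" "!!t D'. perturbed t D' ==> ~ eigenvalue D' (cr E)"
    if E: "E \<in> {a..b} - \<Union>\<N>" for E
  proof -
    show "~ eigenvalue D (cr E)" using E by (auto simp: \<N>_def)
    fix t D' assume "perturbed t D'"
    thus "~ eigenvalue D' (cr E)" using perturbed_eigenvalue[of t D' E a b] E by (auto simp: \<N>_def)
  qed
  ultimately show ?thesis by blast
qed

text \<open>The exceptional parameters are covered by countably many images under \<open>ef\<close>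
  of compact sets without interior, on each of which \<open>ef\<close> is strictly increasing. Such
  images are nowhere dense.\<close>

theorem purely_sc_generic:
  assumes ab: "a < b" and sp: "interval_in_spectrum D a b" and nac: "no_ac_spectrum_on D a b"
  shows "EX \<N>. countable \<N> & (ALL N:\<N>. closed N & interior N = {}) &
     (ALL t D'. t \<notin> \<Union>\<N> --> perturbed t D' --> purely_sc_spectrum_on D' a b)"
proof -
  \<comment> \<open>Slices of length 1/(m + 1) keep any two points within the radius in the
    definition of \<open>P\<close>. The closure is taken for compactness; it stays inside
    \<open>G\<close>, where continuity of \<open>ef\<close> carries the slope bound over.\<close>
  define Q where "Q n m j = closure (P a b n m \<inter> {of_int j/real (Suc m)..(of_int j + 1)/real (Suc m)})" for n m :: nat and j :: int
  have QG: "Q n m j \<subseteq> G a b n" for n m j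
    unfolding Q_def by (rule closure_minimal[OF _ closed_G]) (auto simp: P_def)
  have Qc: "compact (Q n m j)" for n m j
  proof -
    have "Q n m j \<subseteq> {a..b}" using QG G_subset by blast
    hence "bounded (Q n m j)" using bounded_subset bounded_closed_interval by blast
    moreover have "closed (Q n m j)" by (simp add: Q_def)
    ultimately show ?thesis by (simp add: compact_eq_bounded_closed)
  qed
  have Qi: "interior (Q n m j) = {}" for n m j using interior_mono[OF QG] interior_G_empty[OF sp] by fastforce
  have cont: "continuous_on (Q n m j) ef" for n m j by (rule continuous_on_subset[OF ef_continuous QG])
  have low: "(F - E)*(1/real (Suc m)) <= ef F - ef E" if EF: "E \<in> Q n m j" "F \<in> Q n m j" "E < F" for E F n m j
  proof -
    let ?I = "P a b n m \<inter> {of_int j/real (Suc m)..(of_int j + 1)/real (Suc m)}"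
    obtain s where "(ALL k. s k \<in> ?I) & s ----> E"
      using EF(1)[unfolded Q_def closure_sequential] by (rule exE)
    hence s: "!!k. s k \<in> ?I" "s ----> E" by simp_all
    obtain t where "(ALL k. t k \<in> ?I) & t ----> F"
      using EF(2)[unfolded Q_def closure_sequential] by (rule exE)
    hence t: "!!k. t k \<in> ?I" "t ----> F" by simp_all
    have inQ: "s k \<in> Q n m j" "t k \<in> Q n m j" for k using s(1) t(1) closure_subset unfolding Q_def by blast+
    have "\<forall>\<^sub>F k in sequentially. s k < t k"
    proof -
      have "\<forall>\<^sub>F k in sequentially. s k < (E + F)/2" using that(3) by (intro order_tendstoD(2)[OF s(2)]) simp
      moreover have "\<forall>\<^sub>F k in sequentially. (E + F)/2 < t k" using that(3) by (intro order_tendstoD(1)[OF t(2)]) simp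
      ultimately show ?thesis by eventually_elim simp
    qed
    hence ev: "\<forall>\<^sub>F k in sequentially. (t k - s k)*(1/real (Suc m)) <= ef (t k) - ef (s k)"
    proof eventually_elim
      case (elim k)
      have "t k - s k <= (of_int j + 1)/real (Suc m) - of_int j/real (Suc m)" using s(1)[of k] t(1)[of k] by auto
      also have "... = 1/real (Suc m)" by (simp add: diff_divide_distrib[symmetric] del: of_nat_Suc)
      finally show ?case using elim s(1)[of k] QG inQ(2)[of k] by (intro P_mono[of _ a b n]) auto
    qed
    have "(%k. ef (s k)) ----> ef E" "(%k. ef (t k)) ----> ef F"
      using continuous_on_tendsto_compose[OF cont s(2) that(1)] continuous_on_tendsto_compose[OF cont t(2) that(2)] inQ by simp_all
    hence l1: "(%k. ef (t k) - ef (s k)) ----> ef F - ef E" by (rule tendsto_diff[rotated])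
    have l2: "(%k. (t k - s k)*(1/real (Suc m))) ----> (F - E)*(1/real (Suc m))" by (intro tendsto_intros s t)
    show ?thesis by (rule tendsto_le[OF _ l1 l2 ev]) simp
  qed
  have mono: "strict_mono_on (Q n m j) ef" for n m j
  proof (rule strict_mono_onI)
    fix E F assume "E \<in> Q n m j" "F \<in> Q n m j" "E < F"
    moreover from this have "0 < (F - E)*(1/real (Suc m))" by (simp del: of_nat_Suc)
    ultimately show "ef E < ef F" using low[of E n m j F] by linarith
  qed
  define \<N> where "\<N> = (%(n, m, j). ef ` Q n m j) ` UNIV"
  have "countable \<N>" by (simp add: \<N>_def)
  moreover have "closed N & interior N = {}" if "N \<in> \<N>" for N
    using that inj_image_nowhere_dense[OF Qc Qi cont strict_mono_on_imp_inj_on[OF mono]] unfolding \<N>_def by auto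
  moreover have "purely_sc_spectrum_on D' a b" if t: "t \<notin> \<Union>\<N>" and D': "perturbed t D'" for t D'
  proof -
    interpret B: boundary_triple D' "shift_triple t T" by (rule perturbed_triple[OF D'])
    show ?thesis
    proof (rule B.purely_sc_spectrumI)
      show "interval_in_spectrum D' a b"
        by (rule B.interval_in_spectrum_perturbed[OF perturbed_back[OF D'] ab sp])
      show "no_ac_spectrum_on D' a b" by (rule no_ac_spectrum_perturbed[OF D' ab nac])
      fix E assume E: "E \<in> {a..b}"
      show "~ eigenvalue D' (cr E)"
      proof
        assume "eigenvalue D' (cr E)"
        then obtain n where n: "E \<in> G a b n" "ef E = t" using perturbed_eigenvalue[OF D' _ E] by blast
        obtain m where m: "E \<in> P a b n m" using G_covered[OF n(1)] by blast
        define j where "j = \<lfloor>E*real (Suc m)\<rfloor>"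
        have "of_int j <= E*real (Suc m)" "E*real (Suc m) <= of_int j + 1" unfolding j_def by linarith+
        hence "E \<in> {of_int j/real (Suc m)..(of_int j + 1)/real (Suc m)}"
          by (simp add: divide_le_eq le_divide_eq del: of_nat_Suc)
        hence "E \<in> Q n m j" unfolding Q_def by (intro subsetD[OF closure_subset] IntI m)
        hence "t \<in> ef ` Q n m j" using n(2) by blast
        thus False using t unfolding \<N>_def by blast
      qed
    qed
  qed
  ultimately show ?thesis by blast
qed

end

section \<open>Generic parameters\<close>

text \<open>Density is first obtained on the whole line; intersecting with an open set keeps it, and
  \<open>S\<close> is reached through an open subset that is dense in it.\<close>

lemma dense_gdelta_in_restrict:
  fixes L :: "real set"
  assumes L: "dense_gdelta_in UNIV L" and U: "open U" "U \<subseteq> S" "S \<subseteq> closure U"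
  shows "dense_gdelta_in S (L \<inter> S)"
proof -
  have g: "gdelta_in euclidean L" and d: "closure L = UNIV" using L by (simp_all add: dense_gdelta_in_def)
  have "gdelta_in (top_of_set S) (S \<inter> L)"
    using g unfolding gdelta_in_subtopology by (auto simp: Int_commute)
  moreover have "S \<subseteq> closure (S \<inter> L)"
  proof -
    have "U \<subseteq> closure (U \<inter> L)" using open_Int_closure_subset[OF U(1), of L] d by simp
    hence "closure U \<subseteq> closure (U \<inter> L)" by (rule closure_minimal) simp
    also have "... \<subseteq> closure (S \<inter> L)" using U(2) by (intro closure_mono) blast
    finally show ?thesis using U(3) by blast
  qed
  ultimately show ?thesis
    by (simp add: dense_gdelta_in_def closure_of_subtopology Int_commute Int_absorb1) (simp add: Int_absorb2)
qed

text \<open>If the set contained an interval inside \<open>W\<close>, a nonconstant continuous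
  \<open>t\<close> would map it onto a connected set with two values, hence an interval in
  \<open>N\<close>. The implication also puts the complement of \<open>W\<close> into the set to be
  avoided.\<close>

lemma nowhere_dense_preimage:
  fixes t :: "real => real"
  assumes W: "open W" "interior (- W) = {}" and t: "continuous_on W t"
    and nonconst: "!!p q. p < q ==> {p<..<q} \<subseteq> W ==> EX x:{p<..<q}. EX y:{p<..<q}. t x < t y"
    and N: "closed N" "interior N = {}"
  shows "closed {x. x \<in> W --> t x \<in> N}" "interior {x. x \<in> W --> t x \<in> N} = {}"
proof -
  have "open (W \<inter> t -` (- N))" using continuous_open_preimage[OF t W(1), of "- N"] N(1) by auto
  moreover have "- {x. x \<in> W --> t x \<in> N} = W \<inter> t -` (- N)" by auto
  ultimately show "closed {x. x \<in> W --> t x \<in> N}" unfolding closed_def by simp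
  show "interior {x. x \<in> W --> t x \<in> N} = {}"
  proof (rule ccontr)
    let ?I = "interior {x. x \<in> W --> t x \<in> N}"
    assume ne: "?I ~= {}"
    have "?I \<inter> W ~= {}"
    proof
      assume "?I \<inter> W = {}"
      hence "?I \<subseteq> interior (- W)" by (intro interior_maximal) auto
      thus False using W(2) ne by blast
    qed
    then obtain x where x: "x \<in> ?I \<inter> W" by blast
    have "open (?I \<inter> W)" using W(1) by auto
    then obtain e where e: "e > 0" "ball x e \<subseteq> ?I \<inter> W" using x open_contains_ball by blast
    have I: "{x - e<..<x + e} \<subseteq> ?I \<inter> W" using e(2) by (simp add: ball_eq_greaterThanLessThan)
    then obtain u v where uv: "u \<in> {x - e<..<x + e}" "v \<in> {x - e<..<x + e}" "t u < t v"
      using nonconst[of "x - e" "x + e"] e(1) by auto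
    have tN: "t ` {x - e<..<x + e} \<subseteq> N" using I interior_subset by blast
    have "connected (t ` {x - e<..<x + e})"
      using I by (intro connected_continuous_image continuous_on_subset[OF t]) auto
    hence iv: "{t u..t v} \<subseteq> t ` {x - e<..<x + e}" by (rule connected_contains_Icc) (use uv in auto)
    have "{t u<..<t v} \<subseteq> {t u..t v}" by auto
    from order_trans[OF this order_trans[OF iv tN]] have "{t u<..<t v} \<subseteq> N" .
    hence "{t u<..<t v} \<subseteq> interior N" by (intro interior_maximal) auto
    thus False using N(2) uv(3) by auto
  qed
qed

lemma generic_parameter:
  fixes t :: "real => real"
  assumes W: "open W" "interior (- W) = {}" and t: "continuous_on W t"
    and nonconst: "!!p q. p < q ==> {p<..<q} \<subseteq> W ==> EX x:{p<..<q}. EX y:{p<..<q}. t x < t y"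
    and N: "countable \<N>" "!!N. N \<in> \<N> ==> closed N & interior N = {}"
  shows "EX L. dense_gdelta_in UNIV L & (ALL x:L. x \<in> W & t x \<notin> \<Union>\<N>)"
proof -
  \<comment> \<open>The empty set is added so that the complement of \<open>W\<close> is avoided
    even if the given family is empty.\<close>
  define \<M> where "\<M> = (%N. {x. x \<in> W --> t x \<in> N}) ` insert {} \<N>"
  have M: "closed M" "interior M = {}" if MM: "M \<in> \<M>" for M
  proof -
    obtain N where MN: "M = {x. x \<in> W --> t x \<in> N}" and NN: "N \<in> insert {} \<N>"
      using MM unfolding \<M>_def by (rule imageE)
    have "closed N" "interior N = {}" using NN N(2) by auto
    note * = nowhere_dense_preimage[OF W t _ this]
    show "closed M" unfolding MN by (rule *(1)) (rule nonconst)
    show "interior M = {}" unfolding MN by (rule *(2)) (rule nonconst)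
  qed
  have "dense_gdelta_in UNIV (UNIV - \<Union>\<M>)"
  proof (rule dense_gdelta_in_countable_Int)
    show "UNIV \<subseteq> closure (UNIV - M)" if "M \<in> \<M>" for M
      using M(2)[OF that] by (simp add: closure_interior Compl_eq_Diff_UNIV[symmetric])
  qed (use N(1) M in \<open>auto simp: \<M>_def\<close>)
  thus ?thesis by (intro exI[of _ "UNIV - \<Union>\<M>"]) (auto simp: \<M>_def)
qed


section \<open>Rank one perturbations\<close>

lemma orth_proj_span:
  assumes "\<phi> ~= 0"
  shows "orth_proj (complex_vector.span {\<phi>}) x = (cinner \<phi> x/cr ((norm \<phi>)\<^sup>2)) *\<^sub>C \<phi>"
  unfolding orth_proj_def
proof (rule the_equality)
  have n: "cr ((norm \<phi>)\<^sup>2) ~= 0" using assms by simp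
  show "(cinner \<phi> x/cr ((norm \<phi>)\<^sup>2)) *\<^sub>C \<phi> \<in> complex_vector.span {\<phi>} &
      (ALL m:complex_vector.span {\<phi>}. cinner m (x - (cinner \<phi> x/cr ((norm \<phi>)\<^sup>2)) *\<^sub>C \<phi>) = 0)"
  proof
    show "(cinner \<phi> x/cr ((norm \<phi>)\<^sup>2)) *\<^sub>C \<phi> \<in> complex_vector.span {\<phi>}"
      by (intro complex_vector.span_scale complex_vector.span_base) simp
    show "ALL m:complex_vector.span {\<phi>}. cinner m (x - (cinner \<phi> x/cr ((norm \<phi>)\<^sup>2)) *\<^sub>C \<phi>) = 0"
      unfolding complex_vector.span_singleton using n by (auto simp: cinner_simps cinner_self simp del: of_real_power)
  qed
  fix y assume y: "y \<in> complex_vector.span {\<phi>} & (ALL m:complex_vector.span {\<phi>}. cinner m (x - y) = 0)"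
  then obtain k where k: "y = k *\<^sub>C \<phi>" unfolding complex_vector.span_singleton by blast
  have "cinner \<phi> (x - y) = 0" using y complex_vector.span_base[of \<phi> "{\<phi>}"] by blast
  thus "y = (cinner \<phi> x/cr ((norm \<phi>)\<^sup>2)) *\<^sub>C \<phi>"
    unfolding k using n by (simp add: cinner_simps cinner_self del: of_real_power)
qed

lemma rank_one_perturbation_0 [simp]: "rank_one_perturbation A \<phi> 0 = A"
  by (simp add: rank_one_perturbation_def)

definition rank_one_triple :: "'a :: complex_hilbert_space unbounded_op => 'a => ('a \<times> 'a \<times> complex \<times> complex) set" where
  "rank_one_triple A \<phi> = {(x, y, g, h). x \<in> op_dom A & y = op_app A x - g *\<^sub>C \<phi> & h = cinner \<phi> x}"

lemma rank_one_triple: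
  assumes A: "self_adjoint A" and \<phi>: "\<phi> ~= 0"
  shows "boundary_triple A (rank_one_triple A \<phi>)"
proof -
  interpret selfadj A by (rule selfadj.intro[OF A])
  show ?thesis
  proof
    show "(x + x', y + y', g + g', h + h') \<in> rank_one_triple A \<phi>"
      if "(x, y, g, h) \<in> rank_one_triple A \<phi>" "(x', y', g', h') \<in> rank_one_triple A \<phi>" for x y g h x' y' g' h'
      using that by (auto simp: rank_one_triple_def dom_simps cinner_simps scaleC_add_left)
    show "(c *\<^sub>C x, c *\<^sub>C y, c*g, c*h) \<in> rank_one_triple A \<phi>"
      if "(x, y, g, h) \<in> rank_one_triple A \<phi>" for x y g h c
      using that by (auto simp: rank_one_triple_def dom_simps cinner_simps scaleC_diff_right scaleC_scaleC)
    show "cinner x y' - cinner y x' = cnj g*h' - cnj h*g'"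
      if "(x, y, g, h) \<in> rank_one_triple A \<phi>" "(x', y', g', h') \<in> rank_one_triple A \<phi>" for x y g h x' y' g' h'
      using that by (auto simp: rank_one_triple_def symmetric cinner_simps cnj_cinner mult.commute)
    show "g = 0 & h = 0" if "(0, 0, g, h) \<in> rank_one_triple A \<phi>" for g h
      using that \<phi> linear_opD(8)[OF lin] by (auto simp: rank_one_triple_def)
    show "x \<in> op_dom A & op_app A x = y \<longleftrightarrow> (EX h. (x, y, 0, h) \<in> rank_one_triple A \<phi>)" for x y
      by (auto simp: rank_one_triple_def)
    show "EX x h z. Im z ~= 0 & (x, z *\<^sub>C x, 1, h) \<in> rank_one_triple A \<phi>"
      by (intro exI[of _ "R \<i> \<phi>"] exI[of _ "cinner \<phi> (R \<i> \<phi>)"] exI[of _ "\<i>"])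
        (simp add: rank_one_triple_def resolvent_in_dom[OF i_resolvent(1)] resolvent_right[OF i_resolvent(1)])
  qed
qed

text \<open>Here \<open>gam z\<close> is R z \<open>\<phi>\<close>, so totality of the deficiency
  vectors is cyclicity of \<open>\<phi>\<close>.\<close>

lemma rank_one_cyclic_triple:
  assumes A: "self_adjoint A" and \<phi>: "\<phi> ~= 0" and cyc: "cyclic_vector A \<phi>"
  shows "cyclic_boundary_triple A (rank_one_triple A \<phi>)"
proof -
  interpret boundary_triple A "rank_one_triple A \<phi>" by (rule rank_one_triple[OF A \<phi>])
  show ?thesis
  proof
    fix v assume v: "!!z. Im z ~= 0 ==> cinner (gam z) v = 0"
    have g: "R z \<phi> = gam z" if z: "Im z ~= 0" for z
    proof (rule gam_unique)
      note zr = nonreal_in_resolvent_set[OF z]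
      show "z \<in> resolvent_set A" by (rule zr)
      show "(R z \<phi>, z *\<^sub>C R z \<phi>, 1, cinner \<phi> (R z \<phi>)) \<in> rank_one_triple A \<phi>"
        by (simp add: rank_one_triple_def resolvent_in_dom[OF zr] resolvent_right[OF zr])
    qed
    show "v = 0"
    proof (rule dense_orthogonal_zero)
      show "closure (complex_vector.span {R z \<phi> |z. z \<notin> \<real>}) = UNIV"
        using cyc by (simp add: cyclic_vector_def)
      fix x assume "x \<in> complex_vector.span {R z \<phi> |z. z \<notin> \<real>}"
      thus "cinner x v = 0"
      proof (induction rule: complex_vector.span_induct_alt)
        case base
        show ?case by simp
      next
        case (step c x y)
        then obtain z where z: "x = R z \<phi>" "z \<notin> \<real>" by blast
        hence "Im z ~= 0" by (auto simp: complex_is_Real_iff)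
        thus ?case using step v g z by (simp add: cinner_simps)
      qed
    qed
  qed
qed

text \<open>The norm of \<open>\<phi>\<close> appears because P projects along \<open>\<phi>\<close>
  without its being normalised: A x + (r/|\<phi>|^2) (\<open>\<phi>\<close>, x)
  \<open>\<phi>\<close> equals A x - g \<open>\<phi>\<close> exactly when h = - (|\<phi>|^2/r)
  g.\<close>

lemma rank_one_perturbed:
  assumes A: "self_adjoint A" and \<phi>: "\<phi> ~= 0" and r: "r ~= 0"
  shows "boundary_triple.perturbed (rank_one_triple A \<phi>) (- (norm \<phi>)\<^sup>2/r) (rank_one_perturbation A \<phi> r)"
proof -
  interpret boundary_triple A "rank_one_triple A \<phi>" by (rule rank_one_triple[OF A \<phi>])
  have n: "norm \<phi> ~= 0" using \<phi> by simp
  define k where "k = - (norm \<phi>)\<^sup>2/r"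
  have k: "k ~= 0" "r/(norm \<phi>)\<^sup>2 = - 1/k" using n r by (auto simp: k_def)
  have app: "op_app (rank_one_perturbation A \<phi> r) x = op_app A x - (cinner \<phi> x/cr k) *\<^sub>C \<phi>" for x
  proof -
    have "cr r*(cinner \<phi> x/cr ((norm \<phi>)\<^sup>2)) = cr (r/(norm \<phi>)\<^sup>2)*cinner \<phi> x"
      by simp
    also have "... = - (cinner \<phi> x/cr k)" unfolding k by simp
    finally show ?thesis
      by (simp add: rank_one_perturbation_def orth_proj_span[OF \<phi>] scaleR_scaleC scaleC_scaleC scaleC_minus_left del: of_real_power)
  qed
  have "(EX g. y = op_app A x - g *\<^sub>C \<phi> & cr k*g = cinner \<phi> x) \<longleftrightarrow> y = op_app A x - (cinner \<phi> x/cr k) *\<^sub>C \<phi>" for x y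
  proof
    assume "EX g. y = op_app A x - g *\<^sub>C \<phi> & cr k*g = cinner \<phi> x"
    then obtain g where g: "y = op_app A x - g *\<^sub>C \<phi>" "cr k*g = cinner \<phi> x" by blast
    have "cinner \<phi> x/cr k = g" unfolding g(2)[symmetric] using k(1) by simp
    thus "y = op_app A x - (cinner \<phi> x/cr k) *\<^sub>C \<phi>" using g(1) by simp
  next
    assume "y = op_app A x - (cinner \<phi> x/cr k) *\<^sub>C \<phi>"
    thus "EX g. y = op_app A x - g *\<^sub>C \<phi> & cr k*g = cinner \<phi> x"
      using k(1) by (intro exI[of _ "cinner \<phi> x/cr k"]) simp
  qed
  moreover have "op_dom (rank_one_perturbation A \<phi> r) = op_dom A" by (simp add: rank_one_perturbation_def)
  ultimately show ?thesis unfolding perturbed_def k_def[symmetric] app by (auto simp: rank_one_triple_def)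
qed

text \<open>A cyclic zero vector leaves only the zero space, on which the spectrum is empty. This
  excludes the degenerate case in which the boundary triple would fail.\<close>

lemma cyclic_vector_nonzero:
  assumes A: "self_adjoint A" and cyc: "cyclic_vector A \<phi>" and z: "z \<in> spectrum A"
  shows "\<phi> ~= 0"
proof
  interpret selfadj A by (rule selfadj.intro[OF A])
  assume "\<phi> = 0"
  have "w = 0" for w :: 'a
  proof (rule dense_orthogonal_zero)
    show "closure (complex_vector.span {R z \<phi> |z. z \<notin> \<real>}) = UNIV"
      using cyc by (simp add: cyclic_vector_def)
    fix x assume "x \<in> complex_vector.span {R z \<phi> |z. z \<notin> \<real>}"
    thus "cinner x w = 0"
    proof (induction rule: complex_vector.span_induct_alt)
      case base
      show ?case by simp
    next
      case (step c x y)
      then obtain z where z: "x = R z \<phi>" "z \<notin> \<real>" by blast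
      hence "Im z ~= 0" by (auto simp: complex_is_Real_iff)
      hence "x = 0" using z \<open>\<phi> = 0\<close> resolvent_norm_le[of z 0] by simp
      thus ?case using step by (simp add: cinner_simps)
    qed
  qed
  hence 1: "x = y" for x y :: 'a by metis
  have "bij_betw (op_minus_scalar A z) (op_dom A) UNIV"
    unfolding bij_betw_def inj_on_def using 1 dom_simps(1) by blast
  moreover have "norm x <= 0*norm (op_minus_scalar A z x)" for x using 1[of x 0] by simp
  ultimately have "z \<in> resolvent_set A" unfolding resolvent_set_def by blast
  thus False using z by (simp add: spectrum_def)
qed

theorem rank_one_perturbation_generic:
  fixes A :: "'a :: complex_hilbert_space unbounded_op"
  assumes A: "self_adjoint A" and cyc: "cyclic_vector A \<phi>" and ab: "a < b"
    and sp: "interval_in_spectrum A a b" and nac: "no_ac_spectrum_on A a b"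
  shows "EX C. dense_gdelta_in {a..b} C &
         (ALL E:C. ALL r. ~ eigenvalue (rank_one_perturbation A \<phi> r) (cr E))"
    and "EX L. dense_gdelta_in UNIV L &
         (ALL r:L. purely_sc_spectrum_on (rank_one_perturbation A \<phi> r) a b)"
proof -
  have "cr a \<in> spectrum A" using sp ab by (auto simp: interval_in_spectrum_def)
  hence \<phi>: "\<phi> ~= 0" by (rule cyclic_vector_nonzero[OF A cyc])
  interpret cyclic_boundary_triple A "rank_one_triple A \<phi>"
    by (rule rank_one_cyclic_triple[OF A \<phi> cyc])
  obtain C where C: "dense_gdelta_in {a..b} C"
    and CA: "!!E. E \<in> C ==> ~ eigenvalue A (cr E)"
    and CD: "!!E t D'. E \<in> C ==> perturbed t D' ==> ~ eigenvalue D' (cr E)"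
    using eigenvalues_generic[OF ab sp] by blast
  have "~ eigenvalue (rank_one_perturbation A \<phi> r) (cr E)" if "E \<in> C" for E r
    using CA[OF that] CD[OF that rank_one_perturbed[OF A \<phi>]] by (cases "r = 0") auto
  thus "EX C. dense_gdelta_in {a..b} C &
         (ALL E:C. ALL r. ~ eigenvalue (rank_one_perturbation A \<phi> r) (cr E))" using C by blast
  obtain \<N> where N: "countable \<N>" "!!N. N \<in> \<N> ==> closed N & interior N = {}"
    and ND: "!!t D'. t \<notin> \<Union>\<N> ==> perturbed t D' ==> purely_sc_spectrum_on D' a b"
    using purely_sc_generic[OF ab sp nac] by blast
  have "EX L. dense_gdelta_in UNIV L & (ALL x:L. x \<in> - {0} & - (norm \<phi>)\<^sup>2/x \<notin> \<Union>\<N>)"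
  proof (rule generic_parameter[OF _ _ _ _ N])
    show "continuous_on (- {0}) (%x. - (norm \<phi>)\<^sup>2/x)" by (intro continuous_intros) auto
    fix p q :: real assume pq: "p < q" "{p<..<q} \<subseteq> - {0}"
    define x y where "x = (2*p + q)/3" and "y = (p + 2*q)/3"
    have x: "x \<in> {p<..<q}" and y: "y \<in> {p<..<q}" and "x ~= y" using pq(1) by (auto simp: x_def y_def)
    moreover have "x ~= 0" "y ~= 0" using pq(2) x y by auto
    ultimately have "- (norm \<phi>)\<^sup>2/x ~= - (norm \<phi>)\<^sup>2/y" using \<phi> by (simp add: frac_eq_eq)
    thus "EX x:{p<..<q}. EX y:{p<..<q}. - (norm \<phi>)\<^sup>2/x < - (norm \<phi>)\<^sup>2/y"
      using x y linorder_neq_iff by blast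
  qed auto
  then obtain L where L: "dense_gdelta_in UNIV L" "!!x. x \<in> L ==> x ~= 0" "!!x. x \<in> L ==> - (norm \<phi>)\<^sup>2/x \<notin> \<Union>\<N>"
    by auto
  thus "EX L. dense_gdelta_in UNIV L &
         (ALL r:L. purely_sc_spectrum_on (rank_one_perturbation A \<phi> r) a b)"
    using ND[OF L(3) rank_one_perturbed[OF A \<phi> L(2)]] by blast
qed

section \<open>Locally absolutely continuous functions\<close>

lemma integrable_lebesgue_on_iff:
  fixes f :: "real => complex"
  shows "integrable (lebesgue_on {a..b}) f \<longleftrightarrow> f absolutely_integrable_on {a..b}"
  by (simp add: set_integrable_def integrable_restrict_space)

definition loc_int :: "(real => complex) => bool" where
  "loc_int h \<longleftrightarrow> (ALL x>=0. h absolutely_integrable_on {0..x})"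

lemma loc_intD:
  assumes "loc_int h" "0 <= a"
  shows "h absolutely_integrable_on {a..b}" "h integrable_on {a..b}"
proof -
  have "h absolutely_integrable_on {0..max 0 b}" using assms(1) by (simp add: loc_int_def)
  thus "h absolutely_integrable_on {a..b}"
    by (rule absolutely_integrable_on_subinterval) (use assms(2) in auto)
  thus "h integrable_on {a..b}" by (rule set_lebesgue_integral_eq_integral(1))
qed

lemma loc_int_add: "loc_int f ==> loc_int g ==> loc_int (%x. f x + g x)"
  unfolding loc_int_def by (auto intro: set_integral_add)

lemma loc_int_cmult: "loc_int f ==> loc_int (%x. c*f x)" unfolding loc_int_def by auto

lemma loc_int_cnj: "loc_int f ==> loc_int (%x. cnj (f x))" unfolding loc_int_def set_integrable_def
  by (auto simp: complex_cnj_scaleR[symmetric] simp del: complex_cnj_scaleR)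

lemma continuous_on_halflineI:
  fixes f :: "real => complex"
  assumes "!!b. b >= 0 ==> continuous_on {0..b} f"
  shows "continuous_on {0..} f" unfolding continuous_on_eq_continuous_within
proof
  fix x :: real assume x: "x \<in> {0..}"
  have "at x within {0..} = at x within {0..x + 1}" by (rule at_within_nhd[of x "{..<x + 1}"]) auto
  thus "continuous (at x within {0..}) f"
    using assms[of "x + 1"] x by (simp add: continuous_on_eq_continuous_within)
qed

lemma loc_int_continuous_mult:
  assumes c: "continuous_on {0..} c" and h: "loc_int h"
  shows "loc_int (%x. c x*h x)" unfolding loc_int_def
proof (intro allI impI absolutely_integrable_bounded_measurable_product[where h = "(*)"])
  fix x :: real assume x: "x >= 0"
  have cx: "continuous_on {0..x} c" by (rule continuous_on_subset[OF c]) auto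
  thus "c \<in> borel_measurable (lebesgue_on {0..x})"
    by (intro continuous_imp_measurable_on_sets_lebesgue) auto
  show "bounded (c ` {0..x})" by (intro compact_imp_bounded compact_continuous_image cx) simp
  show "h absolutely_integrable_on {0..x}" using h x by (simp add: loc_int_def)
qed (auto simp: bilinear_times)

lemma loc_int_continuous: "continuous_on {0..} c ==> loc_int c"
  using loc_int_continuous_mult[of c "%x. 1"] unfolding loc_int_def by auto

lemma loc_int_primitive_continuous: "loc_int h ==> continuous_on {0..} (%x. integral {0..x} h)"
  using loc_intD by (intro continuous_on_halflineI indefinite_integral_continuous_1) auto

lemma locally_ac_alt: "locally_ac f f' \<longleftrightarrow> loc_int f' & (ALL x>=0. f x - f 0 = integral {0..x} f')"
  unfolding locally_ac_def loc_int_def by (simp add: diff_eq_eq add.commute) blast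

lemma locally_acD:
  assumes "locally_ac f f'"
  shows "loc_int f'" "x >= 0 ==> f x = f 0 + integral {0..x} f'"
  using assms unfolding locally_ac_def loc_int_def by blast+

lemma locally_ac_continuous:
  assumes f: "locally_ac f f'"
  shows "continuous_on {0..} f"
proof -
  have "continuous_on {0..} (%x. f 0 + integral {0..x} f')"
    by (intro continuous_on_add continuous_on_const loc_int_primitive_continuous)
      (rule locally_acD[OF f])
  thus ?thesis by (rule continuous_on_eq) (metis locally_acD(2)[OF f] atLeast_iff)
qed

lemma locally_ac_add:
  "locally_ac f f' ==> locally_ac g g' ==> locally_ac (%x. f x + g x) (%x. f' x + g' x)"
  unfolding locally_ac_alt
  by (auto simp: loc_int_add loc_intD(2) Henstock_Kurzweil_Integration.integral_add add_diff_add)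

lemma locally_ac_cmult: "locally_ac f f' ==> locally_ac (%x. c*f x) (%x. c*f' x)"
  unfolding locally_ac_alt by (auto simp: loc_int_cmult right_diff_distrib[symmetric])

lemma locally_ac_diff:
  "locally_ac f f' ==> locally_ac g g' ==> locally_ac (%x. f x - g x) (%x. f' x - g' x)"
  using locally_ac_add[of f f' "%x. - 1*g x" "%x. - 1*g' x"] locally_ac_cmult[of g g' "- 1"] by simp

lemma locally_ac_cnj: "locally_ac f f' ==> locally_ac (%x. cnj (f x)) (%x. cnj (f' x))"
  unfolding locally_ac_alt by (metis loc_int_cnj complex_cnj_diff integral_cnj)

lemma locally_ac_primitive: "loc_int h ==> locally_ac (%x. a + integral {0..x} h) h"
  by (simp add: locally_ac_alt)

lemma locally_ac_cong:
  assumes "locally_ac f f'" "!!x. x >= 0 ==> f x = g x" "!!x. x >= 0 ==> f' x = g' x"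
  shows "locally_ac g g'" unfolding locally_ac_def
proof (intro allI impI conjI)
  fix x :: real assume x: "0 <= x"
  show "g' absolutely_integrable_on {0..x}"
    by (rule absolutely_integrable_spike[OF loc_intD(1)[OF locally_acD(1)[OF assms(1)]], of 0 "{}"])
      (use assms(3) in auto)
  have "integral {0..x} f' = integral {0..x} g'" using assms(3) by (intro integral_cong) auto
  thus "g x = g 0 + integral {0..x} g'"
    using locally_acD(2)[OF assms(1) x] assms(2)[OF x] assms(2)[OF order_refl] by metis
qed

lemma locally_ac_const:
  assumes "locally_ac f f'" "!!x. x >= 0 ==> f' x = 0" "x >= 0"
  shows "f x = f 0"
proof -
  have "integral {0..x} f' = integral {0..x} (%x. 0)" using assms(2) by (intro integral_cong) auto
  thus ?thesis using locally_acD(2)[OF assms(1,3)] by (metis add.right_neutral integral_0)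
qed

text \<open>Integration by parts from Fubini's theorem on the triangle t <= s: integrating f'(s)
  g'(t) first over t gives f' G, first over s gives (F x - F t) g'.\<close>

lemma integral_product:
  fixes f' g' :: "real => complex"
  defines "F \<equiv> %x. integral {0..x} f'" and "G \<equiv> %x. integral {0..x} g'"
  assumes f: "loc_int f'" and g: "loc_int g'" and x: "x >= 0"
  shows "integral {0..x} (%s. f' s*G s + F s*g' s) = F x*G x"
proof -
  let ?M = "lebesgue_on {0..x}"
  interpret M: finite_measure ?M by (rule finite_measure_lebesgue_on) auto
  interpret P: pair_sigma_finite ?M ?M ..
  have fi: "integrable ?M f'" and gi: "integrable ?M g'"
    using loc_intD(1)[OF f, of 0 x] loc_intD(1)[OF g, of 0 x] by (simp_all add: integrable_lebesgue_on_iff)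
  note [measurable] = borel_measurable_integrable[OF fi] borel_measurable_integrable[OF gi]
  have [measurable]: "(%s. s) \<in> borel_measurable ?M"
    by (intro continuous_imp_measurable_on_sets_lebesgue) auto
  define h where "h s t = (if t <= s then f' s*g' t else 0)" for s t
  have [measurable]: "case_prod h \<in> borel_measurable (?M \<Otimes>\<^sub>M ?M)" unfolding h_def by measurable
  have hi: "integrable ?M (%t. h s t)" for s
    unfolding h_def by (rule Bochner_Integration.integrable_bound[OF integrable_mult_right[OF gi, of "f' s"]]) auto
  have "integrable (?M \<Otimes>\<^sub>M ?M) (case_prod h)"
  proof (rule P.Fubini_integrable)
    show "integrable ?M (%s. LINT t|?M. norm (case_prod h (s, t)))"
    proof (rule Bochner_Integration.integrable_bound)
      show "integrable ?M (%s. norm (f' s)*(LINT t|?M. norm (g' t)))" using fi by (intro integrable_mult_left integrable_norm)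
      have "(LINT t|?M. norm (h s t)) <= norm (f' s)*(LINT t|?M. norm (g' t))" for s
        unfolding integral_mult_right_zero[symmetric] using hi gi
        by (intro integral_mono integrable_norm integrable_mult_right) (auto simp: h_def norm_mult)
      thus "AE s in ?M. norm (LINT t|?M. norm (case_prod h (s, t))) <= norm (norm (f' s)*(LINT t|?M. norm (g' t)))"
        by (intro AE_I2) (simp add: integral_nonneg)
    qed measurable
  qed (use hi in auto)
  from P.Fubini_integral[OF this] have sw: "(LINT t|?M. LINT s|?M. h s t) = (LINT s|?M. LINT t|?M. h s t)" .
  have 1: "(LINT t|?M. h s t) = f' s*G s" if s: "s \<in> {0..x}" for s
  proof -
    have "(LINT t|?M. h s t) = integral {0..x} (h s)" by (rule lebesgue_integral_eq_integral[OF hi]) simp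
    also have "... = integral {0..x} (%t. if t \<in> {0..s} then f' s*g' t else 0)"
      by (intro integral_cong) (auto simp: h_def)
    also have "... = integral {0..s} (%t. f' s*g' t)" unfolding integral_restrict_Int using s by simp
    finally show ?thesis by (simp add: G_def)
  qed
  have 2: "(LINT s|?M. h s t) = (F x - F t)*g' t" if t: "t \<in> {0..x}" for t
  proof -
    have "integrable ?M (%s. h s t)"
      unfolding h_def by (rule Bochner_Integration.integrable_bound[OF integrable_mult_left[OF fi, of "g' t"]]) auto
    hence "(LINT s|?M. h s t) = integral {0..x} (%s. h s t)" by (rule lebesgue_integral_eq_integral) simp
    also have "... = integral {0..x} (%s. if s \<in> {t..x} then f' s*g' t else 0)"
      by (intro integral_cong) (auto simp: h_def)
    also have "... = integral {t..x} (%s. f' s*g' t)" unfolding integral_restrict_Int using t by simp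
    also have "... = integral {t..x} f'*g' t" by simp
    also have "integral {t..x} f' = F x - F t"
      using Henstock_Kurzweil_Integration.integral_combine[of 0 t x f'] t loc_intD(2)[OF f, of 0 x]
      unfolding F_def by (auto simp: eq_diff_eq add.commute)
    finally show ?thesis .
  qed
  have Fc: "continuous_on {0..} F" and Gc: "continuous_on {0..} G"
    unfolding F_def G_def using loc_int_primitive_continuous f g by auto
  have lf: "loc_int (%s. G s*f' s)" and lg: "loc_int (%t. F t*g' t)"
    using loc_int_continuous_mult Fc Gc f g by blast+
  have "(LINT s|?M. LINT t|?M. h s t) = (LINT s|?M. G s*f' s)"
    by (intro Bochner_Integration.integral_cong) (auto simp: 1)
  moreover have "(LINT t|?M. LINT s|?M. h s t) = (LINT t|?M. F x*g' t - F t*g' t)"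
    by (intro Bochner_Integration.integral_cong) (auto simp: 2 left_diff_distrib)
  moreover have "(LINT s|?M. G s*f' s) = integral {0..x} (%s. G s*f' s)"
    "(LINT t|?M. F x*g' t - F t*g' t) = integral {0..x} (%t. F x*g' t - F t*g' t)"
    using loc_intD(1)[OF lf, of 0 x] loc_intD(1)[OF lg, of 0 x] gi
    by (intro lebesgue_integral_eq_integral Bochner_Integration.integrable_diff integrable_mult_right;
      simp add: integrable_lebesgue_on_iff)+
  ultimately have "integral {0..x} (%t. F x*g' t - F t*g' t) = integral {0..x} (%s. G s*f' s)"
    using sw by metis
  moreover have "integral {0..x} (%t. F x*g' t - F t*g' t) = F x*G x - integral {0..x} (%t. F t*g' t)"
    using loc_intD(2)[OF lg, of 0 x] loc_intD(2)[OF loc_int_cmult[OF g], of 0 "F x" x]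
    by (simp add: Henstock_Kurzweil_Integration.integral_diff G_def)
  ultimately show ?thesis using loc_intD(2)[OF lf, of 0 x] loc_intD(2)[OF lg, of 0 x]
    by (simp add: Henstock_Kurzweil_Integration.integral_add mult.commute algebra_simps)
qed

text \<open>Splitting off the values at 0 reduces the product rule to primitives vanishing at
  0.\<close>

lemma locally_ac_mult:
  assumes f: "locally_ac f f'" and g: "locally_ac g g'"
  shows "locally_ac (%x. f x*g x) (%x. f' x*g x + f x*g' x)"
proof -
  have fg: "loc_int f'" "loc_int g'" using f g by (auto simp: locally_ac_alt)
  have l: "loc_int (%x. g x*f' x)" "loc_int (%x. f x*g' x)"
    using f g locally_ac_continuous loc_int_continuous_mult fg by blast+
  have "f x*g x = f 0*g 0 + integral {0..x} (%x. f' x*g x + f x*g' x)" if x: "x >= 0" for x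
  proof -
    define F G where "F = (%x. integral {0..x} f')" and "G = (%x. integral {0..x} g')"
    have F: "f y = f 0 + F y" "g y = g 0 + G y" if "y >= 0" for y
      unfolding F_def G_def using locally_acD(2)[OF f that] locally_acD(2)[OF g that] by blast+
    have i: "(%s. f' s*G s + F s*g' s) integrable_on {0..x}"
      using loc_intD(2)[OF loc_int_add[OF loc_int_continuous_mult[OF loc_int_primitive_continuous[OF fg(2)] fg(1)]
        loc_int_continuous_mult[OF loc_int_primitive_continuous[OF fg(1)] fg(2)]], of 0 x]
      by (simp add: F_def G_def mult.commute)
    have "integral {0..x} (%x. f' x*g x + f x*g' x) =
        integral {0..x} (%s. (f' s*G s + F s*g' s) + (g 0*f' s + f 0*g' s))"
    proof (intro integral_cong)
      fix t assume "t \<in> {0..x}"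
      hence "f t = f 0 + F t" "g t = g 0 + G t" using F[of t] by auto
      thus "f' t*g t + f t*g' t = (f' t*G t + F t*g' t) + (g 0*f' t + f 0*g' t)" by (simp add: algebra_simps)
    qed
    also have "... = F x*G x + (g 0*F x + f 0*G x)"
      using integral_product[OF fg x] i loc_intD(2)[OF loc_int_cmult[OF fg(1)]] loc_intD(2)[OF loc_int_cmult[OF fg(2)]]
      by (simp add: Henstock_Kurzweil_Integration.integral_add integrable_add F_def G_def)
    finally show ?thesis using F[OF x] by (simp add: algebra_simps)
  qed
  moreover have "loc_int (%x. f' x*g x + f x*g' x)" using loc_int_add[OF l] by (simp add: mult.commute)
  ultimately show ?thesis unfolding locally_ac_def loc_int_def by blast
qed

text \<open>On each [0, X] the integrals over all half-lines vanish. Half-lines are stable under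
  intersection and generate the Borel sets, and every Lebesgue set is a Borel set up to a null set;
  so all integrals vanish, and with them the function.\<close>

lemma AE_zero_if_integral_zero:
  assumes h: "loc_int h" and z: "!!x. x >= 0 ==> integral {0..x} h = 0"
  shows "AE x in half_line. h x = 0"
proof -
  have "AE x in lebesgue. indicator {0..real X} x *\<^sub>R h x = 0" for X :: nat
  proof -
    define k where "k = (%x. indicator {0..real X} x *\<^sub>R h x)"
    have ki: "integrable lebesgue k"
      using loc_intD(1)[OF h, of 0 "real X"] by (simp add: k_def set_integrable_def)
    have si: "set_integrable lebesgue A k" if "A \<in> sets lebesgue" for A
      unfolding set_integrable_def by (rule integrable_mult_indicator[OF that ki])
    have At: "set_lebesgue_integral lebesgue {..b} k = 0" for b
    proof -
      have "set_lebesgue_integral lebesgue {..b} k = set_lebesgue_integral lebesgue {0..min b (real X)} h"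
        unfolding set_lebesgue_integral_def k_def
        by (intro Bochner_Integration.integral_cong) (auto simp: indicator_def)
      also have "... = integral {0..min b (real X)} h"
        by (rule set_lebesgue_integral_eq_integral(2)[OF loc_intD(1)[OF h]]) simp
      also have "... = 0" using z[of "min b (real X)"] by (cases "min b (real X) >= 0") auto
      finally show ?thesis .
    qed
    have tot: "integral\<^sup>L lebesgue k = 0" using At[of "real X"] unfolding set_lebesgue_integral_def
      by (subst (asm) Bochner_Integration.integral_cong[of _ _ _ k]) (auto simp: k_def indicator_def)
    have sb: "sigma_sets UNIV (range atMost) = sets (borel :: real measure)" by (simp add: borel_eq_atMost)
    have st: "Int_stable (range (atMost :: real => _))" "range (atMost :: real => _) \<subseteq> Pow UNIV"
      by (auto simp: Int_stable_def)
    have bor: "set_lebesgue_integral lebesgue A k = 0" if "A \<in> sets borel" for A using st that[folded sb]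
    proof (induction rule: sigma_sets_induct_disjoint)
      case (basic A)
      thus ?case using At by auto
    next
      case empty
      show ?case by (simp add: set_lebesgue_integral_def)
    next
      case (compl A)
      hence "A \<in> sets borel" by (simp add: sb)
      hence "A \<in> sets lebesgue" by simp
      hence "set_lebesgue_integral lebesgue (A \<union> (UNIV - A)) k =
         set_lebesgue_integral lebesgue A k + set_lebesgue_integral lebesgue (UNIV - A) k"
        using sets.compl_sets[of A lebesgue] by (intro set_integral_Un si) auto
      thus ?case using compl(2) tot by (simp add: set_lebesgue_integral_def)
    next
      case (union A)
      hence "range A \<subseteq> sets borel" by (simp add: sb)
      hence A: "A i \<in> sets lebesgue" for i by (auto simp: image_subset_iff)
      have "set_lebesgue_integral lebesgue (\<Union>i. A i) k = (\<Sum>i. set_lebesgue_integral lebesgue (A i) k)"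
        using union(1) A by (intro lebesgue_integral_countable_add si) (auto simp: disjoint_family_on_def)
      thus ?case using union by simp
    qed
    have sf: "sigma_finite_measure (lebesgue :: real measure)"
      using lborel.sigma_finite_countable by unfold_locales (fastforce simp: subset_eq)
    have "AE x in lebesgue. k x = 0"
    proof (rule sigma_finite_measure.density_zero[OF sf ki])
      fix A :: "real set" assume "A \<in> sets lebesgue"
      then obtain S N N' where A: "A = S \<union> N" "N \<subseteq> N'" "N' \<in> null_sets lborel" "S \<in> sets lborel"
        by (rule sets_completionE)
      have S: "S \<in> sets borel" using A(4) by simp
      have "AE x in lebesgue. x \<notin> N'" using A(3) by (intro AE_not_in null_sets_completionI)
      hence "set_lebesgue_integral lebesgue A k = set_lebesgue_integral lebesgue S k"
        unfolding set_lebesgue_integral_def using \<open>A \<in> sets lebesgue\<close> S ki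
        by (intro integral_cong_AE borel_measurable_scaleR borel_measurable_indicator borel_measurable_integrable)
          (auto simp: A(1) indicator_def elim!: eventually_mono dest: subsetD[OF A(2)])
      thus "set_lebesgue_integral lebesgue A k = 0" using bor[OF S] by simp
    qed
    thus ?thesis by (simp add: k_def)
  qed
  hence "AE x in lebesgue. ALL X::nat. indicator {0..real X} x *\<^sub>R h x = 0"
    unfolding AE_all_countable by blast
  hence "AE x in lebesgue. x \<in> {0..} --> h x = 0"
  proof eventually_elim
    case (elim x)
    obtain X :: nat where "x <= real X" using real_arch_simple by blast
    with elim[rule_format, of X] show ?case by (auto simp: indicator_def)
  qed
  thus ?thesis by (simp add: AE_restrict_space_iff)
qed

section \<open>The Schroedinger equation\<close>

lemma locally_ac_power:
  assumes "locally_ac b b'"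
  shows "locally_ac (%x. b x^Suc n) (%x. of_nat (Suc n)*(b' x*b x^n))"
proof (induction n)
  case (Suc n)
  from locally_ac_mult[OF assms Suc] show ?case by (rule locally_ac_cong) (auto simp: algebra_simps)
qed (use assms in simp)

lemma absolutely_integrable_of_real:
  "(f :: real => real) absolutely_integrable_on S ==> (%x. cr (f x)) absolutely_integrable_on S"
  using absolutely_integrable_linear[OF _ bounded_linear_of_real[where 'a = complex]] by (simp add: o_def)

lemma integral_norm_bound_Re:
  fixes f g :: "real => complex"
  assumes "f integrable_on S" "g integrable_on S" "!!x. x \<in> S ==> cmod (f x) <= Re (g x)"
  shows "cmod (integral S f) <= Re (integral S g)"
  using integral_norm_bound_integral_component[of f S g 1] assms by (simp add: inner_complex_def)

text \<open>A system of two first order equations, indexed by \<open>bool\<close> and solved by the Picard series.\<close>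

lemma volterra_system:
  fixes c :: "bool => real => complex" and a :: "bool => complex"
  assumes c: "!!i. loc_int (c i)"
  obtains u where "!!i. locally_ac (u i) (%t. c i t*u (~ i) t)" "!!i. u i 0 = a i"
proof -
  \<comment> \<open>The terms of the Picard series, not its partial sums; a component is always
    integrated from the other one.\<close>
  define W where "W = rec_nat (%i x. a i) (%n w i x. integral {0..x} (%t. c i t*w (~ i) t))"
  have W0: "W 0 i x = a i" and WS: "W (Suc n) i = (%x. integral {0..x} (%t. c i t*W n (~ i) t))" for n i x
    by (auto simp: W_def)
  have Wc: "continuous_on {0..} (W n i)" and Wl: "loc_int (%t. c i t*W n (~ i) t)" for n i
  proof -
    have "ALL i. continuous_on {0..} (W n i)"
    proof (induction n)
      case (Suc n)
      show ?case unfolding WS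
      proof
        fix i
        show "continuous_on {0..} (%x. integral {0..x} (%t. c i t*W n (~ i) t))"
          using loc_int_continuous_mult[OF Suc[rule_format, of "~ i"] c[of i]]
          by (intro loc_int_primitive_continuous) (simp add: mult.commute)
      qed
    qed (simp add: W_def)
    thus "continuous_on {0..} (W n i)" "loc_int (%t. c i t*W n (~ i) t)"
      using loc_int_continuous_mult[of "W n (~ i)" "c i"] c by (auto simp: mult.commute)
  qed
  define r where "r t = cmod (c True t) + cmod (c False t)" for t
  \<comment> \<open>Its powers divided by factorials dominate the terms \<open>W\<close>. It is kept
    complex valued, so that the calculus of \<open>locally_ac\<close> applies to the powers; the
    bounds are therefore stated with real parts.\<close>
  define b where "b x = integral {0..x} (%t. cr (r t))" for x
  define C where "C = cmod (a True) + cmod (a False)"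
  have C0: "C >= 0" by (simp add: C_def)
  have rl: "loc_int (%t. cr (r t))" using c unfolding r_def loc_int_def
    by (auto intro!: absolutely_integrable_of_real set_integral_add absolutely_integrable_norm[unfolded o_def])
  have b: "locally_ac b (%t. cr (r t))" using locally_ac_primitive[OF rl, of 0] by (simp add: b_def[abs_def])
  have b0: "b 0 = 0" by (simp add: b_def)
  have bound: "cmod (W n i x) <= Re (cr (C/fact n)*b x^n)" if "x >= 0" for n i x using that
  proof (induction n arbitrary: i x)
    case 0
    show ?case by (cases i) (auto simp: W0 C_def)
  next
    case (Suc n)
    note bn = locally_ac_power[OF b, of n]
    let ?g = "%t. cr (r t)*(cr (C/fact n)*b t^n)"
    have bp: "locally_ac (%x. cr (C/fact (Suc n))*b x^Suc n) ?g"
    proof (rule locally_ac_cong[OF locally_ac_cmult[OF bn, of "cr (C/fact (Suc n))"]])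
      fix t :: real
      have e: "cr (C/fact (Suc n)) * of_nat (Suc n) = cr (C/fact n)"
        by (simp add: field_simps del: of_nat_Suc)
      show "cr (C/fact (Suc n))*(of_nat (Suc n)*(cr (r t)*b t^n)) = ?g t"
        unfolding e[symmetric] by (simp only: mult_ac)
    qed simp
    have "cmod (integral {0..x} (%t. c i t*W n (~ i) t)) <= Re (integral {0..x} ?g)"
    proof (rule integral_norm_bound_Re)
      show "(%t. c i t*W n (~ i) t) integrable_on {0..x}" by (rule loc_intD(2)[OF Wl]) simp
      show "?g integrable_on {0..x}" by (rule loc_intD(2)[OF locally_acD(1)[OF bp]]) simp
      fix t assume "t \<in> {0..x}"
      hence IH: "cmod (W n (~ i) t) <= Re (cr (C/fact n)*b t^n)" using Suc.IH by auto
      have "cmod (c i t) <= r t" by (cases i) (auto simp: r_def)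
      hence "cmod (c i t*W n (~ i) t) <= r t*Re (cr (C/fact n)*b t^n)"
        unfolding norm_mult by (intro mult_mono IH) (auto simp: r_def)
      moreover have "Re (cr p*z) = p*Re z" for p z by simp
      ultimately show "cmod (c i t*W n (~ i) t) <= Re (?g t)" by (simp only:)
    qed
    thus ?case using locally_acD(2)[OF bp Suc.prems] by (simp add: WS b0)
  qed
  \<comment> \<open>The bound on the partial sums, uniform on [0, X], supplies the dominating
    function for passing to the limit under the integral.\<close>
  have unif: "EX E. ALL i. ALL x:{0..X}. summable (%n. W n i x) & (ALL N. cmod (\<Sum>n<N. W n i x) <= E)" for X
  proof -
    have "compact (b ` {0..X})"
      by (intro compact_continuous_image continuous_on_subset[OF locally_ac_continuous[OF b]]) auto
    from compact_imp_bounded[OF this] obtain K where "ALL y:b ` {0..X}. cmod y <= K"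
      unfolding bounded_iff by blast
    hence K: "cmod (b x) <= K" if "x \<in> {0..X}" for x using that by blast
    have le: "cmod (W n i x) <= C*(inverse (fact n)*K^n)" if x: "x \<in> {0..X}" for n i x
    proof -
      have "cmod (W n i x) <= cmod (cr (C/fact n)*b x^n)"
        using bound[of x n i] x complex_Re_le_cmod order_trans by auto
      also have "... = C/fact n*cmod (b x)^n" by (simp add: norm_mult norm_power norm_divide C0)
      also have "... <= C/fact n*K^n" by (intro mult_left_mono power_mono K x) (auto simp: C0)
      finally show ?thesis by (simp add: field_simps)
    qed
    have sE: "summable (%n. C*(inverse (fact n)*K^n))" by (intro summable_mult summable_exp)
    have "summable (%n. W n i x)" "cmod (\<Sum>n<N. W n i x) <= (\<Sum>n. C*(inverse (fact n)*K^n))"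
      if x: "x \<in> {0..X}" for i x N
    proof -
      show "summable (%n. W n i x)" by (rule summable_comparison_test'[OF sE]) (rule le[OF x])
      have "cmod (\<Sum>n<N. W n i x) <= (\<Sum>n<N. C*(inverse (fact n)*K^n))"
        by (rule sum_norm_le) (rule le[OF x])
      also have "... <= (\<Sum>n. C*(inverse (fact n)*K^n))"
        by (intro sum_le_suminf[OF sE] ballI order_trans[OF norm_ge_zero le[OF x]]) simp
      finally show "cmod (\<Sum>n<N. W n i x) <= (\<Sum>n. C*(inverse (fact n)*K^n))" .
    qed
    thus ?thesis by blast
  qed
  define u where "u i x = (\<Sum>n. W n i x)" for i x
  have lim: "(%N. \<Sum>n<N. W n i x) ----> u i x" if "x >= 0" for i x
    using unif[of x] that unfolding u_def by (intro summable_LIMSEQ) auto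
  have ui: "(%t. c i t*u (~ i) t) integrable_on {0..x} &
      u i x = a i + integral {0..x} (%t. c i t*u (~ i) t)" if x: "x >= 0" for i x
  proof -
    obtain E where E: "!!i t N. t \<in> {0..x} ==> cmod (\<Sum>n<N. W n i t) <= E" using unif[of x] by blast
    have f: "(%t. c i t*(\<Sum>n<N. W n (~ i) t)) integrable_on {0..x}" for N
      unfolding sum_distrib_left using loc_intD(2)[OF Wl] by (intro integrable_sum) auto
    have h: "(%t. cmod (c i t)*E) integrable_on {0..x}"
      using absolutely_integrable_norm[OF loc_intD(1)[OF c[of i], of 0 x]]
      by (intro integrable_on_mult_left set_lebesgue_integral_eq_integral(1)) (auto simp: o_def)
    have le: "norm (c i t*(\<Sum>n<N. W n (~ i) t)) <= cmod (c i t)*E" if "t \<in> {0..x}" for t N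
      unfolding norm_mult by (intro mult_left_mono E that) simp
    have cv: "(%N. c i t*(\<Sum>n<N. W n (~ i) t)) ----> c i t*u (~ i) t" if "t \<in> {0..x}" for t
      using that by (intro tendsto_intros lim) auto
    note dc = dominated_convergence[OF f h le cv]
    have "(\<Sum>n<Suc N. W n i x) = a i + integral {0..x} (%t. c i t*(\<Sum>n<N. W n (~ i) t))" for N
      unfolding sum.lessThan_Suc_shift sum_distrib_left WS W0 using loc_intD(2)[OF Wl]
      by (subst integral_sum) auto
    moreover have "(%N. \<Sum>n<Suc N. W n i x) ----> u i x" by (rule LIMSEQ_Suc[OF lim[OF x]])
    ultimately have "(%N. a i + integral {0..x} (%t. c i t*(\<Sum>n<N. W n (~ i) t))) ----> u i x" by simp
    moreover have "(%N. a i + integral {0..x} (%t. c i t*(\<Sum>n<N. W n (~ i) t))) \<longlonglongrightarrow>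
        a i + integral {0..x} (%t. c i t*u (~ i) t)" by (intro tendsto_intros dc)
    ultimately show ?thesis using dc(1) LIMSEQ_unique by blast
  qed
  have uc: "continuous_on {0..} (u i)" for i
  proof (rule continuous_on_halflineI)
    fix d :: real assume d: "d >= 0"
    have "continuous_on {0..d} (%x. a i + integral {0..x} (%t. c i t*u (~ i) t))"
      using ui[OF d] by (intro continuous_on_add continuous_on_const indefinite_integral_continuous_1) auto
    thus "continuous_on {0..d} (u i)" by (rule continuous_on_eq) (use ui in auto)
  qed
  have "loc_int (%t. c i t*u (~ i) t)" for i
    using loc_int_continuous_mult[OF uc[of "~ i"] c[of i]] by (simp add: mult.commute)
  moreover have "u i 0 = a i" for i using ui[of 0 i] by simp
  ultimately show thesis using that[of u] ui by (auto simp: locally_ac_def loc_int_def)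
qed

locale potential =
  fixes V :: "real => real"
  assumes V: "locally_integrable V"
begin

abbreviation "expr \<equiv> schroedinger_expr V"

lemma loc_int_V: "loc_int (%x. cr (V x))"
  using V unfolding loc_int_def locally_integrable_def by (auto intro: absolutely_integrable_of_real)

lemma expr_iff: "expr u u' f \<longleftrightarrow> locally_ac u u' & locally_ac u' (%x. cr (V x)*u x - f x)"
proof
  assume "expr u u' f"
  then obtain u'' where u: "locally_ac u u'" "locally_ac u' u''" "ALL x>=0. f x = - u'' x + cr (V x)*u x"
    unfolding schroedinger_expr_def by blast
  have "locally_ac u' (%x. cr (V x)*u x - f x)" by (rule locally_ac_cong[OF u(2)]) (use u(3) in auto)
  thus "locally_ac u u' & locally_ac u' (%x. cr (V x)*u x - f x)" using u(1) by simp
next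
  assume "locally_ac u u' & locally_ac u' (%x. cr (V x)*u x - f x)"
  thus "expr u u' f" unfolding schroedinger_expr_def by (intro exI[of _ "%x. cr (V x)*u x - f x"]) simp
qed

lemma expr_add:
  assumes u: "expr u u' f" and w: "expr w w' g"
  shows "expr (%x. u x + w x) (%x. u' x + w' x) (%x. f x + g x)" unfolding expr_iff
proof
  show "locally_ac (%x. u x + w x) (%x. u' x + w' x)" using u w by (auto simp: expr_iff locally_ac_add)
  show "locally_ac (%x. u' x + w' x) (%x. cr (V x)*(u x + w x) - (f x + g x))"
    by (rule locally_ac_cong[OF locally_ac_add[of u' _ w']])
      (use u w in \<open>auto simp: expr_iff algebra_simps\<close>)
qed

lemma expr_cmult:
  assumes u: "expr u u' f"
  shows "expr (%x. k*u x) (%x. k*u' x) (%x. k*f x)" unfolding expr_iff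
proof
  show "locally_ac (%x. k*u x) (%x. k*u' x)" using u by (auto simp: expr_iff locally_ac_cmult)
  show "locally_ac (%x. k*u' x) (%x. cr (V x)*(k*u x) - k*f x)"
    by (rule locally_ac_cong[OF locally_ac_cmult[of u' _ k]])
      (use u in \<open>auto simp: expr_iff algebra_simps\<close>)
qed

lemma expr_cnj: "expr u u' f ==> expr (%x. cnj (u x)) (%x. cnj (u' x)) (%x. cnj (f x))"
  unfolding expr_iff by (auto intro!: locally_ac_cnj dest: locally_ac_cnj)

lemma expr_cong:
  assumes "expr u u' f" "!!x. x >= 0 ==> u x = w x" "!!x. x >= 0 ==> u' x = w' x" "!!x. x >= 0 ==> f x = g x"
  shows "expr w w' g"
  using assms(1) locally_ac_cong[of u u' w w'] locally_ac_cong[of u' _ w' "%x. cr (V x)*w x - g x"] assms(2-)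
  unfolding expr_iff by (metis (no_types, lifting))

text \<open>The potential cancels in the derivative of the Wronskian; all later identities of
  Lagrange and Green type rest on this.\<close>

lemma wronskian_ac:
  assumes "expr u u' f" "expr w w' g"
  shows "locally_ac (%x. u x*w' x - u' x*w x) (%x. f x*w x - u x*g x)"
proof -
  have u: "locally_ac u u'" "locally_ac u' (%x. cr (V x)*u x - f x)"
    and w: "locally_ac w w'" "locally_ac w' (%x. cr (V x)*w x - g x)" using assms by (auto simp: expr_iff)
  from locally_ac_diff[OF locally_ac_mult[OF u(1) w(2)] locally_ac_mult[OF u(2) w(1)]]
  show ?thesis by (rule locally_ac_cong) (auto simp: algebra_simps)
qed

lemma solution_exists:
  obtains u u' where "expr u u' (%x. z*u x)" "u 0 = a" "u' 0 = b"
proof -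
  let ?c = "%i x. if i then 1 else cr (V x) - z"
  have "loc_int (?c i)" for i using loc_int_V loc_int_continuous[of "%x. 1"] loc_int_continuous[of "%x. - z"]
      loc_int_add[of "%x. cr (V x)" "%x. - z"] by (cases i) auto
  from volterra_system[where c = ?c and a = "%i. if i then a else b", OF this]
  obtain u where u: "!!i. locally_ac (u i) (%t. ?c i t*u (~ i) t)" "!!i. u i 0 = (if i then a else b)"
    by metis
  have "expr (u True) (u False) (%x. z*u True x)"
    using u(1)[of True] u(1)[of False] by (simp add: expr_iff left_diff_distrib)
  thus thesis using that u(2)[of True] u(2)[of False] by simp
qed

end

section \<open>Square integrable functions\<close>

lemma to_L2_add: "square_integrable f ==> square_integrable g ==> to_L2 f + to_L2 g = to_L2 (%x. f x + g x)"
  by (simp add: plus_half_line_L2.abs_eq L2_rel_def)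

lemma to_L2_diff: "square_integrable f ==> square_integrable g ==> to_L2 f - to_L2 g = to_L2 (%x. f x - g x)"
  by (simp add: minus_half_line_L2.abs_eq L2_rel_def)

lemma to_L2_scale: "square_integrable f ==> k *\<^sub>C to_L2 f = to_L2 (%x. k*f x)"
  by (simp add: scaleC_half_line_L2.abs_eq L2_rel_def)

lemma cinner_to_L2:
  "square_integrable f ==> square_integrable g ==> cinner (to_L2 f) (to_L2 g) = (LINT x|half_line. cnj (f x)*g x)"
  by (simp add: cinner_half_line_L2.abs_eq L2_rel_def)

lemma norm_to_L2: "square_integrable f ==> (norm (to_L2 f))\<^sup>2 = (LINT x|half_line. (cmod (f x))\<^sup>2)"
  by (simp add: power2_norm_eq_inner inner_to_L2_self)

lemma to_L2_eq_iff:
  "square_integrable f ==> square_integrable g ==> to_L2 f = to_L2 g \<longleftrightarrow> (AE x in half_line. f x = g x)"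
  using Quotient3_rel[OF Quotient3_half_line_L2, of f g] by (simp add: L2_rel_def)

lemma square_integrable_cnj: "square_integrable f ==> square_integrable (%x. cnj (f x))"
  by (auto simp: square_integrable_def intro: measurable_compose[OF _ borel_measurable_continuous_onI[OF continuous_on_cnj[OF continuous_on_id]]])

lemma square_integrable_cong:
  assumes "square_integrable f" "!!x. x >= 0 ==> f x = g x"
  shows "square_integrable g"
proof -
  have "f x = g x" if "x \<in> space half_line" for x using that assms(2) by simp
  thus ?thesis using assms(1) measurable_cong[of half_line f g borel]
      Bochner_Integration.integrable_cong[of half_line half_line "%x. (cmod (f x))\<^sup>2" "%x. (cmod (g x))\<^sup>2"]
    by (simp add: square_integrable_def)
qed

lemma square_integrable_restrict:
  assumes "square_integrable f"
  shows "square_integrable (%x. if x <= X then f x else 0)"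
proof -
  note [measurable] = square_integrable_measurable[OF assms]
  have [measurable]: "(%x. x) \<in> borel_measurable half_line"
    by (intro continuous_imp_measurable_on_sets_lebesgue) auto
  have m: "(%x. if x <= X then f x else 0) \<in> borel_measurable half_line" by measurable
  thus ?thesis using assms unfolding square_integrable_def
    by (auto intro: Bochner_Integration.integrable_bound[of _ "%x. (cmod (f x))\<^sup>2"])
qed

lemma half_line_set_integrable: "integrable half_line f \<longleftrightarrow> set_integrable lebesgue {0..} f"
  for f :: "real => 'b :: euclidean_space" by (simp add: set_integrable_def integrable_restrict_space)

lemma half_line_integral_lim:
  fixes f :: "real => 'b :: euclidean_space"
  assumes f: "integrable half_line f"
  shows "f absolutely_integrable_on {0..X}" "(%n. integral {0..real n} f) ----> (LINT x|half_line. f x)"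
proof -
  show ai: "f absolutely_integrable_on {0..X}" for X
    using f unfolding half_line_set_integrable by (rule set_integrable_subset) auto
  have "(%n. LINT x|lebesgue. indicator {0..real n} x *\<^sub>R f x) ----> (LINT x|lebesgue. indicator {0..} x *\<^sub>R f x)"
  proof (rule integral_dominated_convergence[where w = "%x. norm (indicator {0..} x *\<^sub>R f x)"])
    show "integrable lebesgue (%x. norm (indicator {0..} x *\<^sub>R f x))"
      using f unfolding half_line_set_integrable set_integrable_def by (rule integrable_norm)
    show "AE x in lebesgue. (%n. indicator {0..real n} x *\<^sub>R f x) ----> indicator {0..} x *\<^sub>R f x"
    proof (rule AE_I2)
      fix x :: real
      obtain N :: nat where "x <= real N" using real_arch_simple by blast
      hence "\<forall>\<^sub>F n in sequentially. indicator {0..real n} x *\<^sub>R f x = indicator {0..} x *\<^sub>R f x"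
        by (intro eventually_sequentiallyI[of N]) (auto simp: indicator_def)
      thus "(%n. indicator {0..real n} x *\<^sub>R f x) ----> indicator {0..} x *\<^sub>R f x"
        by (rule tendsto_eventually)
    qed
  qed (use ai f in \<open>auto simp: half_line_set_integrable set_integrable_def indicator_def\<close>)
  moreover have "(LINT x|lebesgue. indicator {0..real n} x *\<^sub>R f x) = integral {0..real n} f" for n
    using set_lebesgue_integral_eq_integral(2)[OF ai] by (simp add: set_lebesgue_integral_def)
  ultimately show "(%n. integral {0..real n} f) ----> (LINT x|half_line. f x)"
    by (simp add: integral_restrict_space)
qed

lemma square_integrable_loc_int:
  assumes "square_integrable f"
  shows "loc_int f" unfolding loc_int_def
proof (intro allI impI)
  fix x :: real
  have i: "(%x. (cmod (f x))\<^sup>2) absolutely_integrable_on {0..x}"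
    using assms half_line_integral_lim(1) by (auto simp: square_integrable_def)
  show "f absolutely_integrable_on {0..x}"
  proof (rule measurable_bounded_by_integrable_imp_absolutely_integrable)
    show "f \<in> borel_measurable (lebesgue_on {0..x})"
      using square_integrable_measurable[OF assms] by (rule measurable_restrict_mono) auto
    show "(%x. 1 + (cmod (f x))\<^sup>2) integrable_on {0..x}"
      using i by (intro integrable_add set_lebesgue_integral_eq_integral(1)) auto
    show "cmod (f y) <= 1 + (cmod (f y))\<^sup>2" for y
      using sum_squares_bound[of 1 "cmod (f y)", simplified] norm_ge_zero[of "f y"] by linarith
  qed simp
qed

text \<open>Fatou's lemma, for functions that are only defined on growing intervals.\<close>

lemma square_integrable_limit:
  assumes f: "!!n. continuous_on {0..} (f n)" and lim: "!!x. x >= 0 ==> (%n. f n x) ----> g x"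
    and bd: "!!n. integral {0..real n} (%x. (cmod (f n x))\<^sup>2) <= B"
  shows "square_integrable g" "(LINT x|half_line. (cmod (g x))\<^sup>2) <= B"
proof -
  have B: "B >= 0" using bd[of 0] by simp
  define k where "k n = (%x. indicator {0..real n} x*(cmod (f n x))\<^sup>2)" for n
  have sub: "continuous_on {0..real n} (%x. (cmod (f n x))\<^sup>2)" for n
    by (intro continuous_intros continuous_on_subset[OF f]) auto
  have ki: "integrable lebesgue (k n)" for n
    using absolutely_integrable_continuous_real[OF sub[of n]] by (simp add: set_integrable_def k_def)
  have kB: "(LINT x|lebesgue. k n x) <= B" for n
    using set_lebesgue_integral_eq_integral(2)[OF absolutely_integrable_continuous_real[OF sub[of n]]] bd[of n]
    by (simp add: set_lebesgue_integral_def k_def)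
  have [measurable]: "g \<in> borel_measurable half_line"
    by (rule borel_measurable_LIMSEQ_metric[where f = f])
      (use f lim in \<open>auto intro: continuous_imp_measurable_on_sets_lebesgue\<close>)
  have kl: "(%n. k n x) ----> indicator {0..} x*(cmod (g x))\<^sup>2" for x
  proof (cases "x >= 0")
    case True
    obtain N :: nat where N: "x <= real N" using real_arch_simple by blast
    have "(%n. (cmod (f n x))\<^sup>2) ----> (cmod (g x))\<^sup>2" by (intro tendsto_intros lim True)
    moreover have "\<forall>\<^sub>F n in sequentially. (cmod (f n x))\<^sup>2 = k n x"
      using N True by (intro eventually_sequentiallyI[of N]) (auto simp: k_def indicator_def)
    ultimately show ?thesis using True by (auto intro: Lim_transform_eventually)
  qed (simp add: k_def)
  have "(\<integral>\<^sup>+x. ennreal (indicator {0..} x*(cmod (g x))\<^sup>2) \<partial>lebesgue) = (\<integral>\<^sup>+x. liminf (%n. ennreal (k n x)) \<partial>lebesgue)"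
    by (simp add: lim_imp_Liminf[OF _ tendsto_ennrealI[OF kl]])
  also have "... <= liminf (%n. \<integral>\<^sup>+x. ennreal (k n x) \<partial>lebesgue)"
    using ki by (intro nn_integral_liminf) auto
  also have "... <= liminf (%n. ennreal B)"
    using ki kB by (intro Liminf_mono always_eventually allI) (auto simp: nn_integral_eq_integral k_def ennreal_leI)
  also have "liminf (%n. ennreal B) = ennreal B" by (rule Liminf_const) simp
  finally have le0: "(\<integral>\<^sup>+x. ennreal (indicator {0..} x*(cmod (g x))\<^sup>2) \<partial>lebesgue) <= ennreal B" .
  have eq: "(\<integral>\<^sup>+x. ennreal (indicator {0..} x*(cmod (g x))\<^sup>2) \<partial>lebesgue) = (\<integral>\<^sup>+x. ennreal ((cmod (g x))\<^sup>2) \<partial>half_line)"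
    by (subst nn_integral_restrict_space) (auto intro!: nn_integral_cong simp: indicator_def)
  have le: "(\<integral>\<^sup>+x. ennreal ((cmod (g x))\<^sup>2) \<partial>half_line) <= ennreal B" using le0 unfolding eq .
  have gi: "integrable half_line (%x. (cmod (g x))\<^sup>2)"
    using le by (intro integrableI_bounded) (auto simp: less_top[symmetric] top_unique)
  thus "square_integrable g" by (simp add: square_integrable_def)
  show "(LINT x|half_line. (cmod (g x))\<^sup>2) <= B"
    using le B unfolding nn_integral_eq_integral[OF gi, OF AE_I2[OF zero_le_power2]] by (simp add: integral_nonneg)
qed

lemma restrict_tendsto:
  assumes v: "square_integrable v"
  shows "(%n. to_L2 (%x. if x <= real n then v x else 0)) ----> to_L2 v"
proof -
  let ?v = "%n x. if x <= real n then v x else 0"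
  have vi: "integrable half_line (%x. (cmod (v x))\<^sup>2)" using v by (simp add: square_integrable_def)
  have d: "(dist (to_L2 (?v n)) (to_L2 v))\<^sup>2 = (LINT x|half_line. (cmod (v x))\<^sup>2) - integral {0..real n} (%x. (cmod (v x))\<^sup>2)" for n
  proof -
    have "(dist (to_L2 (?v n)) (to_L2 v))\<^sup>2 = (LINT x|half_line. (cmod (?v n x - v x))\<^sup>2)"
      unfolding dist_to_L2[OF square_integrable_restrict[OF v] v] by (simp add: integral_nonneg)
    also have "... = (LINT x|half_line. (cmod (v x))\<^sup>2 - indicator {0..real n} x*(cmod (v x))\<^sup>2)"
      by (intro Bochner_Integration.integral_cong) (auto simp: indicator_def)
    also have "... = (LINT x|half_line. (cmod (v x))\<^sup>2) - (LINT x|half_line. indicator {0..real n} x*(cmod (v x))\<^sup>2)"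
      using integrable_mult_indicator[OF _ vi, of "{0..real n}"]
      by (intro Bochner_Integration.integral_diff vi) (auto simp: sets_restrict_space_iff)
    also have "(LINT x|half_line. indicator {0..real n} x*(cmod (v x))\<^sup>2) = (LINT x:{0..real n}|lebesgue. (cmod (v x))\<^sup>2)"
      unfolding set_lebesgue_integral_def
      by (subst integral_restrict_space) (auto intro!: Bochner_Integration.integral_cong simp: indicator_def)
    finally show ?thesis using set_lebesgue_integral_eq_integral(2)[OF half_line_integral_lim(1)[OF vi]] by simp
  qed
  have "(%n. (dist (to_L2 (?v n)) (to_L2 v))\<^sup>2) ----> (LINT x|half_line. (cmod (v x))\<^sup>2) - (LINT x|half_line. (cmod (v x))\<^sup>2)"
    unfolding d by (intro tendsto_intros half_line_integral_lim(2) vi)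
  hence "(%n. sqrt ((dist (to_L2 (?v n)) (to_L2 v))\<^sup>2)) ----> sqrt 0" by (intro tendsto_real_sqrt) simp
  thus ?thesis by (subst tendsto_dist_iff) simp
qed

section \<open>Weyl's construction\<close>

text \<open>Everything is done at the single spectral parameter i: one nonreal point suffices for a
  boundary triple. The pair (C, S) stands for the cosine and sine of the boundary angle.\<close>

locale fundamental = potential +
  fixes C S :: real and c c' s s' :: "real => complex"
  assumes CS: "C\<^sup>2 + S\<^sup>2 = 1"
    and c: "expr c c' (%x. \<i>*c x)" "c 0 = C" "c' 0 = S"
    and s: "expr s s' (%x. \<i> * s x)" "s 0 = - S" "s' 0 = C"
begin

text \<open>Boundary values at \<open>0\<close>; \<open>c\<close> and \<open>s\<close> have the boundary values \<open>(1, 0)\<close> and \<open>(0, 1)\<close>.\<close>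

definition B0 :: "(real => complex) => (real => complex) => complex" where "B0 u u' = cr C*u 0 + cr S*u' 0"
definition B1 :: "(real => complex) => (real => complex) => complex" where "B1 u u' = cr C*u' 0 - cr S*u 0"

lemma CS': "cr C*cr C + cr S*cr S = 1" using CS by (simp add: power2_eq_square flip: of_real_mult of_real_add)

lemma boundary_values: "u 0 = cr C*B0 u u' - cr S*B1 u u'"
    "u' 0 = cr S*B0 u u' + cr C*B1 u u'"
  using arg_cong[OF CS', of "%z. z*u 0"] arg_cong[OF CS', of "%z. z*u' 0"]
  by (simp_all add: B0_def B1_def algebra_simps)

lemma boundary_form:
  "cnj (u 0)*w' 0 - cnj (u' 0)*w 0 = cnj (B0 u u')*B1 w w' - cnj (B1 u u')*B0 w w'"
  using arg_cong[OF CS', of "%z. z*(cnj (u 0)*w' 0 - cnj (u' 0)*w 0)"]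
  by (simp add: B0_def B1_def algebra_simps)

lemma wronskian:
  assumes "x >= 0"
  shows "c x * s' x - c' x * s x = 1"
  using locally_ac_const[OF wronskian_ac[OF c(1) s(1)] _ assms] CS' by (simp add: c s algebra_simps)

lemma cont: "continuous_on {0..} c" "continuous_on {0..} s" "continuous_on {0..} c'" "continuous_on {0..} s'"
  using c(1) s(1) locally_ac_continuous unfolding expr_iff by blast+

lemma loc_int_cs: "loc_int v ==> loc_int (%t. c t * v t)" "loc_int v ==> loc_int (%t. s t * v t)"
  by (intro loc_int_continuous_mult cont; assumption)+

text \<open>Variation of constants for the inhomogeneity \<open>v\<close>, with prescribed boundary
  values \<open>g\<close> and \<open>h\<close>; no denominator appears because the Wronskian of
  \<open>c\<close> and \<open>s\<close> is 1.\<close>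

definition sol :: "complex => complex => (real => complex) => real => complex" where
  "sol g h v x = (g + integral {0..x} (%t. s t * v t))*c x + (h - integral {0..x} (%t. c t * v t)) * s x"
definition sol' :: "complex => complex => (real => complex) => real => complex" where
  "sol' g h v x = (g + integral {0..x} (%t. s t * v t))*c' x + (h - integral {0..x} (%t. c t * v t)) * s' x"

lemma sol_boundary [simp]: "B0 (sol g h v) (sol' g h v) = g" "B1 (sol g h v) (sol' g h v) = h"
  using arg_cong[OF CS', of "%z. z*g"] arg_cong[OF CS', of "%z. z*h"]
  by (simp_all add: B0_def B1_def sol_def sol'_def c s algebra_simps)

lemma expr_sol:
  assumes v: "loc_int v"
  shows "expr (sol g h v) (sol' g h v) (%x. v x + \<i> * sol g h v x)"
proof -
  have P: "locally_ac (%x. g + integral {0..x} (%t. s t * v t)) (%x. s x * v x)"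
    and Q: "locally_ac (%x. h - integral {0..x} (%t. c t * v t)) (%x. - (c x * v x))"
    using locally_ac_primitive[OF loc_int_cs(2)[OF v], of g]
      locally_ac_primitive[OF loc_int_cmult[OF loc_int_cs(1)[OF v], of "- 1"], of h] by simp_all
  have cs: "locally_ac c c'" "locally_ac c' (%x. cr (V x)*c x - \<i>*c x)"
    "locally_ac s s'" "locally_ac s' (%x. cr (V x) * s x - \<i> * s x)"
    using c(1) s(1) by (auto simp: expr_iff)
  show ?thesis unfolding expr_iff
  proof
    show "locally_ac (sol g h v) (sol' g h v)"
      by (rule locally_ac_cong[OF locally_ac_add[OF locally_ac_mult[OF P cs(1)] locally_ac_mult[OF Q cs(3)]]])
        (auto simp: sol_def sol'_def)
    show "locally_ac (sol' g h v) (%x. cr (V x) * sol g h v x - (v x + \<i> * sol g h v x))"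
    proof (rule locally_ac_cong[OF locally_ac_add[OF locally_ac_mult[OF P cs(2)] locally_ac_mult[OF Q cs(4)]]])
      fix x :: real assume "x >= 0"
      from arg_cong[OF wronskian[OF this], of "%z. z * v x"]
      show "s x * v x*c' x + (g + integral {0..x} (%t. s t * v t))*(cr (V x)*c x - \<i>*c x) +
          (- (c x * v x) * s' x + (h - integral {0..x} (%t. c t * v t))*(cr (V x) * s x - \<i> * s x)) =
          cr (V x) * sol g h v x - (v x + \<i> * sol g h v x)" by (simp add: sol_def algebra_simps)
    qed (simp add: sol'_def)
  qed
qed

text \<open>The Wronskians of \<open>u\<close> with \<open>s\<close> and with \<open>c\<close> are
  the two coefficients in the variation of constants formula, and together they recover
  \<open>u\<close> and \<open>u'\<close>.\<close>

lemma sol_unique: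
  assumes u: "expr u u' f" and x: "x >= 0"
  defines "v \<equiv> %x. f x - \<i>*u x"
  shows "u x = sol (B0 u u') (B1 u u') v x" "u' x = sol' (B0 u u') (B1 u u') v x"
proof -
  have "locally_ac (%x. u x * s' x - u' x * s x) (%x. s x * v x)"
    by (rule locally_ac_cong[OF wronskian_ac[OF u s(1)]]) (auto simp: v_def algebra_simps)
  from locally_acD(2)[OF this x] have p: "u x * s' x - u' x * s x = B0 u u' + integral {0..x} (%t. s t * v t)"
    by (simp add: s B0_def mult.commute)
  have "locally_ac (%x. u x*c' x - u' x*c x) (%x. c x * v x)"
    by (rule locally_ac_cong[OF wronskian_ac[OF u c(1)]]) (auto simp: v_def algebra_simps)
  from locally_acD(2)[OF this x] have q: "- (u x*c' x - u' x*c x) = B1 u u' - integral {0..x} (%t. c t * v t)"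
    by (simp add: c B1_def mult.commute)
  show "u x = sol (B0 u u') (B1 u u') v x" "u' x = sol' (B0 u u') (B1 u u') v x"
    unfolding sol_def sol'_def p[symmetric] q[symmetric]
    using arg_cong[OF wronskian[OF x], of "%z. z*u x"] arg_cong[OF wronskian[OF x], of "%z. z*u' x"]
    by (simp_all add: algebra_simps)
qed

lemma lagrange:
  assumes u: "expr u u' f" and w: "expr w w' g" and X: "X >= 0"
  shows "integral {0..X} (%x. cnj (u x)*g x - cnj (f x)*w x) =
    (cnj (B0 u u')*B1 w w' - cnj (B1 u u')*B0 w w') - (cnj (u X)*w' X - cnj (u' X)*w X)"
proof -
  have "integral {0..X} (%x. cnj (u x)*g x - cnj (f x)*w x) = - integral {0..X} (%x. cnj (f x)*w x - cnj (u x)*g x)"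
    by (subst Henstock_Kurzweil_Integration.integral_neg[symmetric]) simp
  thus ?thesis
    using locally_acD(2)[OF wronskian_ac[OF expr_cnj[OF u] w] X] unfolding boundary_form[symmetric] by simp
qed

text \<open>The imaginary part of Lagrange's identity for \<open>u\<close> with itself: the nonreal
  spectral parameter turns it into a formula for the L2 norm on [0, X].\<close>

lemma energy:
  assumes u: "expr u u' (%x. v x + \<i>*u x)" and v: "loc_int v" and X: "X >= 0"
  shows "integral {0..X} (%x. (cmod (u x))\<^sup>2) =
    Im (cnj (B0 u u')*B1 u u') - Im (cnj (u X)*u' X) - Im (integral {0..X} (%x. cnj (u x) * v x))"
proof -
  have uc: "continuous_on {0..} u" using u locally_ac_continuous unfolding expr_iff by blast
  have i1: "(%x. cnj (u x) * v x) integrable_on {0..X}"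
    by (intro loc_intD(2) loc_int_continuous_mult v continuous_intros uc) simp
  have i2: "(%x. cr ((cmod (u x))\<^sup>2)) integrable_on {0..X}"
    by (intro integrable_continuous_real continuous_intros continuous_on_subset[OF uc]) auto
  have i3: "(%x. cnj (v x)*u x) integrable_on {0..X}"
    using loc_intD(2)[OF loc_int_continuous_mult[OF uc loc_int_cnj[OF v]]] by (simp add: mult.commute)
  have cn: "integral {0..X} (%x. cnj (v x)*u x) = cnj (integral {0..X} (%x. cnj (u x) * v x))"
    unfolding integral_cnj by (simp add: mult.commute)
  have "(%x. cnj (u x)*(v x + \<i>*u x) - cnj (v x + \<i>*u x)*u x) =
     (%x. (cnj (u x) * v x - cnj (v x)*u x) + 2*\<i>*cr ((cmod (u x))\<^sup>2))"
    by (rule ext) (simp add: complex_norm_square algebra_simps del: of_real_power)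
  hence eq: "integral {0..X} (%x. cnj (u x) * v x) - cnj (integral {0..X} (%x. cnj (u x) * v x))
      + 2*\<i>*integral {0..X} (%x. cr ((cmod (u x))\<^sup>2)) =
    (cnj (B0 u u')*B1 u u' - cnj (B1 u u')*B0 u u') - (cnj (u X)*u' X - cnj (u' X)*u X)"
    using lagrange[OF u u X] i1 i2 i3 unfolding cn[symmetric]
    by (simp add: Henstock_Kurzweil_Integration.integral_add Henstock_Kurzweil_Integration.integral_diff
        integrable_diff del: of_real_power)
  have of: "integral {0..X} (%x. cr ((cmod (u x))\<^sup>2)) = cr (integral {0..X} (%x. (cmod (u x))\<^sup>2))"
    using integral_linear[OF _ bounded_linear_of_real[where 'a = complex], of "%x. (cmod (u x))\<^sup>2" "{0..X}"]
    by (simp add: o_def integrable_continuous_real continuous_intros continuous_on_subset[OF uc] del: of_real_power)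
  show ?thesis using arg_cong[OF eq[unfolded of], of Im] by (simp add: algebra_simps del: of_real_power)
qed

section \<open>Weyl discs\<close>

definition N :: "(real => complex) => real => real" where "N u X = integral {0..X} (%x. (cmod (u x))\<^sup>2)"

lemma N_integrable: "continuous_on {0..} (u :: real => complex) ==> 0 <= a ==> (%x. (cmod (u x))\<^sup>2) integrable_on {a..X}"
  by (rule integrable_continuous_real) (auto intro!: continuous_intros intro: continuous_on_subset)

lemma N_mono: "continuous_on {0..} u ==> X <= Y ==> N u X <= N u Y"
  unfolding N_def by (rule integral_subset_le) (auto intro: N_integrable)

lemma N_bounded: "continuous_on {0..} u ==> (!!n. N u (real n) <= B) ==> square_integrable u"
  by (rule square_integrable_limit(1)[where f = "%n. u" and B = B]) (auto simp: N_def)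

definition \<psi> :: "complex => real => complex" where "\<psi> m x = c x + m * s x"
definition \<psi>' :: "complex => real => complex" where "\<psi>' m x = c' x + m * s' x"

lemma expr_psi: "expr (\<psi> m) (\<psi>' m) (%x. \<i>*\<psi> m x)"
  unfolding \<psi>_def[abs_def] \<psi>'_def[abs_def]
  by (rule expr_cong[OF expr_add[OF c(1) expr_cmult[OF s(1), of m]]]) (auto simp: algebra_simps)

lemma psi_boundary: "B0 (\<psi> m) (\<psi>' m) = 1" "B1 (\<psi> m) (\<psi>' m) = m"
  unfolding B0_def B1_def \<psi>_def \<psi>'_def c s
  by (use CS' in \<open>simp add: algebra_simps\<close>) (use arg_cong[OF CS', of "%z. z*m"] in \<open>simp add: algebra_simps\<close>)

lemma psi_continuous: "continuous_on {0..} (\<psi> m)"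
  unfolding \<psi>_def[abs_def] by (intro continuous_intros cont)

lemma N_psi: "X >= 0 ==> N (\<psi> m) X = Im m - Im (cnj (\<psi> m X)*\<psi>' m X)"
  using energy[of "\<psi> m" "\<psi>' m" "%x. 0" X] expr_psi[of m]
  by (simp add: N_def loc_int_def psi_boundary)

lemma N_s: "X >= 0 ==> N s X = - Im (cnj (s X) * s' X)"
  using energy[of s s' "%x. 0" X] s by (simp add: N_def loc_int_def B0_def B1_def)

text \<open>The form \<open>Im (cnj y * y')\<close> has signature \<open>(1, 1)\<close>; this is its Gram determinant.\<close>

lemma form_det:
  fixes y y' t t' :: complex
  assumes "y*t' - y'*t = 1"
  shows "Im (cnj y*y')*Im (cnj t*t') = (cmod (cnj y'*t - cnj y*t'))\<^sup>2/4 - 1/4"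
proof -
  have "(cmod (cnj y'*t - cnj y*t'))\<^sup>2 - (cmod (y*t' - y'*t))\<^sup>2 = 4*(Im (cnj y*y')*Im (cnj t*t'))"
    unfolding cmod_power2 by (simp add: power2_eq_square algebra_simps)
  thus ?thesis unfolding assms by simp
qed

lemma psi_wronskian: "x >= 0 ==> \<psi> m x * s' x - \<psi>' m x * s x = 1"
  using wronskian[of x] by (simp add: \<psi>_def \<psi>'_def algebra_simps)

text \<open>If \<open>s\<close> vanished on [0, 1], so would S; moreover s' would be the constant C
  there, and the primitive of s' being zero gives C = 0, contrary to C^2 + S^2 = 1.\<close>

lemma N_s_pos: "N s 1 > 0"
proof (rule ccontr)
  have cs: "continuous_on {0..1} (%x. (cmod (s x))\<^sup>2)"
    by (intro continuous_intros continuous_on_subset[OF cont(2)]) auto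
  assume "~ N s 1 > 0"
  moreover have "N s 1 >= 0" unfolding N_def by (rule integral_nonneg[OF integrable_continuous_real[OF cs]]) simp
  ultimately have "N s 1 = 0" by simp
  hence "ALL x:{0..1}. (cmod (s x))\<^sup>2 = 0"
    unfolding N_def by (subst (asm) integral_eq_0_iff[OF cs]) auto
  hence s0: "s x = 0" if "x \<in> {0..1}" for x using that by simp
  have ac: "locally_ac s s'" "locally_ac s' (%x. cr (V x) * s x - \<i> * s x)" using s(1) by (auto simp: expr_iff)
  have s1: "s' x = C" if x: "x \<in> {0..1}" for x
  proof -
    have "integral {0..x} (%x. cr (V x) * s x - \<i> * s x) = integral {0..x} (%x. 0)"
      using x s0 by (intro integral_cong) auto
    thus ?thesis using locally_acD(2)[OF ac(2), of x] x s(3) by simp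
  qed
  have "integral {0..1} s' = integral {0..1} (%x::real. cr C)" by (rule integral_cong[OF s1])
  hence "C = 0" using locally_acD(2)[OF ac(1), of 1] s0[of 0] s0[of 1] by simp
  moreover have "S = 0" using s0[of 0] s(2) by simp
  ultimately show False using CS by simp
qed

text \<open>\<open>m\<close> is the centre of the Weyl disc at X: it makes \<open>\<psi> m\<close>
  orthogonal to \<open>s\<close> at X in the indefinite form. The form is negative on
  \<open>s\<close>, so the Gram determinant forces it to be positive on \<open>\<psi> m\<close>,
  which by \<open>N_psi\<close> is the claim.\<close>

lemma weyl_circle: "X >= 1 ==> EX m. N (\<psi> m) X <= Im m"
proof -
  assume X: "X >= 1"
  have a: "N s X > 0" using N_mono[OF cont(2) X] N_s_pos by simp
  define d where "d = cnj (s' X) * s X - cnj (s X) * s' X"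
  have "d ~= 0"
  proof
    assume "d = 0"
    hence "Im (cnj (s X) * s' X) = 0" by (simp add: d_def complex_eq_iff algebra_simps)
    thus False using a X N_s[of X] by simp
  qed
  define m where "m = - cnj ((cnj (c' X) * s X - cnj (c X) * s' X)/d)"
  have "cnj (\<psi>' m X) * s X - cnj (\<psi> m X) * s' X = (cnj (c' X) * s X - cnj (c X) * s' X) + cnj m*d"
    by (simp add: \<psi>_def \<psi>'_def d_def algebra_simps)
  also have "... = 0" using \<open>d ~= 0\<close> by (simp add: m_def)
  finally have pr: "Im (cnj (\<psi> m X)*\<psi>' m X)*Im (cnj (s X) * s' X) = - 1/4"
    using form_det[OF psi_wronskian[of X m]] X by simp
  have X0: "X >= 0" using X by simp
  have "Im (cnj (\<psi> m X)*\<psi>' m X)*N s X = 1/4" unfolding N_s[OF X0] mult_minus_right pr by simp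
  hence "Im (cnj (\<psi> m X)*\<psi>' m X) > 0" using a by (metis zero_less_divide_1_iff zero_less_mult_pos2 zero_less_numeral)
  thus ?thesis using N_psi[of X m] X by (intro exI[of _ m]) simp
qed

text \<open>On the disc at X = 1, |m|^2 N s 1 is at most 2 N (\<open>\<psi> m\<close>) 1 + 2 N c 1,
  which grows only linearly in |m|.\<close>

lemma weyl_bounded: "EX K. ALL m. N (\<psi> m) 1 <= Im m --> cmod m <= K"
proof (intro exI allI impI)
  fix m assume m: "N (\<psi> m) 1 <= Im m"
  have "(cmod m)\<^sup>2*N s 1 = integral {0..1} (%x. (cmod m)\<^sup>2*(cmod (s x))\<^sup>2)" by (simp add: N_def)
  also have "... <= integral {0..1} (%x. 2*(cmod (\<psi> m x))\<^sup>2 + 2*(cmod (c x))\<^sup>2)"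
  proof (rule integral_le)
    fix x :: real assume "x \<in> {0..1}"
    have "cmod m*cmod (s x) <= cmod (\<psi> m x) + cmod (c x)"
      using norm_triangle_ineq4[of "\<psi> m x" "c x"] by (simp add: \<psi>_def norm_mult)
    hence "(cmod m*cmod (s x))\<^sup>2 <= (cmod (\<psi> m x) + cmod (c x))\<^sup>2" by (intro power_mono) auto
    also have "... <= 2*(cmod (\<psi> m x))\<^sup>2 + 2*(cmod (c x))\<^sup>2"
      using sum_squares_bound[of "cmod (\<psi> m x)" "cmod (c x)"] by (simp add: power2_sum)
    finally show "(cmod m)\<^sup>2*(cmod (s x))\<^sup>2 <= 2*(cmod (\<psi> m x))\<^sup>2 + 2*(cmod (c x))\<^sup>2" by (simp add: power_mult_distrib)
  qed (auto intro!: integrable_add integrable_on_mult_right N_integrable cont psi_continuous)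
  also have "... = 2*N (\<psi> m) 1 + 2*N c 1" unfolding N_def
    by (simp add: Henstock_Kurzweil_Integration.integral_add integrable_on_mult_right N_integrable cont psi_continuous)
  also have "... <= 2*cmod m + 2*N c 1" using m abs_Im_le_cmod[of m] by simp
  finally have le: "(cmod m)\<^sup>2*N s 1 <= 2*cmod m + 2*N c 1" .
  have c0: "N c 1 >= 0" unfolding N_def by (rule integral_nonneg[OF N_integrable]) (auto simp: cont)
  show "cmod m <= max 1 ((2 + 2*N c 1)/N s 1)"
  proof (cases "cmod m <= 1")
    case False
    hence "2*cmod m + 2*N c 1 <= (2 + 2*N c 1)*cmod m"
      using mult_left_mono[of 1 "cmod m" "2*N c 1"] c0 by (simp add: algebra_simps)
    hence "(cmod m*N s 1)*cmod m <= (2 + 2*N c 1)*cmod m" using le by (simp add: power2_eq_square algebra_simps)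
    hence "cmod m*N s 1 <= 2 + 2*N c 1" by (rule mult_right_le_imp_le) (use False in linarith)
    hence "cmod m <= (2 + 2*N c 1)/N s 1" using N_s_pos by (simp only: pos_le_divide_eq)
    thus ?thesis by simp
  qed simp
qed

text \<open>The discs shrink as X grows, so centres for growing X stay in the compact disc at 1. A
  limit point belongs to all discs, since membership is the closed condition that the boundary form
  is nonnegative.\<close>

lemma weyl_solution: "EX m. ALL X>=0. N (\<psi> m) X <= Im m"
proof -
  have "ALL n::nat. EX m. N (\<psi> m) (real n + 1) <= Im m" by (auto intro: weyl_circle)
  from choice[OF this] obtain m where m: "!!n. N (\<psi> (m n)) (real n + 1) <= Im (m n)" by blast
  hence mX: "N (\<psi> (m n)) X <= Im (m n)" if "X <= real n + 1" for n X
    using N_mono[OF psi_continuous that, of "m n"] order_trans by blast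
  obtain K where K: "!!m. N (\<psi> m) 1 <= Im m ==> cmod m <= K" using weyl_bounded by blast
  have "m n \<in> cball 0 K" for n using K[OF mX[of 1 n]] by simp
  then obtain l r where l: "strict_mono r" "(m \<circ> r) ----> l"
    using compact_cball[of "0::complex" K] unfolding compact_def by metis
  have "N (\<psi> l) X <= Im l" if X: "X >= 0" for X
  proof -
    have "(%n. Im (cnj (\<psi> (m (r n)) X)*\<psi>' (m (r n)) X)) ----> Im (cnj (\<psi> l X)*\<psi>' l X)"
      unfolding \<psi>_def \<psi>'_def using l(2) by (intro tendsto_intros) (auto simp: o_def)
    moreover have "\<forall>\<^sub>F n in sequentially. 0 <= Im (cnj (\<psi> (m (r n)) X)*\<psi>' (m (r n)) X)"
    proof -
      obtain n0 :: nat where n0: "X <= real n0" using real_arch_simple by blast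
      have "0 <= Im (cnj (\<psi> (m (r n)) X)*\<psi>' (m (r n)) X)" if "n >= n0" for n
      proof -
        have "X <= real (r n) + 1" using n0 that seq_suble[OF l(1), of n] by linarith
        thus ?thesis using mX[of X "r n"] N_psi[OF X, of "m (r n)"] by simp
      qed
      thus ?thesis by (rule eventually_sequentiallyI)
    qed
    ultimately have "0 <= Im (cnj (\<psi> l X)*\<psi>' l X)" by (rule tendsto_lowerbound) simp
    thus ?thesis using N_psi[OF X, of l] by simp
  qed
  thus ?thesis by blast
qed

end

lemma half_line_integral_le:
  fixes h :: "real => real"
  assumes h: "integrable half_line h" and h0: "!!x. 0 <= h x"
  shows "integral {0..X} h <= (LINT x|half_line. h x)"
proof -
  have "integral {0..X} h <= integral {0..real n} h" if "X <= real n" for n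
    using half_line_integral_lim(1)[OF h] that
    by (intro integral_subset_le set_lebesgue_integral_eq_integral(1)) (auto simp: h0)
  moreover obtain N :: nat where "X <= real N" using real_arch_simple by blast
  ultimately show ?thesis by (intro LIMSEQ_le_const[OF half_line_integral_lim(2)[OF h]] exI[of _ N]) auto
qed

context fundamental
begin

text \<open>Beyond some \<open>n0\<close> the coefficients \<open>p\<close> and \<open>q\<close> of \<open>u = p c + q s\<close> change by at most
  half of their maximum, so they are bounded.\<close>

lemma limit_circleI:
  assumes cL: "square_integrable c" and sL: "square_integrable s"
  shows "limit_circle V" unfolding limit_circle_def
proof (intro allI impI)
  fix z u u' assume u: "expr u u' (%x. z*u x)"
  define k where "k = cmod (z - \<i>)"
  \<comment> \<open>Chosen to dominate k (|c| + |s|)^2, the factor that arises when u = p c + q s is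
    inserted into the integrals defining \<open>p\<close> and \<open>q\<close>.\<close>
  define h where "h x = 2*k*((cmod (c x))\<^sup>2 + (cmod (s x))\<^sup>2)" for x
  have hi: "integrable half_line h"
    using cL sL unfolding h_def square_integrable_def by (intro integrable_mult_right Bochner_Integration.integrable_add) auto
  have h0: "h x >= 0" for x by (simp add: h_def k_def)
  define v where "v = (%x. z*u x - \<i>*u x)"
  have uc: "continuous_on {0..} u" using u locally_ac_continuous unfolding expr_iff by blast
  have vl: "loc_int v" unfolding v_def by (intro loc_int_continuous continuous_intros uc)
  define p q where "p x = B0 u u' + integral {0..x} (%t. s t * v t)"
    and "q x = B1 u u' - integral {0..x} (%t. c t * v t)" for x
  have us: "u x = p x*c x + q x * s x" if "x >= 0" for x
    using sol_unique(1)[OF u that] by (simp add: sol_def p_def q_def v_def)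
  define y where "y x = cmod (p x) + cmod (q x)" for x
  have ub: "cmod (u x) <= (cmod (c x) + cmod (s x))*y x" if "x >= 0" for x
  proof -
    have "cmod (u x) <= cmod (p x)*cmod (c x) + cmod (q x)*cmod (s x)"
      unfolding us[OF that] norm_mult[symmetric] by (rule norm_triangle_ineq)
    also have "... <= y x*cmod (c x) + y x*cmod (s x)" by (intro add_mono mult_right_mono) (auto simp: y_def)
    finally show ?thesis by (simp add: algebra_simps)
  qed
  have yc: "continuous_on {0..} y"
    unfolding y_def p_def q_def by (intro continuous_intros loc_int_primitive_continuous loc_int_cs vl)
  \<comment> \<open>Beyond \<open>n0\<close> the integral of \<open>h\<close> is at most 1/4, so
    \<open>p\<close> and \<open>q\<close> each change by at most a quarter of the maximum of
    \<open>y\<close>.\<close>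
  obtain n0 :: nat where n0: "(LINT x|half_line. h x) - 1/4 < integral {0..real n0} h"
    using order_tendstoD(1)[OF half_line_integral_lim(2)[OF hi], of "(LINT x|half_line. h x) - 1/4"]
    by (auto dest: eventually_happens)
  have tail: "integral {real n0..x} h <= 1/4" if x: "x >= real n0" for x
  proof -
    have "h integrable_on {0..x}" using half_line_integral_lim(1)[OF hi] by (rule set_lebesgue_integral_eq_integral(1))
    hence "integral {0..real n0} h + integral {real n0..x} h = integral {0..x} h"
      by (intro Henstock_Kurzweil_Integration.integral_combine) (use x in auto)
    moreover have "integral {0..x} h <= (LINT x|half_line. h x)" by (rule half_line_integral_le[OF hi h0])
    ultimately show ?thesis using n0 by linarith
  qed
  obtain Y where Y: "!!x. x \<in> {0..real n0} ==> y x <= Y"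
  proof -
    have "compact (y ` {0..real n0})" by (intro compact_continuous_image continuous_on_subset[OF yc]) auto
    from bounded_imp_bdd_above[OF compact_imp_bounded[OF this]] show ?thesis
      using that unfolding bdd_above_def by blast
  qed
  have Yb: "y x <= 2*Y" if x: "x >= 0" for x
  proof (cases "x <= real n0")
    case True
    hence "y x <= Y" using Y x by simp
    moreover have "0 <= y x" by (simp add: y_def)
    ultimately show ?thesis by linarith
  next
    case False
    \<comment> \<open>At a maximum of \<open>y\<close> on [n0, x] the estimate closes on itself: y
      \<xi> is at most Y + y \<xi>/2, whence the bound 2 Y, independent of x.\<close>
    obtain \<xi> where \<xi>: "\<xi> \<in> {real n0..x}" "!!t. t \<in> {real n0..x} ==> y t <= y \<xi>"
      using continuous_attains_sup[of "{real n0..x}" y] continuous_on_subset[OF yc, of "{real n0..x}"] False by auto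
    have gr: "cmod (integral {0..\<xi>} (%t. e t * v t) - integral {0..real n0} (%t. e t * v t)) <= y \<xi>/4"
      if e: "loc_int (%t. e t * v t)" and ecs: "!!t. cmod (e t) <= cmod (c t) + cmod (s t)" for e
    proof -
      have "integral {0..real n0} (%t. e t * v t) + integral {real n0..\<xi>} (%t. e t * v t) = integral {0..\<xi>} (%t. e t * v t)"
        by (intro Henstock_Kurzweil_Integration.integral_combine loc_intD(2)[OF e]) (use \<xi>(1) in auto)
      hence "integral {0..\<xi>} (%t. e t * v t) - integral {0..real n0} (%t. e t * v t) = integral {real n0..\<xi>} (%t. e t * v t)"
        by (metis add_diff_cancel_left')
      moreover have "cmod (integral {real n0..\<xi>} (%t. e t * v t)) <= integral {real n0..\<xi>} (%t. h t*y \<xi>)"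
      proof (rule integral_norm_bound_integral)
        show "(%t. e t * v t) integrable_on {real n0..\<xi>}" by (rule loc_intD(2)[OF e]) simp
        show "(%t. h t*y \<xi>) integrable_on {real n0..\<xi>}"
          by (intro integrable_on_mult_left integrable_on_subinterval[OF set_lebesgue_integral_eq_integral(1)[OF half_line_integral_lim(1)[OF hi, of \<xi>]]]) auto
        fix t assume t: "t \<in> {real n0..\<xi>}"
        have "cmod (u t) <= (cmod (c t) + cmod (s t))*y t" using t by (intro ub) auto
        also have "... <= (cmod (c t) + cmod (s t))*y \<xi>" using t \<xi>(1) by (intro mult_left_mono \<xi>(2)) auto
        finally have ub': "cmod (u t) <= (cmod (c t) + cmod (s t))*y \<xi>" .
        have "cmod (e t * v t) = k*(cmod (e t)*cmod (u t))"
          by (simp add: v_def k_def norm_mult left_diff_distrib[symmetric])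
        also have "... <= k*((cmod (c t) + cmod (s t))*((cmod (c t) + cmod (s t))*y \<xi>))"
          by (intro mult_left_mono mult_mono ecs ub') (auto simp: k_def)
        also have "... = k*(cmod (c t) + cmod (s t))\<^sup>2*y \<xi>" by (simp add: power2_eq_square)
        also have "... <= k*(2*((cmod (c t))\<^sup>2 + (cmod (s t))\<^sup>2))*y \<xi>"
          using sum_squares_bound[of "cmod (c t)" "cmod (s t)"]
          by (intro mult_right_mono mult_left_mono) (auto simp: k_def y_def power2_sum)
        finally show "cmod (e t * v t) <= h t*y \<xi>" by (simp add: h_def mult_ac)
      qed
      moreover have "integral {real n0..\<xi>} (%t. h t*y \<xi>) <= 1/4*y \<xi>"
        unfolding integral_mult_left using \<xi>(1) by (intro mult_right_mono tail) (auto simp: y_def)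
      ultimately show ?thesis by simp
    qed
    have "cmod (p \<xi> - p (real n0)) <= y \<xi>/4" "cmod (q (real n0) - q \<xi>) <= y \<xi>/4"
      using gr[OF loc_int_cs(2)[OF vl]] gr[OF loc_int_cs(1)[OF vl]] by (simp_all add: p_def q_def)
    moreover have "cmod (p \<xi>) <= cmod (p (real n0)) + cmod (p \<xi> - p (real n0))"
      "cmod (q \<xi>) <= cmod (q (real n0)) + cmod (q (real n0) - q \<xi>)"
      using norm_triangle_sub norm_minus_commute by metis+
    moreover have "cmod (p (real n0)) + cmod (q (real n0)) <= Y" using Y[of "real n0"] by (simp add: y_def)
    moreover have "y \<xi> = cmod (p \<xi>) + cmod (q \<xi>)" by (simp add: y_def)
    ultimately have "y \<xi> <= 2*Y" by linarith
    thus ?thesis using \<xi>(2)[of x] False by simp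
  qed
  have sq: "(cmod (c x) + cmod (s x))\<^sup>2 <= 2*((cmod (c x))\<^sup>2 + (cmod (s x))\<^sup>2)" for x
    using sum_squares_bound[of "cmod (c x)" "cmod (s x)"] by (simp add: power2_sum)
  have le: "(cmod (u x))\<^sup>2 <= (2*Y)\<^sup>2*(2*((cmod (c x))\<^sup>2 + (cmod (s x))\<^sup>2))" if x: "x >= 0" for x
  proof -
    have "cmod (u x) <= 2*Y*(cmod (c x) + cmod (s x))"
      using ub[OF x] mult_left_mono[OF Yb[OF x], of "cmod (c x) + cmod (s x)"] by (simp add: mult.commute)
    hence "(cmod (u x))\<^sup>2 <= (2*Y*(cmod (c x) + cmod (s x)))\<^sup>2" by (intro power_mono) auto
    also have "... <= (2*Y)\<^sup>2*(2*((cmod (c x))\<^sup>2 + (cmod (s x))\<^sup>2))"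
      unfolding power_mult_distrib by (intro mult_left_mono sq[unfolded power_mult_distrib]) auto
    finally show ?thesis .
  qed
  have um: "u \<in> borel_measurable half_line"
    using uc by (intro continuous_imp_measurable_on_sets_lebesgue) auto
  have cn: "(%x. (cmod (u x))\<^sup>2) \<in> borel_measurable half_line" using um by measurable
  have "integrable half_line (%x. (cmod (u x))\<^sup>2)"
  proof (rule Bochner_Integration.integrable_bound[OF _ cn])
    show "integrable half_line (%x. (2*Y)\<^sup>2*(2*((cmod (c x))\<^sup>2 + (cmod (s x))\<^sup>2)))"
      using cL sL unfolding square_integrable_def by (intro integrable_mult_right Bochner_Integration.integrable_add) auto
    show "AE x in half_line. norm ((cmod (u x))\<^sup>2) <= norm ((2*Y)\<^sup>2*(2*((cmod (c x))\<^sup>2 + (cmod (s x))\<^sup>2)))"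
      using le by (intro AE_I2) auto
  qed
  thus "square_integrable u" using um by (simp add: square_integrable_def)
qed

end

lemma integral_zero_beyond:
  fixes g :: "real => complex"
  assumes "!!x. x > b ==> g x = 0" "b <= k"
  shows "integral {0..k} g = integral {0..b} g"
proof -
  have "integral {0..k} g = integral {0..k} (%x. if x \<in> {..b} then g x else 0)"
    using assms(1) by (intro integral_cong) auto
  also have "... = integral {0..b} g" unfolding integral_restrict_Int using assms(2) by (intro arg_cong2[where f = integral]) auto
  finally show ?thesis .
qed

text \<open>\<open>\<psi> m\<close> is the Weyl solution.\<close>

locale weyl = fundamental +
  fixes m :: complex
  assumes mN: "X >= 0 ==> N (\<psi> m) X <= Im m" and lp: "limit_point V"
begin

lemma psi_L2: "square_integrable (\<psi> m)" by (rule N_bounded[OF psi_continuous mN]) simp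

text \<open>The limit point hypothesis enters here: with \<open>\<psi> m\<close> square integrable,
  a square integrable \<open>s\<close> would make \<open>c\<close> square integrable too, and every
  solution for every z would follow.\<close>

lemma s_not_L2: "~ square_integrable s"
proof
  assume s: "square_integrable s"
  have "square_integrable (%x. \<psi> m x - m * s x)"
    by (intro square_integrable_diff psi_L2 square_integrable_scale s)
  hence "square_integrable c" by (simp add: \<psi>_def)
  with limit_circleI s lp show False by (auto simp: limit_point_def)
qed

definition J :: "real => real" where "J X = Im (cnj (\<psi> m X)*\<psi>' m X)"

lemma J_nonneg: assumes "X >= 0" shows "0 <= J X"
  using mN[OF assms] N_psi[OF assms, of m] unfolding J_def by linarith

text \<open>By the Gram determinant J X times N s X is at most 1/4, while N s X is unbounded because
  \<open>s\<close> is not square integrable.\<close>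

lemma J_lim: "(%n. J (real n)) ----> 0"
proof (rule LIMSEQ_I)
  fix e :: real assume e: "e > 0"
  obtain n0 :: nat where n0: "N s (real n0) > 1/e" using N_bounded[OF cont(2), of "1/e"] s_not_L2 not_le by blast
  have "norm (J (real n) - 0) < e" if n: "n >= n0" for n
  proof -
    have "- (J (real n)*N s (real n)) >= - 1/4"
      using form_det[OF psi_wronskian[of "real n" m]] by (simp only: J_def N_s[OF of_nat_0_le_iff] mult_minus_right) simp
    hence "J (real n)*N s (real n) <= 1/4" by simp
    moreover have "J (real n)*(1/e) <= J (real n)*N s (real n)"
      using n0 N_mono[OF cont(2), of "real n0" "real n"] n by (intro mult_left_mono J_nonneg) auto
    ultimately have "J (real n)*(1/e) <= 1/4" by linarith
    hence "J (real n) <= e/4" using e by (simp add: field_simps)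
    thus ?thesis using e J_nonneg[of "real n"] by simp
  qed
  thus "EX no. ALL n>=no. norm (J (real n) - 0) < e" by blast
qed

section \<open>The resolvent at \<open>\<i>\<close>\<close>

definition K :: "(real => complex) => complex" where "K v = (LINT x|half_line. \<psi> m x * v x)"
text \<open>The boundary value \<open>K v\<close> is the one for which the growing solution
  \<open>s\<close> drops out at infinity; \<open>resolvent_R0\<close> identifies \<open>R0\<close>
  with the resolvent.\<close>

definition R0 :: "(real => complex) => real => complex" where "R0 v = sol 0 (K v) v"

lemma K_integrable: "square_integrable v ==> integrable half_line (%x. \<psi> m x * v x)"
  using square_integrable_product[OF square_integrable_cnj[OF psi_L2]] by simp

lemma K_cinner: "square_integrable v ==> K v = cinner (to_L2 (%x. cnj (\<psi> m x))) (to_L2 v)"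
  by (simp add: K_def cinner_to_L2 square_integrable_cnj[OF psi_L2])

text \<open>With the integral against \<open>\<psi> m\<close> cut off at x, the solution and its
  derivative are at x a common multiple of the Weyl solution, so the boundary form there has the
  sign of \<open>J\<close>.\<close>

lemma sol_psi:
  assumes "loc_int v" "x >= 0"
  shows "sol g (g*m + integral {0..x} (%t. \<psi> m t * v t)) v x = (g + integral {0..x} (%t. s t * v t))*\<psi> m x"
    "sol' g (g*m + integral {0..x} (%t. \<psi> m t * v t)) v x = (g + integral {0..x} (%t. s t * v t))*\<psi>' m x"
proof -
  have "integral {0..x} (%t. \<psi> m t * v t) = integral {0..x} (%t. c t * v t + m*(s t * v t))"
    by (simp add: \<psi>_def algebra_simps)
  also have "... = integral {0..x} (%t. c t * v t) + m*integral {0..x} (%t. s t * v t)"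
    using loc_int_cs[OF assms(1)] loc_intD(2)
    by (subst Henstock_Kurzweil_Integration.integral_add) (auto intro: loc_int_cmult)
  finally show "sol g (g*m + integral {0..x} (%t. \<psi> m t * v t)) v x = (g + integral {0..x} (%t. s t * v t))*\<psi> m x"
    "sol' g (g*m + integral {0..x} (%t. \<psi> m t * v t)) v x = (g + integral {0..x} (%t. s t * v t))*\<psi>' m x"
    by (simp_all add: sol_def sol'_def \<psi>_def \<psi>'_def algebra_simps)
qed

text \<open>The approximants \<open>f n\<close> use the cut-off boundary value and match the Weyl
  solution at n. The boundary term in the energy identity then has a favourable sign, and |f v| <=
  (|f|^2 + |v|^2)/2 bounds the norm on [0, n] by that of \<open>v\<close>. Fatou's lemma passes to
  the limit.\<close>

lemma R0_L2:
  assumes v: "square_integrable v"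
  shows "square_integrable (R0 v)" "norm (to_L2 (R0 v)) <= norm (to_L2 v)"
proof -
  have vl: "loc_int v" by (rule square_integrable_loc_int[OF v])
  define k where "k n = integral {0..real n} (%t. \<psi> m t * v t)" for n
  define f where "f n = sol 0 (k n) v" for n
  have fe: "expr (f n) (sol' 0 (k n) v) (%x. v x + \<i>*f n x)" for n
    unfolding f_def by (rule expr_sol[OF vl])
  have fc: "continuous_on {0..} (f n)" for n using fe locally_ac_continuous unfolding expr_iff by blast
  have "k ----> K v" unfolding k_def K_def by (rule half_line_integral_lim(2)[OF K_integrable[OF v]])
  hence lim: "(%n. f n x) ----> R0 v x" for x unfolding f_def R0_def sol_def by (intro tendsto_intros)
  have vi: "integrable half_line (%x. (cmod (v x))\<^sup>2)" using v by (simp add: square_integrable_def)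
  have bd: "integral {0..real n} (%x. (cmod (f n x))\<^sup>2) <= (LINT x|half_line. (cmod (v x))\<^sup>2)" (is "?N <= _") for n
  proof -
    let ?I = "{0..real n}"
    have vn: "(%x. (cmod (v x))\<^sup>2) integrable_on ?I"
      using half_line_integral_lim(1)[OF vi] by (rule set_lebesgue_integral_eq_integral(1))
    have "f n (real n) = integral ?I (%t. s t * v t)*\<psi> m (real n)"
      "sol' 0 (k n) v (real n) = integral ?I (%t. s t * v t)*\<psi>' m (real n)"
      using sol_psi[OF vl, of "real n" 0] by (simp_all add: f_def k_def)
    moreover have "Im (cnj (l*p)*(l*q)) = (cmod l)\<^sup>2*Im (cnj p*q)" for l p q
      unfolding cmod_power2 by (simp add: power2_eq_square algebra_simps)
    ultimately have "0 <= Im (cnj (f n (real n)) * sol' 0 (k n) v (real n))" using J_nonneg[of "real n"] by (simp only: J_def[symmetric]) simp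
    hence "?N <= - Im (integral ?I (%x. cnj (f n x) * v x))"
      using energy[OF fe vl, of "real n"] unfolding f_def sol_boundary by simp
    also have "... <= cmod (integral ?I (%x. cnj (f n x) * v x))" using abs_Im_le_cmod abs_le_D2 by blast
    also have "... <= integral ?I (%x. ((cmod (f n x))\<^sup>2 + (cmod (v x))\<^sup>2)/2)"
    proof (rule integral_norm_bound_integral)
      show "(%x. cnj (f n x) * v x) integrable_on ?I"
        by (intro loc_intD(2) loc_int_continuous_mult vl continuous_intros fc) simp
      show "(%x. ((cmod (f n x))\<^sup>2 + (cmod (v x))\<^sup>2)/2) integrable_on ?I"
        by (intro integrable_on_divide integrable_add vn N_integrable fc) simp
      show "cmod (cnj (f n x) * v x) <= ((cmod (f n x))\<^sup>2 + (cmod (v x))\<^sup>2)/2" for x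
        using sum_squares_bound[of "cmod (f n x)" "cmod (v x)"] by (simp add: norm_mult)
    qed
    also have "... = (?N + integral ?I (%x. (cmod (v x))\<^sup>2))/2"
      using vn N_integrable[OF fc, of 0] by (simp add: Henstock_Kurzweil_Integration.integral_add)
    finally have "?N <= integral ?I (%x. (cmod (v x))\<^sup>2)" by simp
    also have "... <= (LINT x|half_line. (cmod (v x))\<^sup>2)" by (rule half_line_integral_le[OF vi]) simp
    finally show ?thesis .
  qed
  show R: "square_integrable (R0 v)" by (rule square_integrable_limit(1)[OF fc lim bd])
  have "(norm (to_L2 (R0 v)))\<^sup>2 <= (norm (to_L2 v))\<^sup>2"
    unfolding norm_to_L2[OF R] norm_to_L2[OF v] by (rule square_integrable_limit(2)[OF fc lim bd])
  thus "norm (to_L2 (R0 v)) <= norm (to_L2 v)" by (rule power2_le_imp_le) simp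
qed

lemma R0_diff:
  assumes v: "square_integrable v" and w: "square_integrable w" and x: "x >= 0"
  shows "R0 v x - R0 w x = R0 (%x. v x - w x) x"
proof -
  have l: "loc_int v" "loc_int w" using v w by (auto intro: square_integrable_loc_int)
  have I: "integral {0..x} (%t. e t*(v t - w t)) = integral {0..x} (%t. e t * v t) - integral {0..x} (%t. e t*w t)"
    if "continuous_on {0..} e" for e unfolding right_diff_distrib
    by (intro Henstock_Kurzweil_Integration.integral_diff loc_intD(2) loc_int_continuous_mult l that) auto
  have Kd: "K (%x. v x - w x) = K v - K w"
    unfolding K_def right_diff_distrib by (intro Bochner_Integration.integral_diff K_integrable v w)
  show ?thesis unfolding R0_def sol_def I[OF cont(1)] I[OF cont(2)] Kd by (simp add: algebra_simps)
qed

section \<open>The maximal operator and Green's formula at infinity\<close>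

definition T :: "(half_line_L2 \<times> half_line_L2 \<times> complex \<times> complex) set" where
  "T = {(to_L2 u, to_L2 f, B0 u u', B1 u u') | u u' f. expr u u' f & square_integrable u & square_integrable f}"

lemma T_I: "expr u u' f ==> square_integrable u ==> square_integrable f ==> (to_L2 u, to_L2 f, B0 u u', B1 u u') \<in> T"
  unfolding T_def by blast

lemma R0_T:
  assumes v: "square_integrable v"
  shows "(to_L2 (R0 v), to_L2 v + \<i> *\<^sub>C to_L2 (R0 v), 0, K v) \<in> T"
  using T_I[OF expr_sol[OF square_integrable_loc_int[OF v], of 0 "K v"]] R0_L2(1)[OF v] v
  by (simp add: R0_def to_L2_scale to_L2_add square_integrable_add square_integrable_scale)

lemma psi_T: "(to_L2 (\<psi> m), \<i> *\<^sub>C to_L2 (\<psi> m), 1, m) \<in> T"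
  using T_I[OF expr_psi[of m] psi_L2] by (simp add: psi_boundary psi_L2 to_L2_scale square_integrable_scale)

text \<open>Every element of the maximal operator, as a combination of \<open>\<psi>\<close> and a solution with zero
  first boundary value: here the limit point property makes the coefficient of \<open>s\<close> vanish.\<close>

lemma T_decomp:
  assumes "(x, y, g, h) \<in> T"
  obtains v where "square_integrable v" "x = g *\<^sub>C to_L2 (\<psi> m) + to_L2 (R0 v)" "y = to_L2 v + \<i> *\<^sub>C x" "h = g*m + K v"
proof -
  obtain u u' f where u: "x = to_L2 u" "y = to_L2 f" "g = B0 u u'" "h = B1 u u'" "expr u u' f"
    "square_integrable u" "square_integrable f" using assms unfolding T_def by blast
  define v where "v = (%x. f x - \<i>*u x)"
  have v: "square_integrable v" unfolding v_def by (intro square_integrable_diff square_integrable_scale u)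
  have us: "u x = g*\<psi> m x + R0 v x + (h - g*m - K v) * s x" if "x >= 0" for x
    using sol_unique(1)[OF u(5) that] by (simp add: v_def[symmetric] u(3,4)[symmetric] R0_def sol_def \<psi>_def algebra_simps)
  have pR: "square_integrable (%x. g*\<psi> m x + R0 v x)"
    by (intro square_integrable_add square_integrable_scale psi_L2 R0_L2 v)
  have "h - g*m - K v = 0"
  proof (rule ccontr)
    assume ne: "h - g*m - K v ~= 0"
    have "square_integrable (%x. 1/(h - g*m - K v)*(u x - (g*\<psi> m x + R0 v x)))"
      by (intro square_integrable_scale square_integrable_diff u pR)
    hence "square_integrable s" by (rule square_integrable_cong) (use us ne in simp)
    thus False using s_not_L2 by blast
  qed
  hence h: "h = g*m + K v" by (simp add: algebra_simps)
  have "x = to_L2 (%x. g*\<psi> m x + R0 v x)"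
    unfolding u(1) to_L2_eq_iff[OF u(6) pR] using us h by (intro AE_I2) simp
  also have "... = g *\<^sub>C to_L2 (\<psi> m) + to_L2 (R0 v)"
    by (simp add: to_L2_scale to_L2_add psi_L2 R0_L2 v square_integrable_scale)
  finally have x: "x = g *\<^sub>C to_L2 (\<psi> m) + to_L2 (R0 v)" .
  have "y = to_L2 v + \<i> *\<^sub>C x"
    unfolding u(1,2) v_def by (simp add: to_L2_scale to_L2_add u square_integrable_diff square_integrable_scale)
  with that v x h show thesis by blast
qed

lemma green_limit:
  assumes u: "expr u u' f" "square_integrable u" "square_integrable f"
    and w: "expr w w' k" "square_integrable w" "square_integrable k"
    and lim: "(%n. cnj (u (real n))*w' (real n) - cnj (u' (real n))*w (real n)) ----> 0"
  shows "cinner (to_L2 u) (to_L2 k) - cinner (to_L2 f) (to_L2 w) = cnj (B0 u u')*B1 w w' - cnj (B1 u u')*B0 w w'"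
proof (rule LIMSEQ_unique)
  have "(%n. integral {0..real n} (%x. cnj (u x)*k x - cnj (f x)*w x)) \<longlonglongrightarrow>
      (LINT x|half_line. cnj (u x)*k x - cnj (f x)*w x)"
    by (intro half_line_integral_lim(2) Bochner_Integration.integrable_diff square_integrable_product u w)
  also have "(LINT x|half_line. cnj (u x)*k x - cnj (f x)*w x) = cinner (to_L2 u) (to_L2 k) - cinner (to_L2 f) (to_L2 w)"
    using u w by (simp add: cinner_to_L2 square_integrable_product)
  finally show "(%n. integral {0..real n} (%x. cnj (u x)*k x - cnj (f x)*w x)) \<longlonglongrightarrow>
      cinner (to_L2 u) (to_L2 k) - cinner (to_L2 f) (to_L2 w)" .
  show "(%n. integral {0..real n} (%x. cnj (u x)*k x - cnj (f x)*w x)) \<longlonglongrightarrow>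
      cnj (B0 u u')*B1 w w' - cnj (B1 u u')*B0 w w'"
    using tendsto_diff[OF tendsto_const lim, of "cnj (B0 u u')*B1 w w' - cnj (B1 u u')*B0 w w'"]
    by (simp add: lagrange[OF u(1) w(1)])
qed

text \<open>If \<open>v\<close> has bounded support, then \<open>R0 v\<close> is a multiple of \<open>\<psi>\<close> near infinity.\<close>

lemma green_truncated:
  fixes a b :: complex and n0 :: nat
  assumes v: "square_integrable v" "!!x. x > real n0 ==> v x = 0"
    and w: "square_integrable w" "!!x. x > real n0 ==> w x = 0"
  defines "x \<equiv> a *\<^sub>C to_L2 (\<psi> m) + to_L2 (R0 v)" and "y \<equiv> b *\<^sub>C to_L2 (\<psi> m) + to_L2 (R0 w)"
  shows "cinner x (to_L2 w + \<i> *\<^sub>C y) - cinner (to_L2 v + \<i> *\<^sub>C x) y = cnj a*(b*m + K w) - cnj (a*m + K v)*b"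
proof -
  have rep: "a *\<^sub>C to_L2 (\<psi> m) + to_L2 (R0 v) = to_L2 (sol a (a*m + K v) v)" "square_integrable (sol a (a*m + K v) v)"
    if "square_integrable v" for a v
  proof -
    have "(%x. a*\<psi> m x + R0 v x) = sol a (a*m + K v) v" by (rule ext) (simp add: R0_def sol_def \<psi>_def algebra_simps)
    thus "a *\<^sub>C to_L2 (\<psi> m) + to_L2 (R0 v) = to_L2 (sol a (a*m + K v) v)" "square_integrable (sol a (a*m + K v) v)"
      using square_integrable_add[OF square_integrable_scale[OF psi_L2, of a] R0_L2(1)[OF that]]
      by (simp_all add: to_L2_scale to_L2_add psi_L2 R0_L2(1) that square_integrable_scale)
  qed
  have far: "EX \<kappa>. ALL n>=n0. sol a (a*m + K v) v (real n) = \<kappa>*\<psi> m (real n) & sol' a (a*m + K v) v (real n) = \<kappa>*\<psi>' m (real n)"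
    if v: "square_integrable v" "!!x. x > real n0 ==> v x = 0" for a v
  proof (intro exI allI impI)
    fix n assume n: "n >= n0"
    have z: "integral {0..real k} (%t. e t * v t) = integral {0..real n0} (%t. e t * v t)" if "k >= n0" for e k
      by (rule integral_zero_beyond) (use v(2) that in auto)
    have "(%k. integral {0..real k} (%t. \<psi> m t * v t)) ----> integral {0..real n0} (%t. \<psi> m t * v t)"
      by (intro tendsto_eventually eventually_sequentiallyI[of n0] z)
    with half_line_integral_lim(2)[OF K_integrable[OF v(1)]] have "K v = integral {0..real n} (%t. \<psi> m t * v t)"
      unfolding K_def z[OF n] by (rule LIMSEQ_unique)
    with sol_psi[OF square_integrable_loc_int[OF v(1)], of "real n" a]
    show "sol a (a*m + K v) v (real n) = (a + integral {0..real n0} (%t. s t * v t))*\<psi> m (real n) &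
        sol' a (a*m + K v) v (real n) = (a + integral {0..real n0} (%t. s t * v t))*\<psi>' m (real n)"
      by (simp add: z[OF n])
  qed
  let ?u = "sol a (a*m + K v) v" and ?u' = "sol' a (a*m + K v) v"
    and ?w = "sol b (b*m + K w) w" and ?w' = "sol' b (b*m + K w) w"
  obtain \<kappa> where \<kappa>: "!!n. n >= n0 ==> ?u (real n) = \<kappa>*\<psi> m (real n) & ?u' (real n) = \<kappa>*\<psi>' m (real n)"
    using far[OF v, of a] by blast
  obtain \<mu> where \<mu>: "!!n. n >= n0 ==> ?w (real n) = \<mu>*\<psi> m (real n) & ?w' (real n) = \<mu>*\<psi>' m (real n)"
    using far[OF w, of b] by blast
  have "cnj (?u (real n))*?w' (real n) - cnj (?u' (real n))*?w (real n) = cnj \<kappa>*\<mu>*(2*\<i>*J (real n))" if "n >= n0" for n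
  proof -
    have e: "2*\<i>*J (real n) = cnj (\<psi> m (real n))*\<psi>' m (real n) - cnj (\<psi>' m (real n))*\<psi> m (real n)"
      by (simp add: J_def complex_eq_iff)
    show ?thesis unfolding e using \<kappa>[OF that] \<mu>[OF that] by (simp add: algebra_simps)
  qed
  hence "\<forall>\<^sub>F n in sequentially. cnj \<kappa>*\<mu>*(2*\<i>*J (real n)) = cnj (?u (real n))*?w' (real n) - cnj (?u' (real n))*?w (real n)"
    by (intro eventually_sequentiallyI[of n0]) simp
  moreover have "(%n. cnj \<kappa>*\<mu>*(2*\<i>*J (real n))) ----> cnj \<kappa>*\<mu>*(2*\<i>*cr 0)"
    by (intro tendsto_intros J_lim)
  ultimately have "(%n. cnj (?u (real n))*?w' (real n) - cnj (?u' (real n))*?w (real n)) ----> 0"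
    by (auto intro: Lim_transform_eventually)
  from green_limit[OF expr_sol[OF square_integrable_loc_int[OF v(1)]] _ _ expr_sol[OF square_integrable_loc_int[OF w(1)]] _ _ this]
  show ?thesis using rep[OF v(1), of a] rep[OF w(1), of b] v(1) w(1)
    by (simp add: x_def y_def to_L2_scale to_L2_add square_integrable_add square_integrable_scale)
qed

text \<open>The boundary term at infinity is only under control for \<open>v\<close> of bounded
  support. By \<open>T_decomp\<close> both sides depend on such data through \<open>R0\<close> and
  \<open>K\<close>, which are continuous in L2, so truncation suffices.\<close>

lemma green_T:
  assumes "(x, y, g, h) \<in> T" "(x', y', g', h') \<in> T"
  shows "cinner x y' - cinner y x' = cnj g*h' - cnj h*g'"
proof -
  obtain v where v: "square_integrable v" "x = g *\<^sub>C to_L2 (\<psi> m) + to_L2 (R0 v)" "y = to_L2 v + \<i> *\<^sub>C x" "h = g*m + K v"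
    using T_decomp[OF assms(1)] .
  obtain w where w: "square_integrable w" "x' = g' *\<^sub>C to_L2 (\<psi> m) + to_L2 (R0 w)" "y' = to_L2 w + \<i> *\<^sub>C x'" "h' = g'*m + K w"
    using T_decomp[OF assms(2)] .
  define tr where "tr v n = (%x. if x <= real n then v x else 0)" for v :: "real => complex" and n
  have tr: "square_integrable (tr v n)" if "square_integrable v" for v n
    unfolding tr_def by (rule square_integrable_restrict[OF that])
  have lim: "(%n. to_L2 (tr v n)) ----> to_L2 v" if "square_integrable v" for v
    unfolding tr_def by (rule restrict_tendsto[OF that])
  have limR: "(%n. to_L2 (R0 (tr v n))) ----> to_L2 (R0 v)" if v: "square_integrable v" for v
  proof -
    have le: "norm (to_L2 (R0 v) - to_L2 (R0 (tr v n))) <= norm (to_L2 v - to_L2 (tr v n))" for n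
    proof -
      have "to_L2 (R0 v) - to_L2 (R0 (tr v n)) = to_L2 (R0 (%x. v x - tr v n x))"
        using R0_diff[OF v tr[OF v, of n]]
        by (auto simp: to_L2_diff to_L2_eq_iff R0_L2 v tr square_integrable_diff intro!: AE_I2)
      thus ?thesis using R0_L2(2)[OF square_integrable_diff[OF v tr[OF v, of n]]] by (simp add: to_L2_diff v tr)
    qed
    have "(%n. norm (to_L2 v - to_L2 (tr v n))) ----> 0"
      using tendsto_norm[OF tendsto_diff[OF tendsto_const lim[OF v]], of "to_L2 v"] by simp
    hence "(%n. to_L2 (R0 v) - to_L2 (R0 (tr v n))) ----> 0"
      by (rule Lim_null_comparison[rotated]) (simp add: le)
    from tendsto_diff[OF tendsto_const this, of "to_L2 (R0 v)"] show ?thesis by simp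
  qed
  have limK: "(%n. K (tr v n)) ----> K v" if v: "square_integrable v" for v
    unfolding K_cinner[OF v] K_cinner[OF tr[OF v]] by (intro tendsto_intros lim v)
  have eq: "cinner (g *\<^sub>C to_L2 (\<psi> m) + to_L2 (R0 (tr v n))) (to_L2 (tr w n) + \<i> *\<^sub>C (g' *\<^sub>C to_L2 (\<psi> m) + to_L2 (R0 (tr w n))))
      - cinner (to_L2 (tr v n) + \<i> *\<^sub>C (g *\<^sub>C to_L2 (\<psi> m) + to_L2 (R0 (tr v n)))) (g' *\<^sub>C to_L2 (\<psi> m) + to_L2 (R0 (tr w n)))
      = cnj g*(g'*m + K (tr w n)) - cnj (g*m + K (tr v n))*g'" (is "?L n = ?R n") for n
    by (rule green_truncated[where ?n0.0 = n]) (use v(1) w(1) tr in \<open>auto simp: tr_def\<close>)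
  have "?L ----> cinner x y' - cinner y x'" unfolding v w by (intro tendsto_intros lim limR v(1) w(1))
  moreover have "?R ----> cnj g*h' - cnj h*g'" unfolding v w by (intro tendsto_intros limK v(1) w(1))
  ultimately show ?thesis unfolding eq by (rule LIMSEQ_unique)
qed

end

section \<open>Cyclicity\<close>

text \<open>On the circle \<open>|z| = r\<close> one has \<open>|z\<^sup>2 - r\<^sup>2| = 2 r |Im z|\<close>, so \<open>(z\<^sup>2 - r\<^sup>2) P z\<close> is bounded there by \<open>2 r B\<close>.\<close>

lemma entire_bounded_by_inverse_Im:
  assumes hol: "P holomorphic_on UNIV" and B: "!!z. cmod (P z)*\<bar>Im z\<bar> <= B"
  shows "P z0 = 0"
proof -
  have B0: "B >= 0" using B[of 0] by simp
  \<comment> \<open>For r > 2 |z0| the modulus of z0^2 - r^2 is at least 3/4 r^2; together with the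
    bound 2 r B from the circle this gives 8/3.\<close>
  have le: "cmod (P z0)*r <= 8/3*B" if r: "r > 2*cmod z0" "r > 0" for r
  proof -
    have "cmod ((z0\<^sup>2 - cr r^2)*P z0) <= 2*r*B"
    proof (rule maximum_modulus_frontier[where S = "cball 0 r" and f = "%z. (z\<^sup>2 - cr r^2)*P z"])
      show "(%z. (z\<^sup>2 - cr r^2)*P z) holomorphic_on interior (cball 0 r)"
        by (intro holomorphic_intros holomorphic_on_subset[OF hol]) simp
      show "continuous_on (closure (cball 0 r)) (%z. (z\<^sup>2 - cr r^2)*P z)"
        by (intro continuous_intros continuous_on_subset[OF holomorphic_on_imp_continuous_on[OF hol]]) simp
      fix z :: complex assume "z \<in> frontier (cball 0 r)"
      hence zr: "cmod z = r" using r(2) by simp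
      have "z\<^sup>2 - cr r^2 = z*(2*\<i>*Im z)"
        unfolding zr[symmetric] of_real_power[symmetric] complex_norm_square
        by (simp add: power2_eq_square complex_eq_iff algebra_simps)
      hence "cmod ((z\<^sup>2 - cr r^2)*P z) = 2*r*(cmod (P z)*\<bar>Im z\<bar>)"
        using zr by (simp add: norm_mult)
      thus "cmod ((z\<^sup>2 - cr r^2)*P z) <= 2*r*B" using B[of z] r(2) by simp
    qed (use r in auto)
    moreover have "3/4*r\<^sup>2 <= cmod (z0\<^sup>2 - cr r^2)"
    proof -
      have "(cmod z0)\<^sup>2 <= (r/2)\<^sup>2" using r by (intro power_mono) auto
      moreover have "r\<^sup>2 - (cmod z0)\<^sup>2 <= cmod (z0\<^sup>2 - cr r^2)"
        using norm_triangle_ineq2[of "cr r^2" "z0\<^sup>2"] by (simp add: norm_power norm_minus_commute)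
      ultimately show ?thesis by (simp add: power_divide)
    qed
    hence "3/4*r\<^sup>2*cmod (P z0) <= cmod ((z0\<^sup>2 - cr r^2)*P z0)"
      unfolding norm_mult by (rule mult_right_mono) simp
    ultimately have "r*(3/4*(r*cmod (P z0))) <= r*(2*B)" by (simp add: power2_eq_square mult_ac)
    thus ?thesis using r(2) by (simp add: mult.commute)
  qed
  show ?thesis
  proof (rule ccontr)
    assume ne: "P z0 ~= 0"
    \<comment> \<open>With this radius |P z0| r exceeds 3 B, against the bound 8/3 B.\<close>
    define r where "r = 2*cmod z0 + 1 + 3*B/cmod (P z0)"
    have "3*B/cmod (P z0) >= 0" using B0 by simp
    hence "r > 2*cmod z0" "r > 0" unfolding r_def using norm_ge_zero[of z0] by linarith+
    from le[OF this] have "cmod (P z0)*(2*cmod z0 + 1) + 3*B <= 8/3*B"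
      using ne by (simp add: r_def distrib_left)
    moreover have "cmod (P z0)*(2*cmod z0 + 1) > 0" using ne by (intro mult_pos_pos add_nonneg_pos) auto
    ultimately show False using B0 by linarith
  qed
qed

context selfadj
begin

text \<open>The Taylor coefficients of (f, R z v) at \<open>\<i>\<close> are the matrix elements of
  powers of R i. If they decay like A^n/n!, the series is an entire function that agrees with (f, R
  z v) off the real axis, where it is bounded by |f| |v| / |Im z|; such a function vanishes.\<close>

lemma resolvent_entire_zero:
  assumes v: "v \<in> M" and inv: "!!z v. Im z ~= 0 ==> v \<in> M ==> R z v \<in> M"
    and bd: "!!v. v \<in> M ==> EX A B. ALL n. cmod (cinner f ((R \<i> ^^ Suc n) v)) <= B*(A^n/fact n)"
  shows "cinner f (R \<i> v) = 0"
proof -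
  define a where "a n v = cinner f ((R \<i> ^^ Suc n) v)" for n v
  have sm: "summable (%n. a n v * y^n)" if vM: "v \<in> M" for v y
  proof -
    obtain A B where AB: "!!n. cmod (a n v) <= B*(A^n/fact n)" using bd[OF vM] unfolding a_def by blast
    have "summable (%n. B*(inverse (fact n)*(A*cmod y)^n))" by (intro summable_mult summable_exp)
    moreover have "norm (a n v * y^n) <= B*(inverse (fact n)*(A*cmod y)^n)" for n
      using mult_right_mono[OF AB[of n], of "cmod y^n"] by (simp add: norm_mult norm_power power_mult_distrib field_simps)
    ultimately show ?thesis by (rule summable_comparison_test'[where N = 0]) 
  qed
  note ir = i_resolvent(1)
  \<comment> \<open>A finite expansion with remainder, valid in both half-planes, so the series
    represents the function beyond the real axis as well. The remainder tends to 0 because R z v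
    lies in \<open>M\<close> and has small coefficients too.\<close>
  have exp: "cinner f (R z v) = (\<Sum>n<Suc N. a n v * (z - \<i>)^n) + (z - \<i>)*(a N (R z v)*(z - \<i>)^N)"
    if z: "Im z ~= 0" for z N
  proof -
    have step: "R z v = R \<i> v + (z - \<i>) *\<^sub>C R \<i> (R z v)"
      using resolvent_identity[OF nonreal_in_resolvent_set[OF z] ir, of v]
        resolvent_commute[OF nonreal_in_resolvent_set[OF z] ir, of v] by (simp add: algebra_simps)
    have lin: "(R \<i> ^^ k) (x + c *\<^sub>C y) = (R \<i> ^^ k) x + c *\<^sub>C (R \<i> ^^ k) y" for k x y c
      by (induction k) (simp_all add: resolvent_linear[OF ir])
    have rec: "a n (R z v) = a (Suc n) v + (z - \<i>)*a (Suc n) (R z v)" for n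
    proof -
      have "(R \<i> ^^ Suc n) (R z v) = (R \<i> ^^ Suc n) (R \<i> v + (z - \<i>) *\<^sub>C R \<i> (R z v))"
        by (rule arg_cong[OF step])
      thus ?thesis unfolding a_def lin funpow_Suc_right[of "Suc n"] o_apply by (simp only: cinner_simps)
    qed
    show ?thesis
    proof (induction N)
      case 0
      have "cinner f (R z v) = cinner f (R \<i> v + (z - \<i>) *\<^sub>C R \<i> (R z v))" using step by simp
      thus ?case by (simp add: a_def cinner_simps)
    next
      case (Suc N)
      thus ?case unfolding rec[of N] by (simp add: algebra_simps)
    qed
  qed
  define P where "P z = (\<Sum>n. a n v * (z - \<i>)^n)" for z
  have PF: "P z = cinner f (R z v)" if z: "Im z ~= 0" for z
  proof (rule LIMSEQ_unique)
    show "(%N. \<Sum>n<Suc N. a n v * (z - \<i>)^n) ----> P z"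
      unfolding P_def by (rule LIMSEQ_Suc[OF summable_LIMSEQ[OF sm[OF v]]])
    have "(%N. cinner f (R z v) - (z - \<i>)*(a N (R z v)*(z - \<i>)^N)) ----> cinner f (R z v) - (z - \<i>)*0"
      by (intro tendsto_intros summable_LIMSEQ_zero sm inv v z)
    moreover have "(\<Sum>n<Suc N. a n v * (z - \<i>)^n) = cinner f (R z v) - (z - \<i>)*(a N (R z v)*(z - \<i>)^N)" for N
      using exp[OF z, of N] by (metis add_diff_cancel_right')
    ultimately show "(%N. \<Sum>n<Suc N. a n v * (z - \<i>)^n) ----> cinner f (R z v)"
      by (simp only: mult_zero_right diff_zero)
  qed
  have "P \<i> = 0"
  proof (rule entire_bounded_by_inverse_Im[where P = P])
    have h: "(%y. \<Sum>n. a n v * y^n) holomorphic_on UNIV"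
      unfolding holomorphic_on_def field_differentiable_def
      using termdiffs_strong_converges_everywhere[OF sm[OF v]] by blast
    have "(%z. z - \<i>) holomorphic_on UNIV" by (intro holomorphic_intros)
    from holomorphic_on_compose_gen[OF this h]
    show "P holomorphic_on UNIV" unfolding P_def[abs_def] o_def by simp
    show "cmod (P z)*\<bar>Im z\<bar> <= norm f*norm v" for z
    proof (cases "Im z = 0")
      case False
      have "cmod (P z) <= norm f*norm (R z v)" unfolding PF[OF False] by (rule cmod_cinner_le)
      also have "... <= norm f*(norm v/\<bar>Im z\<bar>)" by (intro mult_left_mono resolvent_norm_le False) simp
      finally show ?thesis using False by (simp add: field_simps)
    qed simp
  qed
  thus ?thesis by (simp add: PF)
qed

end

context boundary_triple
begin

text \<open>Off w = cnj z the difference of two deficiency vectors is a nonzero multiple of R (cnj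
  z) (gam w), and both are orthogonal to v; the adjoint moves the resolvent to v. The exceptional w
  is reached by continuity.\<close>

lemma orthogonal_gam_invariant:
  assumes v: "!!w. Im w ~= 0 ==> cinner (gam w) v = 0" and z: "Im z ~= 0" and w: "Im w ~= 0"
  shows "cinner (gam w) (R z v) = 0"
proof -
  have zr: "cnj z \<in> resolvent_set D" "z \<in> resolvent_set D" using z by (auto intro: nonreal_in_resolvent_set)
  have off: "cinner (gam w) (R z v) = 0" if w: "Im w ~= 0" "w ~= cnj z" for w
  proof -
    have "cinner (gam w) v + cnj (cnj z - w)*cinner (R (cnj z) (gam w)) v = cinner (gam (cnj z)) v"
      unfolding gam_resolvent[OF zr(1) nonreal_in_resolvent_set[OF w(1)]] by (simp add: cinner_simps)
    hence "cnj (cnj z - w)*cinner (gam w) (R z v) = 0"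
      using v[OF w(1)] v[of "cnj z"] z by (simp add: resolvent_adjoint[OF zr(2,1)])
    thus ?thesis using w(2) by auto
  qed
  show ?thesis
  proof (cases "w = cnj z")
    case True
    let ?g = "%w. gam \<i> + (w - \<i>) *\<^sub>C R w (gam \<i>)"
    have g: "gam w = ?g w" if "Im w ~= 0" for w
      by (rule gam_resolvent[OF nonreal_in_resolvent_set[OF that] i_resolvent(1)])
    have lim: "((%w. cinner (?g w) (R z v)) \<longlongrightarrow> cinner (?g (cnj z)) (R z v)) (at (cnj z))"
      using z by (intro tendsto_intros resolvent_tendsto) auto
    have "((%w. Im w) \<longlongrightarrow> Im (cnj z)) (at (cnj z))" by (intro tendsto_intros)
    hence "\<forall>\<^sub>F w in at (cnj z). Im w ~= 0" by (rule tendsto_imp_eventually_ne) (use z in simp)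
    hence ev: "\<forall>\<^sub>F w in at (cnj z). cinner (?g w) (R z v) = 0"
      using eventually_neq_at_within[of "cnj z" "cnj z" UNIV]
    proof eventually_elim
      case (elim w)
      show ?case unfolding g[OF elim(1), symmetric] by (rule off[OF elim])
    qed
    have "cinner (?g (cnj z)) (R z v) = 0"
      by (rule tendsto_unique[OF at_neq_bot lim tendsto_eventually[OF ev]])
    moreover have "Im (cnj z) ~= 0" using z by simp
    ultimately show ?thesis unfolding True by (subst g)
  qed (use off w in simp)
qed

end

section \<open>Schroedinger operators on the half-line\<close>

lemma AE_zero_continuous:
  fixes u :: "real => complex"
  assumes uc: "continuous_on {0..} u" and ae: "AE x in half_line. u x = 0" and x: "x >= 0"
  shows "u x = 0"
proof -
  have z: "(%x. (cmod (u x))\<^sup>2) absolutely_integrable_on {0..x + 1}"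
    and c: "continuous_on {0..x + 1} (%x. (cmod (u x))\<^sup>2)"
    by (auto intro!: absolutely_integrable_continuous_real continuous_intros intro: continuous_on_subset[OF uc])
  have "integral {0..x + 1} (%x. (cmod (u x))\<^sup>2) = (LINT t|lebesgue. indicator {0..x + 1} t*(cmod (u t))\<^sup>2)"
    using set_lebesgue_integral_eq_integral(2)[OF z] by (simp add: set_lebesgue_integral_def)
  also have "... = 0"
  proof (rule integral_eq_zero_AE)
    have "AE t in lebesgue. t \<in> {0..} --> u t = 0" using ae by (simp add: AE_restrict_space_iff)
    thus "AE t in lebesgue. indicator {0..x + 1} t*(cmod (u t))\<^sup>2 = 0"
      by eventually_elim (auto simp: indicator_def)
  qed
  finally have "ALL t:{0..x + 1}. (cmod (u t))\<^sup>2 = 0" by (subst (asm) integral_eq_0_iff[OF c]) (use x in auto)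
  thus ?thesis using x by simp
qed

text \<open>Makes boundary values and image depend only on the equivalence class of
  \<open>u\<close>: it vanishes identically by continuity, then so does u' as its primitive is 0,
  and finally f almost everywhere.\<close>

lemma (in potential) expr_AE_zero:
  assumes e: "expr u u' f" and u: "AE x in half_line. u x = 0"
  shows "u 0 = 0" "u' 0 = 0" "AE x in half_line. f x = 0"
proof -
  have ac: "locally_ac u u'" "locally_ac u' (%x. cr (V x)*u x - f x)" using e by (auto simp: expr_iff)
  have u0: "u x = 0" if "x >= 0" for x by (rule AE_zero_continuous[OF locally_ac_continuous[OF ac(1)] u that])
  have u'0: "u' x = 0" if "x >= 0" for x
  proof (rule AE_zero_continuous[OF locally_ac_continuous[OF ac(2)] AE_zero_if_integral_zero that])
    show "loc_int u'" by (rule locally_acD(1)[OF ac(1)])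
    show "integral {0..x} u' = 0" if "x >= 0" for x using locally_acD(2)[OF ac(1) that] u0[OF that] u0[of 0] by simp
  qed
  show "u 0 = 0" "u' 0 = 0" using u0 u'0 by simp_all
  have "AE x in half_line. cr (V x)*u x - f x = 0"
  proof (rule AE_zero_if_integral_zero)
    show "loc_int (%x. cr (V x)*u x - f x)" by (rule locally_acD(1)[OF ac(2)])
    show "integral {0..x} (%x. cr (V x)*u x - f x) = 0" if "x >= 0" for x
      using locally_acD(2)[OF ac(2) that] u'0[OF that] u'0[of 0] by simp
  qed
  with u show "AE x in half_line. f x = 0" by eventually_elim simp
qed

section \<open>The maximal operator as a boundary triple\<close>

context weyl
begin

lemma T_add:
  assumes "(x, y, g, h) \<in> T" "(x', y', g', h') \<in> T"
  shows "(x + x', y + y', g + g', h + h') \<in> T"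
proof -
  obtain u u' f where u: "x = to_L2 u" "y = to_L2 f" "g = B0 u u'" "h = B1 u u'" "expr u u' f"
    "square_integrable u" "square_integrable f" using assms(1) unfolding T_def by blast
  obtain w w' k where w: "x' = to_L2 w" "y' = to_L2 k" "g' = B0 w w'" "h' = B1 w w'" "expr w w' k"
    "square_integrable w" "square_integrable k" using assms(2) unfolding T_def by blast
  show ?thesis
    using T_I[OF expr_add[OF u(5) w(5)] square_integrable_add[OF u(6) w(6)] square_integrable_add[OF u(7) w(7)]]
    unfolding u(1-4) w(1-4) by (simp add: to_L2_add u w B0_def B1_def algebra_simps)
qed

lemma T_scale:
  assumes "(x, y, g, h) \<in> T"
  shows "(k *\<^sub>C x, k *\<^sub>C y, k*g, k*h) \<in> T"
proof -
  obtain u u' f where u: "x = to_L2 u" "y = to_L2 f" "g = B0 u u'" "h = B1 u u'" "expr u u' f"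
    "square_integrable u" "square_integrable f" using assms(1) unfolding T_def by blast
  show ?thesis
    using T_I[OF expr_cmult[OF u(5), of k] square_integrable_scale[OF u(6)] square_integrable_scale[OF u(7)]]
    unfolding u(1-4) by (simp add: to_L2_scale u B0_def B1_def algebra_simps)
qed

lemma T_zero:
  assumes "(0, y, g, h) \<in> T"
  shows "y = 0" "g = 0" "h = 0"
proof -
  obtain u u' f where u: "0 = to_L2 u" "y = to_L2 f" "g = B0 u u'" "h = B1 u u'" "expr u u' f"
    "square_integrable u" "square_integrable f" using assms(1) unfolding T_def by blast
  have z: "(0 :: half_line_L2) = to_L2 (%x. 0)" by (simp add: zero_half_line_L2_def)
  have "AE x in half_line. u x = 0" using u(1)[symmetric] unfolding z to_L2_eq_iff[OF u(6) square_integrable_zero] .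
  note e = expr_AE_zero[OF u(5) this]
  show "y = 0" unfolding z u(2) by (subst to_L2_eq_iff[OF u(7) square_integrable_zero]) (rule e(3))
  show "g = 0" "h = 0" using e(1,2) unfolding u(3,4) by (simp_all add: B0_def B1_def)
qed

lemma T_single: "(x, y, g, h) \<in> T ==> (x, y', g', h') \<in> T ==> y = y'"
  using T_zero(1)[of "y - y'"] T_add[OF _ T_scale[of x y' g' h' "- 1"]] by (fastforce simp: scaleC_minus1)

text \<open>Cosine and sine of the angle relative to the reference boundary condition; they rewrite
  the condition for \<open>\<theta>\<close> in the rotated boundary values \<open>B0\<close> and
  \<open>B1\<close>.\<close>

definition ca :: "real => real" where "ca \<theta> = cos \<theta>*C + sin \<theta>*S"
definition sa :: "real => real" where "sa \<theta> = sin \<theta>*C - cos \<theta>*S"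

lemma op_T: "x \<in> op_dom (schroedinger_op V \<theta>) & op_app (schroedinger_op V \<theta>) x = y \<longleftrightarrow>
   (EX g h. (x, y, g, h) \<in> T & cr (ca \<theta>)*g + cr (sa \<theta>)*h = 0)"
proof -
  have gr: "(x, y) \<in> schroedinger_graph V \<theta> \<longleftrightarrow>
      (EX g h. (x, y, g, h) \<in> T & cr (ca \<theta>)*g + cr (sa \<theta>)*h = 0)" for x y
  proof -
    have e: "cr (cos \<theta>)*u 0 + cr (sin \<theta>)*u' 0 =
        cr (ca \<theta>)*B0 u u' + cr (sa \<theta>)*B1 u u'" for u u'
      by (simp add: boundary_values(1)[of u u'] boundary_values(2)[of u' u] ca_def sa_def algebra_simps)
    show ?thesis
    proof
      assume "(x, y) \<in> schroedinger_graph V \<theta>"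
      then obtain u f u' where "x = to_L2 u" "y = to_L2 f" "expr u u' f" "square_integrable u" "square_integrable f"
        "cr (ca \<theta>)*B0 u u' + cr (sa \<theta>)*B1 u u' = 0" unfolding schroedinger_graph_def e by blast
      thus "EX g h. (x, y, g, h) \<in> T & cr (ca \<theta>)*g + cr (sa \<theta>)*h = 0" using T_I by blast
    next
      assume "EX g h. (x, y, g, h) \<in> T & cr (ca \<theta>)*g + cr (sa \<theta>)*h = 0"
      thus "(x, y) \<in> schroedinger_graph V \<theta>" unfolding schroedinger_graph_def e T_def by blast
    qed
  qed
  have "(THE \<eta>. (x, \<eta>) \<in> schroedinger_graph V \<theta>) = y" if "(x, y) \<in> schroedinger_graph V \<theta>" for x y
    using that by (intro the_equality) (auto simp: gr dest: T_single)
  thus ?thesis unfolding gr[symmetric] by (auto simp: schroedinger_op_def)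
qed

end

text \<open>The boundary condition that defines \<open>C\<close> and \<open>S\<close>.\<close>

locale half_line_problem = weyl +
  fixes \<theta>\<^sub>0 :: real
  assumes th: "C = cos \<theta>\<^sub>0" "S = sin \<theta>\<^sub>0"
begin

abbreviation "H \<equiv> schroedinger_op V \<theta>\<^sub>0"

lemma H_T: "x \<in> op_dom H & op_app H x = y \<longleftrightarrow> (EX h. (x, y, 0, h) \<in> T)"
proof -
  have "ca \<theta>\<^sub>0 = 1" "sa \<theta>\<^sub>0 = 0" 
    unfolding ca_def sa_def th[symmetric] using CS by (simp_all add: power2_eq_square)
  thus ?thesis unfolding op_T by simp
qed

lemma H_T_dom: "x \<in> op_dom H ==> EX h. (x, op_app H x, 0, h) \<in> T" using H_T by blast

text \<open>\<open>R0\<close> solves the equation for H - i. Since V and the boundary condition are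
  real, conjugation turns it into a solution for H + i.\<close>

lemma self_adjoint_H: "self_adjoint H"
proof (rule self_adjointI)
  have add: "x + y \<in> op_dom H & op_app H (x + y) = op_app H x + op_app H y" if "x \<in> op_dom H" "y \<in> op_dom H" for x y
    unfolding H_T using H_T_dom[OF that(1)] H_T_dom[OF that(2)] T_add[of x _ 0 _ y _ 0] by fastforce
  have scale: "k *\<^sub>C x \<in> op_dom H & op_app H (k *\<^sub>C x) = k *\<^sub>C op_app H x" if "x \<in> op_dom H" for k x
    unfolding H_T using H_T_dom[OF that] T_scale[of x _ 0 _ k] by fastforce
  have "0 \<in> op_dom H" using H_T[of 0 0] T_scale[OF psi_T, of 0] by auto
  thus "linear_op H" unfolding linear_op_def complex_vector.subspace_def using add scale by blast
  show "cinner x (op_app H y) = cinner (op_app H x) y" if "x \<in> op_dom H" "y \<in> op_dom H" for x y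
    using H_T_dom[OF that(1)] H_T_dom[OF that(2)] green_T by fastforce
  fix y :: half_line_L2
  obtain v where v: "square_integrable v" "y = to_L2 v" by (rule to_L2_cases)
  have "to_L2 (R0 v) \<in> op_dom H & op_app H (to_L2 (R0 v)) = y + \<i> *\<^sub>C to_L2 (R0 v)"
    unfolding H_T v(2) using R0_T[OF v(1)] by blast
  thus "EX x:op_dom H. op_app H x - \<i> *\<^sub>C x = y" by (intro bexI[of _ "to_L2 (R0 v)"]) auto
  let ?v = "%x. cnj (v x)"
  have cv: "square_integrable ?v" by (rule square_integrable_cnj[OF v(1)])
  let ?u = "%x. cnj (R0 ?v x)" and ?u' = "%x. cnj (sol' 0 (K ?v) ?v x)"
  have su: "square_integrable ?u" by (intro square_integrable_cnj R0_L2 cv)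
  have e: "expr ?u ?u' (%x. v x - \<i>*?u x)"
    using expr_cnj[OF expr_sol[OF square_integrable_loc_int[OF cv], of 0 "K ?v"]] by (simp add: R0_def)
  have "B0 ?u ?u' = cnj (B0 (R0 ?v) (sol' 0 (K ?v) ?v))" by (simp add: B0_def)
  hence b: "B0 ?u ?u' = 0" by (simp add: R0_def)
  have "to_L2 ?u \<in> op_dom H & op_app H (to_L2 ?u) = y - \<i> *\<^sub>C to_L2 ?u" unfolding H_T v(2)
    using T_I[OF e su square_integrable_diff[OF v(1) square_integrable_scale[OF su]]]
    by (auto simp: b to_L2_scale to_L2_diff su v(1) square_integrable_scale)
  thus "EX x:op_dom H. op_app H x + \<i> *\<^sub>C x = y" by (intro bexI[of _ "to_L2 ?u"]) auto
qed

sublocale B: boundary_triple H T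
proof
  show "self_adjoint H" by (rule self_adjoint_H)
  show "EX x h z. Im z ~= 0 & (x, z *\<^sub>C x, 1, h) \<in> T" using psi_T by (intro exI[of _ "to_L2 (\<psi> m)"] exI[of _ m] exI[of _ "\<i>"]) simp
qed (rule T_add T_scale green_T H_T; assumption | (auto dest: T_zero)[1])+

lemma resolvent_R0: "square_integrable v ==> B.R \<i> (to_L2 v) = to_L2 (R0 v)"
  by (rule B.T_resolvent_eq[OF B.i_resolvent(1) R0_T, symmetric])

text \<open>A vector orthogonal to all \<open>gam z\<close> is mapped by the powers of the resolvent to solutions with zero
  Cauchy data, on which the iterated Volterra operator is small.\<close>

lemma orthogonal_resolvent_powers:
  assumes v: "square_integrable v" and orth: "!!z. Im z ~= 0 ==> cinner (B.gam z) (to_L2 v) = 0"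
    and f: "square_integrable f" and X: "X >= 0"
  shows "EX A B. ALL n. cmod (cinner (to_L2 (%x. if x <= X then f x else 0)) ((B.R \<i> ^^ Suc n) (to_L2 v))) <= B*(A^n/fact n)"
proof -
  define g where "g n = (R0 ^^ n) v" for n
  have gS: "g (Suc n) = R0 (g n)" for n by (simp add: g_def)
  have gL: "square_integrable (g n)" for n by (induction n) (simp_all add: g_def v R0_L2)
  have gR: "(B.R \<i> ^^ n) (to_L2 v) = to_L2 (g n)" for n
    by (induction n) (simp_all add: gS resolvent_R0 gL, simp add: g_def)
  \<comment> \<open>\<open>K\<close> is the inner product with the deficiency vector at -i, and
    orthogonality to the deficiency vectors is inherited by resolvents. Together with the first
    boundary value 0 of \<open>R0\<close>, this gives zero Cauchy data.\<close>
  have K0: "K (g n) = 0" for n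
  proof -
    have "cinner (B.gam z) (to_L2 (g n)) = 0" if "Im z ~= 0" for z using that
    proof (induction n arbitrary: z)
      case (Suc n)
      thus ?case unfolding gS resolvent_R0[OF gL, symmetric] by (intro B.orthogonal_gam_invariant) auto
    qed (simp add: g_def orth)
    moreover have "K (g n) = cinner (B.gam (cnj \<i>)) (to_L2 (g n))"
      using B.T_same(2)[OF R0_T[OF gL, of n]] B.resolvent_T[of \<i> "to_L2 (g n)"] B.i_resolvent
      by (simp add: resolvent_R0 gL)
    ultimately show ?thesis by simp
  qed
  have "compact (c ` {0..X} \<union> s ` {0..X})"
    by (intro compact_Un compact_continuous_image continuous_on_subset[OF cont(1)] continuous_on_subset[OF cont(2)]) auto
  from compact_imp_bounded[OF this] obtain M0 where "ALL y:c ` {0..X} \<union> s ` {0..X}. cmod y <= M0"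
    unfolding bounded_iff by blast
  hence M: "cmod (c x) <= M0" "cmod (s x) <= M0" if "x \<in> {0..X}" for x using that by blast+
  \<comment> \<open>Two terms in the variation of constants formula, each with one factor
    \<open>c\<close> and one factor \<open>s\<close>, both at most M0 on [0, X].\<close>
  define A where "A = 2*M0\<^sup>2"
  have M0p: "M0 >= 0" using order_trans[OF norm_ge_zero M(1)[of 0]] X by simp
  have gi: "g n absolutely_integrable_on {0..x}" for n x using loc_intD(1)[OF square_integrable_loc_int[OF gL]] by simp
  have gn: "(%t. cmod (g n t)) integrable_on {0..x}" for n x using gi by (auto simp: absolutely_integrable_on_def)
  have gb: "cmod (g (Suc n) x) <= A*integral {0..x} (%t. cmod (g n t))" if x: "x \<in> {0..X}" for n x
  proof -
    have le: "cmod (integral {0..x} (%t. e t*g n t)) <= M0*integral {0..x} (%t. cmod (g n t))"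
      if e: "continuous_on {0..} e" "!!t. t \<in> {0..X} ==> cmod (e t) <= M0" for e
      unfolding integral_mult_right[symmetric]
    proof (rule integral_norm_bound_integral)
      show "(%t. e t*g n t) integrable_on {0..x}"
        by (intro loc_intD(2) loc_int_continuous_mult e square_integrable_loc_int gL) simp
      show "(%t. M0*cmod (g n t)) integrable_on {0..x}" by (intro integrable_on_mult_right gn)
    qed (use e(2) x in \<open>auto simp: norm_mult intro!: mult_right_mono\<close>)
    let ?I = "integral {0..x} (%t. cmod (g n t))"
    have "cmod (g (Suc n) x) <= cmod (integral {0..x} (%t. s t*g n t))*cmod (c x) + cmod (integral {0..x} (%t. c t*g n t))*cmod (s x)"
      unfolding gS R0_def K0 sol_def by (rule order_trans[OF norm_triangle_ineq]) (simp add: norm_mult)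
    also have "... <= M0*?I*M0 + M0*?I*M0"
      using M0p by (intro add_mono mult_mono le cont M x mult_nonneg_nonneg integral_nonneg gn) auto
    finally show ?thesis by (simp add: A_def power2_eq_square algebra_simps)
  qed
  define G where "G = integral {0..X} (%t. cmod (v t))"
  have A0: "A >= 0" by (simp add: A_def)
  have bound: "cmod (g (Suc n) x) <= A*G*((A*x)^n/fact n)" if "x \<in> {0..X}" for n x using that
  proof (induction n arbitrary: x)
    case 0
    have "integral {0..x} (%t. cmod (v t)) <= G"
      unfolding G_def by (rule integral_subset_le) (use 0 gn[of 0] in \<open>auto simp: g_def\<close>)
    thus ?case using gb[OF 0, of 0] mult_left_mono[OF _ A0] by (fastforce simp: g_def)
  next
    case (Suc n)
    have "((%t. A*G*(A^n/fact n)*(t^Suc n/real (Suc n))) has_vector_derivative A*G*((A*t)^n/fact n)) (at t within {0..x})" for t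
      by (auto intro!: derivative_eq_intros simp: has_real_derivative_iff_has_vector_derivative[symmetric] power_mult_distrib field_simps simp del: of_nat_Suc power_Suc)
    hence hi: "((%t. A*G*((A*t)^n/fact n)) has_integral A*G*(A^n/fact n)*(x^Suc n/real (Suc n))) {0..x}"
      using fundamental_theorem_of_calculus[of 0 x] Suc.prems by fastforce
    have "integral {0..x} (%t. cmod (g (Suc n) t)) <= A*G*(A^n/fact n)*(x^Suc n/real (Suc n))"
      unfolding integral_unique[OF hi, symmetric]
      by (rule integral_le[OF gn has_integral_integrable[OF hi]]) (use Suc in auto)
    from mult_left_mono[OF this A0]
    have "cmod (g (Suc (Suc n)) x) <= A*(A*G*(A^n/fact n)*(x^Suc n/real (Suc n)))"
      using gb[OF Suc.prems, of "Suc n"] by linarith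
    also have "... = A*G*((A*x)^Suc n/fact (Suc n))" by (simp add: power_mult_distrib field_simps)
    finally show ?case .
  qed
  let ?f = "%x. if x <= X then f x else 0"
  have fL: "square_integrable ?f" by (rule square_integrable_restrict[OF f])
  have fi: "(%t. cmod (f t)) integrable_on {0..X}"
    using loc_intD(1)[OF square_integrable_loc_int[OF f], of 0 X] by (auto simp: absolutely_integrable_on_def)
  have "cmod (cinner (to_L2 ?f) ((B.R \<i> ^^ Suc n) (to_L2 v))) <= (A*G*integral {0..X} (%t. cmod (f t)))*((A*X)^n/fact n)" for n
  proof -
    have pi: "integrable half_line (%x. cnj (?f x)*g (Suc n) x)" by (rule square_integrable_product[OF fL gL])
    have "(%k. integral {0..real k} (%x. cnj (?f x)*g (Suc n) x)) ----> integral {0..X} (%x. cnj (?f x)*g (Suc n) x)"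
    proof (rule tendsto_eventually)
      obtain k0 :: nat where "X <= real k0" using real_arch_simple by blast
      thus "\<forall>\<^sub>F k in sequentially. integral {0..real k} (%x. cnj (?f x)*g (Suc n) x) = integral {0..X} (%x. cnj (?f x)*g (Suc n) x)"
        by (intro eventually_sequentiallyI[of k0] integral_zero_beyond) auto
    qed
    with half_line_integral_lim(2)[OF pi] have "(LINT x|half_line. cnj (?f x)*g (Suc n) x) = integral {0..X} (%x. cnj (?f x)*g (Suc n) x)"
      by (rule LIMSEQ_unique)
    hence "cinner (to_L2 ?f) ((B.R \<i> ^^ Suc n) (to_L2 v)) = integral {0..X} (%x. cnj (?f x)*g (Suc n) x)"
      unfolding gR cinner_to_L2[OF fL gL] .
    also have "cmod ... <= integral {0..X} (%x. cmod (f x)*(A*G*((A*X)^n/fact n)))"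
    proof (rule integral_norm_bound_integral)
      show "(%x. cnj (?f x)*g (Suc n) x) integrable_on {0..X}"
        using half_line_integral_lim(1)[OF pi] by (rule set_lebesgue_integral_eq_integral(1))
      show "(%x. cmod (f x)*(A*G*((A*X)^n/fact n))) integrable_on {0..X}" by (intro integrable_on_mult_left fi)
      fix x assume x: "x \<in> {0..X}"
      have G0: "G >= 0" unfolding G_def by (rule integral_nonneg) (use gn[of 0] in \<open>auto simp: g_def\<close>)
      have "cmod (g (Suc n) x) <= A*G*((A*X)^n/fact n)" by (rule order_trans[OF bound[OF x]])
          (use x A0 G0 in \<open>intro mult_left_mono divide_right_mono power_mono; auto\<close>)
      from mult_left_mono[OF this norm_ge_zero[of "f x"]]
      show "cmod (cnj (?f x)*g (Suc n) x) <= cmod (f x)*(A*G*((A*X)^n/fact n))"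
        using x by (simp add: norm_mult)
    qed
    finally show ?thesis by (simp add: mult_ac)
  qed
  thus ?thesis by blast
qed

text \<open>The test vectors are truncations of R i v itself. The factorial decay makes each of them
  orthogonal to R i v; letting the truncation go to infinity gives |R i v|^2 = 0, hence v =
  0.\<close>

sublocale B: cyclic_boundary_triple H T
proof
  fix v assume orth: "!!z. Im z ~= 0 ==> cinner (B.gam z) v = 0"
  obtain g where g: "square_integrable g" "v = to_L2 g" by (rule to_L2_cases)
  define M where "M = {v. ALL z. Im z ~= 0 --> cinner (B.gam z) v = 0}"
  have "cinner (to_L2 (%x. if x <= real n then R0 g x else 0)) (B.R \<i> v) = 0" for n
  proof (rule B.resolvent_entire_zero[where M = M])
    show "v \<in> M" using orth by (simp add: M_def)
    show "B.R z v \<in> M" if "Im z ~= 0" "v \<in> M" for z v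
      using that B.orthogonal_gam_invariant[of v z] by (auto simp: M_def)
    fix v assume "v \<in> M"
    moreover obtain w where "square_integrable w" "v = to_L2 w" by (rule to_L2_cases)
    ultimately show "EX A B. ALL k. cmod (cinner (to_L2 (%x. if x <= real n then R0 g x else 0)) ((B.R \<i> ^^ Suc k) v)) <= B*(A^k/fact k)"
      using orthogonal_resolvent_powers[of w "R0 g" "real n"] R0_L2(1)[OF g(1)] by (simp add: M_def)
  qed
  moreover have "(%n. cinner (to_L2 (%x. if x <= real n then R0 g x else 0)) (B.R \<i> v)) ----> cinner (to_L2 (R0 g)) (B.R \<i> v)"
    by (intro tendsto_intros restrict_tendsto R0_L2 g)
  ultimately have "(%n::nat. 0) ----> cinner (to_L2 (R0 g)) (B.R \<i> v)" by simp
  from LIMSEQ_unique[OF this tendsto_const] have "B.R \<i> v = 0" using resolvent_R0[OF g(1)] g(2) by simp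
  thus "v = 0" using B.resolvent_right[OF B.i_resolvent(1), of v] B.dom_simps(8) by simp
qed

end

text \<open>The expression is sin (y - x), and the two points are chosen at distance at most 1 < pi.
  It serves twice: the zeros of the sine contain no interval, and the cotangent is constant on
  none.\<close>

lemma two_points:
  assumes "p < (q :: real)"
  obtains x y where "x \<in> {p<..<q}" "y \<in> {p<..<q}" "sin (y - r)*cos (x - r) - cos (y - r) * sin (x - r) ~= 0"
proof -
  define d where "d = min ((q - p)/3) 1"
  have d: "d > 0" "d <= 1" "d <= (q - p)/3" using assms by (auto simp: d_def min_def)
  have "sin ((p + 2*d - r) - (p + d - r)) > 0" using d pi_gt3 by (intro sin_gt_zero) auto
  thus thesis using that[of "p + d" "p + 2*d"] d unfolding sin_diff by auto
qed

lemma (in half_line_problem) perturbed_H: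
  assumes "sa \<theta> ~= 0"
  shows "B.perturbed (- ca \<theta>/sa \<theta>) (schroedinger_op V \<theta>)"
proof -
  have "cr (ca \<theta>)*g + cr (sa \<theta>)*h = 0 \<longleftrightarrow> h = cr (- ca \<theta>/sa \<theta>)*g" for g h
    using assms by (auto simp: field_simps eq_neg_iff_add_eq_0)
  thus ?thesis unfolding B.perturbed_def op_T by auto
qed

theorem schroedinger_generic:
  assumes V: "locally_integrable V" and lp: "limit_point V" and th0: "\<theta>\<^sub>0 \<in> {0..<pi}" and ab: "a < b"
    and sp: "interval_in_spectrum (schroedinger_op V \<theta>\<^sub>0) a b" and nac: "no_ac_spectrum_on (schroedinger_op V \<theta>\<^sub>0) a b"
  shows "EX C. dense_gdelta_in {a..b} C &
      (ALL E:C. ALL \<theta>:{0..<pi}. ~ eigenvalue (schroedinger_op V \<theta>) (cr E))"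
    and "EX L. dense_gdelta_in {0..<pi} L & (ALL \<theta>:L. purely_sc_spectrum_on (schroedinger_op V \<theta>) a b)"
proof -
  interpret potential V by (rule potential.intro[OF V])
  obtain c c' where c: "expr c c' (%x. \<i>*c x)" "c 0 = cos \<theta>\<^sub>0" "c' 0 = sin \<theta>\<^sub>0" by (rule solution_exists)
  obtain s s' where s: "expr s s' (%x. \<i> * s x)" "s 0 = - sin \<theta>\<^sub>0" "s' 0 = cos \<theta>\<^sub>0" by (rule solution_exists)
  interpret fundamental V "cos \<theta>\<^sub>0" "sin \<theta>\<^sub>0" c c' s s' by unfold_locales (use c s in auto)
  obtain m where m: "!!X. X >= 0 ==> N (\<psi> m) X <= Im m" using weyl_solution by blast
  interpret half_line_problem V "cos \<theta>\<^sub>0" "sin \<theta>\<^sub>0" c c' s s' m \<theta>\<^sub>0 by unfold_locales (use m lp in auto)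
  have sa: "sa \<theta> = sin (\<theta> - \<theta>\<^sub>0)" and ca: "ca \<theta> = cos (\<theta> - \<theta>\<^sub>0)" for \<theta>
    by (simp_all add: sa_def ca_def sin_diff cos_diff)
  obtain E where E: "dense_gdelta_in {a..b} E" and EH: "!!e. e \<in> E ==> ~ eigenvalue H (cr e)"
    and ED: "!!e t D'. e \<in> E ==> B.perturbed t D' ==> ~ eigenvalue D' (cr e)"
    using B.eigenvalues_generic[OF ab sp] by blast
  have "~ eigenvalue (schroedinger_op V \<theta>) (cr e)" if e: "e \<in> E" and \<theta>: "\<theta> \<in> {0..<pi}" for e \<theta>
  proof (cases "sa \<theta> = 0")
    \<comment> \<open>Both angles lie in [0, pi), so the sine vanishes only at the reference angle;
      this is the operator \<open>H\<close>, which corresponds to no finite parameter.\<close>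
    case True
    have "\<theta> - \<theta>\<^sub>0 = 0"
      by (rule sin_eq_0_pi) (use True \<theta> th0 in \<open>auto simp: sa\<close>)
    thus ?thesis using EH[OF e] by simp
  qed (use ED[OF e perturbed_H] in blast)
  thus "EX C. dense_gdelta_in {a..b} C &
      (ALL E:C. ALL \<theta>:{0..<pi}. ~ eigenvalue (schroedinger_op V \<theta>) (cr E))" using E by blast
  obtain \<N> where Nc: "countable \<N>" "!!N. N \<in> \<N> ==> closed N & interior N = {}"
    and ND: "!!t D'. t \<notin> \<Union>\<N> ==> B.perturbed t D' ==> purely_sc_spectrum_on D' a b"
    using B.purely_sc_generic[OF ab sp nac] by blast
  define W where "W = {\<theta>. sin (\<theta> - \<theta>\<^sub>0) ~= 0}"
  let ?t = "%\<theta>. - cos (\<theta> - \<theta>\<^sub>0)/sin (\<theta> - \<theta>\<^sub>0)"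
  have "EX L. dense_gdelta_in UNIV L & (ALL \<theta>:L. \<theta> \<in> W & ?t \<theta> \<notin> \<Union>\<N>)"
  proof (rule generic_parameter[OF _ _ _ _ Nc])
    show "open W" unfolding W_def by (intro open_Collect_neq continuous_intros)
    show "continuous_on W ?t" unfolding W_def by (intro continuous_intros) auto
    show "interior (- W) = {}"
    proof (rule ccontr)
      assume "interior (- W) ~= {}"
      then obtain \<theta> where "\<theta> \<in> interior (- W)" by blast
      then obtain e where e: "e > 0" "ball \<theta> e \<subseteq> - W" unfolding mem_interior by blast
      hence I: "{\<theta> - e<..<\<theta> + e} \<subseteq> - W" by (simp add: ball_eq_greaterThanLessThan)
      obtain x y where "x \<in> {\<theta> - e<..<\<theta> + e}" "y \<in> {\<theta> - e<..<\<theta> + e}"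
        "sin (y - \<theta>\<^sub>0)*cos (x - \<theta>\<^sub>0) - cos (y - \<theta>\<^sub>0) * sin (x - \<theta>\<^sub>0) ~= 0"
        by (rule two_points[of "\<theta> - e" "\<theta> + e" \<theta>\<^sub>0]) (use e in auto)
      moreover from this I have "sin (x - \<theta>\<^sub>0) = 0" "sin (y - \<theta>\<^sub>0) = 0" by (auto simp: W_def subset_iff)
      ultimately show False by simp
    qed
    fix p q :: real assume pq: "p < q" "{p<..<q} \<subseteq> W"
    obtain x y where xy: "x \<in> {p<..<q}" "y \<in> {p<..<q}"
      "sin (y - \<theta>\<^sub>0)*cos (x - \<theta>\<^sub>0) - cos (y - \<theta>\<^sub>0) * sin (x - \<theta>\<^sub>0) ~= 0"
      by (rule two_points[OF pq(1), of \<theta>\<^sub>0])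
    have "sin (x - \<theta>\<^sub>0) ~= 0" "sin (y - \<theta>\<^sub>0) ~= 0" using pq(2) xy(1,2) by (auto simp: W_def subset_iff)
    hence "?t x ~= ?t y" using xy(3) by (simp add: frac_eq_eq mult.commute)
    thus "EX x:{p<..<q}. EX y:{p<..<q}. ?t x < ?t y" using xy(1,2) linorder_neq_iff by blast
  qed
  then obtain L where L: "dense_gdelta_in UNIV L" "!!\<theta>. \<theta> \<in> L ==> \<theta> \<in> W" "!!\<theta>. \<theta> \<in> L ==> ?t \<theta> \<notin> \<Union>\<N>" by auto
  have "purely_sc_spectrum_on (schroedinger_op V \<theta>) a b" if "\<theta> \<in> L" for \<theta>
    using ND[OF L(3)[OF that]] perturbed_H[of \<theta>] L(2)[OF that] by (simp add: sa ca W_def)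
  \<comment> \<open>The parameter set is half-open; its open part (0, pi) is dense in it, which
    suffices for the restriction.\<close>
  moreover have "dense_gdelta_in {0..<pi} (L \<inter> {0..<pi})"
    by (rule dense_gdelta_in_restrict[OF L(1), of "{0<..<pi}"]) auto
  ultimately show "EX L. dense_gdelta_in {0..<pi} L & (ALL \<theta>:L. purely_sc_spectrum_on (schroedinger_op V \<theta>) a b)"
    by blast
qed

theorem theorem5:
  shows "(\<forall>(A :: 'a :: complex_hilbert_space unbounded_op) \<phi> a b.
      self_adjoint A \<and> cyclic_vector A \<phi> \<and> a < b \<and>
      interval_in_spectrum A a b \<and> no_ac_spectrum_on A a b \<longrightarrow>
      (\<exists>C. dense_gdelta_in {a..b} C \<and>
         (\<forall>E\<in>C. \<forall>r. \<not> eigenvalue (rank_one_perturbation A \<phi> r) (complex_of_real E))) \<and>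
      (\<exists>L. dense_gdelta_in UNIV L \<and>
         (\<forall>r\<in>L. purely_sc_spectrum_on (rank_one_perturbation A \<phi> r) a b))) \<and>
    (\<forall>V \<theta>\<^sub>0 a b.
      locally_integrable V \<and> limit_point V \<and> \<theta>\<^sub>0 \<in> {0..<pi} \<and> a < b \<and>
      interval_in_spectrum (schroedinger_op V \<theta>\<^sub>0) a b \<and>
      no_ac_spectrum_on (schroedinger_op V \<theta>\<^sub>0) a b \<longrightarrow>
      (\<exists>C. dense_gdelta_in {a..b} C \<and>
         (\<forall>E\<in>C. \<forall>\<theta>\<in>{0..<pi}. \<not> eigenvalue (schroedinger_op V \<theta>) (complex_of_real E))) \<and>
      (\<exists>L. dense_gdelta_in {0..<pi} L \<and>
         (\<forall>\<theta>\<in>L. purely_sc_spectrum_on (schroedinger_op V \<theta>) a b)))"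
  by (intro conjI allI impI; elim conjE; rule rank_one_perturbation_generic schroedinger_generic; assumption)

end
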